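(* Let $Y_1$ and $Y_2$ be closed connected oriented 3-manifolds having first Betti number at least $1$, and suppose that $b_1(Y_1)$ and $b_1(Y_2)$ are not both odd. Let $Y=Y_1\#Y_2$, and set $b=b_1(Y)=b_1(Y_1)+b_1(Y_2)$. Then $$h(Y)\geq\frac43L(b),$$ where $L(b)=3^{\frac{b-1}{2}}$ if $b$ is odd and $L(b)=2\cdot3^{\frac b2-1}$ if $b$ is even.
   Context: Let $Y$ be a closed oriented 3-manifold and $H=H^1(Y;\mathbb Z)$, with dual $H^*=\mathrm{Hom}(H,\mathbb Z)$. Let $\mu_Y\in\Lambda^3H^*$ be the 3-form $\mu_Y(a,b,c)=\langle a\cup b\cup c,[Y]\rangle$. For $\omega\in H^*$ let $\omega\angle\cdot:\Lambda^kH\to\Lambda^{k-1}H$ be the interior product (contraction) induced by the duality between $H^*$ and $H$; it satisfies $\omega\angle(\omega\angle\alpha)=0$ and extends to maps $\Lambda^pH^*\otimes\Lambda^kH\to\Lambda^{k-p}H$ with $(\omega\wedge\eta)\angle\alpha=\omega\angle(\eta\angle\alpha)$. The cup complex $C^\infty_*(Y)$ is $\Lambda^*H\otimes\mathbb Z[U,U^{-1}]$, where $U$ is a formal variable of degree $-2$ and $\Lambda^\ell H$ has degree $\ell$, with differential $\partial:C^\infty_k\to C^\infty_{k-1}$, $\partial(\alpha\otimes U^n)=(\mu_Y\angle\alpha)\otimes U^{n-1}$. Its homology is denoted $HC^\infty_*(Y)$. Multiplication by $U$ gives $HC^\infty_k(Y)\cong HC^\infty_{k-2}(Y)$. If $b_1(Y)\ge1$,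 the rank $\mathrm{rk}_{\mathbb Z}HC^\infty_k(Y)$ is the same for all $k\in\mathbb Z$, and $h(Y)$ is defined to be this common rank. If $b_1(Y)=0$, one sets $h(Y)=\frac12$. *)

theory Defs
  imports "HOL-Homology.Homology" "HOL-Analysis.Analysis"
begin

section \<open>Rank of an abelian group\<close>

definition int_independent :: "('a, 'm) monoid_scheme \<Rightarrow> 'a set \<Rightarrow> bool" where
  "int_independent G S \<longleftrightarrow> finite S \<and> S \<subseteq> carrier G \<and>
     (\<forall>c :: 'a \<Rightarrow> int. finprod G (\<lambda>x. x [^]\<^bsub>G\<^esub> c x) S = \<one>\<^bsub>G\<^esub> \<longrightarrow> (\<forall>x\<in>S. c x = 0))"

text \<open>The supremum is taken in \<^typ>\<open>nat\<close>, so this is meaningful only for groups of finite rank;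
  it is applied below to finitely generated groups only.\<close>

definition abelian_rank :: "('a, 'm) monoid_scheme \<Rightarrow> nat" where
  "abelian_rank G = Sup {card S | S. int_independent G S}"

definition betti :: "nat \<Rightarrow> 'a topology \<Rightarrow> nat" where
  "betti p X = abelian_rank (homology_group (int p) X)"

section \<open>Singular cohomology with integer coefficients\<close>

definition cochain_group :: "nat \<Rightarrow> 'a topology \<Rightarrow> (((nat \<Rightarrow> real) \<Rightarrow> 'a) \<Rightarrow> int) monoid" where
  "cochain_group p X = product_group (singular_simplex_set p X) (\<lambda>_. integer_group)"

definition cochain_eval :: "(((nat \<Rightarrow> real) \<Rightarrow> 'a) \<Rightarrow> int) \<Rightarrow> 'a chain \<Rightarrow> int" where
  "cochain_eval \<phi> c = (\<Sum>\<sigma>\<in>Poly_Mapping.keys c. Poly_Mapping.lookup c \<sigma> * \<phi> \<sigma>)"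

definition coboundary ::
    "nat \<Rightarrow> 'a topology \<Rightarrow> (((nat \<Rightarrow> real) \<Rightarrow> 'a) \<Rightarrow> int) \<Rightarrow> (((nat \<Rightarrow> real) \<Rightarrow> 'a) \<Rightarrow> int)" where
  "coboundary p X \<phi> =
     (\<lambda>\<sigma>\<in>singular_simplex_set (Suc p) X. cochain_eval \<phi> (chain_boundary (Suc p) (frag_of \<sigma>)))"

definition cocycle_set :: "nat \<Rightarrow> 'a topology \<Rightarrow> (((nat \<Rightarrow> real) \<Rightarrow> 'a) \<Rightarrow> int) set" where
  "cocycle_set p X = kernel (cochain_group p X) (cochain_group (Suc p) X) (coboundary p X)"

definition coboundary_set :: "nat \<Rightarrow> 'a topology \<Rightarrow> (((nat \<Rightarrow> real) \<Rightarrow> 'a) \<Rightarrow> int) set" where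
  "coboundary_set p X =
     (case p of 0 \<Rightarrow> {\<one>\<^bsub>cochain_group 0 X\<^esub>}
      | Suc q \<Rightarrow> coboundary q X ` carrier (cochain_group q X))"

definition cohomology_group ::
    "nat \<Rightarrow> 'a topology \<Rightarrow> (((nat \<Rightarrow> real) \<Rightarrow> 'a) \<Rightarrow> int) set monoid" where
  "cohomology_group p X =
     subgroup_generated (cochain_group p X) (cocycle_set p X) Mod coboundary_set p X"

text \<open>Front face: a point of \<^term>\<open>standard_simplex p\<close> is, as a function on \<^typ>\<open>nat\<close>, already a
  point of \<^term>\<open>standard_simplex (p + q)\<close>, so the front face is a mere restriction.
  The back face sends the \<open>i\<close>-th vertex to the \<open>(p + i)\<close>-th one.\<close>

definition front_face :: "nat \<Rightarrow> ((nat \<Rightarrow> real) \<Rightarrow> 'a) \<Rightarrow> ((nat \<Rightarrow> real) \<Rightarrow> 'a)" where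
  "front_face p \<sigma> = restrict \<sigma> (standard_simplex p)"

definition back_face :: "nat \<Rightarrow> nat \<Rightarrow> ((nat \<Rightarrow> real) \<Rightarrow> 'a) \<Rightarrow> ((nat \<Rightarrow> real) \<Rightarrow> 'a)" where
  "back_face p q \<sigma> = restrict (\<sigma> \<circ> (\<lambda>t i. if i < p then 0 else t (i - p))) (standard_simplex q)"

definition cochain_cup ::
    "nat \<Rightarrow> nat \<Rightarrow> 'a topology \<Rightarrow> (((nat \<Rightarrow> real) \<Rightarrow> 'a) \<Rightarrow> int) \<Rightarrow> (((nat \<Rightarrow> real) \<Rightarrow> 'a) \<Rightarrow> int)
      \<Rightarrow> (((nat \<Rightarrow> real) \<Rightarrow> 'a) \<Rightarrow> int)" where
  "cochain_cup p q X \<phi> \<psi> =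
     (\<lambda>\<sigma>\<in>singular_simplex_set (p + q) X. \<phi> (front_face p \<sigma>) * \<psi> (back_face p q \<sigma>))"

text \<open>Operations on (co)homology classes are given by representatives; the results do not depend
  on their choice.\<close>

definition cup ::
    "nat \<Rightarrow> nat \<Rightarrow> 'a topology \<Rightarrow> (((nat \<Rightarrow> real) \<Rightarrow> 'a) \<Rightarrow> int) set \<Rightarrow> (((nat \<Rightarrow> real) \<Rightarrow> 'a) \<Rightarrow> int) set
      \<Rightarrow> (((nat \<Rightarrow> real) \<Rightarrow> 'a) \<Rightarrow> int) set" where
  "cup p q X A B =
     coboundary_set (p + q) X #>\<^bsub>cochain_group (p + q) X\<^esub>
       cochain_cup p q X (SOME \<phi>. \<phi> \<in> A) (SOME \<psi>. \<psi> \<in> B)"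

definition class_eval :: "(((nat \<Rightarrow> real) \<Rightarrow> 'a) \<Rightarrow> int) set \<Rightarrow> 'a chain set \<Rightarrow> int" where
  "class_eval A z = cochain_eval (SOME \<phi>. \<phi> \<in> A) (SOME c. c \<in> z)"

section \<open>Closed oriented manifolds and connected sums\<close>

definition closed_manifold :: "nat \<Rightarrow> 'a topology \<Rightarrow> bool" where
  "closed_manifold n X \<longleftrightarrow>
     compact_space X \<and> Hausdorff_space X \<and> second_countable X \<and>
     (\<forall>x\<in>topspace X. \<exists>U. openin X U \<and> x \<in> U \<and>
        subtopology X U homeomorphic_space Euclidean_space n)"

definition local_class :: "nat \<Rightarrow> 'a topology \<Rightarrow> 'a chain set \<Rightarrow> 'a \<Rightarrow> 'a chain set" where
  "local_class n X z x = hom_induced (int n) X {} X (topspace X - {x}) id z"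

text \<open>An orientation is recorded by its fundamental class: a class in the top homology
  that restricts to a generator of each local homology group.\<close>

definition fundamental_class :: "nat \<Rightarrow> 'a topology \<Rightarrow> 'a chain set \<Rightarrow> bool" where
  "fundamental_class n X z \<longleftrightarrow>
     z \<in> carrier (homology_group (int n) X) \<and>
     (\<forall>x\<in>topspace X.
        subgroup_generated (relative_homology_group (int n) X (topspace X - {x})) {local_class n X z x}
          = relative_homology_group (int n) X (topspace X - {x}))"

definition closed_oriented_manifold :: "nat \<Rightarrow> 'a topology \<Rightarrow> 'a chain set \<Rightarrow> bool" where
  "closed_oriented_manifold n X z \<longleftrightarrow> closed_manifold n X \<and> fundamental_class n X z"

text \<open>The embedding \<open>h\<close> of the subspace \<open>P\<close> of \<open>X\<close> into \<open>X'\<close> preserves the orientations at the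
  point \<open>x\<close>, assumed interior to \<open>P\<close>; then the class \<open>c\<close> below is unique by excision.\<close>

definition orientation_preserving_at ::
    "nat \<Rightarrow> 'a topology \<Rightarrow> 'a chain set \<Rightarrow> 'a set \<Rightarrow> 'b topology \<Rightarrow> 'b chain set \<Rightarrow> ('a \<Rightarrow> 'b) \<Rightarrow> 'a \<Rightarrow> bool"
  where
  "orientation_preserving_at n X z P X' z' h x \<longleftrightarrow>
     (\<exists>c \<in> carrier (relative_homology_group (int n) (subtopology X P) (P - {x})).
        hom_induced (int n) (subtopology X P) (P - {x}) X (topspace X - {x}) id c = local_class n X z x \<and>
        hom_induced (int n) (subtopology X P) (P - {x}) X' (topspace X' - {h x}) h c = local_class n X' z' (h x))"

definition open_unit_ball :: "nat \<Rightarrow> (nat \<Rightarrow> real) set" where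
  "open_unit_ball n = {u \<in> topspace (Euclidean_space n). (\<Sum>i<n. (u i)\<^sup>2) < 1}"

definition unit_sphere :: "nat \<Rightarrow> (nat \<Rightarrow> real) set" where
  "unit_sphere n = {u \<in> topspace (Euclidean_space n). (\<Sum>i<n. (u i)\<^sup>2) = 1}"

definition remove_ball :: "nat \<Rightarrow> 'a topology \<Rightarrow> ((nat \<Rightarrow> real) \<Rightarrow> 'a) \<Rightarrow> 'a set" where
  "remove_ball n X e = topspace X - e ` open_unit_ball n"

text \<open>\<open>X\<close> is the connected sum of the closed oriented manifolds \<open>X1\<close> and \<open>X2\<close>: remove from each the
  interior of a collared ball and glue what remains along the boundary spheres, so that the
  orientations of both pieces agree with that of \<open>X\<close>. This last condition is what makes the gluing
  map orientation-reversing. As all spaces are compact Hausdorff, a union of two embedded pieces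
  meeting exactly in the image of the boundary spheres carries the quotient topology. Requiring
  \<open>h1 \<circ> e1 = h2 \<circ> e2\<close> on the sphere does not restrict the gluing map, since a homeomorphism of the
  sphere extends radially and can be absorbed into \<open>e2\<close>.\<close>

definition connected_sum ::
    "nat \<Rightarrow> 'a topology \<Rightarrow> 'a chain set \<Rightarrow> 'b topology \<Rightarrow> 'b chain set \<Rightarrow> 'c topology \<Rightarrow> 'c chain set \<Rightarrow> bool"
  where
  "connected_sum n X1 z1 X2 z2 X z \<longleftrightarrow>
     closed_oriented_manifold n X1 z1 \<and> closed_oriented_manifold n X2 z2 \<and>
     closed_oriented_manifold n X z \<and>
     (\<exists>e1 e2 h1 h2.
        embedding_map (Euclidean_space n) X1 e1 \<and>
        embedding_map (Euclidean_space n) X2 e2 \<and>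
        embedding_map (subtopology X1 (remove_ball n X1 e1)) X h1 \<and>
        embedding_map (subtopology X2 (remove_ball n X2 e2)) X h2 \<and>
        h1 ` remove_ball n X1 e1 \<union> h2 ` remove_ball n X2 e2 = topspace X \<and>
        h1 ` remove_ball n X1 e1 \<inter> h2 ` remove_ball n X2 e2 = h1 ` e1 ` unit_sphere n \<and>
        (\<forall>u\<in>unit_sphere n. h1 (e1 u) = h2 (e2 u)) \<and>
        (\<forall>x \<in> remove_ball n X1 e1 - e1 ` unit_sphere n.
           orientation_preserving_at n X1 z1 (remove_ball n X1 e1) X z h1 x) \<and>
        (\<forall>x \<in> remove_ball n X2 e2 - e2 ` unit_sphere n.
           orientation_preserving_at n X2 z2 (remove_ball n X2 e2) X z h2 x))"

section \<open>Exterior powers and contraction\<close>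

text \<open>Exterior powers over the integers of an abelian group \<open>H\<close>, the latter written multiplicatively
  as in \<^theory>\<open>HOL-Algebra.Group\<close>: formal sums of words of length \<open>k\<close>, the word
  \<open>[a\<^sub>1, \<dots>, a\<^sub>k]\<close> standing for \<open>a\<^sub>1 \<and> \<dots> \<and> a\<^sub>k\<close>, modulo additivity in each letter and \<open>a \<and> a = 0\<close>.\<close>

definition word_group :: "'h monoid \<Rightarrow> nat \<Rightarrow> ('h list \<Rightarrow>\<^sub>0 int) monoid" where
  "word_group H k = free_Abelian_group {xs. length xs = k \<and> set xs \<subseteq> carrier H}"

definition ext_relations :: "'h monoid \<Rightarrow> nat \<Rightarrow> ('h list \<Rightarrow>\<^sub>0 int) set" where
  "ext_relations H k = generate (word_group H k)
     ({frag_of (xs @ [a \<otimes>\<^bsub>H\<^esub> b] @ ys) - frag_of (xs @ [a] @ ys) - frag_of (xs @ [b] @ ys) | xs a b ys.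
          set xs \<union> {a, b} \<union> set ys \<subseteq> carrier H \<and> length xs + 1 + length ys = k} \<union>
      {frag_of (xs @ [a, a] @ ys) | xs a ys.
          set xs \<union> {a} \<union> set ys \<subseteq> carrier H \<and> length xs + 2 + length ys = k})"

definition ext_power :: "'h monoid \<Rightarrow> nat \<Rightarrow> ('h list \<Rightarrow>\<^sub>0 int) set monoid" where
  "ext_power H k = word_group H k Mod ext_relations H k"

text \<open>Contraction of a word by a linear form and by an alternating trilinear form. The sign in
  the second definition is the one forced by \<open>(\<omega> \<and> \<eta>) \<angle> \<alpha> = \<omega> \<angle> (\<eta> \<angle> \<alpha>)\<close>; see the lemma
  \<open>contract3_wedge\<close> below.\<close>

definition contract1 :: "('h \<Rightarrow> int) \<Rightarrow> 'h list \<Rightarrow> ('h list \<Rightarrow>\<^sub>0 int)" where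
  "contract1 \<omega> xs =
     (\<Sum>i<length xs. frag_cmul ((-1) ^ i * \<omega> (xs ! i)) (frag_of (nths xs (- {i}))))"

definition contract3 :: "('h \<Rightarrow> 'h \<Rightarrow> 'h \<Rightarrow> int) \<Rightarrow> 'h list \<Rightarrow> ('h list \<Rightarrow>\<^sub>0 int)" where
  "contract3 \<mu> xs =
     (\<Sum>l<length xs. \<Sum>j<l. \<Sum>i<j.
        frag_cmul ((-1) ^ (i + j + l) * \<mu> (xs ! i) (xs ! j) (xs ! l)) (frag_of (nths xs (- {i, j, l}))))"

definition wedge3 :: "('h \<Rightarrow> int) \<Rightarrow> ('h \<Rightarrow> int) \<Rightarrow> ('h \<Rightarrow> int) \<Rightarrow> 'h \<Rightarrow> 'h \<Rightarrow> 'h \<Rightarrow> int" where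
  "wedge3 \<omega> \<eta> \<theta> a b c =
     \<omega> a * (\<eta> b * \<theta> c - \<eta> c * \<theta> b) - \<omega> b * (\<eta> a * \<theta> c - \<eta> c * \<theta> a) + \<omega> c * (\<eta> a * \<theta> b - \<eta> b * \<theta> a)"

definition contract2 :: "('h \<Rightarrow> 'h \<Rightarrow> int) \<Rightarrow> 'h list \<Rightarrow> ('h list \<Rightarrow>\<^sub>0 int)" where
  "contract2 \<nu> xs =
     (\<Sum>l<length xs. \<Sum>j<l.
        frag_cmul ((-1) ^ (j + l) * \<nu> (xs ! j) (xs ! l)) (frag_of (nths xs (- {j, l}))))"

definition prepend :: "'h \<Rightarrow> ('h list \<Rightarrow>\<^sub>0 int) \<Rightarrow> ('h list \<Rightarrow>\<^sub>0 int)" where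
  "prepend a = frag_extend (\<lambda>xs. frag_of (a # xs))"

lemma prepend_simps:
  "prepend a 0 = 0" "prepend a (x + y) = prepend a x + prepend a y"
  "prepend a (- x) = - prepend a x" "prepend a (x - y) = prepend a x - prepend a y"
  "prepend a (frag_cmul k x) = frag_cmul k (prepend a x)" "prepend a (frag_of xs) = frag_of (a # xs)"
  by (simp_all add: prepend_def frag_extend_add frag_extend_minus frag_extend_diff frag_extend_cmul)

lemma prepend_sum: "prepend a (\<Sum>i\<in>I. f i) = (\<Sum>i\<in>I. prepend a (f i))"
  by (induction I rule: infinite_finite_induct) (auto simp: prepend_simps)

lemma nths_Cons_removed:
  "nths (a # xs) (- {0}) = xs"
  "nths (a # xs) (- {Suc i}) = a # nths xs (- {i})"
  "nths (a # xs) (- {0, Suc i}) = nths xs (- {i})"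
  "nths (a # xs) (- {Suc i, Suc j}) = a # nths xs (- {i, j})"
  "nths (a # xs) (- {0, Suc i, Suc j}) = nths xs (- {i, j})"
  "nths (a # xs) (- {Suc i, Suc j, Suc k}) = a # nths xs (- {i, j, k})"
  by (simp_all add: nths_Cons Compl_eq nths_all)

lemma contract1_Cons:
  "contract1 \<omega> (a # xs) = frag_cmul (\<omega> a) (frag_of xs) - prepend a (contract1 \<omega> xs)"
  unfolding contract1_def
  by (simp add: sum.lessThan_Suc_shift nths_Cons_removed prepend_sum prepend_simps
      sum_negf[symmetric] del: sum.lessThan_Suc)

lemma contract2_Cons:
  "contract2 \<nu> (a # xs) = - contract1 (\<nu> a) xs + prepend a (contract2 \<nu> xs)"
  unfolding contract2_def contract1_def
  by (simp add: sum.lessThan_Suc_shift nths_Cons_removed prepend_sum prepend_simps sum.distrib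
      sum_negf[symmetric] del: sum.lessThan_Suc)

lemma contract3_Cons:
  "contract3 \<mu> (a # xs) = contract2 (\<mu> a) xs - prepend a (contract3 \<mu> xs)"
  unfolding contract3_def contract2_def
  by (simp add: sum.lessThan_Suc_shift nths_Cons_removed prepend_sum prepend_simps sum.distrib
      sum_negf[symmetric] del: sum.lessThan_Suc)

lemma frag_extend_contract1_prepend:
  "frag_extend (contract1 \<omega>) (prepend a x) = frag_cmul (\<omega> a) x - prepend a (frag_extend (contract1 \<omega>) x)"
  using subset_UNIV
proof (induction x rule: frag_induction)
  case (diff x y)
  have "frag_cmul (\<omega> a) (x - y) = frag_cmul (\<omega> a) x - frag_cmul (\<omega> a) y"
    using frag_cmul_distrib2[of "\<omega> a" "x - y" y] by simp
  then show ?case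
    using diff by (simp add: prepend_simps frag_extend_diff)
qed (auto simp: prepend_simps contract1_Cons)

lemma contract1_lincomb:
  "contract1 (\<lambda>x. k * f x - l * g x) xs = frag_cmul k (contract1 f xs) - frag_cmul l (contract1 g xs)"
  unfolding contract1_def
  by (simp add: frag_cmul_sum sum_subtractf[symmetric] frag_cmul_diff_distrib[symmetric] algebra_simps)

lemma contract2_lincomb:
  "contract2 (\<lambda>x y. k * f x y - l * g x y + m * h x y) xs =
     frag_cmul k (contract2 f xs) - frag_cmul l (contract2 g xs) + frag_cmul m (contract2 h xs)"
  unfolding contract2_def
  by (simp add: frag_cmul_sum sum_subtractf[symmetric] sum.distrib[symmetric]
      frag_cmul_diff_distrib[symmetric] frag_cmul_distrib[symmetric] algebra_simps)

lemma contract2_wedge: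
  "contract2 (\<lambda>a b. \<eta> a * \<theta> b - \<eta> b * \<theta> a) xs = frag_extend (contract1 \<eta>) (contract1 \<theta> xs)"
proof (induction xs)
  case (Cons a xs)
  have "contract1 (\<lambda>b. \<eta> a * \<theta> b - \<eta> b * \<theta> a) xs
        = frag_cmul (\<eta> a) (contract1 \<theta> xs) - frag_cmul (\<theta> a) (contract1 \<eta> xs)"
    using contract1_lincomb[of "\<eta> a" \<theta> "\<theta> a" \<eta> xs] by (simp add: mult.commute)
  with Cons show ?case
    by (simp add: contract1_Cons contract2_Cons frag_extend_diff frag_extend_cmul
        frag_extend_contract1_prepend)
qed (simp add: contract1_def contract2_def)

lemma contract3_wedge:
  "contract3 (wedge3 \<omega> \<eta> \<theta>) xs =
     frag_extend (contract1 \<omega>) (frag_extend (contract1 \<eta>) (contract1 \<theta> xs))"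
proof (induction xs)
  case (Cons a xs)
  have "wedge3 \<omega> \<eta> \<theta> a =
      (\<lambda>b c. \<omega> a * (\<eta> b * \<theta> c - \<eta> c * \<theta> b) - \<eta> a * (\<omega> b * \<theta> c - \<omega> c * \<theta> b)
             + \<theta> a * (\<omega> b * \<eta> c - \<omega> c * \<eta> b))"
    by (intro ext) (simp add: wedge3_def algebra_simps)
  then have "contract2 (wedge3 \<omega> \<eta> \<theta> a) xs =
      frag_cmul (\<omega> a) (frag_extend (contract1 \<eta>) (contract1 \<theta> xs))
      - frag_cmul (\<eta> a) (frag_extend (contract1 \<omega>) (contract1 \<theta> xs))
      + frag_cmul (\<theta> a) (frag_extend (contract1 \<omega>) (contract1 \<eta> xs))"
    by (simp only: contract2_lincomb contract2_wedge)
  with Cons show ?case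
    by (simp add: contract1_Cons contract3_Cons frag_extend_diff frag_extend_cmul
        frag_extend_contract1_prepend prepend_simps)
qed (simp add: contract1_def contract3_def)

section \<open>The cup complex\<close>

text \<open>The contraction induced on exterior powers; the choice of representative is immaterial
  for alternating \<open>\<mu>\<close>. It vanishes on degrees below 3, where it is not used.\<close>

definition ext_contract ::
    "'h monoid \<Rightarrow> ('h \<Rightarrow> 'h \<Rightarrow> 'h \<Rightarrow> int) \<Rightarrow> nat \<Rightarrow> ('h list \<Rightarrow>\<^sub>0 int) set \<Rightarrow> ('h list \<Rightarrow>\<^sub>0 int) set" where
  "ext_contract H \<mu> k A =
     ext_relations H (k - 3) #>\<^bsub>word_group H (k - 3)\<^esub> frag_extend (contract3 \<mu>) (SOME c. c \<in> A)"

text \<open>An element of degree \<open>k\<close> is a finite sum of terms \<open>x n \<otimes> U\<^sup>n\<close> with \<open>x n\<close> in the exterior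
  power of degree \<open>k + 2 n\<close>, encoded as the family \<open>x\<close>.\<close>

definition cup_complex :: "'h monoid \<Rightarrow> int \<Rightarrow> (int \<Rightarrow> ('h list \<Rightarrow>\<^sub>0 int) set) monoid" where
  "cup_complex H k = sum_group {n. 0 \<le> k + 2 * n} (\<lambda>n. ext_power H (nat (k + 2 * n)))"

definition cup_differential ::
    "'h monoid \<Rightarrow> ('h \<Rightarrow> 'h \<Rightarrow> 'h \<Rightarrow> int) \<Rightarrow> int
      \<Rightarrow> (int \<Rightarrow> ('h list \<Rightarrow>\<^sub>0 int) set) \<Rightarrow> (int \<Rightarrow> ('h list \<Rightarrow>\<^sub>0 int) set)" where
  "cup_differential H \<mu> k x =
     (\<lambda>m\<in>{m. 0 \<le> (k - 1) + 2 * m}. ext_contract H \<mu> (nat (k + 2 * (m + 1))) (x (m + 1)))"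

definition cup_homology ::
    "'h monoid \<Rightarrow> ('h \<Rightarrow> 'h \<Rightarrow> 'h \<Rightarrow> int) \<Rightarrow> int \<Rightarrow> (int \<Rightarrow> ('h list \<Rightarrow>\<^sub>0 int) set) set monoid" where
  "cup_homology H \<mu> k =
     subgroup_generated (cup_complex H k)
       (kernel (cup_complex H k) (cup_complex H (k - 1)) (cup_differential H \<mu> k))
     Mod (cup_differential H \<mu> (k + 1) ` carrier (cup_complex H (k + 1)))"

definition triple_cup_form ::
    "'a topology \<Rightarrow> 'a chain set \<Rightarrow> (((nat \<Rightarrow> real) \<Rightarrow> 'a) \<Rightarrow> int) set \<Rightarrow> (((nat \<Rightarrow> real) \<Rightarrow> 'a) \<Rightarrow> int) set
      \<Rightarrow> (((nat \<Rightarrow> real) \<Rightarrow> 'a) \<Rightarrow> int) set \<Rightarrow> int" where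
  "triple_cup_form Y z a b c = class_eval (cup 2 1 Y (cup 1 1 Y a b) c) z"

definition HC_infinity ::
    "'a topology \<Rightarrow> 'a chain set \<Rightarrow> int \<Rightarrow> (int \<Rightarrow> ((((nat \<Rightarrow> real) \<Rightarrow> 'a) \<Rightarrow> int) set list \<Rightarrow>\<^sub>0 int) set) set monoid"
  where
  "HC_infinity Y z k = cup_homology (cohomology_group 1 Y) (triple_cup_form Y z) k"

definition cup_rank :: "'a topology \<Rightarrow> 'a chain set \<Rightarrow> real" where
  "cup_rank Y z =
     (if betti 1 Y = 0 then 1 / 2
      else real (THE r. \<forall>k::int. abelian_rank (HC_infinity Y z k) = r))"

definition L_bound :: "nat \<Rightarrow> real" where
  "L_bound b = (if odd b then 3 powr ((real b - 1) / 2) else 2 * 3 powr (real b / 2 - 1))"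

end

theory Submission
  imports Defs "HOL-Library.Function_Algebras"
begin

text \<open>The proof has a topological part, which computes the first homology and the triple cup product form
  of a connected sum, and an algebraic part, which bounds the homology of the cup complex of such a form.

  Topology. The inclusion of each summand, with a ball removed, extends to an open embedding of the
  summand punctured at one point; the punctured ball is mapped by inversion in its boundary sphere. The
  inverses of the two embeddings extend to pinch maps from the sum onto the summands
  (\<open>connected_sum_pinch_maps\<close>). The two open images overlap in a copy of Euclidean 3-space minus a
  point, which is connected and has trivial first homology. Two Mayer-Vietoris arguments then show that
  the pinch maps induce an isomorphism of first homology onto the direct sum (\<open>dual_basis_pinch\<close>), and
  the first Betti numbers add up. First cohomology has a rational basis dual to one of homology, which
  consists of classes pulled back from the two summands. The cocycles can be chosen such that those of
  the first summand vanish on the second punctured summand, and conversely. The fundamental class is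
  represented by a sum of simplices each of which lies in one of the two open sets. On it every product
  that involves cocycles of both kinds vanishes (\<open>mixed_triple_eval\<close>). In the chosen basis the form
  therefore consists of two blocks.

  Algebra. Over the rationals the cup complex has a basis indexed by the subsets \<open>S\<close> of the basis of
  cohomology, and its differential removes three elements of \<open>S\<close>. With two blocks, all three belong to the
  same block. So the numbers of elements of \<open>S\<close> in the two blocks, modulo 3, are preserved, and the
  complex splits into nine summands. Each has homology of rank at least the absolute value of its Euler
  characteristic, which is a product of two sums, over the subsets of one block whose cardinality has a
  given residue modulo 3, of the signs of these cardinalities (\<open>euler_type_sets\<close>). For a block of \<open>n\<close>
  elements the absolute values of the three sums add up to \<open>2 L(n)\<close> (\<open>sum_abs_euler_mod3\<close>). The ranks
  in even and in odd degree are equal, so each is at least \<open>2 L(b\<^sub>1) L(b\<^sub>2)\<close>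
  (\<open>cup_homology_rank_bound\<close>). This product equals \<open>4/3 L(b\<^sub>1 + b\<^sub>2)\<close> unless both numbers are odd
  (\<open>L_int_product\<close>).\<close>

section \<open>Ranks and rational coordinates\<close>

text \<open>All coordinates below are functions with rational values, with pointwise addition and this scaling.\<close>

definition qscale :: "rat \<Rightarrow> ('i \<Rightarrow> rat) \<Rightarrow> 'i \<Rightarrow> rat" where
  "qscale r f = (\<lambda>x. r * f x)"

interpretation Q: vector_space "qscale :: rat \<Rightarrow> ('i \<Rightarrow> rat) \<Rightarrow> 'i \<Rightarrow> rat"
  by unfold_locales (auto simp: qscale_def algebra_simps fun_eq_iff)

interpretation QQ: vector_space_pair "qscale :: rat \<Rightarrow> ('i \<Rightarrow> rat) \<Rightarrow> 'i \<Rightarrow> rat"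
    "qscale :: rat \<Rightarrow> ('j \<Rightarrow> rat) \<Rightarrow> 'j \<Rightarrow> rat" ..

abbreviation qlinear :: "(('i \<Rightarrow> rat) \<Rightarrow> ('j \<Rightarrow> rat)) \<Rightarrow> bool" where
  "qlinear \<equiv> Vector_Spaces.linear qscale qscale"

lemma projection_along:
  assumes ind: "Q.independent C" and K: "K \<subseteq> C"
  obtains g where "qlinear g" "\<And>x. x \<in> Q.span K \<Longrightarrow> g x = 0"
    "\<And>x. x \<in> Q.span (C - K) \<Longrightarrow> g x = x" "\<And>x. x \<in> Q.span C \<Longrightarrow> x - g x \<in> Q.span K"
proof -
  obtain g where g: "qlinear g" "\<And>x. x \<in> C \<Longrightarrow> g x = (if x \<in> K then 0 else x)"
    using QQ.linear_independent_extend[OF ind, of "\<lambda>x. if x \<in> K then 0 else x"] by blast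
  interpret g: Vector_Spaces.linear qscale qscale g by (rule g(1))
  have 1: "g x = 0" if "x \<in> Q.span K" for x
    using g.eq_0_on_span[OF _ that] g(2) K by (metis subsetD)
  have 2: "g x = x" if "x \<in> Q.span (C - K)" for x
    using QQ.linear_eq_on[OF g(1) Q.linear_id that] g(2) by auto
  have 3: "x - g x \<in> Q.span K" if "x \<in> Q.span C" for x
    using that
  proof (induction rule: Q.span_induct_alt)
    case (step c x y)
    have "x - g x \<in> Q.span K"
      using g(2)[OF step(1)] by (auto simp: Q.span_base Q.span_zero)
    moreover have "qscale c x + y - g (qscale c x + y) = qscale c (x - g x) + (y - g y)"
      by (simp add: g.add g.scale Q.scale_right_diff_distrib)
    ultimately show ?case
      using step by (metis Q.span_add Q.span_scale)
  next
    case base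
    show ?case unfolding g.zero diff_self by (rule Q.span_zero)
  qed
  show ?thesis using that[OF g(1) 1 2 3] .
qed

lemma finite_basis_of_subset:
  assumes "K \<subseteq> V" "Q.independent K" "V \<subseteq> Q.span S" "finite S"
  obtains C where "K \<subseteq> C" "C \<subseteq> V" "Q.independent C" "V \<subseteq> Q.span C" "finite C"
    "card C = Q.dim V"
proof -
  obtain C where C: "K \<subseteq> C" "C \<subseteq> V" "Q.independent C" "V \<subseteq> Q.span C"
    using Q.maximal_independent_subset_extend[OF assms(1,2)] by metis
  have "finite C" using Q.independent_span_bound[OF assms(4) C(3)] C(2) assms(3) by auto
  with C show ?thesis using that Q.basis_card_eq_dim by metis
qed

lemma rank_nullity:
  assumes lin: "qlinear f" and V: "Q.subspace V" "V \<subseteq> Q.span S" "finite S"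
  shows "Q.dim V = Q.dim {x \<in> V. f x = 0} + Q.dim (f ` V)"
proof -
  interpret f: Vector_Spaces.linear qscale qscale f by (rule lin)
  let ?N = "{x \<in> V. f x = 0}"
  obtain K where K: "K \<subseteq> ?N" "Q.independent K" "?N \<subseteq> Q.span K" "finite K" "card K = Q.dim ?N"
    by (rule finite_basis_of_subset[of "{}" ?N S]) (use V Q.independent_empty in auto)
  obtain C where C: "K \<subseteq> C" "C \<subseteq> V" "Q.independent C" "V \<subseteq> Q.span C" "finite C" "card C = Q.dim V"
    by (rule finite_basis_of_subset[of K V S]) (use K V in auto)
  obtain g where g: "qlinear g" "\<And>x. x \<in> Q.span K \<Longrightarrow> g x = 0" "\<And>x. x \<in> Q.span (C - K) \<Longrightarrow> g x = x"
    using projection_along[OF C(3,1)] by metis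
  have CKV: "Q.span (C - K) \<subseteq> V"
    using C(2) V(1) by (meson Diff_subset Q.span_minimal order_trans)
  have inj: "inj_on f (Q.span (C - K))"
    unfolding f.inj_on_iff_eq_0[OF Q.subspace_span]
  proof safe
    fix x assume x: "x \<in> Q.span (C - K)" "f x = 0"
    then have "x \<in> Q.span K" using K(3) CKV by blast
    then show "x = 0" using g(2,3) x(1) by metis
  qed
  have ind: "Q.independent (f ` (C - K))"
    using f.independent_injective_image[OF Q.independent_mono[OF C(3)] inj] by auto
  have "f ` V \<subseteq> f ` Q.span C" using C(4) by blast
  also have "\<dots> = Q.span (f ` C)" by (simp add: f.span_image)
  also have "\<dots> \<subseteq> Q.span (insert 0 (f ` (C - K)))"
    using K(1) by (intro Q.span_mono) auto
  finally have "f ` V \<subseteq> Q.span (f ` (C - K))" by simp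
  then have "Q.dim (f ` V) = card (f ` (C - K))"
    using Q.basis_card_eq_dim[of "f ` (C - K)" "f ` V"] ind C(2) by (metis Diff_subset image_mono order_trans)
  also have "\<dots> = card (C - K)"
    using inj by (intro card_image inj_on_subset[OF inj]) (auto intro: Q.span_base)
  also have "\<dots> = card C - card K" using C(1) K(4) by (simp add: card_Diff_subset)
  finally show ?thesis
    using C(6) K(5) card_mono[OF C(5,1)] by linarith
qed

lemma dim_mono_finite:
  assumes "V \<subseteq> W" "W \<subseteq> Q.span S" "finite S"
  shows "Q.dim V \<le> Q.dim W"
proof -
  obtain C where C: "C \<subseteq> W" "W \<subseteq> Q.span C" "finite C" "card C = Q.dim W"
    by (rule finite_basis_of_subset[OF _ Q.independent_empty assms(2,3)]) auto
  have "Q.dim V \<le> card C" by (rule Q.dim_le_card) (use C assms in auto)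
  then show ?thesis using C by simp
qed

lemma dim_le_sum_dim:
  assumes I: "finite I" and V: "V \<subseteq> Q.span (\<Union>i\<in>I. W i)" and W: "\<And>i. i \<in> I \<Longrightarrow> W i \<subseteq> Q.span (S i) \<and> finite (S i)"
  shows "Q.dim V \<le> (\<Sum>i\<in>I. Q.dim (W i))"
proof -
  have "\<exists>C. C \<subseteq> W i \<and> W i \<subseteq> Q.span C \<and> finite C \<and> card C = Q.dim (W i)" if "i \<in> I" for i
  proof -
    have *: "W i \<subseteq> Q.span (S i)" "finite (S i)" using W[OF that] by auto
    show ?thesis
      by (rule finite_basis_of_subset[OF _ Q.independent_empty *]) auto
  qed
  then obtain C where C: "\<And>i. i \<in> I \<Longrightarrow> C i \<subseteq> W i \<and> W i \<subseteq> Q.span (C i) \<and> finite (C i) \<and> card (C i) = Q.dim (W i)"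
    by metis
  have "(\<Union>i\<in>I. W i) \<subseteq> Q.span (\<Union>i\<in>I. C i)"
  proof (rule UN_least)
    fix i assume i: "i \<in> I"
    have "Q.span (C i) \<subseteq> Q.span (\<Union>i\<in>I. C i)"
      by (rule Q.span_mono) (use i in blast)
    then show "W i \<subseteq> Q.span (\<Union>i\<in>I. C i)" using C[OF i] by blast
  qed
  then have "V \<subseteq> Q.span (\<Union>i\<in>I. C i)"
    using V Q.span_minimal[OF _ Q.subspace_span] by blast
  then have "Q.dim V \<le> card (\<Union>i\<in>I. C i)"
    using I C by (intro Q.dim_le_card) auto
  also have "\<dots> \<le> (\<Sum>i\<in>I. card (C i))" by (rule card_UN_le[OF I])
  finally show ?thesis using C by simp
qed

lemma clear_denominators:
  fixes q :: "'s \<Rightarrow> rat"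
  assumes "finite S"
  obtains D :: int and c :: "'s \<Rightarrow> int" where "D > 0" "\<And>x. x \<in> S \<Longrightarrow> of_int (c x) = of_int D * q x"
proof -
  have "\<exists>D::int. \<exists>c. D > 0 \<and> (\<forall>x\<in>S. of_int (c x) = of_int D * q x)"
    using assms
  proof induction
    case empty
    show ?case by (intro exI[of _ 1]) auto
  next
    case (insert a S)
    then obtain D c where D: "(D::int) > 0" "\<forall>x\<in>S. of_int (c x) = of_int D * q x" by blast
    obtain m n where mn: "q a = of_int m / of_int n" "n > (0::int)"
      by (metis quotient_of_div quotient_of_denom_pos surj_pair)
    show ?case
      using D mn insert(2)
      by (intro exI[of _ "D * n"] exI[of _ "\<lambda>x. if x = a then D * m else n * c x"]) auto
  qed
  then show ?thesis using that by blast
qed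

lemma (in comm_group) finprod_int_pow:
  assumes "finite S" "S \<subseteq> carrier G"
  shows "finprod G (\<lambda>x. x [^] c x) S [^] (n::int) = finprod G (\<lambda>x. x [^] (c x * n)) S"
  using assms
proof (induction S)
  case (insert a S)
  have "(\<lambda>x. x [^] c x) \<in> S \<rightarrow> carrier G" "(\<lambda>x. x [^] (c x * n)) \<in> S \<rightarrow> carrier G"
    using insert by auto
  then show ?case
    using insert by (simp add: finprod_insert int_pow_distrib int_pow_pow finprod_closed)
qed auto

text \<open>A homomorphism to a rational vector space whose kernel is torsion turns independence over the
  integers into linear independence, by clearing denominators.\<close>

lemma abelian_rank_eq:
  fixes \<psi> :: "'g \<Rightarrow> 'i \<Rightarrow> rat"
  assumes G: "comm_group G"
    and add: "\<And>a b. a \<in> carrier G \<Longrightarrow> b \<in> carrier G \<Longrightarrow> \<psi> (a \<otimes>\<^bsub>G\<^esub> b) = \<psi> a + \<psi> b"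
    and tors: "\<And>a. a \<in> carrier G \<Longrightarrow> \<psi> a = 0 \<Longrightarrow> \<exists>n>0::int. a [^]\<^bsub>G\<^esub> n = \<one>\<^bsub>G\<^esub>"
    and T: "finite T" "Q.independent T" "T \<subseteq> \<psi> ` carrier G" "\<psi> ` carrier G \<subseteq> Q.span T"
  shows "abelian_rank G = card T"
proof -
  interpret G: comm_group G by (rule G)
  have \<psi>1: "\<psi> \<one>\<^bsub>G\<^esub> = 0" using add[of "\<one>\<^bsub>G\<^esub>" "\<one>\<^bsub>G\<^esub>"] by simp
  have \<psi>nat: "\<psi> (a [^]\<^bsub>G\<^esub> (n::nat)) = qscale (of_nat n) (\<psi> a)" if "a \<in> carrier G" for a n
    by (induction n) (auto simp: \<psi>1 that add qscale_def fun_eq_iff algebra_simps)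
  have \<psi>inv: "\<psi> (inv\<^bsub>G\<^esub> a) = - \<psi> a" if "a \<in> carrier G" for a
    using add[of a "inv\<^bsub>G\<^esub> a"] that \<psi>1 by (simp add: eq_neg_iff_add_eq_0 add.commute)
  have \<psi>int: "\<psi> (a [^]\<^bsub>G\<^esub> (n::int)) = qscale (of_int n) (\<psi> a)" if "a \<in> carrier G" for a n
  proof (cases "n \<ge> 0")
    case True
    have "of_nat (nat n) = (of_int n :: rat)" using True by simp
    then show ?thesis using \<psi>nat[OF that, of "nat n"] True int_pow_int[of G a "nat n"] by simp
  next
    case False
    define m where "m = nat (-n)"
    have n: "n = - int m" using False by (simp add: m_def)
    have "a [^]\<^bsub>G\<^esub> n = inv\<^bsub>G\<^esub> (a [^]\<^bsub>G\<^esub> m)"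
      unfolding n by (rule G.int_pow_neg_int[OF that])
    then have "\<psi> (a [^]\<^bsub>G\<^esub> n) = - qscale (of_nat m) (\<psi> a)"
      using \<psi>inv[OF G.nat_pow_closed[OF that, of m]] \<psi>nat[OF that, of m] by simp
    then show ?thesis unfolding n by (simp add: qscale_def fun_eq_iff)
  qed
  have \<psi>sum: "\<psi> (finprod G (\<lambda>x. x [^]\<^bsub>G\<^esub> c x) S) = (\<Sum>x\<in>S. qscale (of_int (c x)) (\<psi> x))"
    if "finite S" "S \<subseteq> carrier G" for S and c :: "'g \<Rightarrow> int"
    using that
  proof (induction S)
    case (insert a S)
    have "(\<lambda>x. x [^]\<^bsub>G\<^esub> c x) \<in> S \<rightarrow> carrier G" using insert by auto
    then show ?case
      using insert by (simp add: G.finprod_insert add \<psi>int G.finprod_closed)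
  qed (simp add: \<psi>1)
  have upper: "card S \<le> card T" if S: "int_independent G S" for S
  proof -
    have fin: "finite S" and sub: "S \<subseteq> carrier G" using S by (auto simp: int_independent_def)
    have key: "q x = 0" if q: "(\<Sum>x\<in>S. qscale (q x) (\<psi> x)) = 0" and x: "x \<in> S" for q x
    proof -
      obtain D c where D: "(D::int) > 0" "\<And>x. x \<in> S \<Longrightarrow> of_int (c x) = of_int D * q x"
        using clear_denominators[OF fin] by blast
      let ?p = "finprod G (\<lambda>x. x [^]\<^bsub>G\<^esub> c x) S"
      have pc: "?p \<in> carrier G" using sub by (intro G.finprod_closed) auto
      have "\<psi> ?p = (\<Sum>x\<in>S. qscale (of_int D) (qscale (q x) (\<psi> x)))"
        unfolding \<psi>sum[OF fin sub] using D(2) by (intro sum.cong) (auto simp: qscale_def mult.assoc)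
      also have "\<dots> = qscale (of_int D) (\<Sum>x\<in>S. qscale (q x) (\<psi> x))"
        by (rule Q.scale_sum_right[symmetric])
      also have "\<dots> = 0" unfolding q by (rule Q.scale_zero_right)
      finally obtain n :: int where n: "n > 0" "?p [^]\<^bsub>G\<^esub> n = \<one>\<^bsub>G\<^esub>" using tors[OF pc] by blast
      then have "finprod G (\<lambda>x. x [^]\<^bsub>G\<^esub> (c x * n)) S = \<one>\<^bsub>G\<^esub>"
        using G.finprod_int_pow[OF fin sub] by simp
      then have "c x * n = 0" using S x unfolding int_independent_def by metis
      then have "c x = 0" using n by simp
      then show "q x = 0" using D x by fastforce
    qed
    have inj: "inj_on \<psi> S"
    proof (rule inj_onI, rule ccontr)
      fix x y assume xy: "x \<in> S" "y \<in> S" "\<psi> x = \<psi> y" "x \<noteq> y"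
      let ?q = "\<lambda>z. if z = x then 1 else if z = y then -1 else (0::rat)"
      have "(\<Sum>z\<in>S. qscale (?q z) (\<psi> z)) = (\<Sum>z\<in>{x,y}. qscale (?q z) (\<psi> z))"
        using fin xy by (intro sum.mono_neutral_right) (auto simp: qscale_def zero_fun_def)
      also have "\<dots> = 0" using xy by (simp add: qscale_def fun_eq_iff)
      finally have "?q x = 0" by (rule key) (rule xy)
      then show False by simp
    qed
    have "Q.independent (\<psi> ` S)"
    proof
      assume "Q.dependent (\<psi> ` S)"
      then obtain u v where u: "v \<in> \<psi> ` S" "u v \<noteq> 0" "(\<Sum>v\<in>\<psi> ` S. qscale (u v) v) = 0"
        using Q.dependent_finite[of "\<psi> ` S"] fin by auto
      then obtain x where x: "x \<in> S" "v = \<psi> x" by blast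
      have "(\<Sum>x\<in>S. qscale (u (\<psi> x)) (\<psi> x)) = 0" using u(3) by (simp add: sum.reindex[OF inj])
      from key[OF this x(1)] show False using u x by simp
    qed
    moreover have "\<psi> ` S \<subseteq> Q.span T" using T(4) sub by blast
    ultimately have "card (\<psi> ` S) \<le> card T" using Q.independent_span_bound[OF T(1)] by blast
    then show ?thesis using card_image[OF inj] by simp
  qed
  obtain r where r: "\<And>t. t \<in> T \<Longrightarrow> r t \<in> carrier G \<and> \<psi> (r t) = t"
    using T(3) by (metis (no_types, lifting) image_iff subsetD)
  have injr: "inj_on r T" by (metis inj_onI r)
  have "int_independent G (r ` T)"
    unfolding int_independent_def
  proof (intro conjI allI impI)
    show "finite (r ` T)" "r ` T \<subseteq> carrier G" using T r by auto
    fix c :: "'g \<Rightarrow> int" assume c: "finprod G (\<lambda>x. x [^]\<^bsub>G\<^esub> c x) (r ` T) = \<one>\<^bsub>G\<^esub>"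
    have "0 = (\<Sum>x\<in>r ` T. qscale (of_int (c x)) (\<psi> x))"
      using \<psi>sum[of "r ` T" c] c \<psi>1 T r by (metis (no_types, lifting) finite_imageI image_subsetI)
    also have "\<dots> = (\<Sum>t\<in>T. qscale (of_int (c (r t))) t)"
      using r by (simp add: sum.reindex[OF injr])
    finally have "\<forall>t\<in>T. of_int (c (r t)) = (0::rat)"
      using Q.dependent_finite[OF T(1)] T(2) by metis
    then show "\<forall>x\<in>r ` T. c x = 0" by auto
  qed
  then have "card T \<in> {card S |S. int_independent G S}"
    using card_image[OF injr] by force
  then show ?thesis
    unfolding abelian_rank_def using upper by (intro cSup_eq_maximum) auto
qed

definition frag_subgroup :: "('x \<Rightarrow>\<^sub>0 int) set \<Rightarrow> bool" where
  "frag_subgroup Z \<longleftrightarrow> 0 \<in> Z \<and> (\<forall>a\<in>Z. \<forall>b\<in>Z. a - b \<in> Z)"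

lemma frag_subgroupD:
  assumes "frag_subgroup Z"
  shows "0 \<in> Z" "a \<in> Z \<Longrightarrow> b \<in> Z \<Longrightarrow> a - b \<in> Z" "a \<in> Z \<Longrightarrow> - a \<in> Z"
    "a \<in> Z \<Longrightarrow> b \<in> Z \<Longrightarrow> a + b \<in> Z"
proof -
  show 0: "0 \<in> Z" and d: "a \<in> Z \<Longrightarrow> b \<in> Z \<Longrightarrow> a - b \<in> Z" for a b using assms by (auto simp: frag_subgroup_def)
  show m: "- a \<in> Z" if "a \<in> Z" for a using d[OF 0 that] by simp
  show "a \<in> Z \<Longrightarrow> b \<in> Z \<Longrightarrow> a + b \<in> Z" using d[of a "-b"] m[of b] by simp
qed

lemma frag_cmul_Suc: "frag_cmul (int (Suc n)) a = frag_cmul (int n) a + a"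
  using frag_cmul_distrib[of "int n" 1 a] by (simp add: add.commute)

lemma frag_subgroup_cmul:
  assumes Z: "frag_subgroup Z" and a: "a \<in> Z"
  shows "frag_cmul k a \<in> Z"
proof -
  have nat: "frag_cmul (int n) a \<in> Z" for n
  proof (induction n)
    case (Suc n)
    then show ?case unfolding frag_cmul_Suc using a frag_subgroupD[OF Z] by blast
  qed (simp add: frag_subgroupD[OF Z])
  show ?thesis
  proof (cases "k \<ge> 0")
    case True then show ?thesis using nat[of "nat k"] by simp
  next
    case False
    then have "frag_cmul k a = - frag_cmul (int (nat (-k))) a" by simp
    then show ?thesis using nat frag_subgroupD(3)[OF Z] by metis
  qed
qed

lemma frag_subgroup_sum:
  assumes Z: "frag_subgroup Z" and "\<And>i. i \<in> I \<Longrightarrow> g i \<in> Z"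
  shows "(\<Sum>i\<in>I. g i) \<in> Z"
  using assms(2) by (induction I rule: infinite_finite_induct) (auto simp: frag_subgroupD[OF Z])

definition additive_on :: "('x \<Rightarrow>\<^sub>0 int) set \<Rightarrow> (('x \<Rightarrow>\<^sub>0 int) \<Rightarrow> 'v::ab_group_add) \<Rightarrow> bool" where
  "additive_on Z f \<longleftrightarrow> (\<forall>a\<in>Z. \<forall>b\<in>Z. f (a + b) = f a + f b)"

context
  fixes Z :: "('x \<Rightarrow>\<^sub>0 int) set" and f :: "('x \<Rightarrow>\<^sub>0 int) \<Rightarrow> 'v::ab_group_add"
  assumes Z: "frag_subgroup Z" and f: "additive_on Z f"
begin

lemma additive_on_add: "a \<in> Z \<Longrightarrow> b \<in> Z \<Longrightarrow> f (a + b) = f a + f b"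
  using f by (simp add: additive_on_def)

lemma additive_on_0: "f 0 = 0"
  using additive_on_add[of 0 0] frag_subgroupD(1)[OF Z] by simp

lemma additive_on_minus:
  assumes "a \<in> Z"
  shows "f (- a) = - f a"
  using additive_on_add[OF assms frag_subgroupD(3)[OF Z assms]] additive_on_0
  by (simp add: eq_neg_iff_add_eq_0 add.commute)

lemma additive_on_diff:
  assumes "a \<in> Z" "b \<in> Z"
  shows "f (a - b) = f a - f b"
  using additive_on_add[OF assms(1) frag_subgroupD(3)[OF Z assms(2)]] additive_on_minus[OF assms(2)] by simp

lemma additive_on_sum:
  assumes "\<And>i. i \<in> I \<Longrightarrow> g i \<in> Z"
  shows "f (\<Sum>i\<in>I. g i) = (\<Sum>i\<in>I. f (g i))"
  using assms
proof (induction I rule: infinite_finite_induct)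
  case (insert x F)
  then have "f (g x + (\<Sum>i\<in>F. g i)) = f (g x) + f (\<Sum>i\<in>F. g i)"
    by (intro additive_on_add frag_subgroup_sum[OF Z]) auto
  with insert show ?case by simp
qed (simp_all add: additive_on_0)

end

lemma additive_on_cmul:
  fixes f :: "('x \<Rightarrow>\<^sub>0 int) \<Rightarrow> int"
  assumes Z: "frag_subgroup Z" and f: "additive_on Z f" and a: "a \<in> Z"
  shows "f (frag_cmul k a) = k * f a"
proof -
  have nat: "f (frag_cmul (int n) a) = int n * f a" for n
  proof (induction n)
    case (Suc n)
    show ?case unfolding frag_cmul_Suc
      using Suc additive_on_add[OF Z f frag_subgroup_cmul[OF Z a] a] by (simp add: algebra_simps)
  qed (simp add: additive_on_0[OF Z f])
  show ?thesis
  proof (cases "k \<ge> 0")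
    case True then show ?thesis using nat[of "nat k"] by simp
  next
    case False
    then have "frag_cmul k a = - frag_cmul (int (nat (-k))) a" by simp
    then have "f (frag_cmul k a) = - f (frag_cmul (int (nat (-k))) a)"
      using additive_on_minus[OF Z f frag_subgroup_cmul[OF Z a, of "int (nat (-k))"]] by simp
    then show ?thesis using nat[of "nat (-k)"] False by simp
  qed
qed

text \<open>The same for a group that is presented as a quotient of a group of formal sums, as homology
  groups are.\<close>

lemma abelian_rank_quotient:
  fixes \<pi> :: "('x \<Rightarrow>\<^sub>0 int) \<Rightarrow> 'g" and \<Phi> :: "('x \<Rightarrow>\<^sub>0 int) \<Rightarrow> 'i \<Rightarrow> rat"
  assumes G: "comm_group G" and Z: "frag_subgroup Z"
    and \<pi>: "\<pi> ` Z = carrier G" "\<And>a b. a \<in> Z \<Longrightarrow> b \<in> Z \<Longrightarrow> \<pi> (a + b) = \<pi> a \<otimes>\<^bsub>G\<^esub> \<pi> b"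
    and \<Phi>: "additive_on Z \<Phi>"
    and ker: "\<And>a. a \<in> Z \<Longrightarrow> \<pi> a = \<one>\<^bsub>G\<^esub> \<Longrightarrow> \<Phi> a = 0"
    and tors: "\<And>a. a \<in> Z \<Longrightarrow> \<Phi> a = 0 \<Longrightarrow> \<exists>n>0::int. \<pi> (frag_cmul n a) = \<one>\<^bsub>G\<^esub>"
    and T: "finite T" "Q.independent T" "T \<subseteq> \<Phi> ` Z" "\<Phi> ` Z \<subseteq> Q.span T"
  shows "abelian_rank G = card T"
proof -
  interpret G: comm_group G by (rule G)
  have \<pi>c: "\<pi> a \<in> carrier G" if "a \<in> Z" for a using \<pi>(1) imageI[OF that, of \<pi>] by simp
  have \<pi>0: "\<pi> 0 = \<one>\<^bsub>G\<^esub>"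
    using \<pi>(2)[of 0 0] frag_subgroupD(1)[OF Z] \<pi>c G.r_cancel_one' by (metis add_0)
  have \<pi>m: "\<pi> (- a) = inv\<^bsub>G\<^esub> \<pi> a" if "a \<in> Z" for a
    using \<pi>(2)[of "-a" a] \<pi>0 \<pi>c frag_subgroupD(3)[OF Z that] that by (metis G.inv_equality add.left_inverse)
  have \<pi>n: "\<pi> (frag_cmul (int n) a) = \<pi> a [^]\<^bsub>G\<^esub> n" if "a \<in> Z" for a n
  proof (induction n)
    case (Suc n)
    then show ?case unfolding frag_cmul_Suc using \<pi>(2)[OF frag_subgroup_cmul[OF Z that] that] by simp
  qed (simp add: \<pi>0)
  define r where "r g = (SOME a. a \<in> Z \<and> \<pi> a = g)" for g
  have r: "r g \<in> Z \<and> \<pi> (r g) = g" if "g \<in> carrier G" for g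
  proof -
    have "g \<in> \<pi> ` Z" using that \<pi>(1) by simp
    then have "\<exists>a. a \<in> Z \<and> \<pi> a = g" by (auto simp: image_iff)
    then show ?thesis unfolding r_def by (rule someI_ex)
  qed
  have wd: "\<Phi> a = \<Phi> b" if "a \<in> Z" "b \<in> Z" "\<pi> a = \<pi> b" for a b
  proof -
    have "\<pi> (a - b) = \<one>\<^bsub>G\<^esub>"
      using \<pi>(2)[OF that(1) frag_subgroupD(3)[OF Z that(2)]] \<pi>m[OF that(2)] that(3) G.r_inv[OF \<pi>c[OF that(2)]]
      by (simp only: add_uminus_conv_diff)
    then have "\<Phi> (a - b) = 0" using ker[OF frag_subgroupD(2)[OF Z that(1,2)]] by simp
    then show ?thesis using additive_on_diff[OF Z \<Phi> that(1,2)] by simp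
  qed
  have img: "(\<lambda>g. \<Phi> (r g)) ` carrier G = \<Phi> ` Z"
  proof safe
    fix a assume a: "a \<in> Z"
    have "\<Phi> a = \<Phi> (r (\<pi> a))" using wd[of a "r (\<pi> a)"] r[OF \<pi>c[OF a]] a by simp
    then show "\<Phi> a \<in> (\<lambda>g. \<Phi> (r g)) ` carrier G" using \<pi>c[OF a] by blast
  qed (use r in blast)
  show ?thesis
  proof (rule abelian_rank_eq[OF G, of "\<lambda>g. \<Phi> (r g)"])
    fix a b assume ab: "a \<in> carrier G" "b \<in> carrier G"
    have "\<Phi> (r (a \<otimes>\<^bsub>G\<^esub> b)) = \<Phi> (r a + r b)"
      using r[OF ab(1)] r[OF ab(2)] r[OF G.m_closed[OF ab]] \<pi>(2)[of "r a" "r b"] frag_subgroupD(4)[OF Z]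
      by (intro wd) simp_all
    then show "\<Phi> (r (a \<otimes>\<^bsub>G\<^esub> b)) = \<Phi> (r a) + \<Phi> (r b)"
      using additive_on_add[OF Z \<Phi>, of "r a" "r b"] r[OF ab(1)] r[OF ab(2)] by simp
  next
    fix a assume a: "a \<in> carrier G" "\<Phi> (r a) = 0"
    obtain n :: int where n: "n > 0" "\<pi> (frag_cmul n (r a)) = \<one>\<^bsub>G\<^esub>" using tors r a by blast
    then have "a [^]\<^bsub>G\<^esub> (nat n) = \<one>\<^bsub>G\<^esub>" using \<pi>n[of "r a" "nat n"] r[OF a(1)] by simp
    then show "\<exists>n>0::int. a [^]\<^bsub>G\<^esub> n = \<one>\<^bsub>G\<^esub>" 
      using n(1) int_pow_int[of G a "nat n"] by (intro exI[of _ n]) (simp only: int_nat_eq if_True order_less_imp_le)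
  qed (simp_all only: img T not_False_eq_True)
qed

text \<open>Elements of \<open>Z\<close> and forms on the quotient of \<open>Z\<close> by \<open>B\<close> that are dual up to the factor \<open>N\<close>,
  the forms detecting everything but torsion. The factor keeps all values integral.\<close>

definition dual_basis ::
    "('x \<Rightarrow>\<^sub>0 int) set \<Rightarrow> ('x \<Rightarrow>\<^sub>0 int) set \<Rightarrow> nat \<Rightarrow> (nat \<Rightarrow> 'x \<Rightarrow>\<^sub>0 int) \<Rightarrow> (nat \<Rightarrow> ('x \<Rightarrow>\<^sub>0 int) \<Rightarrow> int) \<Rightarrow> int \<Rightarrow> bool"
  where
  "dual_basis Z B b x f N \<longleftrightarrow> N > 0 \<and> (\<forall>j<b. x j \<in> Z) \<and> (\<forall>j<b. additive_on Z (f j)) \<and>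
     (\<forall>j<b. \<forall>a\<in>B. f j a = 0) \<and> (\<forall>i<b. \<forall>j<b. f j (x i) = (if i = j then N else 0)) \<and>
     (\<forall>c\<in>Z. (\<forall>j<b. f j c = 0) \<longrightarrow> (\<exists>n>0. frag_cmul n c \<in> B))"

lemma independent_scaled_units:
  assumes "finite J" "N \<noteq> (0::rat)"
  shows "Q.independent ((\<lambda>j k. if k = j then N else 0) ` J)" "inj_on (\<lambda>j k. if k = j then N else (0::rat)) J"
proof -
  let ?u = "\<lambda>j k. if k = j then N else 0"
  show inj: "inj_on ?u J"
    using assms(2) by (auto simp: inj_on_def fun_eq_iff split: if_splits)
  show "Q.independent (?u ` J)"
  proof
    assume "Q.dependent (?u ` J)"
    then obtain u v where u: "v \<in> ?u ` J" "u v \<noteq> 0" "(\<Sum>v\<in>?u ` J. qscale (u v) v) = 0"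
      using Q.dependent_finite[of "?u ` J"] assms(1) by auto
    then obtain i where i: "i \<in> J" "v = ?u i" by blast
    have "0 = (\<Sum>j\<in>J. qscale (u (?u j)) (?u j)) i" using u(3) by (simp add: sum.reindex[OF inj])
    also have "\<dots> = (\<Sum>j\<in>J. u (?u j) * ?u j i)" by (induction J rule: infinite_finite_induct) (simp_all add: qscale_def)
    also have "\<dots> = (\<Sum>j\<in>{i}. u (?u j) * ?u j i)"
      using i assms(1) by (intro sum.mono_neutral_right) auto
    finally show False using u(2) i assms(2) by simp
  qed
qed

lemma sum_fun_apply: "(\<Sum>i\<in>I. f i) x = (\<Sum>i\<in>I. f i x)"
  by (induction I rule: infinite_finite_induct) simp_all

lemma span_scaled_units:
  assumes "finite J" "N \<noteq> (0::rat)" and v: "\<And>k. k \<notin> J \<Longrightarrow> v k = 0"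
  shows "v \<in> Q.span ((\<lambda>j k. if k = j then N else 0) ` J)"
proof -
  have "v = (\<Sum>j\<in>J. qscale (v j / N) (\<lambda>k. if k = j then N else 0))"
  proof
    fix k
    have "(\<Sum>j\<in>J. qscale (v j / N) (\<lambda>k. if k = j then N else 0)) k = (\<Sum>j\<in>J. if k = j then v k else 0)"
      unfolding sum_fun_apply using assms(2) by (intro sum.cong) (auto simp: qscale_def)
    also have "\<dots> = v k" using assms(1) v by (simp add: sum.delta')
    finally show "v k = (\<Sum>j\<in>J. qscale (v j / N) (\<lambda>k. if k = j then N else 0)) k" by simp
  qed
  also have "\<dots> \<in> Q.span ((\<lambda>j k. if k = j then N else 0) ` J)"
    by (intro Q.span_sum Q.span_scale Q.span_base) auto
  finally show ?thesis .
qed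

text \<open>The forms are coordinates that map the quotient onto a lattice of full rank, up to torsion.\<close>

lemma abelian_rank_dual_basis:
  fixes \<pi> :: "('x \<Rightarrow>\<^sub>0 int) \<Rightarrow> 'g"
  assumes G: "comm_group G" and Z: "frag_subgroup Z"
    and \<pi>: "\<pi> ` Z = carrier G" "\<And>a b. a \<in> Z \<Longrightarrow> b \<in> Z \<Longrightarrow> \<pi> (a + b) = \<pi> a \<otimes>\<^bsub>G\<^esub> \<pi> b"
    and ker: "\<And>a. a \<in> Z \<Longrightarrow> \<pi> a = \<one>\<^bsub>G\<^esub> \<longleftrightarrow> a \<in> B"
    and db: "dual_basis Z B b x f N"
  shows "abelian_rank G = b"
proof -
  define \<Phi> :: "('x \<Rightarrow>\<^sub>0 int) \<Rightarrow> nat \<Rightarrow> rat" where "\<Phi> c = (\<lambda>j. if j < b then of_int (f j c) else 0)" for c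
  define u :: "nat \<Rightarrow> nat \<Rightarrow> rat" where "u = (\<lambda>j k. if k = j then of_int N else 0)"
  have N: "of_int N \<noteq> (0::rat)" using db by (simp add: dual_basis_def)
  have "abelian_rank G = card (u ` {..<b})"
  proof (rule abelian_rank_quotient[where G = G and Z = Z and \<pi> = \<pi> and \<Phi> = \<Phi>, OF G Z \<pi>])
    show "additive_on Z \<Phi>" using db by (auto simp: additive_on_def \<Phi>_def dual_basis_def fun_eq_iff)
    show "\<Phi> a = 0" if "a \<in> Z" "\<pi> a = \<one>\<^bsub>G\<^esub>" for a
      using ker[OF that(1)] that(2) db by (auto simp: \<Phi>_def dual_basis_def fun_eq_iff)
    show "\<exists>n>0. \<pi> (frag_cmul n a) = \<one>\<^bsub>G\<^esub>" if a: "a \<in> Z" "\<Phi> a = 0" for a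
    proof -
      have "f j a = 0" if "j < b" for j using fun_cong[OF a(2), of j] that by (simp add: \<Phi>_def)
      then obtain n where n: "n > 0" "frag_cmul n a \<in> B" using db a(1) unfolding dual_basis_def by blast
      then show ?thesis using ker[OF frag_subgroup_cmul[OF Z a(1), of n]] by blast
    qed
    show "finite (u ` {..<b})" by simp
    show "Q.independent (u ` {..<b})" unfolding u_def by (rule independent_scaled_units) (use N in auto)
    show "u ` {..<b} \<subseteq> \<Phi> ` Z"
    proof safe
      fix j assume j: "j < b"
      have "u j = \<Phi> (x j)" using db j by (auto simp: u_def \<Phi>_def dual_basis_def fun_eq_iff)
      then show "u j \<in> \<Phi> ` Z" using db j by (auto simp: dual_basis_def)
    qed
    show "\<Phi> ` Z \<subseteq> Q.span (u ` {..<b})"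
    proof safe
      fix c show "\<Phi> c \<in> Q.span (u ` {..<b})"
        unfolding u_def by (rule span_scaled_units) (use N in \<open>auto simp: \<Phi>_def\<close>)
    qed
  qed
  also have "\<dots> = b"
    unfolding u_def by (subst card_image) (rule independent_scaled_units(2), simp, rule N, simp)
  finally show ?thesis .
qed

lemma frag_cmul_diff: "frag_cmul k (a - b) = frag_cmul k a - frag_cmul k b"
  using frag_cmul_distrib2[of k "a - b" b] by (simp add: eq_diff_eq)

text \<open>A maximal independent set of generators spans the quotient up to torsion. The factor \<open>N\<close> is a
  common denominator of the resulting rational coordinates.\<close>

lemma exists_dual_basis:
  fixes Z B :: "('x \<Rightarrow>\<^sub>0 int) set"
  assumes Z: "frag_subgroup Z" and B: "frag_subgroup B" and D: "finite D"
    and gen: "\<And>c. c \<in> Z \<Longrightarrow> \<exists>k. c - (\<Sum>d\<in>D. frag_cmul (k d) d) \<in> B"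
    and BZ: "B \<subseteq> Z"
  obtains b x f N where "dual_basis Z B b x f N"
proof -
  define comb :: "(('x \<Rightarrow>\<^sub>0 int) \<Rightarrow> int) \<Rightarrow> ('x \<Rightarrow>\<^sub>0 int) set \<Rightarrow> ('x \<Rightarrow>\<^sub>0 int)" where
    "comb k S = (\<Sum>d\<in>S. frag_cmul (k d) d)" for k S
  define ind where "ind S \<longleftrightarrow> (\<forall>k. comb k S \<in> B \<longrightarrow> (\<forall>d\<in>S. k d = 0))" for S
  have comb_add: "comb (\<lambda>d. k d + l d) S = comb k S + comb l S" for k l S
    by (simp add: comb_def frag_cmul_distrib sum.distrib)
  have comb_mult: "comb (\<lambda>d. m * k d) S = frag_cmul m (comb k S)" for m k S
    by (simp add: comb_def frag_cmul_sum)
  have comb_sum: "comb (\<lambda>d. \<Sum>i\<in>I. k i d) S = (\<Sum>i\<in>I. comb (k i) S)" for k and I :: "('x \<Rightarrow>\<^sub>0 int) set" and S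
  proof (induction I rule: infinite_finite_induct)
    case (insert i I) then show ?case by (simp add: comb_add)
  qed (simp_all add: comb_def)
  obtain S where S: "S \<subseteq> D" "ind S" "\<And>S'. S' \<subseteq> D \<Longrightarrow> ind S' \<Longrightarrow> card S' \<le> card S"
  proof -
    let ?P = "\<lambda>S. S \<subseteq> D \<and> ind S"
    have "?P {}" by (simp add: ind_def)
    moreover have "\<forall>S. ?P S \<longrightarrow> card S \<le> card D" using card_mono[OF D] by blast
    ultimately obtain S where "?P S" "\<forall>S'. ?P S' \<longrightarrow> card S' \<le> card S"
      using ex_has_greatest_nat[of ?P "{}" card "Suc (card D)"] by (metis (no_types, lifting) less_Suc_eq_le)
    then show ?thesis using that by blast
  qed
  have finS: "finite S" using S(1) D finite_subset by blast
  have dep: "\<exists>N k. N > 0 \<and> frag_cmul N d - comb k S \<in> B" if d: "d \<in> D" for d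
  proof (cases "d \<in> S")
    case True
    have "comb (\<lambda>e. if e = d then 1 else 0) S = (\<Sum>e\<in>{d}. frag_cmul (if e = d then 1 else 0) e)"
      unfolding comb_def using finS True by (intro sum.mono_neutral_right) auto
    then have "frag_cmul 1 d - comb (\<lambda>e. if e = d then 1 else 0) S \<in> B"
      using frag_subgroupD(1)[OF B] by simp
    then have "\<exists>k. frag_cmul 1 d - comb k S \<in> B" by blast
    then show ?thesis using zero_less_one by blast
  next
    case False
    have "\<not> ind (insert d S)" using S(3)[of "insert d S"] S(1) d False finS by auto
    then obtain k where k: "comb k (insert d S) \<in> B" "\<exists>e\<in>insert d S. k e \<noteq> 0" by (auto simp: ind_def)
    have eq: "comb k (insert d S) = frag_cmul (k d) d + comb k S"
      unfolding comb_def using finS False by simp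
    have "k d \<noteq> 0"
    proof
      assume 0: "k d = 0"
      then have "comb k S \<in> B" using k(1) eq by simp
      then show False using S(2) k(2) 0 unfolding ind_def by auto
    qed
    show ?thesis
    proof (cases "k d > 0")
      case True
      have "frag_cmul (k d) d - comb (\<lambda>e. (-1) * k e) S \<in> B" using k(1) unfolding comb_mult by (simp add: eq)
      then show ?thesis using True by blast
    next
      case False
      have "- comb k (insert d S) = frag_cmul (- k d) d - comb k S" by (simp add: eq)
      then have "frag_cmul (- k d) d - comb k S \<in> B" using frag_subgroupD(3)[OF B k(1)] by metis
      then show ?thesis using False \<open>k d \<noteq> 0\<close> by (intro exI[of _ "- k d"] exI[of _ k]) simp
    qed
  qed
  obtain N0 k0 where N0: "\<And>d. d \<in> D \<Longrightarrow> N0 d > (0::int) \<and> frag_cmul (N0 d) d - comb (k0 d) S \<in> B"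
    using dep by metis
  define N where "N = (\<Prod>d\<in>D. N0 d)"
  have Npos: "N > 0" unfolding N_def using N0 by (intro prod_pos) blast
  have dep': "\<exists>k. frag_cmul N d - comb k S \<in> B" if d: "d \<in> D" for d
  proof -
    have N: "N = prod N0 (D - {d}) * N0 d" unfolding N_def using prod.remove[OF D d, of N0] by (simp add: mult.commute)
    have "frag_cmul (prod N0 (D - {d})) (frag_cmul (N0 d) d - comb (k0 d) S) \<in> B"
      using frag_subgroup_cmul[OF B] N0[OF d] by blast
    then have "frag_cmul N d - comb (\<lambda>e. prod N0 (D - {d}) * k0 d e) S \<in> B"
      unfolding comb_mult by (simp add: frag_cmul_diff N)
    then show ?thesis by blast
  qed
  obtain k1 where k1: "\<And>d. d \<in> D \<Longrightarrow> frag_cmul N d - comb (k1 d) S \<in> B" using dep' by metis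
  have ex: "\<exists>k. frag_cmul N c - comb k S \<in> B" if c: "c \<in> Z" for c
  proof -
    obtain m where m: "c - comb m D \<in> B" using gen[OF c] unfolding comb_def by blast
    have "(\<Sum>d\<in>D. frag_cmul (m d) (frag_cmul N d - comb (k1 d) S)) \<in> B"
      using k1 by (intro frag_subgroup_sum[OF B] frag_subgroup_cmul[OF B]) auto
    moreover have "(\<Sum>d\<in>D. frag_cmul (m d) (frag_cmul N d - comb (k1 d) S))
        = frag_cmul N (comb m D) - comb (\<lambda>e. \<Sum>d\<in>D. m d * k1 d e) S"
      unfolding comb_sum comb_mult
      by (simp add: frag_cmul_diff sum_subtractf comb_def frag_cmul_sum mult.commute)
    moreover have "frag_cmul N (c - comb m D) \<in> B" using frag_subgroup_cmul[OF B m] .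
    ultimately have "frag_cmul N (c - comb m D) + (frag_cmul N (comb m D) - comb (\<lambda>e. \<Sum>d\<in>D. m d * k1 d e) S) \<in> B"
      using frag_subgroupD(4)[OF B] by metis
    then show ?thesis by (auto simp: frag_cmul_diff)
  qed
  define \<kappa> where "\<kappa> c = (\<lambda>d. if d \<in> S then (SOME k. frag_cmul N c - comb k S \<in> B) d else 0)" for c
  have comb_cong: "comb k S = comb l S" if "\<And>d. d \<in> S \<Longrightarrow> k d = l d" for k l
    unfolding comb_def using that by (intro sum.cong) auto
  have \<kappa>: "frag_cmul N c - comb (\<kappa> c) S \<in> B" if c: "c \<in> Z" for c
    using someI_ex[OF ex[OF c]] comb_cong[of "\<kappa> c" "SOME k. frag_cmul N c - comb k S \<in> B"]
    by (simp add: \<kappa>_def)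
  have \<kappa>_unique: "k d = \<kappa> c d" if c: "c \<in> Z" and k: "frag_cmul N c - comb k S \<in> B" and d: "d \<in> S" for c k d
  proof -
    have "(frag_cmul N c - comb (\<kappa> c) S) - (frag_cmul N c - comb k S) \<in> B"
      using frag_subgroupD(2)[OF B \<kappa>[OF c] k] .
    moreover have "comb (\<lambda>d. k d + (-1) * \<kappa> c d) S = comb k S - comb (\<kappa> c) S"
      unfolding comb_add comb_mult by simp
    ultimately have "comb (\<lambda>d. k d + (-1) * \<kappa> c d) S \<in> B" by simp
    then have "k d + (-1) * \<kappa> c d = 0" using S(2) d unfolding ind_def by blast
    then show ?thesis by simp
  qed
  define \<Psi> :: "('x \<Rightarrow>\<^sub>0 int) \<Rightarrow> ('x \<Rightarrow>\<^sub>0 int) \<Rightarrow> rat" where "\<Psi> c = (\<lambda>d. of_int (\<kappa> c d))" for c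
  have \<kappa>0: "\<kappa> c d = 0" if "d \<notin> S" for c d using that by (simp add: \<kappa>_def)
  have \<kappa>_add: "\<kappa> (a + c) d = \<kappa> a d + \<kappa> c d" if "a \<in> Z" "c \<in> Z" for a c d
  proof (cases "d \<in> S")
    case True
    have "(frag_cmul N a - comb (\<kappa> a) S) + (frag_cmul N c - comb (\<kappa> c) S) \<in> B"
      using frag_subgroupD(4)[OF B \<kappa>[OF that(1)] \<kappa>[OF that(2)]] .
    then have "frag_cmul N (a + c) - comb (\<lambda>d. \<kappa> a d + \<kappa> c d) S \<in> B"
      unfolding comb_add by (simp add: frag_cmul_distrib2 algebra_simps)
    from \<kappa>_unique[OF frag_subgroupD(4)[OF Z that] this True] show ?thesis by simp
  qed (simp add: \<kappa>0)
  have \<kappa>B: "\<kappa> a d = 0" if a: "a \<in> B" for a d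
  proof (cases "d \<in> S")
    case True
    have "frag_cmul N a - comb (\<lambda>d. 0) S \<in> B" using frag_subgroup_cmul[OF B a] by (simp add: comb_def)
    from \<kappa>_unique[OF _ this True] show ?thesis using a BZ by auto
  qed (simp add: \<kappa>0)
  have \<Psi>ker: "frag_cmul N c \<in> B" if "c \<in> Z" "\<Psi> c = 0" for c
  proof -
    have "\<kappa> c d = 0" for d using fun_cong[OF that(2), of d] by (simp add: \<Psi>_def)
    then have "comb (\<kappa> c) S = 0" by (simp add: comb_def)
    then show ?thesis using \<kappa>[OF that(1)] by simp
  qed
  define \<delta> :: "('x \<Rightarrow>\<^sub>0 int) \<Rightarrow> ('x \<Rightarrow>\<^sub>0 int) \<Rightarrow> rat" where "\<delta> = (\<lambda>j k. if k = j then 1 else 0)"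
  have \<Psi>sum: "\<Psi> c = (\<Sum>d\<in>S. qscale (of_int (\<kappa> c d)) (\<delta> d))" for c
  proof
    fix e
    have "(\<Sum>d\<in>S. qscale (of_int (\<kappa> c d)) (\<delta> d)) e = (\<Sum>d\<in>S. if e = d then of_int (\<kappa> c e) else 0)"
      unfolding sum_fun_apply by (intro sum.cong) (auto simp: qscale_def \<delta>_def)
    then show "\<Psi> c e = (\<Sum>d\<in>S. qscale (of_int (\<kappa> c d)) (\<delta> d)) e"
      using finS \<kappa>0 by (simp add: sum.delta' \<Psi>_def)
  qed
  have img: "\<Psi> ` Z \<subseteq> Q.span (\<delta> ` S)"
  proof safe
    fix c show "\<Psi> c \<in> Q.span (\<delta> ` S)"
      unfolding \<Psi>sum[of c] by (rule Q.span_sum, rule Q.span_scale, rule Q.span_base, rule imageI)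
  qed
  obtain T where T: "T \<subseteq> \<Psi> ` Z" "Q.independent T" "\<Psi> ` Z \<subseteq> Q.span T" "finite T"
    by (rule finite_basis_of_subset[OF _ Q.independent_empty img]) (use finS in auto)
  obtain C where C: "T \<subseteq> C" "Q.independent C" "UNIV \<subseteq> Q.span C"
    using Q.maximal_independent_subset_extend[OF subset_UNIV T(2)] by metis
  have sp: "v \<in> Q.span C" for v using C(3) by blast
  obtain N' m where N': "(N'::int) > 0" "\<And>p. p \<in> S \<times> T \<Longrightarrow> of_int (m p) = of_int N' * Q.representation C (\<delta> (fst p)) (snd p)"
    using clear_denominators[of "S \<times> T" "\<lambda>p. Q.representation C (\<delta> (fst p)) (snd p)"] finS T(4) by blast
  define g where "g t c = (\<Sum>d\<in>S. \<kappa> c d * m (d, t))" for t c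
  have g: "of_int (g t c) = of_int N' * Q.representation C (\<Psi> c) t" if "t \<in> T" for t c
  proof -
    have "Q.representation C (\<Psi> c) t = (\<Sum>d\<in>S. of_int (\<kappa> c d) * Q.representation C (\<delta> d) t)"
      unfolding \<Psi>sum by (simp add: Q.representation_sum[OF C(2) sp] Q.representation_scale[OF C(2) sp])
    then show ?thesis
      using N'(2) that by (simp add: g_def sum_distrib_left mult.left_commute)
  qed
  obtain t where t: "bij_betw t {..<card T} T" using ex_bij_betw_nat_finite[OF T(4)] by (auto simp: atLeast0LessThan)
  have tT: "t j \<in> T" if "j < card T" for j using t that by (auto simp: bij_betw_def)
  have "\<exists>x. x \<in> Z \<and> \<Psi> x = t j" if "j < card T" for j
  proof -
    have "t j \<in> \<Psi> ` Z" using tT[OF that] T(1) by blast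
    then show ?thesis by (elim imageE) (metis)
  qed
  then obtain x where x: "\<And>j. j < card T \<Longrightarrow> x j \<in> Z \<and> \<Psi> (x j) = t j" by metis
  have "dual_basis Z B (card T) x (\<lambda>j. g (t j)) N'"
    unfolding dual_basis_def
  proof (intro conjI allI impI ballI)
    show "N' > 0" by (rule N')
    show "x j \<in> Z" if "j < card T" for j using x that by blast
    show "additive_on Z (g (t j))" for j
      by (simp add: additive_on_def g_def \<kappa>_add distrib_right sum.distrib)
    show "g (t j) a = 0" if "a \<in> B" for j a by (simp add: g_def \<kappa>B[OF that])
    show "g (t j) (x i) = (if i = j then N' else 0)" if ij: "i < card T" "j < card T" for i j
    proof -
      have "t i = t j \<longleftrightarrow> i = j" using t ij by (auto simp: bij_betw_def inj_on_def)
      moreover have "of_int (g (t j) (x i)) = of_int N' * (if t j = t i then 1 else (0::rat))"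
        using g[OF tT[OF ij(2)], of "x i"] x[OF ij(1)] Q.representation_basis[OF C(2), of "t i"] C(1) tT[OF ij(1)]
        by auto
      ultimately show ?thesis by (auto split: if_splits)
    qed
    show "\<exists>n>0. frag_cmul n c \<in> B" if c: "c \<in> Z" and 0: "\<forall>j<card T. g (t j) c = 0" for c
    proof -
      have sT: "\<Psi> c \<in> Q.span T" using T(3) c by blast
      have "Q.representation T (\<Psi> c) s = 0" if s: "s \<in> T" for s
      proof -
        obtain j where j: "j < card T" "s = t j" using t s by (auto simp: bij_betw_def)
        have "of_int N' * Q.representation C (\<Psi> c) s = 0" using g[OF s, of c] 0 j by simp
        then show ?thesis using N'(1) Q.representation_extend[OF C(2) sT C(1)] by simp
      qed
      then have "\<Psi> c = 0"
        using Q.sum_representation_eq[OF T(2) sT T(4) order_refl] by simp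
      then show ?thesis using \<Psi>ker[OF c] Npos by blast
    qed
  qed
  then show ?thesis using that by blast
qed

section \<open>Contraction and the relations of the exterior algebra\<close>

definition frag_eval :: "('x \<Rightarrow> 'r::ring_1) \<Rightarrow> ('x \<Rightarrow>\<^sub>0 int) \<Rightarrow> 'r" where
  "frag_eval \<phi> c = (\<Sum>x\<in>Poly_Mapping.keys c. of_int (Poly_Mapping.lookup c x) * \<phi> x)"

lemma frag_eval_superset:
  assumes "finite S" "Poly_Mapping.keys c \<subseteq> S"
  shows "frag_eval \<phi> c = (\<Sum>x\<in>S. of_int (Poly_Mapping.lookup c x) * \<phi> x)"
  unfolding frag_eval_def using assms by (intro sum.mono_neutral_left) (auto simp: in_keys_iff)

lemma frag_eval_0 [simp]: "frag_eval \<phi> 0 = 0"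
  by (simp add: frag_eval_def)

lemma frag_eval_of [simp]: "frag_eval \<phi> (frag_of x) = \<phi> x"
  by (simp add: frag_eval_def)

lemma frag_eval_diff [simp]: "frag_eval \<phi> (a - b) = frag_eval \<phi> a - frag_eval \<phi> b"
proof -
  let ?S = "Poly_Mapping.keys a \<union> Poly_Mapping.keys b"
  have "Poly_Mapping.keys (a - b) \<subseteq> ?S" by (rule keys_diff)
  then show ?thesis
    using frag_eval_superset[of ?S "a - b" \<phi>] frag_eval_superset[of ?S a \<phi>] frag_eval_superset[of ?S b \<phi>]
    by (simp add: lookup_minus left_diff_distrib sum_subtractf)
qed

lemma frag_eval_minus [simp]: "frag_eval \<phi> (- a) = - frag_eval \<phi> a"
  using frag_eval_diff[of \<phi> 0 a] by simp

lemma frag_eval_add [simp]: "frag_eval \<phi> (a + b) = frag_eval \<phi> a + frag_eval \<phi> b"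
  using frag_eval_diff[of \<phi> a "- b"] by simp

lemma frag_eval_cmul [simp]: "frag_eval \<phi> (frag_cmul k a) = of_int k * frag_eval \<phi> a"
proof -
  have "Poly_Mapping.keys (frag_cmul k a) \<subseteq> Poly_Mapping.keys a" by (rule keys_cmul)
  then show ?thesis
    using frag_eval_superset[of "Poly_Mapping.keys a" "frag_cmul k a"]
    by (simp add: frag_eval_def sum_distrib_left mult.assoc)
qed

lemma frag_eval_sum: "frag_eval \<phi> (\<Sum>i\<in>I. g i) = (\<Sum>i\<in>I. frag_eval \<phi> (g i))"
  by (induction I rule: infinite_finite_induct) simp_all

lemma frag_eval_frag_extend: "frag_eval \<phi> (frag_extend g c) = frag_eval (\<lambda>x. frag_eval \<phi> (g x)) c"
  unfolding frag_extend_def frag_eval_sum by (simp add: frag_eval_def[of _ c])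

text \<open>To prove a statement for all formal sums of members of a set.\<close>

lemma frag_subgroup_induct:
  assumes "frag_subgroup P" "\<And>x. x \<in> S \<Longrightarrow> frag_of x \<in> P" "Poly_Mapping.keys c \<subseteq> S"
  shows "c \<in> P"
  using assms(3)
  by (induction c rule: frag_induction) (use assms in \<open>auto simp: frag_subgroup_def\<close>)

abbreviation "C1 \<omega> \<equiv> frag_extend (contract1 \<omega>)"
abbreviation "C2 \<nu> \<equiv> frag_extend (contract2 \<nu>)"
abbreviation "C3 \<mu> \<equiv> frag_extend (contract3 \<mu>)"

lemma contract_Nil [simp]: "contract1 \<omega> [] = 0" "contract2 \<nu> [] = 0" "contract3 \<mu> [] = 0"
  by (simp_all add: contract1_def contract2_def contract3_def)

lemmas frag_extend_simps = frag_extend_add frag_extend_diff frag_extend_minus frag_extend_cmul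

lemma prepend_induct [case_names Nil Cons diff zero]:
  assumes "P (frag_of [])" "\<And>x w. P w \<Longrightarrow> P (prepend x w)"
    "\<And>v w. P v \<Longrightarrow> P w \<Longrightarrow> P (v - w)" "P 0"
  shows "P w"
proof -
  have word: "P (frag_of xs)" for xs
  proof (induction xs)
    case (Cons x xs)
    then show ?case using assms(2)[of "frag_of xs" x] by (simp add: prepend_simps)
  qed (rule assms(1))
  show ?thesis
    using subset_UNIV by (induction w rule: frag_induction) (use assms word in auto)
qed

lemma C1_prepend: "C1 \<omega> (prepend a w) = frag_cmul (\<omega> a) w - prepend a (C1 \<omega> w)"
  by (rule frag_extend_contract1_prepend)

lemma C2_prepend: "C2 \<nu> (prepend a w) = - C1 (\<nu> a) w + prepend a (C2 \<nu> w)"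
  using subset_UNIV
proof (induction w rule: frag_induction)
  case (diff v w)
  show ?case unfolding prepend_simps frag_extend_simps diff.IH by simp
qed (auto simp: prepend_simps contract2_Cons)

lemma C3_prepend: "C3 \<mu> (prepend a w) = C2 (\<mu> a) w - prepend a (C3 \<mu> w)"
  using subset_UNIV
proof (induction w rule: frag_induction)
  case (diff v w)
  show ?case unfolding prepend_simps frag_extend_simps diff.IH by simp
qed (auto simp: prepend_simps contract3_Cons)

lemmas C_prepend = C1_prepend C2_prepend C3_prepend

text \<open>Contractions with two forms commute, up to a sign if both degrees are odd. This holds for words,
  before any relation is imposed, and follows from the recursions on the first letter.\<close>

lemma C1_C1: "C1 \<alpha> (C1 \<beta> w) = - C1 \<beta> (C1 \<alpha> w)"
proof (induction w rule: prepend_induct)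
  case (Cons x w)
  show ?case
    by (simp add: C_prepend frag_extend_simps prepend_simps Cons)
qed (auto simp: frag_extend_simps algebra_simps)

lemma C1_C2: "C1 \<alpha> (C2 \<nu> w) = C2 \<nu> (C1 \<alpha> w)"
proof (induction w rule: prepend_induct)
  case (Cons x w)
  have "C1 \<alpha> (C1 (\<nu> x) w) = - C1 (\<nu> x) (C1 \<alpha> w)"
    by (rule C1_C1)
  then show ?case
    using Cons by (simp add: C_prepend frag_extend_simps prepend_simps)
qed (auto simp: frag_extend_simps algebra_simps)

lemma C2_C2: "C2 \<nu> (C2 \<nu>' w) = C2 \<nu>' (C2 \<nu> w)"
proof (induction w rule: prepend_induct)
  case (Cons x w)
  show ?case
    using Cons by (simp add: C_prepend frag_extend_simps prepend_simps C1_C2)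
qed (auto simp: frag_extend_simps algebra_simps)

lemma C1_C3: "C1 \<alpha> (C3 \<mu> w) = - C3 \<mu> (C1 \<alpha> w)"
proof (induction w rule: prepend_induct)
  case (Cons x w)
  show ?case
    by (simp add: C_prepend frag_extend_simps prepend_simps C1_C2 Cons)
qed (auto simp: frag_extend_simps algebra_simps)

lemma C2_C3: "C2 \<nu> (C3 \<mu> w) = C3 \<mu> (C2 \<nu> w)"
proof (induction w rule: prepend_induct)
  case (Cons x w)
  have "C1 (\<nu> x) (C3 \<mu> w) = - C3 \<mu> (C1 (\<nu> x) w)"
    by (rule C1_C3)
  then show ?case
    using Cons
    by (simp add: C_prepend frag_extend_simps prepend_simps C2_C2[of \<nu>])
qed (auto simp: frag_extend_simps algebra_simps)

lemma C3_C3: "C3 \<mu> (C3 \<mu>' w) = - C3 \<mu>' (C3 \<mu> w)"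
proof (induction w rule: prepend_induct)
  case (Cons x w)
  show ?case
    by (simp add: C_prepend frag_extend_simps prepend_simps C2_C3 Cons)
qed (auto simp: frag_extend_simps algebra_simps)

text \<open>Twice the square vanishes by anticommutation, and formal sums have no torsion.\<close>

lemma C3_square: "C3 \<mu> (C3 \<mu> w) = 0"
proof (rule poly_mapping_eqI)
  fix xs
  have "Poly_Mapping.lookup (C3 \<mu> (C3 \<mu> w)) xs = Poly_Mapping.lookup (- C3 \<mu> (C3 \<mu> w)) xs"
    by (rule arg_cong[OF C3_C3])
  then show "Poly_Mapping.lookup (C3 \<mu> (C3 \<mu> w)) xs = Poly_Mapping.lookup 0 xs" by simp
qed

text \<open>All words, of whatever length, at once.\<close>

definition words :: "'h monoid \<Rightarrow> ('h list \<Rightarrow>\<^sub>0 int) set" where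
  "words H = {w. \<forall>xs\<in>Poly_Mapping.keys w. set xs \<subseteq> carrier H}"

text \<open>The relations of the exterior powers of all degrees at once. Contractions lower the degree, so
  statements about them would otherwise have to carry two degrees.\<close>

inductive_set relations :: "'h monoid \<Rightarrow> ('h list \<Rightarrow>\<^sub>0 int) set" for H where
  zero: "0 \<in> relations H"
| diff: "v \<in> relations H \<Longrightarrow> w \<in> relations H \<Longrightarrow> v - w \<in> relations H"
| lin: "set xs \<union> {a, b} \<union> set ys \<subseteq> carrier H \<Longrightarrow>
    frag_of (xs @ [a \<otimes>\<^bsub>H\<^esub> b] @ ys) - frag_of (xs @ [a] @ ys) - frag_of (xs @ [b] @ ys) \<in> relations H"
| alt: "set xs \<union> {a} \<union> set ys \<subseteq> carrier H \<Longrightarrow> frag_of (xs @ [a, a] @ ys) \<in> relations H"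

lemma frag_subgroup_words: "frag_subgroup (words H)"
  unfolding frag_subgroup_def words_def using keys_diff by fastforce

lemma frag_subgroup_relations: "frag_subgroup (relations H)"
  unfolding frag_subgroup_def by (auto intro: relations.zero relations.diff)

lemma words_induct:
  assumes "w \<in> words H" "frag_subgroup P" "\<And>xs. set xs \<subseteq> carrier H \<Longrightarrow> frag_of xs \<in> P"
  shows "w \<in> P"
  using frag_subgroup_induct[OF assms(2), of "{xs. set xs \<subseteq> carrier H}"] assms by (auto simp: words_def)

lemma frag_subgroup_vimage:
  assumes "frag_subgroup P" "\<And>v w. f (v - w) = f v - f w" "f 0 = (0::'x \<Rightarrow>\<^sub>0 int)"
  shows "frag_subgroup {w::'y \<Rightarrow>\<^sub>0 int. f w \<in> P}"
  using assms by (auto simp: frag_subgroup_def)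

lemma frag_of_words [simp]: "frag_of xs \<in> words H \<longleftrightarrow> set xs \<subseteq> carrier H"
  by (simp add: words_def)

lemma prepend_words:
  assumes "w \<in> words H" "a \<in> carrier H"
  shows "prepend a w \<in> words H"
proof -
  have "w \<in> {w. prepend a w \<in> words H}"
    by (rule words_induct[OF assms(1)], rule frag_subgroup_vimage[OF frag_subgroup_words])
      (use assms in \<open>auto simp: prepend_simps\<close>)
  then show ?thesis by simp
qed

lemma C1_words: "w \<in> words H \<Longrightarrow> C1 \<omega> w \<in> words H"
proof -
  assume w: "w \<in> words H"
  have "C1 \<omega> (frag_of xs) \<in> words H" if "set xs \<subseteq> carrier H" for xs
    using that
  proof (induction xs)
    case (Cons x xs)
    then have "frag_of xs \<in> words H" "prepend x (C1 \<omega> (frag_of xs)) \<in> words H" by (auto intro: prepend_words)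
    then have "C1 \<omega> (prepend x (frag_of xs)) \<in> words H"
      unfolding C1_prepend by (intro frag_subgroupD(2)[OF frag_subgroup_words] frag_subgroup_cmul[OF frag_subgroup_words])
    then show ?case by (simp only: prepend_simps)
  qed (simp add: frag_subgroupD(1)[OF frag_subgroup_words])
  then have "w \<in> {w. C1 \<omega> w \<in> words H}"
    by (intro words_induct[OF w] frag_subgroup_vimage[OF frag_subgroup_words])
      (simp_all only: mem_Collect_eq frag_extend_simps frag_extend_0)
  then show ?thesis by simp
qed

lemma C2_words: "w \<in> words H \<Longrightarrow> C2 \<nu> w \<in> words H"
proof -
  assume w: "w \<in> words H"
  have "C2 \<nu> (frag_of xs) \<in> words H" if "set xs \<subseteq> carrier H" for xs
    using that
  proof (induction xs)
    case (Cons x xs)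
    then have "C1 (\<nu> x) (frag_of xs) \<in> words H" "prepend x (C2 \<nu> (frag_of xs)) \<in> words H"
      by (auto intro: prepend_words C1_words simp del: frag_extend_of)
    then have "C2 \<nu> (prepend x (frag_of xs)) \<in> words H"
      unfolding C2_prepend by (intro frag_subgroupD(3,4)[OF frag_subgroup_words])
    then show ?case by (simp only: prepend_simps)
  qed (simp add: frag_subgroupD(1)[OF frag_subgroup_words])
  then have "w \<in> {w. C2 \<nu> w \<in> words H}"
    by (intro words_induct[OF w] frag_subgroup_vimage[OF frag_subgroup_words])
      (simp_all only: mem_Collect_eq frag_extend_simps frag_extend_0)
  then show ?thesis by simp
qed

lemma C3_words: "w \<in> words H \<Longrightarrow> C3 \<mu> w \<in> words H"
proof -
  assume w: "w \<in> words H"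
  have "C3 \<mu> (frag_of xs) \<in> words H" if "set xs \<subseteq> carrier H" for xs
    using that
  proof (induction xs)
    case (Cons x xs)
    then have "C2 (\<mu> x) (frag_of xs) \<in> words H" "prepend x (C3 \<mu> (frag_of xs)) \<in> words H"
      by (auto intro: prepend_words C2_words simp del: frag_extend_of)
    then have "C3 \<mu> (prepend x (frag_of xs)) \<in> words H"
      unfolding C3_prepend by (intro frag_subgroupD(2)[OF frag_subgroup_words])
    then show ?case by (simp only: prepend_simps)
  qed (simp add: frag_subgroupD(1)[OF frag_subgroup_words])
  then have "w \<in> {w. C3 \<mu> w \<in> words H}"
    by (intro words_induct[OF w] frag_subgroup_vimage[OF frag_subgroup_words])
      (simp_all only: mem_Collect_eq frag_extend_simps frag_extend_0)
  then show ?thesis by simp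
qed

lemma relations_prepend:
  assumes "w \<in> relations H" "x \<in> carrier H"
  shows "prepend x w \<in> relations H"
  using assms(1)
proof induction
  case (lin xs a b ys)
  then show ?case using relations.lin[of "x # xs" a b ys H] assms(2) by (simp add: prepend_simps)
next
  case (alt xs a ys)
  then show ?case using relations.alt[of "x # xs" a ys H] assms(2) by (simp add: prepend_simps)
qed (auto simp: prepend_simps intro: relations.intros)

lemma relations_lin:
  assumes w: "w \<in> words H" and ab: "a \<in> carrier H" "b \<in> carrier H"
  shows "prepend (a \<otimes>\<^bsub>H\<^esub> b) w - prepend a w - prepend b w \<in> relations H"
proof -
  have "w \<in> {w. prepend (a \<otimes>\<^bsub>H\<^esub> b) w - prepend a w - prepend b w \<in> relations H}"
    using relations.lin[of "[]" a b _ H] ab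
    by (intro words_induct[OF w] frag_subgroup_vimage[OF frag_subgroup_relations])
      (auto simp: prepend_simps algebra_simps)
  then show ?thesis by simp
qed

lemma relations_alt:
  assumes w: "w \<in> words H" and a: "a \<in> carrier H"
  shows "prepend a (prepend a w) \<in> relations H"
proof -
  have "w \<in> {w. prepend a (prepend a w) \<in> relations H}"
    using relations.alt[of "[]" a _ H] a
    by (intro words_induct[OF w] frag_subgroup_vimage[OF frag_subgroup_relations])
      (auto simp: prepend_simps)
  then show ?thesis by simp
qed

text \<open>The relations form the smallest subgroup that is closed under prepending a letter and contains
  the relations that involve the first letters only.\<close>

lemma relations_induct_prepend [consumes 2, case_names lin alt prepend]:
  assumes r: "r \<in> relations H" and P: "frag_subgroup P"
    and lin: "\<And>a b w. a \<in> carrier H \<Longrightarrow> b \<in> carrier H \<Longrightarrow> w \<in> words H \<Longrightarrow>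
      prepend (a \<otimes>\<^bsub>H\<^esub> b) w - prepend a w - prepend b w \<in> P"
    and alt: "\<And>a w. a \<in> carrier H \<Longrightarrow> w \<in> words H \<Longrightarrow> prepend a (prepend a w) \<in> P"
    and pre: "\<And>x r. x \<in> carrier H \<Longrightarrow> r \<in> relations H \<Longrightarrow> r \<in> P \<Longrightarrow> prepend x r \<in> P"
  shows "r \<in> P"
  using r
proof induction
  case (lin xs a b ys)
  then show ?case
  proof (induction xs)
    case Nil
    then show ?case using assms(3)[of a b "frag_of ys"] by (simp add: prepend_simps)
  next
    case (Cons x xs)
    then show ?case
      using pre[of x, OF _ relations.lin[of xs a b ys H]] by (simp add: prepend_simps)
  qed
next
  case (alt xs a ys)
  then show ?case
  proof (induction xs)
    case Nil
    then show ?case using assms(4)[of a "frag_of ys"] by (simp add: prepend_simps)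
  next
    case (Cons x xs)
    then show ?case
      using pre[of x, OF _ relations.alt[of xs a ys H]] by (simp add: prepend_simps)
  qed
qed (use frag_subgroupD[OF P] in auto)

definition additive_form :: "'h monoid \<Rightarrow> ('h \<Rightarrow> int) \<Rightarrow> bool" where
  "additive_form H \<omega> \<longleftrightarrow> (\<forall>a\<in>carrier H. \<forall>b\<in>carrier H. \<omega> (a \<otimes>\<^bsub>H\<^esub> b) = \<omega> a + \<omega> b)"

text \<open>Alternation of a trilinear form is required in adjacent arguments, which is what the
  relations involve.\<close>

definition alternating2 :: "'h monoid \<Rightarrow> ('h \<Rightarrow> 'h \<Rightarrow> int) \<Rightarrow> bool" where
  "alternating2 H \<nu> \<longleftrightarrow> (\<forall>a\<in>carrier H. additive_form H (\<nu> a) \<and> additive_form H (\<lambda>b. \<nu> b a) \<and> \<nu> a a = 0)"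

definition alternating3 :: "'h monoid \<Rightarrow> ('h \<Rightarrow> 'h \<Rightarrow> 'h \<Rightarrow> int) \<Rightarrow> bool" where
  "alternating3 H \<mu> \<longleftrightarrow> (\<forall>a\<in>carrier H. alternating2 H (\<mu> a) \<and>
     (\<forall>b\<in>carrier H. additive_form H (\<lambda>c. \<mu> c a b) \<and> \<mu> a a b = 0))"

lemma C_lincomb:
  assumes "w \<in> words H"
  shows "\<lbrakk>\<And>x. x \<in> carrier H \<Longrightarrow> f x = g x + h x\<rbrakk> \<Longrightarrow> C1 f w = C1 g w + C1 h w"
    "\<lbrakk>\<And>x y. x \<in> carrier H \<Longrightarrow> y \<in> carrier H \<Longrightarrow> f2 x y = g2 x y + h2 x y\<rbrakk> \<Longrightarrow> C2 f2 w = C2 g2 w + C2 h2 w"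
    "\<lbrakk>\<And>x. x \<in> carrier H \<Longrightarrow> f x = 0\<rbrakk> \<Longrightarrow> C1 f w = 0"
proof -
  assume a: "\<And>x. x \<in> carrier H \<Longrightarrow> f x = g x + h x"
  have "w \<in> {w. C1 f w - C1 g w - C1 h w \<in> {0}}"
  proof (rule words_induct[OF assms], rule frag_subgroup_vimage)
    fix xs assume "set xs \<subseteq> carrier H"
    then have "contract1 f xs - contract1 g xs - contract1 h xs = 0"
      unfolding contract1_def
      by (simp add: sum_subtractf[symmetric] subset_iff a distrib_left frag_cmul_distrib)
    then show "frag_of xs \<in> {w. C1 f w - C1 g w - C1 h w \<in> {0}}" by simp
  qed (auto simp: frag_extend_simps frag_subgroup_def)
  then show "C1 f w = C1 g w + C1 h w" by (simp add: algebra_simps)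
next
  assume a: "\<And>x y. x \<in> carrier H \<Longrightarrow> y \<in> carrier H \<Longrightarrow> f2 x y = g2 x y + h2 x y"
  have "w \<in> {w. C2 f2 w - C2 g2 w - C2 h2 w \<in> {0}}"
  proof (rule words_induct[OF assms], rule frag_subgroup_vimage)
    fix xs assume "set xs \<subseteq> carrier H"
    then have "contract2 f2 xs - contract2 g2 xs - contract2 h2 xs = 0"
      unfolding contract2_def
      by (simp add: sum_subtractf[symmetric] subset_iff a distrib_left frag_cmul_distrib)
    then show "frag_of xs \<in> {w. C2 f2 w - C2 g2 w - C2 h2 w \<in> {0}}" by simp
  qed (auto simp: frag_extend_simps frag_subgroup_def)
  then show "C2 f2 w = C2 g2 w + C2 h2 w" by (simp add: algebra_simps)
next
  assume a: "\<And>x. x \<in> carrier H \<Longrightarrow> f x = 0"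
  have "w \<in> {w. C1 f w \<in> {0}}"
  proof (rule words_induct[OF assms], rule frag_subgroup_vimage)
    fix xs assume "set xs \<subseteq> carrier H"
    then have "contract1 f xs = 0" unfolding contract1_def by (simp add: subset_iff a)
    then show "frag_of xs \<in> {w. C1 f w \<in> {0}}" by simp
  qed (auto simp: frag_extend_simps frag_subgroup_def)
  then show "C1 f w = 0" by simp
qed

lemmas rel_D = frag_subgroupD[OF frag_subgroup_relations]

lemma rel_lin_minus:
  assumes "w \<in> words H" "a \<in> carrier H" "b \<in> carrier H"
  shows "prepend a w + prepend b w - prepend (a \<otimes>\<^bsub>H\<^esub> b) w \<in> relations H"
  using rel_D(3)[OF relations_lin[OF assms]] by (simp add: algebra_simps)

text \<open>Contractions descend to the exterior algebra. The recursions on the first letter reduce this to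
  relations that involve the first letters, whose contractions are again relations.\<close>

lemma C1_relations:
  assumes \<omega>: "additive_form H \<omega>" and r: "r \<in> relations H"
  shows "C1 \<omega> r \<in> relations H"
proof -
  have P: "frag_subgroup {r. C1 \<omega> r \<in> relations H}"
    by (rule frag_subgroup_vimage[OF frag_subgroup_relations]) (simp_all add: frag_extend_simps)
  have "r \<in> {r. C1 \<omega> r \<in> relations H}"
    using r P
  proof (induction rule: relations_induct_prepend)
    case (lin a b w)
    have "frag_cmul (\<omega> (a \<otimes>\<^bsub>H\<^esub> b)) w = frag_cmul (\<omega> a) w + frag_cmul (\<omega> b) w"
      using \<omega> lin by (simp add: additive_form_def frag_cmul_distrib)
    then show ?case
      using rel_lin_minus[OF C1_words[OF lin(3)] lin(1,2)]
      by (simp add: frag_extend_simps C_prepend algebra_simps)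
  next
    case (alt a w)
    then show ?case
      using relations_alt[OF C1_words[OF alt(2)] alt(1)]
      by (simp add: frag_extend_simps C_prepend prepend_simps)
  next
    case (prepend x r)
    then show ?case
      by (auto simp: C_prepend intro: rel_D relations_prepend frag_subgroup_cmul[OF frag_subgroup_relations])
  qed
  then show ?thesis by simp
qed

lemma C2_relations:
  assumes \<nu>: "alternating2 H \<nu>" and r: "r \<in> relations H"
  shows "C2 \<nu> r \<in> relations H"
proof -
  have P: "frag_subgroup {r. C2 \<nu> r \<in> relations H}"
    by (rule frag_subgroup_vimage[OF frag_subgroup_relations]) (simp_all add: frag_extend_simps)
  have "r \<in> {r. C2 \<nu> r \<in> relations H}"
    using r P
  proof (induction rule: relations_induct_prepend)
    case (lin a b w)
    have "C1 (\<nu> (a \<otimes>\<^bsub>H\<^esub> b)) w = C1 (\<nu> a) w + C1 (\<nu> b) w"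
      using \<nu> lin by (intro C_lincomb(1)[OF lin(3)]) (auto simp: alternating2_def additive_form_def)
    then show ?case
      using relations_lin[OF C2_words[OF lin(3)] lin(1,2)]
      by (simp add: frag_extend_simps C_prepend algebra_simps)
  next
    case (alt a w)
    then show ?case
      using relations_alt[OF C2_words[OF alt(2)] alt(1)] \<nu>
      by (simp add: frag_extend_simps C_prepend prepend_simps alternating2_def)
  next
    case (prepend x r)
    then have "C1 (\<nu> x) r \<in> relations H" using \<nu> by (intro C1_relations) (auto simp: alternating2_def)
    then show ?case using prepend by (simp add: C_prepend) (metis relations_prepend rel_D(2))
  qed
  then show ?thesis by simp
qed

lemma C3_relations:
  assumes \<mu>: "alternating3 H \<mu>" and r: "r \<in> relations H"
  shows "C3 \<mu> r \<in> relations H"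
proof -
  have P: "frag_subgroup {r. C3 \<mu> r \<in> relations H}"
    by (rule frag_subgroup_vimage[OF frag_subgroup_relations]) (simp_all add: frag_extend_simps)
  have "r \<in> {r. C3 \<mu> r \<in> relations H}"
    using r P
  proof (induction rule: relations_induct_prepend)
    case (lin a b w)
    have "C2 (\<mu> (a \<otimes>\<^bsub>H\<^esub> b)) w = C2 (\<mu> a) w + C2 (\<mu> b) w"
      using \<mu> lin by (intro C_lincomb(2)[OF lin(3)]) (auto simp: alternating3_def additive_form_def)
    then show ?case
      using rel_lin_minus[OF C3_words[OF lin(3)] lin(1,2)]
      by (simp add: frag_extend_simps C_prepend algebra_simps)
  next
    case (alt a w)
    have "C1 (\<mu> a a) w = 0" using \<mu> alt by (intro C_lincomb(3)[OF alt(2)]) (auto simp: alternating3_def)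
    then show ?case
      using relations_alt[OF C3_words[OF alt(2)] alt(1)]
      by (simp add: frag_extend_simps C_prepend prepend_simps)
  next
    case (prepend x r)
    then have "C2 (\<mu> x) r \<in> relations H" using \<mu> by (intro C2_relations) (auto simp: alternating3_def)
    then show ?case using prepend by (auto simp: C_prepend intro!: relations_prepend rel_D(2))
  qed
  then show ?thesis by simp
qed

text \<open>By expansion of the square of a sum.\<close>

lemma relations_swap:
  assumes H: "monoid H" and w: "w \<in> words H" and ab: "a \<in> carrier H" "b \<in> carrier H"
  shows "prepend a (prepend b w) + prepend b (prepend a w) \<in> relations H"
proof -
  let ?c = "a \<otimes>\<^bsub>H\<^esub> b" and ?P = prepend
  have c: "?c \<in> carrier H" using monoid.m_closed[OF H] ab by blast
  define l where "l = ?P ?c w - ?P a w - ?P b w"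
  define m where "m = ?P ?c (?P ?c w) - ?P a (?P ?c w) - ?P b (?P ?c w)"
  have l: "l \<in> relations H" unfolding l_def by (rule relations_lin[OF w ab])
  have m: "m \<in> relations H" unfolding m_def by (rule relations_lin[OF prepend_words[OF w c] ab])
  have "?P a (?P b w) + ?P b (?P a w)
      = ?P ?c (?P ?c w) - m - ?P a l - ?P b l - ?P a (?P a w) - ?P b (?P b w)"
    by (simp add: m_def l_def prepend_simps)
  also have "\<dots> \<in> relations H"
    by (intro rel_D(2) relations_alt w c ab m relations_prepend l)
  finally show ?thesis .
qed

lemma keys_prepend: "Poly_Mapping.keys (prepend a u) \<subseteq> (#) a ` Poly_Mapping.keys u"
proof -
  have "u \<in> {v. Poly_Mapping.keys (prepend a v) \<subseteq> (#) a ` Poly_Mapping.keys u}"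
  proof (rule frag_subgroup_induct[OF _ _ order_refl])
    show "frag_subgroup {v. Poly_Mapping.keys (prepend a v) \<subseteq> (#) a ` Poly_Mapping.keys u}"
      unfolding frag_subgroup_def by (auto simp: prepend_simps dest!: subsetD[OF keys_diff])
  qed (auto simp: prepend_simps)
  then show ?thesis by simp
qed

context
  fixes H :: "'h monoid" and v :: "'h list \<Rightarrow>\<^sub>0 int"
  assumes H: "comm_group H" and v: "v \<in> words H"
begin

interpretation H: comm_group H by (rule H)

lemma prepend_one: "prepend \<one>\<^bsub>H\<^esub> v \<in> relations H"
  using rel_D(3)[OF relations_lin[OF v H.one_closed H.one_closed]] by simp

lemma prepend_nat_pow:
  assumes a: "a \<in> carrier H"
  shows "prepend (a [^]\<^bsub>H\<^esub> (n::nat)) v - frag_cmul (int n) (prepend a v) \<in> relations H"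
proof (induction n)
  case 0
  then show ?case using prepend_one by simp
next
  case (Suc n)
  have "prepend (a [^]\<^bsub>H\<^esub> Suc n) v - frag_cmul (int (Suc n)) (prepend a v)
     = (prepend (a [^]\<^bsub>H\<^esub> n \<otimes>\<^bsub>H\<^esub> a) v - prepend (a [^]\<^bsub>H\<^esub> n) v - prepend a v)
     + (prepend (a [^]\<^bsub>H\<^esub> n) v - frag_cmul (int n) (prepend a v))"
    unfolding frag_cmul_Suc by simp
  then show ?case using rel_D(4)[OF relations_lin[OF v H.nat_pow_closed[OF a, of n] a] Suc] by metis
qed

lemma prepend_int_pow:
  assumes a: "a \<in> carrier H"
  shows "prepend (a [^]\<^bsub>H\<^esub> (n::int)) v - frag_cmul n (prepend a v) \<in> relations H"
proof (cases "n \<ge> 0")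
  case True
  then show ?thesis using prepend_nat_pow[OF a, of "nat n"] int_pow_int[of H a "nat n"] by simp
next
  case False
  define m where "m = nat (- n)"
  have n: "n = - int m" using False by (simp add: m_def)
  let ?p = "a [^]\<^bsub>H\<^esub> m"
  have p: "?p \<in> carrier H" using a by simp
  have "prepend (inv\<^bsub>H\<^esub> ?p \<otimes>\<^bsub>H\<^esub> ?p) v - prepend (inv\<^bsub>H\<^esub> ?p) v - prepend ?p v \<in> relations H"
    by (rule relations_lin[OF v]) (use p in auto)
  then have 1: "prepend \<one>\<^bsub>H\<^esub> v - prepend (inv\<^bsub>H\<^esub> ?p) v - prepend ?p v \<in> relations H" using p by simp
  have "prepend (inv\<^bsub>H\<^esub> ?p) v - frag_cmul n (prepend a v)
     = prepend \<one>\<^bsub>H\<^esub> v - (prepend \<one>\<^bsub>H\<^esub> v - prepend (inv\<^bsub>H\<^esub> ?p) v - prepend ?p v)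
       - (prepend ?p v - frag_cmul (int m) (prepend a v))"
    unfolding n by simp
  also have "\<dots> \<in> relations H" by (intro rel_D(2) prepend_one 1 prepend_nat_pow a)
  finally show ?thesis unfolding n using H.int_pow_neg_int[OF a, of m] by simp
qed

lemma prepend_finprod:
  assumes "finite I" "\<And>i. i \<in> I \<Longrightarrow> g i \<in> carrier H"
  shows "prepend (finprod H g I) v - (\<Sum>i\<in>I. prepend (g i) v) \<in> relations H"
  using assms
proof (induction I)
  case empty
  then show ?case using prepend_one by simp
next
  case (insert i I)
  have f: "finprod H g I \<in> carrier H" using insert by (intro H.finprod_closed) auto
  have "finprod H g (insert i I) = g i \<otimes>\<^bsub>H\<^esub> finprod H g I"
    using insert by (intro H.finprod_insert) auto
  then have "prepend (finprod H g (insert i I)) v - (\<Sum>i\<in>insert i I. prepend (g i) v)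
    = (prepend (g i \<otimes>\<^bsub>H\<^esub> finprod H g I) v - prepend (g i) v - prepend (finprod H g I) v)
      + (prepend (finprod H g I) v - (\<Sum>i\<in>I. prepend (g i) v))"
    using insert by simp
  moreover have "prepend (finprod H g I) v - (\<Sum>i\<in>I. prepend (g i) v) \<in> relations H" using insert by blast
  ultimately show ?case
    using rel_D(4)[OF relations_lin[OF v _ f, of "g i"]] insert(4) by (metis insertI1)
qed

end

section \<open>Coordinates on the exterior algebra\<close>

text \<open>Up to finite index the group is free with basis \<open>e\<close>: the coordinates embed it into a lattice with
  denominator \<open>M\<close> and take the \<open>e i\<close> to the unit vectors. Cohomology classes dual to a rational basis
  of homology provide this without a choice of an integral basis.\<close>

locale rational_basis = H: comm_group H for H :: "'h monoid" +
  fixes b :: nat and co :: "'h \<Rightarrow> nat \<Rightarrow> rat" and e :: "nat \<Rightarrow> 'h" and M :: int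
  assumes co_mult: "\<And>x y i. x \<in> carrier H \<Longrightarrow> y \<in> carrier H \<Longrightarrow> co (x \<otimes>\<^bsub>H\<^esub> y) i = co x i + co y i"
    and co_inj: "\<And>x y. x \<in> carrier H \<Longrightarrow> y \<in> carrier H \<Longrightarrow> (\<And>i. i < b \<Longrightarrow> co x i = co y i) \<Longrightarrow> x = y"
    and e: "\<And>i. i < b \<Longrightarrow> e i \<in> carrier H"
    and co_e: "\<And>i j. i < b \<Longrightarrow> j < b \<Longrightarrow> co (e i) j = (if i = j then 1 else 0)"
    and M: "M > 0" and integral: "\<And>x i. x \<in> carrier H \<Longrightarrow> i < b \<Longrightarrow> of_int M * co x i \<in> \<int>"
begin

lemma co_one: "co \<one>\<^bsub>H\<^esub> i = 0"
  using co_mult[of "\<one>\<^bsub>H\<^esub>" "\<one>\<^bsub>H\<^esub>" i] by simp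

lemma co_nat_pow: "x \<in> carrier H \<Longrightarrow> co (x [^]\<^bsub>H\<^esub> (n::nat)) i = of_nat n * co x i"
  by (induction n) (auto simp: co_one co_mult algebra_simps)

lemma co_inv: "x \<in> carrier H \<Longrightarrow> co (inv\<^bsub>H\<^esub> x) i = - co x i"
  using co_mult[of x "inv\<^bsub>H\<^esub> x" i] co_one[of i] by simp

lemma co_int_pow:
  assumes x: "x \<in> carrier H"
  shows "co (x [^]\<^bsub>H\<^esub> (n::int)) i = of_int n * co x i"
proof (cases "n \<ge> 0")
  case True
  then show ?thesis using co_nat_pow[OF x, of "nat n"] int_pow_int[of H x "nat n"] by simp
next
  case False
  define m where "m = nat (- n)"
  have n: "n = - int m" using False by (simp add: m_def)
  show ?thesis
    unfolding n using H.int_pow_neg_int[OF x, of m] co_inv[OF H.nat_pow_closed[OF x]] co_nat_pow[OF x] by simp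
qed

lemma co_finprod:
  assumes "finite I" "\<And>j. j \<in> I \<Longrightarrow> g j \<in> carrier H"
  shows "co (finprod H g I) i = (\<Sum>j\<in>I. co (g j) i)"
  using assms
proof (induction I)
  case (insert j I)
  then have "finprod H g I \<in> carrier H" by (intro H.finprod_closed) auto
  moreover have "finprod H g (insert j I) = g j \<otimes>\<^bsub>H\<^esub> finprod H g I"
    using insert by (intro H.finprod_insert) auto
  ultimately show ?case using insert by (simp add: co_mult)
qed (simp add: co_one)

lemma prepend_expand:
  assumes v: "v \<in> words H" and x: "x \<in> carrier H"
  obtains n where "frag_cmul M (prepend x v) - (\<Sum>i<b. frag_cmul (n i) (prepend (e i) v)) \<in> relations H"
proof -
  have "\<exists>n. of_int n = of_int M * co x i" if ib: "i < b" for i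
  proof -
    obtain n where "of_int M * co x i = of_int n" using integral[OF x ib] unfolding Ints_def by blast
    then show ?thesis by (intro exI[of _ n]) simp
  qed
  then obtain n where n: "\<And>i. i < b \<Longrightarrow> of_int (n i) = of_int M * co x i" by metis
  let ?p = "finprod H (\<lambda>i. e i [^]\<^bsub>H\<^esub> n i) {..<b}"
  have ei: "e i [^]\<^bsub>H\<^esub> n i \<in> carrier H" if "i \<in> {..<b}" for i using e that by simp
  have p: "?p \<in> carrier H" using ei by (intro H.finprod_closed) auto
  have "x [^]\<^bsub>H\<^esub> M = ?p"
  proof (rule co_inj)
    fix j assume j: "j < b"
    have "co ?p j = (\<Sum>i<b. co (e i [^]\<^bsub>H\<^esub> n i) j)"
      by (rule co_finprod) (use ei in auto)
    also have "\<dots> = (\<Sum>i<b. of_int (n i) * co (e i) j)"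
      using e by (intro sum.cong) (auto simp: co_int_pow)
    also have "\<dots> = (\<Sum>i<b. if i = j then of_int (n j) else 0)"
      using j co_e by (intro sum.cong) auto
    also have "\<dots> = of_int M * co x j" using j n by simp
    finally show "co (x [^]\<^bsub>H\<^esub> M) j = co ?p j" by (simp add: co_int_pow[OF x])
  qed (use x p in auto)
  then have 1: "prepend ?p v - frag_cmul M (prepend x v) \<in> relations H"
    using prepend_int_pow[OF H.comm_group_axioms v x, of M] by simp
  have 2: "prepend ?p v - (\<Sum>i<b. prepend (e i [^]\<^bsub>H\<^esub> n i) v) \<in> relations H"
    using prepend_finprod[OF H.comm_group_axioms v, of "{..<b}" "\<lambda>i. e i [^]\<^bsub>H\<^esub> n i", OF finite_lessThan ei] .
  have 3: "(\<Sum>i<b. prepend (e i [^]\<^bsub>H\<^esub> n i) v - frag_cmul (n i) (prepend (e i) v)) \<in> relations H"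
    by (intro frag_subgroup_sum[OF frag_subgroup_relations] prepend_int_pow H.comm_group_axioms v e) auto
  have "frag_cmul M (prepend x v) - (\<Sum>i<b. frag_cmul (n i) (prepend (e i) v))
     = (prepend ?p v - (\<Sum>i<b. prepend (e i [^]\<^bsub>H\<^esub> n i) v)) - (prepend ?p v - frag_cmul M (prepend x v))
       + (\<Sum>i<b. prepend (e i [^]\<^bsub>H\<^esub> n i) v - frag_cmul (n i) (prepend (e i) v))"
    by (simp add: sum_subtractf)
  also have "\<dots> \<in> relations H" by (intro rel_D(2,4) 1 2 3)
  finally show ?thesis using that by blast
qed

definition basis_words :: "'h list set" where
  "basis_words = {map e l |l. sorted_wrt (<) l \<and> set l \<subseteq> {..<b}}"

text \<open>Moving the new letter to its place costs only signs, and a repeated letter gives zero.\<close>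

lemma insert_basis_letter:
  assumes "sorted_wrt (<) l" "set l \<subseteq> {..<b}" "i < b"
  shows "\<exists>u. Poly_Mapping.keys u \<subseteq> {map e m |m. sorted_wrt (<) m \<and> set m \<subseteq> insert i (set l)} \<and>
    frag_of (e i # map e l) - u \<in> relations H"
  using assms
proof (induction l)
  case Nil
  have "[e i] = map e [i]" by simp
  then show ?case
    using rel_D(1) by (intro exI[of _ "frag_of [e i]"]) (auto intro!: exI[of _ "[i]"])
next
  case (Cons j l)
  have lw: "frag_of (map e l) \<in> words H" using Cons.prems e by auto
  have ecar: "e i \<in> carrier H" "e j \<in> carrier H" using Cons.prems e by auto
  consider "i < j" | "i = j" | "j < i" by linarith
  then show ?case
  proof cases
    case 1
    then have "sorted_wrt (<) (i # j # l)" using Cons.prems by auto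
    then have "e i # map e (j # l) \<in> {map e m |m. sorted_wrt (<) m \<and> set m \<subseteq> insert i (set (j # l))}"
      by (intro CollectI exI[of _ "i # j # l"]) auto
    then show ?thesis
      using rel_D(1) by (intro exI[of _ "frag_of (e i # map e (j # l))"]) auto
  next
    case 2
    then show ?thesis
      using relations_alt[OF lw ecar(1)] by (intro exI[of _ 0]) (auto simp: prepend_simps)
  next
    case 3
    obtain u where u: "Poly_Mapping.keys u \<subseteq> {map e m |m. sorted_wrt (<) m \<and> set m \<subseteq> insert i (set l)}"
        "frag_of (e i # map e l) - u \<in> relations H"
      using Cons by auto
    have "Poly_Mapping.keys (prepend (e j) u) \<subseteq> {map e m |m. sorted_wrt (<) m \<and> set m \<subseteq> insert i (set (j # l))}"
    proof
      fix xs assume "xs \<in> Poly_Mapping.keys (prepend (e j) u)"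
      then obtain m where m: "xs = e j # map e m" "sorted_wrt (<) m" "set m \<subseteq> insert i (set l)"
        using keys_prepend u(1) by fast
      then have "sorted_wrt (<) (j # m)" using 3 Cons.prems(1) by auto
      then show "xs \<in> {map e m |m. sorted_wrt (<) m \<and> set m \<subseteq> insert i (set (j # l))}"
        using m by (intro CollectI exI[of _ "j # m"]) auto
    qed
    moreover have "frag_of (e i # map e (j # l)) - (- prepend (e j) u)
        = (prepend (e i) (prepend (e j) (frag_of (map e l))) + prepend (e j) (prepend (e i) (frag_of (map e l))))
          - prepend (e j) (frag_of (e i # map e l) - u)"
      by (simp add: prepend_simps)
    moreover have "\<dots> \<in> relations H"
      by (intro rel_D(2) relations_swap relations_prepend u lw ecar H.monoid_axioms)
    ultimately show ?thesis by (intro exI[of _ "- prepend (e j) u"] conjI) (simp, metis)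
  qed
qed

text \<open>Combinations of increasing words in the basis, up to denominators and relations.\<close>

definition rational_span :: "('h list \<Rightarrow>\<^sub>0 int) set" where
  "rational_span = {w. \<exists>N>0. \<exists>u. Poly_Mapping.keys u \<subseteq> basis_words \<and> frag_cmul N w - u \<in> relations H}"

lemma rational_spanI:
  assumes "N > 0" "Poly_Mapping.keys u \<subseteq> basis_words" "frag_cmul N w - u \<in> relations H"
  shows "w \<in> rational_span"
  using assms unfolding rational_span_def by blast

lemma frag_subgroup_rational_span: "frag_subgroup rational_span"
proof -
  have "w - v \<in> rational_span" if wv: "w \<in> rational_span" "v \<in> rational_span" for w v
  proof -
    obtain N u where u: "N > 0" "Poly_Mapping.keys u \<subseteq> basis_words" "frag_cmul N w - u \<in> relations H"
      using wv(1) unfolding rational_span_def by blast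
    obtain K t where t: "K > 0" "Poly_Mapping.keys t \<subseteq> basis_words" "frag_cmul K v - t \<in> relations H"
      using wv(2) unfolding rational_span_def by blast
    show ?thesis
    proof (rule rational_spanI)
      show "N * K > 0" using u t by simp
      show "Poly_Mapping.keys (frag_cmul K u - frag_cmul N t) \<subseteq> basis_words"
        using u(2) t(2) keys_diff keys_cmul by (metis (no_types, opaque_lifting) Un_least order_trans)
      have "frag_cmul (N * K) (w - v) - (frag_cmul K u - frag_cmul N t)
          = frag_cmul K (frag_cmul N w - u) - frag_cmul N (frag_cmul K v - t)"
        by (simp add: frag_cmul_diff mult.commute)
      also have "\<dots> \<in> relations H"
        by (intro rel_D(2) frag_subgroup_cmul frag_subgroup_relations u t)
      finally show "frag_cmul (N * K) (w - v) - (frag_cmul K u - frag_cmul N t) \<in> relations H" .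
    qed
  qed
  moreover have "0 \<in> rational_span"
    by (rule rational_spanI[of 1 0]) (auto simp: rel_D(1))
  ultimately show ?thesis by (auto simp: frag_subgroup_def)
qed

lemma relations_rational_span: "r \<in> relations H \<Longrightarrow> r \<in> rational_span"
  by (rule rational_spanI[of 1 0]) auto

lemma rational_span_saturated:
  assumes "K > 0" "frag_cmul K w \<in> rational_span"
  shows "w \<in> rational_span"
proof -
  obtain N u where u: "N > 0" "Poly_Mapping.keys u \<subseteq> basis_words" "frag_cmul N (frag_cmul K w) - u \<in> relations H"
    using assms(2) unfolding rational_span_def by blast
  then show ?thesis using assms(1) by (intro rational_spanI[of "N * K" u]) auto
qed

lemma words_rational_span: "words H \<subseteq> rational_span"
proof
  note S = frag_subgroup_rational_span
  have letter: "prepend x (frag_of (map e l)) \<in> rational_span"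
    if x: "x \<in> carrier H" and l: "sorted_wrt (<) l" "set l \<subseteq> {..<b}" for x l
  proof -
    let ?v = "frag_of (map e l)"
    have v: "?v \<in> words H" using l e by auto
    obtain n where n: "frag_cmul M (prepend x ?v) - (\<Sum>i<b. frag_cmul (n i) (prepend (e i) ?v)) \<in> relations H"
      using prepend_expand[OF v x] .
    have "prepend (e i) ?v \<in> rational_span" if i: "i < b" for i
    proof -
      obtain u where u: "Poly_Mapping.keys u \<subseteq> {map e m |m. sorted_wrt (<) m \<and> set m \<subseteq> insert i (set l)}"
        "frag_of (e i # map e l) - u \<in> relations H"
        using insert_basis_letter[OF l i] by blast
      have "Poly_Mapping.keys u \<subseteq> basis_words"
        using u(1) l(2) i unfolding basis_words_def by blast
      then show ?thesis using u(2) by (intro rational_spanI[of 1 u]) (auto simp: prepend_simps)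
    qed
    then have "(\<Sum>i<b. frag_cmul (n i) (prepend (e i) ?v)) \<in> rational_span"
      by (intro frag_subgroup_sum[OF S] frag_subgroup_cmul[OF S]) auto
    from frag_subgroupD(4)[OF S relations_rational_span[OF n] this]
    have "frag_cmul M (prepend x ?v) \<in> rational_span" by simp
    then show ?thesis using rational_span_saturated M by blast
  qed
  have word: "frag_of xs \<in> rational_span" if "set xs \<subseteq> carrier H" for xs
    using that
  proof (induction xs)
    case Nil
    have "[] \<in> basis_words" unfolding basis_words_def by (intro CollectI exI[of _ "[]"]) auto
    then show ?case using rel_D(1) by (intro rational_spanI[of 1 "frag_of []"]) auto
  next
    case (Cons x xs)
    then obtain N u where u: "N > 0" "Poly_Mapping.keys u \<subseteq> basis_words" "frag_cmul N (frag_of xs) - u \<in> relations H"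
      unfolding rational_span_def by auto
    have "u \<in> {u. prepend x u \<in> rational_span}"
    proof (rule frag_subgroup_induct[OF _ _ u(2)])
      show "frag_of ys \<in> {u. prepend x u \<in> rational_span}" if "ys \<in> basis_words" for ys
        using letter[of x] Cons.prems that unfolding basis_words_def by auto
    qed (rule frag_subgroup_vimage[OF S], simp_all add: prepend_simps)
    moreover have "prepend x (frag_cmul N (frag_of xs) - u) \<in> rational_span"
      using Cons.prems u(3) by (intro relations_rational_span relations_prepend) auto
    ultimately have "prepend x (frag_cmul N (frag_of xs) - u) + prepend x u \<in> rational_span"
      using frag_subgroupD(4)[OF S] by blast
    then have "frag_cmul N (frag_of (x # xs)) \<in> rational_span" by (simp add: prepend_simps)
    then show ?case using rational_span_saturated u(1) by blast
  qed
  fix w assume "w \<in> words H"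
  then show "w \<in> rational_span" by (rule words_induct[OF _ S word])
qed

end

text \<open>The sign of moving the letter \<open>i\<close> to the front of the wedge product of \<open>S\<close> in increasing order.\<close>

definition sgn_before :: "nat \<Rightarrow> nat set \<Rightarrow> rat" where
  "sgn_before i S = (-1) ^ card {j\<in>S. j < i}"

lemma sgn_before_remove_greater: "i < j \<Longrightarrow> sgn_before i (S - {j}) = sgn_before i S"
  unfolding sgn_before_def by (intro arg_cong[of _ _ "\<lambda>A. (-1) ^ card A"]) auto

lemma sgn_before_remove_less:
  assumes "finite S" "i \<in> S" "i < j"
  shows "sgn_before j (S - {i}) = - sgn_before j S"
proof -
  have "{k\<in>S. k < j} = insert i {k\<in>S - {i}. k < j}" using assms by auto
  then have "card {k\<in>S. k < j} = Suc (card {k\<in>S - {i}. k < j})" using assms(1) by simp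
  then show ?thesis by (simp add: sgn_before_def)
qed

context rational_basis
begin

text \<open>Left exterior multiplication by a vector, in coordinates indexed by sets of basis elements.\<close>

definition lmult :: "(nat \<Rightarrow> rat) \<Rightarrow> (nat set \<Rightarrow> rat) \<Rightarrow> nat set \<Rightarrow> rat" where
  "lmult c f S = (if S \<subseteq> {..<b} then \<Sum>i\<in>S. c i * sgn_before i S * f (S - {i}) else 0)"

text \<open>Each pair of elements is removed in both orders, with opposite signs.\<close>

lemma lmult_lmult: "lmult c (lmult c f) = 0"
proof
  fix S
  show "lmult c (lmult c f) S = 0 S"
  proof (cases "S \<subseteq> {..<b}")
    case True
    then have fin: "finite S" by (rule finite_subset) simp
    define g where "g i j = c i * sgn_before i S * (c j * sgn_before j (S - {i}) * f (S - {i} - {j}))" for i j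
    have anti: "g i j = - g j i" if ij: "i \<in> S" "j \<in> S" "i < j" for i j
      using sgn_before_remove_greater[OF ij(3), of S] sgn_before_remove_less[OF fin ij(1,3)]
      by (simp add: g_def insert_commute Diff_insert2[symmetric] Diff_insert[symmetric])
    have anti': "g i j = - g j i" if ij: "i \<in> S" "j \<in> S" "i \<noteq> j" for i j
      using anti[OF ij(1,2)] anti[OF ij(2,1)] ij(3) by (cases "i < j") auto
    have "lmult c (lmult c f) S = (\<Sum>i\<in>S. \<Sum>j\<in>{j\<in>S. i \<noteq> j}. g i j)"
    proof -
      have "lmult c f (S - {i}) = (\<Sum>j\<in>{j\<in>S. i \<noteq> j}. c j * sgn_before j (S - {i}) * f (S - {i} - {j}))" for i
        using True by (auto simp: lmult_def intro!: sum.cong)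
      then show ?thesis using True by (simp add: lmult_def[of c "lmult c f"] g_def sum_distrib_left)
    qed
    moreover have "(\<Sum>i\<in>S. \<Sum>j\<in>{j\<in>S. i \<noteq> j}. g i j) = - (\<Sum>i\<in>S. \<Sum>j\<in>{j\<in>S. i \<noteq> j}. g i j)"
    proof -
      have "(\<Sum>i\<in>S. \<Sum>j\<in>{j\<in>S. i \<noteq> j}. g i j) = (\<Sum>j\<in>S. \<Sum>i\<in>{i\<in>S. i \<noteq> j}. g i j)"
        by (rule sum.swap_restrict[OF fin fin])
      also have "\<dots> = (\<Sum>j\<in>S. \<Sum>i\<in>{i\<in>S. j \<noteq> i}. - g j i)"
        by (intro sum.cong) (auto intro: anti')
      also have "\<dots> = - (\<Sum>i\<in>S. \<Sum>j\<in>{j\<in>S. i \<noteq> j}. g i j)" by (simp only: sum_negf)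
      finally show ?thesis .
    qed
    ultimately show ?thesis by simp
  qed (simp add: lmult_def)
qed

lemma lmult_add_left:
  assumes "\<And>i. c i = d i + d' i"
  shows "lmult c f = lmult d f + lmult d' f"
  by (rule ext) (simp add: lmult_def assms distrib_right sum.distrib)

lemma lmult_diff: "lmult c (f - g) = lmult c f - lmult c g"
  by (rule ext) (simp add: lmult_def right_diff_distrib sum_subtractf)

lemma lmult_0: "lmult c 0 = 0"
  by (rule ext) (simp add: lmult_def)

fun word_vec :: "'h list \<Rightarrow> nat set \<Rightarrow> rat" where
  "word_vec [] = (\<lambda>S. if S = {} then 1 else 0)"
| "word_vec (x # xs) = lmult (co x) (word_vec xs)"

definition ext_coord :: "('h list \<Rightarrow>\<^sub>0 int) \<Rightarrow> nat set \<Rightarrow> rat" where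
  "ext_coord w = (\<lambda>S. frag_eval (\<lambda>xs. word_vec xs S) w)"

lemma ext_coord_simps:
  "ext_coord (v - w) = ext_coord v - ext_coord w" "ext_coord (v + w) = ext_coord v + ext_coord w"
  "ext_coord (frag_cmul k w) = qscale (of_int k) (ext_coord w)" "ext_coord (- w) = - ext_coord w"
  "ext_coord (frag_of xs) = word_vec xs" "ext_coord 0 = 0"
  by (simp_all add: ext_coord_def fun_eq_iff qscale_def)

lemma ext_coord_sum: "ext_coord (\<Sum>i\<in>I. g i) = (\<Sum>i\<in>I. ext_coord (g i))"
  by (induction I rule: infinite_finite_induct) (simp_all only: sum.infinite sum.empty sum.insert ext_coord_simps if_False not_False_eq_True)

lemma ext_coord_prepend: "ext_coord (prepend x w) = lmult (co x) (ext_coord w)"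
  using subset_UNIV
proof (induction w rule: frag_induction)
  case (diff v w)
  then show ?case by (simp only: prepend_simps ext_coord_simps lmult_diff)
qed (simp_all only: prepend_simps ext_coord_simps lmult_0 word_vec.simps)

lemma ext_coord_relations:
  assumes "r \<in> relations H"
  shows "ext_coord r = 0"
proof -
  have P: "frag_subgroup {r. ext_coord r = 0}" by (simp add: frag_subgroup_def ext_coord_simps)
  have "r \<in> {r. ext_coord r = 0}"
    using assms P
  proof (induction rule: relations_induct_prepend)
    case (lin x y w)
    have "lmult (co (x \<otimes>\<^bsub>H\<^esub> y)) (ext_coord w) = lmult (co x) (ext_coord w) + lmult (co y) (ext_coord w)"
      by (rule lmult_add_left) (rule co_mult[OF lin(1,2)])
    then have "ext_coord (prepend (x \<otimes>\<^bsub>H\<^esub> y) w - prepend x w - prepend y w) = 0"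
      unfolding ext_coord_simps(1) ext_coord_prepend by simp
    then show ?case by (rule CollectI)
  next
    case (alt x w)
    have "ext_coord (prepend x (prepend x w)) = 0" unfolding ext_coord_prepend by (rule lmult_lmult)
    then show ?case by (rule CollectI)
  next
    case (prepend x r)
    then have "ext_coord r = 0" by (simp only: mem_Collect_eq)
    then have "ext_coord (prepend x r) = 0" unfolding ext_coord_prepend by (simp only: lmult_0)
    then show ?case by (rule CollectI)
  qed
  then show ?thesis by (rule CollectD)
qed

lemma word_vec_support:
  assumes "word_vec xs S \<noteq> 0"
  shows "S \<subseteq> {..<b} \<and> card S = length xs"
  using assms
proof (induction xs arbitrary: S)
  case (Cons x xs)
  have S: "S \<subseteq> {..<b}"
    using Cons.prems by (rule contrapos_np) (simp add: lmult_def)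
  have s: "(\<Sum>i\<in>S. co x i * sgn_before i S * word_vec xs (S - {i})) \<noteq> 0"
    using Cons.prems S by (simp add: lmult_def)
  have "\<exists>i\<in>S. word_vec xs (S - {i}) \<noteq> 0"
  proof (rule ccontr)
    assume "\<not> ?thesis"
    then have "(\<Sum>i\<in>S. co x i * sgn_before i S * word_vec xs (S - {i})) = 0"
      by (intro sum.neutral) simp
    then show False using s by simp
  qed
  then obtain i where i: "i \<in> S" "word_vec xs (S - {i}) \<noteq> 0" by blast
  have "finite S" using S by (rule finite_subset) simp
  then have "card S = Suc (card (S - {i}))" using card_Suc_Diff1 i(1) by metis
  then show ?case using Cons.IH[OF i(2)] S by simp
qed (auto split: if_splits)

lemma word_vec_basis:
  assumes "sorted_wrt (<) l" "set l \<subseteq> {..<b}"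
  shows "word_vec (map e l) = (\<lambda>S. if S = set l then 1 else 0)"
  using assms
proof (induction l)
  case (Cons i l)
  show ?case
  proof
    fix S
    have i: "i < b" "i \<notin> set l" and il: "\<And>j. j \<in> set l \<Longrightarrow> i < j" using Cons.prems by auto
    show "word_vec (map e (i # l)) S = (if S = set (i # l) then 1 else 0)"
    proof (cases "S \<subseteq> {..<b}")
      case True
      then have fin: "finite S" by (rule finite_subset) simp
      have IH: "word_vec (map e l) = (\<lambda>S. if S = set l then 1 else 0)" using Cons by simp
      have "word_vec (map e (i # l)) S = (\<Sum>k\<in>S. co (e i) k * sgn_before k S * word_vec (map e l) (S - {k}))"
        using True by (simp add: lmult_def)
      also have "\<dots> = (\<Sum>k\<in>S. if k = i then sgn_before i S * (if S - {i} = set l then 1 else 0) else 0)"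
      proof (rule sum.cong[OF refl])
        fix k assume "k \<in> S"
        then have "k < b" using True by auto
        then show "co (e i) k * sgn_before k S * word_vec (map e l) (S - {k})
          = (if k = i then sgn_before i S * (if S - {i} = set l then 1 else 0) else 0)"
          unfolding IH using co_e[OF i(1)] by (cases "k = i") simp_all
      qed
      also have "\<dots> = (if i \<in> S then sgn_before i S * (if S - {i} = set l then 1 else 0) else 0)"
        using fin by (simp add: sum.delta)
      also have "\<dots> = (if S = set (i # l) then 1 else 0)"
      proof (cases "S = set (i # l)")
        case True
        have "{j\<in>S. j < i} = {}" using True il by fastforce
        then have "sgn_before i S = 1" unfolding sgn_before_def by (simp only: card.empty power_0)
        then show ?thesis using True i(2) by simp
      qed (use i(2) in auto)
      finally show ?thesis .
    qed (use Cons.prems in \<open>auto simp: lmult_def\<close>)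
  qed
qed auto

lemma basis_words_cases:
  assumes "xs \<in> basis_words"
  obtains S where "S \<subseteq> {..<b}" "xs = map e (sorted_list_of_set S)"
proof -
  obtain l where l: "xs = map e l" "sorted_wrt (<) l" "set l \<subseteq> {..<b}"
    using assms unfolding basis_words_def by blast
  have "l = sorted_list_of_set (set l)" using l(2) by (metis strict_sorted_equal sorted_list_of_set.set_sorted_key_list_of_set strict_sorted_list_of_set List.finite_set)
  then show ?thesis using that l by metis
qed

definition basis_word :: "nat set \<Rightarrow> 'h list" where
  "basis_word S = map e (sorted_list_of_set S)"

lemma ext_coord_basis_word:
  assumes "S \<subseteq> {..<b}"
  shows "ext_coord (frag_of (basis_word S)) = (\<lambda>T. if T = S then 1 else 0)"
proof -
  have "finite S" using assms by (rule finite_subset) simp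
  then show ?thesis
    using word_vec_basis[of "sorted_list_of_set S"] assms
    by (simp add: ext_coord_simps basis_word_def strict_sorted_list_of_set)
qed

lemma ext_coord_basis_span:
  assumes u: "Poly_Mapping.keys u \<subseteq> basis_words" and 0: "ext_coord u = 0"
  shows "u = 0"
proof (rule ccontr)
  assume "u \<noteq> 0"
  then obtain xs where xs: "xs \<in> Poly_Mapping.keys u" by (metis all_not_in_conv keys_eq_empty)
  obtain S where S: "S \<subseteq> {..<b}" "xs = basis_word S"
    using basis_words_cases[of xs] u xs unfolding basis_word_def by blast
  have "0 = ext_coord u S" using 0 by simp
  also have "\<dots> = (\<Sum>ys\<in>Poly_Mapping.keys u. of_int (Poly_Mapping.lookup u ys) * (if ys = xs then 1 else 0))"
    unfolding ext_coord_def frag_eval_def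
  proof (rule sum.cong[OF refl])
    fix ys assume "ys \<in> Poly_Mapping.keys u"
    then obtain T where T: "T \<subseteq> {..<b}" "ys = basis_word T"
      using basis_words_cases[of ys] u unfolding basis_word_def by blast
    have "S = T" if "ys = xs"
    proof (rule ccontr)
      assume "S \<noteq> T"
      then show False
        using fun_cong[OF ext_coord_basis_word[OF S(1)], of S] fun_cong[OF ext_coord_basis_word[OF T(1)], of S] that S(2) T(2)
        by simp
    qed
    moreover have "word_vec ys S = (if S = T then 1 else 0)"
      using ext_coord_basis_word[OF T(1)] T(2) by (simp add: ext_coord_simps)
    ultimately show "of_int (Poly_Mapping.lookup u ys) * word_vec ys S = of_int (Poly_Mapping.lookup u ys) * (if ys = xs then 1 else 0)"
      using S T by auto
  qed
  also have "\<dots> = (\<Sum>ys\<in>Poly_Mapping.keys u. if ys = xs then of_int (Poly_Mapping.lookup u xs) else 0)"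
    by (intro sum.cong) auto
  also have "\<dots> = of_int (Poly_Mapping.lookup u xs)"
    using xs by (simp only: sum.delta finite_keys if_True)
  finally show False using xs by (simp add: in_keys_iff)
qed

text \<open>Increasing words have the unit vectors as coordinates and span all words up to denominators.\<close>

lemma ext_coord_torsion:
  assumes w: "w \<in> words H" and 0: "ext_coord w = 0"
  shows "\<exists>N>0. frag_cmul N w \<in> relations H"
proof -
  obtain N u where u: "N > 0" "Poly_Mapping.keys u \<subseteq> basis_words" "frag_cmul N w - u \<in> relations H"
    using words_rational_span w unfolding rational_span_def by blast
  have "ext_coord (frag_cmul N w - u) = 0" by (rule ext_coord_relations[OF u(3)])
  then have "ext_coord u = 0" using 0 by (simp add: ext_coord_simps)
  then have "u = 0" by (rule ext_coord_basis_span[OF u(2)])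
  then show ?thesis using u by auto
qed

lemma ext_coord_support:
  assumes "ext_coord w S \<noteq> 0"
  shows "S \<subseteq> {..<b} \<and> (\<exists>xs\<in>Poly_Mapping.keys w. card S = length xs)"
proof -
  obtain xs where "xs \<in> Poly_Mapping.keys w" "word_vec xs S \<noteq> 0"
    using assms unfolding ext_coord_def frag_eval_def by (metis (no_types, lifting) mult_zero_right sum.neutral)
  then show ?thesis using word_vec_support by blast
qed

definition unit_vec :: "nat set \<Rightarrow> nat set \<Rightarrow> rat" where
  "unit_vec S = (\<lambda>T. if T = S then 1 else 0)"

text \<open>The linear map that the contraction with a trilinear form induces on coordinates.\<close>

definition diff_map :: "('h \<Rightarrow> 'h \<Rightarrow> 'h \<Rightarrow> int) \<Rightarrow> (nat set \<Rightarrow> rat) \<Rightarrow> nat set \<Rightarrow> rat" where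
  "diff_map \<mu> f = (\<Sum>S\<in>Pow {..<b}. qscale (f S) (ext_coord (C3 \<mu> (frag_of (basis_word S)))))"

lemma linear_diff_map: "qlinear (diff_map \<mu>)"
  unfolding Vector_Spaces.linear_iff diff_map_def
proof (intro conjI allI Q.vector_space_axioms)
  fix f g :: "nat set \<Rightarrow> rat" and c
  show "(\<Sum>S\<in>Pow {..<b}. qscale ((f + g) S) (ext_coord (C3 \<mu> (frag_of (basis_word S)))))
    = (\<Sum>S\<in>Pow {..<b}. qscale (f S) (ext_coord (C3 \<mu> (frag_of (basis_word S)))))
      + (\<Sum>S\<in>Pow {..<b}. qscale (g S) (ext_coord (C3 \<mu> (frag_of (basis_word S)))))"
    by (simp add: Q.scale_left_distrib sum.distrib)
  show "(\<Sum>S\<in>Pow {..<b}. qscale (qscale c f S) (ext_coord (C3 \<mu> (frag_of (basis_word S)))))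
    = qscale c (\<Sum>S\<in>Pow {..<b}. qscale (f S) (ext_coord (C3 \<mu> (frag_of (basis_word S)))))"
    unfolding Q.scale_sum_right by (simp add: qscale_def mult.assoc)
qed

lemma diff_map_unit_vec:
  assumes "S \<subseteq> {..<b}"
  shows "diff_map \<mu> (unit_vec S) = ext_coord (C3 \<mu> (frag_of (basis_word S)))"
proof -
  have "diff_map \<mu> (unit_vec S) = (\<Sum>T\<in>{S}. qscale (unit_vec S T) (ext_coord (C3 \<mu> (frag_of (basis_word T)))))"
    unfolding diff_map_def using assms by (intro sum.mono_neutral_right) (auto simp: unit_vec_def)
  then show ?thesis by (simp add: unit_vec_def)
qed

text \<open>Up to denominators a word is a combination of increasing words modulo relations, and both sides
  respect this.\<close>

lemma ext_coord_C3:
  assumes \<mu>: "alternating3 H \<mu>" and w: "w \<in> words H"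
  shows "ext_coord (C3 \<mu> w) = diff_map \<mu> (ext_coord w)"
proof -
  interpret d: Vector_Spaces.linear qscale qscale "diff_map \<mu>" by (rule linear_diff_map)
  obtain N u where u: "N > 0" "Poly_Mapping.keys u \<subseteq> basis_words" "frag_cmul N w - u \<in> relations H"
    using words_rational_span w unfolding rational_span_def by blast
  have "u \<in> {u. ext_coord (C3 \<mu> u) = diff_map \<mu> (ext_coord u)}"
  proof (rule frag_subgroup_induct[OF _ _ u(2)])
    show "frag_subgroup {u. ext_coord (C3 \<mu> u) = diff_map \<mu> (ext_coord u)}"
      by (simp add: frag_subgroup_def frag_extend_simps ext_coord_simps d.diff d.zero)
    fix xs assume "xs \<in> basis_words"
    then obtain S where S: "S \<subseteq> {..<b}" "xs = basis_word S"
      using basis_words_cases[of xs] unfolding basis_word_def by blast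
    show "frag_of xs \<in> {u. ext_coord (C3 \<mu> u) = diff_map \<mu> (ext_coord u)}"
      using diff_map_unit_vec[OF S(1), of \<mu>] ext_coord_basis_word[OF S(1)] S(2) by (simp only: unit_vec_def mem_Collect_eq)
  qed
  then have 1: "ext_coord (C3 \<mu> u) = diff_map \<mu> (ext_coord u)" by simp
  have 2: "ext_coord (frag_cmul N w - u) = 0" by (rule ext_coord_relations[OF u(3)])
  have 3: "ext_coord (C3 \<mu> (frag_cmul N w - u)) = 0"
    by (rule ext_coord_relations[OF C3_relations[OF \<mu> u(3)]])
  have "qscale (of_int N) (ext_coord (C3 \<mu> w)) = ext_coord (C3 \<mu> u)"
    using 3 by (simp add: ext_coord_simps frag_extend_simps)
  also have "\<dots> = diff_map \<mu> (qscale (of_int N) (ext_coord w))"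
    unfolding 1 using 2 by (simp add: ext_coord_simps)
  also have "\<dots> = qscale (of_int N) (diff_map \<mu> (ext_coord w))" by (rule d.scale)
  finally show ?thesis using u(1) by (simp add: Q.scale_cancel_left)
qed

end

section \<open>The homology of the cup complex in terms of words\<close>

lemma comm_FactGroup_facts:
  assumes S: "comm_group S" and I: "subgroup I S"
  shows "comm_group (S Mod I)"
    and "(\<lambda>x. I #>\<^bsub>S\<^esub> x) ` carrier S = carrier (S Mod I)"
    and "\<And>x y. x \<in> carrier S \<Longrightarrow> y \<in> carrier S \<Longrightarrow> I #>\<^bsub>S\<^esub> (x \<otimes>\<^bsub>S\<^esub> y) = (I #>\<^bsub>S\<^esub> x) \<otimes>\<^bsub>S Mod I\<^esub> (I #>\<^bsub>S\<^esub> y)"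
    and "\<And>x. x \<in> carrier S \<Longrightarrow> I #>\<^bsub>S\<^esub> x = \<one>\<^bsub>S Mod I\<^esub> \<longleftrightarrow> x \<in> I"
    and "\<And>x y. x \<in> carrier S \<Longrightarrow> y \<in> carrier S \<Longrightarrow> I #>\<^bsub>S\<^esub> x = I #>\<^bsub>S\<^esub> y \<longleftrightarrow> x \<otimes>\<^bsub>S\<^esub> inv\<^bsub>S\<^esub> y \<in> I"
proof -
  interpret S: comm_group S by (rule S)
  interpret N: normal I S using S.normal_iff_subgroup I by simp
  show "comm_group (S Mod I)" by (rule S.abelian_FactGroup[OF I])
  show "(\<lambda>x. I #>\<^bsub>S\<^esub> x) ` carrier S = carrier (S Mod I)" by (simp add: carrier_FactGroup)
  show "I #>\<^bsub>S\<^esub> (x \<otimes>\<^bsub>S\<^esub> y) = (I #>\<^bsub>S\<^esub> x) \<otimes>\<^bsub>S Mod I\<^esub> (I #>\<^bsub>S\<^esub> y)" if "x \<in> carrier S" "y \<in> carrier S" for x y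
    using N.rcos_sum[OF that] by simp
  show one: "I #>\<^bsub>S\<^esub> x = \<one>\<^bsub>S Mod I\<^esub> \<longleftrightarrow> x \<in> I" if "x \<in> carrier S" for x
    using S.coset_join1[OF _ that I] S.coset_join2[OF that I] N.subset by auto
  show "I #>\<^bsub>S\<^esub> x = I #>\<^bsub>S\<^esub> y \<longleftrightarrow> x \<otimes>\<^bsub>S\<^esub> inv\<^bsub>S\<^esub> y \<in> I" if xy: "x \<in> carrier S" "y \<in> carrier S" for x y
  proof
    assume "I #>\<^bsub>S\<^esub> x = I #>\<^bsub>S\<^esub> y"
    then show "x \<otimes>\<^bsub>S\<^esub> inv\<^bsub>S\<^esub> y \<in> I"
      using S.coset_mult_inv2[of I x y] S.coset_join1[of I "x \<otimes>\<^bsub>S\<^esub> inv\<^bsub>S\<^esub> y"] xy I N.subset by simp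
  next
    assume "x \<otimes>\<^bsub>S\<^esub> inv\<^bsub>S\<^esub> y \<in> I"
    then show "I #>\<^bsub>S\<^esub> x = I #>\<^bsub>S\<^esub> y"
      using S.coset_mult_inv1[of I x y] S.coset_join2[of "x \<otimes>\<^bsub>S\<^esub> inv\<^bsub>S\<^esub> y" I] xy I N.subset by simp
  qed
qed

lemma carrier_word_group: "c \<in> carrier (word_group H m) \<longleftrightarrow> c \<in> words H \<and> (\<forall>xs\<in>Poly_Mapping.keys c. length xs = m)"
  by (auto simp: word_group_def words_def)

lemma comm_group_word_group: "comm_group (word_group H m)"
  unfolding word_group_def by (rule abelian_free_Abelian_group)

lemma word_group_ops [simp]:
  "x \<otimes>\<^bsub>word_group H m\<^esub> y = x + y" "\<one>\<^bsub>word_group H m\<^esub> = 0"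
  by (simp_all add: word_group_def)

lemma inv_word_group: "x \<in> carrier (word_group H m) \<Longrightarrow> inv\<^bsub>word_group H m\<^esub> x = - x"
  by (simp add: word_group_def)

lemma subgroup_ext_relations:
  assumes H: "monoid H"
  shows "subgroup (ext_relations H m) (word_group H m)"
proof -
  interpret W: comm_group "word_group H m" by (rule comm_group_word_group)
  show ?thesis
    unfolding ext_relations_def
  proof (rule W.generate_is_subgroup, safe)
    fix xs a b ys assume "set xs \<union> {a, b} \<union> set ys \<subseteq> carrier H" "m = length xs + 1 + length ys"
    then have "frag_of (xs @ [a \<otimes>\<^bsub>H\<^esub> b] @ ys) \<in> carrier (word_group H (length xs + 1 + length ys))"
      "frag_of (xs @ [a] @ ys) \<in> carrier (word_group H (length xs + 1 + length ys))"
      "frag_of (xs @ [b] @ ys) \<in> carrier (word_group H (length xs + 1 + length ys))"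
      using monoid.m_closed[OF H] by (auto simp: word_group_def)
    then show "frag_of (xs @ [a \<otimes>\<^bsub>H\<^esub> b] @ ys) - frag_of (xs @ [a] @ ys) - frag_of (xs @ [b] @ ys)
        \<in> carrier (word_group H (length xs + 1 + length ys))"
      unfolding word_group_def carrier_free_Abelian_group_iff by (metis (no_types, lifting) Un_least keys_diff order_trans)
  next
    fix xs a ys assume "set xs \<union> {a} \<union> set ys \<subseteq> carrier H"
    then show "frag_of (xs @ [a, a] @ ys) \<in> carrier (word_group H (length xs + 2 + length ys))"
      by (auto simp: word_group_def)
  qed
qed

lemma ext_relations_subset:
  assumes H: "monoid H" and r: "r \<in> ext_relations H m"
  shows "r \<in> relations H" "r \<in> carrier (word_group H m)"
proof -
  show c: "r \<in> carrier (word_group H m)" using subgroup.subset[OF subgroup_ext_relations[OF H]] r by blast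
  interpret W: comm_group "word_group H m" by (rule comm_group_word_group)
  let ?gens = "{frag_of (xs @ [a \<otimes>\<^bsub>H\<^esub> b] @ ys) - frag_of (xs @ [a] @ ys) - frag_of (xs @ [b] @ ys) | xs a b ys.
          set xs \<union> {a, b} \<union> set ys \<subseteq> carrier H \<and> length xs + 1 + length ys = m} \<union>
      {frag_of (xs @ [a, a] @ ys) | xs a ys.
          set xs \<union> {a} \<union> set ys \<subseteq> carrier H \<and> length xs + 2 + length ys = m}"
  have g: "?gens \<subseteq> relations H"
  proof safe
    fix xs a b ys assume "set xs \<union> {a, b} \<union> set ys \<subseteq> carrier H"
    then show "frag_of (xs @ [a \<otimes>\<^bsub>H\<^esub> b] @ ys) - frag_of (xs @ [a] @ ys) - frag_of (xs @ [b] @ ys) \<in> relations H"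
      by (rule relations.lin)
  next
    fix xs a ys assume "set xs \<union> {a} \<union> set ys \<subseteq> carrier H"
    then show "frag_of (xs @ [a, a] @ ys) \<in> relations H" by (rule relations.alt)
  qed
  have gc: "?gens \<subseteq> carrier (word_group H m)"
    using subgroup.subset[OF subgroup_ext_relations[OF H, of m]] generate.incl[of _ ?gens "word_group H m"]
    unfolding ext_relations_def by blast
  have "r \<in> generate (word_group H m) ?gens" using r unfolding ext_relations_def .
  then show "r \<in> relations H"
  proof induction
    case one
    show ?case using rel_D(1) by simp
  next
    case (incl h)
    then show ?case using g by (rule subsetD[rotated])
  next
    case (inv h)
    have "inv\<^bsub>word_group H m\<^esub> h = - h" using inv_word_group[OF subsetD[OF gc inv]] .
    then show ?case using rel_D(3)[OF subsetD[OF g inv]] by simp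
  next
    case (eng h1 h2)
    then show ?case using rel_D(4) by simp
  qed
qed

definition proj :: "nat \<Rightarrow> ('h list \<Rightarrow>\<^sub>0 int) \<Rightarrow> ('h list \<Rightarrow>\<^sub>0 int)" where
  "proj m = frag_extend (\<lambda>xs. if length xs = m then frag_of xs else 0)"

lemma proj_simps:
  "proj m (v - w) = proj m v - proj m w" "proj m (v + w) = proj m v + proj m w" "proj m 0 = 0"
  "proj m (frag_of xs) = (if length xs = m then frag_of xs else 0)"
  by (simp_all add: proj_def frag_extend_simps)

lemma proj_sum: "proj m (\<Sum>i\<in>I. g i) = (\<Sum>i\<in>I. proj m (g i))"
  by (induction I rule: infinite_finite_induct) (simp_all add: proj_simps)

lemma lookup_proj: "Poly_Mapping.lookup (proj m w) xs = (if length xs = m then Poly_Mapping.lookup w xs else 0)"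
  using subset_UNIV
proof (induction w rule: frag_induction)
  case (diff v w)
  then show ?case by (simp add: proj_simps lookup_minus)
qed (auto simp: proj_simps lookup_single when_def)

lemma keys_proj: "Poly_Mapping.keys (proj m w) = {xs \<in> Poly_Mapping.keys w. length xs = m}"
  by (intro equalityI subsetI) (simp_all add: in_keys_iff lookup_proj split: if_splits)

lemma proj_eq_self:
  assumes "\<And>xs. xs \<in> Poly_Mapping.keys w \<Longrightarrow> length xs = m"
  shows "proj m w = w"
  by (rule poly_mapping_eqI) (use assms in \<open>auto simp: lookup_proj in_keys_iff\<close>)

lemma proj_eq_0:
  assumes "\<And>xs. xs \<in> Poly_Mapping.keys w \<Longrightarrow> length xs \<noteq> m"
  shows "proj m w = 0"
  by (rule poly_mapping_eqI) (use assms in \<open>auto simp: lookup_proj in_keys_iff\<close>)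

lemma sum_proj: "(\<Sum>m\<in>length ` Poly_Mapping.keys w. proj m w) = w"
proof (rule poly_mapping_eqI)
  fix xs
  have "Poly_Mapping.lookup (\<Sum>m\<in>length ` Poly_Mapping.keys w. proj m w) xs
     = (\<Sum>m\<in>length ` Poly_Mapping.keys w. if length xs = m then Poly_Mapping.lookup w xs else 0)"
    by (simp add: lookup_sum lookup_proj)
  also have "\<dots> = Poly_Mapping.lookup w xs"
    by (auto simp: sum.delta' in_keys_iff)
  finally show "Poly_Mapping.lookup (\<Sum>m\<in>length ` Poly_Mapping.keys w. proj m w) xs = Poly_Mapping.lookup w xs" .
qed

lemma proj_word_group: "w \<in> words H \<Longrightarrow> proj m w \<in> carrier (word_group H m)"
  unfolding carrier_word_group by (auto simp: keys_proj words_def)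

lemma proj_relations:
  assumes H: "monoid H" and r: "r \<in> relations H"
  shows "proj m r \<in> ext_relations H m"
  using r
proof induction
  case zero
  then show ?case using subgroup.one_closed[OF subgroup_ext_relations[OF H, of m]] by (simp add: proj_simps)
next
  case (diff v w)
  note sg = subgroup_ext_relations[OF H, of m]
  have "- proj m w \<in> ext_relations H m"
    using subgroup.m_inv_closed[OF sg diff.IH(2)] inv_word_group[OF ext_relations_subset(2)[OF H diff.IH(2)]] by simp
  from subgroup.m_closed[OF sg diff.IH(1) this] show ?case by (simp add: proj_simps)
next
  case (lin xs a b ys)
  show ?case
  proof (cases "length xs + 1 + length ys = m")
    case True
    then show ?thesis
      unfolding ext_relations_def using lin by (simp add: proj_simps) (blast intro: generate.incl)
  next
    case False
    then show ?thesis using subgroup.one_closed[OF subgroup_ext_relations[OF H, of m]] by (auto simp: proj_simps)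
  qed
next
  case (alt xs a ys)
  show ?case
  proof (cases "length xs + 2 + length ys = m")
    case True
    then show ?thesis
      unfolding ext_relations_def using alt by (simp add: proj_simps) (blast intro: generate.incl)
  next
    case False
    then show ?thesis using subgroup.one_closed[OF subgroup_ext_relations[OF H, of m]] by (auto simp: proj_simps)
  qed
qed

lemma keys_contract3:
  assumes "ys \<in> Poly_Mapping.keys (contract3 \<mu> xs)"
  obtains i j l where "i < j" "j < l" "l < length xs" "\<mu> (xs ! i) (xs ! j) (xs ! l) \<noteq> 0" "ys = nths xs (- {i, j, l})"
proof -
  define X where "X = {nths xs (- {i, j, l}) | i j l. i < j \<and> j < l \<and> l < length xs \<and> \<mu> (xs ! i) (xs ! j) (xs ! l) \<noteq> 0}"
  have P: "frag_subgroup {w. Poly_Mapping.keys w \<subseteq> X}"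
    unfolding frag_subgroup_def by (auto dest!: subsetD[OF keys_diff])
  have "frag_cmul ((- 1) ^ (i + j + l) * \<mu> (xs ! i) (xs ! j) (xs ! l)) (frag_of (nths xs (- {i, j, l}))) \<in> {w. Poly_Mapping.keys w \<subseteq> X}"
    if "l < length xs" "j < l" "i < j" for i j l
  proof (cases "\<mu> (xs ! i) (xs ! j) (xs ! l) = 0")
    case True
    then show ?thesis by simp
  next
    case False
    then have "frag_of (nths xs (- {i, j, l})) \<in> {w. Poly_Mapping.keys w \<subseteq> X}" using that unfolding X_def by auto
    then show ?thesis by (rule frag_subgroup_cmul[OF P])
  qed
  then have "contract3 \<mu> xs \<in> {w. Poly_Mapping.keys w \<subseteq> X}"
    unfolding contract3_def by (intro frag_subgroup_sum[OF P]) auto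
  then have "ys \<in> X" using assms by blast
  then obtain i j l where "i < j" "j < l" "l < length xs" "\<mu> (xs ! i) (xs ! j) (xs ! l) \<noteq> 0" "ys = nths xs (- {i, j, l})"
    unfolding X_def by blast
  then show ?thesis by (rule that)
qed

lemma length_contract3:
  assumes "ys \<in> Poly_Mapping.keys (contract3 \<mu> xs)"
  shows "length xs = length ys + 3"
proof -
  obtain i j l where ijl: "i < j" "j < l" "l < length xs" "ys = nths xs (- {i, j, l})"
    using keys_contract3[OF assms] by metis
  have "{k. k < length xs \<and> k \<in> - {i, j, l}} = {..<length xs} - {i, j, l}" by auto
  then have "length ys = card ({..<length xs} - {i, j, l})" using ijl(4) by (simp add: length_nths)
  also have "\<dots> = length xs - 3" using ijl by (subst card_Diff_subset) auto
  finally show ?thesis using ijl by linarith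
qed

lemma keys_C3:
  assumes "ys \<in> Poly_Mapping.keys (C3 \<mu> w)"
  obtains xs where "xs \<in> Poly_Mapping.keys w" "ys \<in> Poly_Mapping.keys (contract3 \<mu> xs)"
proof -
  have "Poly_Mapping.keys (C3 \<mu> w) \<subseteq> (\<Union>xs\<in>Poly_Mapping.keys w. Poly_Mapping.keys (contract3 \<mu> xs))"
    by (rule keys_frag_extend)
  then show ?thesis using assms that by blast
qed

lemma proj_C3: "proj m (C3 \<mu> w) = C3 \<mu> (proj (m + 3) w)"
  using subset_UNIV
proof (induction w rule: frag_induction)
  case (diff v w)
  then show ?case by (simp add: proj_simps frag_extend_simps)
next
  case (one xs)
  show ?case
    using length_contract3[of _ \<mu> xs]
    by (auto simp: proj_simps intro!: proj_eq_self proj_eq_0)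
qed (simp add: proj_simps)

definition parity_words :: "'h monoid \<Rightarrow> int \<Rightarrow> ('h list \<Rightarrow>\<^sub>0 int) set" where
  "parity_words H k = {w \<in> words H. \<forall>xs\<in>Poly_Mapping.keys w. even (int (length xs) - k)}"

lemma frag_subgroup_parity_words: "frag_subgroup (parity_words H k)"
  unfolding frag_subgroup_def
proof (intro conjI ballI)
  show "0 \<in> parity_words H k" by (simp add: parity_words_def frag_subgroupD(1)[OF frag_subgroup_words])
  fix v w assume "v \<in> parity_words H k" "w \<in> parity_words H k"
  then show "v - w \<in> parity_words H k"
    using keys_diff[of v w] frag_subgroupD(2)[OF frag_subgroup_words, of v H w] unfolding parity_words_def by blast
qed

lemma C3_parity_words:
  assumes "w \<in> parity_words H k"
  shows "C3 \<mu> w \<in> parity_words H (k - 1)"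
  unfolding parity_words_def
proof (intro CollectI conjI ballI)
  show "C3 \<mu> w \<in> words H" using assms by (intro C3_words) (simp add: parity_words_def)
  fix ys assume "ys \<in> Poly_Mapping.keys (C3 \<mu> w)"
  then obtain xs where "xs \<in> Poly_Mapping.keys w" "length xs = length ys + 3"
    using keys_C3 length_contract3 by metis
  then show "even (int (length ys) - (k - 1))" using assms by (force simp: parity_words_def)
qed

context
  fixes H :: "'h monoid" and \<mu> :: "'h \<Rightarrow> 'h \<Rightarrow> 'h \<Rightarrow> int"
  assumes H: "monoid H"
begin

interpretation ext: comm_group "ext_power H m" for m
  unfolding ext_power_def by (rule comm_FactGroup_facts(1)[OF comm_group_word_group subgroup_ext_relations[OF H]])

lemmas group_ext_power = ext.group_axioms

definition ext_class :: "nat \<Rightarrow> ('h list \<Rightarrow>\<^sub>0 int) \<Rightarrow> ('h list \<Rightarrow>\<^sub>0 int) set" where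
  "ext_class m w = ext_relations H m #>\<^bsub>word_group H m\<^esub> w"

lemma ext_class:
  "ext_class m ` carrier (word_group H m) = carrier (ext_power H m)"
  "v \<in> carrier (word_group H m) \<Longrightarrow> w \<in> carrier (word_group H m) \<Longrightarrow>
     ext_class m (v + w) = ext_class m v \<otimes>\<^bsub>ext_power H m\<^esub> ext_class m w"
  "v \<in> carrier (word_group H m) \<Longrightarrow> ext_class m v = \<one>\<^bsub>ext_power H m\<^esub> \<longleftrightarrow> v \<in> ext_relations H m"
  "v \<in> carrier (word_group H m) \<Longrightarrow> w \<in> carrier (word_group H m) \<Longrightarrow>
     ext_class m v = ext_class m w \<longleftrightarrow> v - w \<in> ext_relations H m"
  using comm_FactGroup_facts(2-)[OF comm_group_word_group subgroup_ext_relations[OF H, of m]]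
  by (simp_all add: ext_class_def[abs_def] ext_power_def inv_word_group)

lemma ext_contract_class:
  assumes \<mu>: "alternating3 H \<mu>" and w: "w \<in> carrier (word_group H (m + 3))"
  shows "ext_contract H \<mu> (m + 3) (ext_class (m + 3) w) = ext_class m (C3 \<mu> w)"
proof -
  let ?c = "SOME c. c \<in> ext_class (m + 3) w"
  have "w \<in> ext_class (m + 3) w"
    unfolding ext_class_def
    using group.rcos_self[OF comm_group.axioms(2)[OF comm_group_word_group] w subgroup_ext_relations[OF H]] .
  then have "?c \<in> ext_class (m + 3) w" by (rule someI)
  then obtain r where r: "r \<in> ext_relations H (m + 3)" "?c = r + w"
    unfolding ext_class_def r_coset_def by auto
  have C3w: "C3 \<mu> v \<in> carrier (word_group H m)" if "v \<in> carrier (word_group H (m + 3))" for v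
    using that unfolding carrier_word_group by (auto intro!: C3_words elim!: keys_C3 dest!: length_contract3)
  have rc: "r \<in> carrier (word_group H (m + 3))" by (rule ext_relations_subset(2)[OF H r(1)])
  have "C3 \<mu> r \<in> ext_relations H m"
    using proj_relations[OF H C3_relations[OF \<mu> ext_relations_subset(1)[OF H r(1)]], of m] C3w[OF rc]
    unfolding carrier_word_group by (simp add: proj_eq_self)
  moreover have "r + w \<in> carrier (word_group H (m + 3))"
    using rc w frag_subgroupD(4)[OF frag_subgroup_words, of r H w] keys_add[of r w]
    unfolding carrier_word_group by blast
  ultimately have "ext_class m (C3 \<mu> ?c) = ext_class m (C3 \<mu> w)"
    using ext_class(4)[OF C3w C3w[OF w], of "r + w"] unfolding r(2) by (simp add: frag_extend_simps)
  then show ?thesis by (simp add: ext_contract_def ext_class_def)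
qed

text \<open>The length of the words determines the exponent of \<open>U\<close>. An element of the cup complex can therefore
  be written as a single formal sum of words whose lengths have the parity of its degree.\<close>

definition complex_class :: "int \<Rightarrow> ('h list \<Rightarrow>\<^sub>0 int) \<Rightarrow> int \<Rightarrow> ('h list \<Rightarrow>\<^sub>0 int) set" where
  "complex_class k w = (\<lambda>n\<in>{n. 0 \<le> k + 2 * n}. ext_class (nat (k + 2 * n)) (proj (nat (k + 2 * n)) w))"

lemma complex_class_apply:
  "0 \<le> k + 2 * n \<Longrightarrow> complex_class k w n = ext_class (nat (k + 2 * n)) (proj (nat (k + 2 * n)) w)"
  "\<not> 0 \<le> k + 2 * n \<Longrightarrow> complex_class k w n = undefined"
  by (simp_all only: complex_class_def restrict_def mem_Collect_eq if_True if_False)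

lemma carrier_cup_complex:
  "carrier (cup_complex H k) = {x \<in> \<Pi>\<^sub>E n\<in>{n. 0 \<le> k + 2 * n}. carrier (ext_power H (nat (k + 2 * n))).
     finite {n \<in> {n. 0 \<le> k + 2 * n}. x n \<noteq> \<one>\<^bsub>ext_power H (nat (k + 2 * n))\<^esub>}}"
  unfolding cup_complex_def by (rule carrier_sum_group) (rule group_ext_power)

lemma comm_group_cup_complex: "comm_group (cup_complex H k)"
proof (rule group.group_comm_groupI)
  show "Group.group (cup_complex H k)" unfolding cup_complex_def by (rule sum_group) (rule group_ext_power)
  fix x y assume "x \<in> carrier (cup_complex H k)" "y \<in> carrier (cup_complex H k)"
  then show "x \<otimes>\<^bsub>cup_complex H k\<^esub> y = y \<otimes>\<^bsub>cup_complex H k\<^esub> x"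
    unfolding carrier_cup_complex unfolding cup_complex_def
    by (auto simp: fun_eq_iff restrict_def intro!: ext.m_comm)
qed

lemma complex_class_add:
  assumes "v \<in> words H" "w \<in> words H"
  shows "complex_class k (v + w) = complex_class k v \<otimes>\<^bsub>cup_complex H k\<^esub> complex_class k w"
  unfolding cup_complex_def complex_class_def
  by (auto simp: fun_eq_iff proj_simps ext_class(2) proj_word_group assms)

lemma complex_class_eq_one:
  assumes w: "w \<in> parity_words H k"
  shows "complex_class k w = \<one>\<^bsub>cup_complex H k\<^esub> \<longleftrightarrow> w \<in> relations H"
proof
  have ww: "w \<in> words H" using w by (simp add: parity_words_def)
  assume 1: "complex_class k w = \<one>\<^bsub>cup_complex H k\<^esub>"
  have "proj m w \<in> relations H" if m: "m \<in> length ` Poly_Mapping.keys w" for m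
  proof -
    have "even (int m - k)" using w m by (auto simp: parity_words_def)
    then obtain n where n: "int m - k = 2 * n" by (elim evenE)
    then have m': "m = nat (k + 2 * n)" "0 \<le> k + 2 * n" by auto
    have "ext_class m (proj m w) = \<one>\<^bsub>ext_power H m\<^esub>"
      using fun_cong[OF 1, of n] m' by (simp add: complex_class_def cup_complex_def)
    then show ?thesis using ext_class(3) proj_word_group[OF ww] ext_relations_subset[OF H] by blast
  qed
  then have "(\<Sum>m\<in>length ` Poly_Mapping.keys w. proj m w) \<in> relations H"
    by (intro frag_subgroup_sum[OF frag_subgroup_relations]) auto
  then show "w \<in> relations H" unfolding sum_proj .
next
  assume r: "w \<in> relations H"
  have ww: "w \<in> words H" using w by (simp add: parity_words_def)
  show "complex_class k w = \<one>\<^bsub>cup_complex H k\<^esub>"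
    using ext_class(3)[OF proj_word_group[OF ww]] proj_relations[OF H r]
    by (simp add: complex_class_def cup_complex_def fun_eq_iff restrict_def)
qed

lemma complex_class_onto: "complex_class k ` parity_words H k = carrier (cup_complex H k)"
proof safe
  fix w assume w: "w \<in> parity_words H k"
  then have ww: "w \<in> words H" by (simp add: parity_words_def)
  have "{n \<in> {n. 0 \<le> k + 2 * n}. complex_class k w n \<noteq> \<one>\<^bsub>ext_power H (nat (k + 2 * n))\<^esub>}
    \<subseteq> (\<lambda>m. (int m - k) div 2) ` length ` Poly_Mapping.keys w"
  proof (rule subsetI, elim CollectE conjE)
    fix n assume n: "0 \<le> k + 2 * n" and n2: "complex_class k w n \<noteq> \<one>\<^bsub>ext_power H (nat (k + 2 * n))\<^esub>"
    have "ext_class (nat (k + 2 * n)) (proj (nat (k + 2 * n)) w) \<noteq> \<one>\<^bsub>ext_power H (nat (k + 2 * n))\<^esub>"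
      using n2 unfolding complex_class_apply(1)[OF n] .
    then have "proj (nat (k + 2 * n)) w \<notin> ext_relations H (nat (k + 2 * n))"
      using ext_class(3)[OF proj_word_group[OF ww]] by blast
    then have "proj (nat (k + 2 * n)) w \<noteq> 0"
      using subgroup.one_closed[OF subgroup_ext_relations[OF H]] by (metis word_group_ops(2))
    then obtain xs where xs: "xs \<in> Poly_Mapping.keys w" "length xs = nat (k + 2 * n)"
      using proj_eq_0 by blast
    have "n = (\<lambda>m. (int m - k) div 2) (length xs)" using n xs(2) by simp
    moreover have "length xs \<in> length ` Poly_Mapping.keys w" by (rule imageI[OF xs(1)])
    ultimately show "n \<in> (\<lambda>m. (int m - k) div 2) ` length ` Poly_Mapping.keys w"
      by (rule image_eqI[where f = "\<lambda>m. (int m - k) div 2"])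
  qed
  then have "finite {n \<in> {n. 0 \<le> k + 2 * n}. complex_class k w n \<noteq> \<one>\<^bsub>ext_power H (nat (k + 2 * n))\<^esub>}"
    by (rule finite_subset) simp
  then show "complex_class k w \<in> carrier (cup_complex H k)"
    unfolding carrier_cup_complex
  proof (intro CollectI conjI PiE_I)
    fix n assume "n \<in> {n. 0 \<le> k + 2 * n}"
    then have n: "0 \<le> k + 2 * n" by simp
    show "complex_class k w n \<in> carrier (ext_power H (nat (k + 2 * n)))"
      unfolding complex_class_apply(1)[OF n] ext_class(1)[symmetric] by (rule imageI) (rule proj_word_group[OF ww])
  next
    fix n assume "n \<notin> {n. 0 \<le> k + 2 * n}"
    then show "complex_class k w n = undefined" by (intro complex_class_apply(2)) simp
  qed
next
  fix x assume x: "x \<in> carrier (cup_complex H k)"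
  let ?J = "{n. 0 \<le> k + 2 * n}"
  define F where "F = {n \<in> ?J. x n \<noteq> \<one>\<^bsub>ext_power H (nat (k + 2 * n))\<^esub>}"
  have fin: "finite F" using x unfolding carrier_cup_complex F_def by blast
  have "\<exists>c. c \<in> carrier (word_group H (nat (k + 2 * n))) \<and> ext_class (nat (k + 2 * n)) c = x n" if "n \<in> ?J" for n
  proof -
    have "x n \<in> carrier (ext_power H (nat (k + 2 * n)))" using x that unfolding carrier_cup_complex by blast
    then show ?thesis unfolding ext_class(1)[symmetric] by blast
  qed
  then obtain c where c: "\<And>n. n \<in> ?J \<Longrightarrow> c n \<in> carrier (word_group H (nat (k + 2 * n))) \<and> ext_class (nat (k + 2 * n)) (c n) = x n"
    by metis
  define w where "w = (\<Sum>n\<in>F. c n)"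
  have "c n \<in> parity_words H k" if nF: "n \<in> F" for n
  proof -
    have n: "0 \<le> k + 2 * n" using nF unfolding F_def by blast
    have cn: "c n \<in> words H" "\<And>xs. xs \<in> Poly_Mapping.keys (c n) \<Longrightarrow> length xs = nat (k + 2 * n)"
      using c[OF CollectI, OF n] unfolding carrier_word_group by blast+
    have "even (int (length xs) - k)" if "xs \<in> Poly_Mapping.keys (c n)" for xs
      using cn(2)[OF that] n by simp
    then show ?thesis using cn(1) unfolding parity_words_def by blast
  qed
  then have w: "w \<in> parity_words H k" unfolding w_def by (intro frag_subgroup_sum[OF frag_subgroup_parity_words]) auto
  have "complex_class k w n = x n" for n
  proof (cases "n \<in> ?J")
    case True
    have pc: "proj (nat (k + 2 * n)) (c i) = (if i = n then c n else 0)" if "i \<in> F" for i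
    proof -
      have i: "0 \<le> k + 2 * i" using that unfolding F_def by blast
      have ci: "\<And>xs. xs \<in> Poly_Mapping.keys (c i) \<Longrightarrow> length xs = nat (k + 2 * i)"
        using c[OF CollectI, OF i] unfolding carrier_word_group by blast
      show ?thesis
      proof (cases "i = n")
        case True
        then show ?thesis using ci by (simp add: proj_eq_self)
      next
        case False
        then have "nat (k + 2 * i) \<noteq> nat (k + 2 * n)" using i \<open>n \<in> ?J\<close> by auto
        then show ?thesis using ci False by (simp add: proj_eq_0)
      qed
    qed
    have "proj (nat (k + 2 * n)) w = (\<Sum>i\<in>F. if i = n then c n else 0)"
      unfolding w_def proj_sum by (intro sum.cong refl pc)
    also have "\<dots> = (if n \<in> F then c n else 0)" using fin by (simp add: sum.delta)
    finally have p: "proj (nat (k + 2 * n)) w = (if n \<in> F then c n else 0)" .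
    have z: "ext_class (nat (k + 2 * n)) 0 = \<one>\<^bsub>ext_power H (nat (k + 2 * n))\<^esub>"
      using ext_class(3)[of 0 "nat (k + 2 * n)"] subgroup.one_closed[OF subgroup_ext_relations[OF H, of "nat (k + 2 * n)"]]
      by (simp add: carrier_word_group frag_subgroupD(1)[OF frag_subgroup_words])
    have n: "0 \<le> k + 2 * n" using True by simp
    show ?thesis
    proof (cases "n \<in> F")
      case True
      then show ?thesis unfolding complex_class_apply(1)[OF n] p using c[OF CollectI, OF n] by simp
    next
      case False
      then have "x n = \<one>\<^bsub>ext_power H (nat (k + 2 * n))\<^esub>" using n unfolding F_def by blast
      then show ?thesis unfolding complex_class_apply(1)[OF n] p using False z by simp
    qed
  next
    case False
    moreover have "x n = undefined"
      using x False unfolding carrier_cup_complex by (auto simp: PiE_def extensional_def)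
    ultimately show ?thesis by (simp add: complex_class_apply(2))
  qed
  then have "x = complex_class k w" by (intro ext) simp
  then show "x \<in> complex_class k ` parity_words H k" using w by (rule image_eqI)
qed

lemma cup_differential_class:
  assumes \<mu>: "alternating3 H \<mu>" and w: "w \<in> words H"
  shows "cup_differential H \<mu> k (complex_class k w) = complex_class (k - 1) (C3 \<mu> w)"
proof
  fix m
  show "cup_differential H \<mu> k (complex_class k w) m = complex_class (k - 1) (C3 \<mu> w) m"
  proof (cases "0 \<le> (k - 1) + 2 * m")
    case True
    then have e: "nat (k + 2 * (m + 1)) = nat (k - 1 + 2 * m) + 3" "0 \<le> k + 2 * (m + 1)" by auto
    have "cup_differential H \<mu> k (complex_class k w) m
      = ext_contract H \<mu> (nat (k - 1 + 2 * m) + 3) (ext_class (nat (k - 1 + 2 * m) + 3) (proj (nat (k - 1 + 2 * m) + 3) w))"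
      using True e by (simp add: cup_differential_def complex_class_apply(1))
    also have "\<dots> = ext_class (nat (k - 1 + 2 * m)) (C3 \<mu> (proj (nat (k - 1 + 2 * m) + 3) w))"
      by (rule ext_contract_class[OF \<mu> proj_word_group[OF w]])
    finally show ?thesis using True by (simp add: complex_class_apply(1) proj_C3)
  qed (simp add: cup_differential_def complex_class_apply(2))
qed

end

definition cycle_words :: "'h monoid \<Rightarrow> ('h \<Rightarrow> 'h \<Rightarrow> 'h \<Rightarrow> int) \<Rightarrow> int \<Rightarrow> ('h list \<Rightarrow>\<^sub>0 int) set" where
  "cycle_words H \<mu> k = {w \<in> parity_words H k. C3 \<mu> w \<in> relations H}"

definition boundary_words :: "'h monoid \<Rightarrow> ('h \<Rightarrow> 'h \<Rightarrow> 'h \<Rightarrow> int) \<Rightarrow> int \<Rightarrow> ('h list \<Rightarrow>\<^sub>0 int) set" where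
  "boundary_words H \<mu> k = {w \<in> parity_words H k. \<exists>v\<in>parity_words H (k + 1). w - C3 \<mu> v \<in> relations H}"

lemma frag_subgroup_cycle_words: "frag_subgroup (cycle_words H \<mu> k)"
  unfolding cycle_words_def frag_subgroup_def
  by (auto simp: frag_extend_simps rel_D(1) frag_subgroupD(1)[OF frag_subgroup_parity_words]
      intro: rel_D(2) frag_subgroupD(2)[OF frag_subgroup_parity_words])

lemma boundary_wordsI:
  assumes "w \<in> parity_words H k" "v \<in> parity_words H (k + 1)" "w - C3 \<mu> v \<in> relations H"
  shows "w \<in> boundary_words H \<mu> k"
  using assms unfolding boundary_words_def by blast

lemma frag_subgroup_boundary_words: "frag_subgroup (boundary_words H \<mu> k)"
  unfolding frag_subgroup_def
proof (intro conjI ballI)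
  show "0 \<in> boundary_words H \<mu> k"
    by (rule boundary_wordsI[of _ _ _ 0]) (simp_all add: frag_subgroupD(1)[OF frag_subgroup_parity_words] rel_D(1))
  fix v w assume "v \<in> boundary_words H \<mu> k" "w \<in> boundary_words H \<mu> k"
  then obtain v' w' where v: "v \<in> parity_words H k" "v' \<in> parity_words H (k + 1)" "v - C3 \<mu> v' \<in> relations H"
    and w: "w \<in> parity_words H k" "w' \<in> parity_words H (k + 1)" "w - C3 \<mu> w' \<in> relations H"
    unfolding boundary_words_def by blast
  have eq: "(v - w) - C3 \<mu> (v' - w') = (v - C3 \<mu> v') - (w - C3 \<mu> w')" by (simp add: frag_extend_simps)
  have "(v - w) - C3 \<mu> (v' - w') \<in> relations H" unfolding eq by (rule rel_D(2)[OF v(3) w(3)])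
  then show "v - w \<in> boundary_words H \<mu> k"
    by (intro boundary_wordsI[of _ _ _ "v' - w'"] frag_subgroupD(2)[OF frag_subgroup_parity_words] v w)
qed

lemma boundary_words_subset:
  assumes "alternating3 H \<mu>"
  shows "boundary_words H \<mu> k \<subseteq> cycle_words H \<mu> k"
proof
  fix w assume "w \<in> boundary_words H \<mu> k"
  then obtain v where v: "w \<in> parity_words H k" "w - C3 \<mu> v \<in> relations H" unfolding boundary_words_def by blast
  have "C3 \<mu> (w - C3 \<mu> v) \<in> relations H" by (rule C3_relations[OF assms v(2)])
  then show "w \<in> cycle_words H \<mu> k" using v(1) by (simp add: cycle_words_def frag_extend_simps C3_square)
qed

definition homology_class where
  "homology_class H \<mu> k w = (cup_differential H \<mu> (k + 1) ` carrier (cup_complex H (k + 1)))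
     #>\<^bsub>cup_complex H k\<^esub> complex_class H k w"

text \<open>The homology of the cup complex as a quotient of groups of words.\<close>

lemma cup_homology_class:
  assumes H: "monoid H" and \<mu>: "alternating3 H \<mu>"
  shows "comm_group (cup_homology H \<mu> k)"
    and "homology_class H \<mu> k ` cycle_words H \<mu> k = carrier (cup_homology H \<mu> k)"
    and "\<And>v w. v \<in> cycle_words H \<mu> k \<Longrightarrow> w \<in> cycle_words H \<mu> k \<Longrightarrow>
      homology_class H \<mu> k (v + w) = homology_class H \<mu> k v \<otimes>\<^bsub>cup_homology H \<mu> k\<^esub> homology_class H \<mu> k w"
    and "\<And>w. w \<in> cycle_words H \<mu> k \<Longrightarrow>
      homology_class H \<mu> k w = \<one>\<^bsub>cup_homology H \<mu> k\<^esub> \<longleftrightarrow> w \<in> boundary_words H \<mu> k"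
proof -
  note cw = complex_class_onto[OF H] complex_class_add[OF H] complex_class_eq_one[OF H] cup_differential_class[OF H \<mu>]
  have pw: "w \<in> words H" if "w \<in> parity_words H j" for w j using that by (simp add: parity_words_def)
  have dhom: "cup_differential H \<mu> (j + 1) \<in> hom (cup_complex H (j + 1)) (cup_complex H j)" for j
  proof (rule homI)
    fix x assume "x \<in> carrier (cup_complex H (j + 1))"
    then obtain v where v: "v \<in> parity_words H (j + 1)" "x = complex_class H (j + 1) v" unfolding cw(1)[symmetric] by blast
    show "cup_differential H \<mu> (j + 1) x \<in> carrier (cup_complex H j)"
      using cw(4)[OF pw[OF v(1)], of "j + 1"] C3_parity_words[OF v(1), of \<mu>] v(2) unfolding cw(1)[symmetric] by simp
    fix y assume "y \<in> carrier (cup_complex H (j + 1))"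
    then obtain w where w: "w \<in> parity_words H (j + 1)" "y = complex_class H (j + 1) w" unfolding cw(1)[symmetric] by blast
    have "cup_differential H \<mu> (j + 1) (x \<otimes>\<^bsub>cup_complex H (j + 1)\<^esub> y) = cup_differential H \<mu> (j + 1) (complex_class H (j + 1) (v + w))"
      unfolding v(2) w(2) cw(2)[OF pw[OF v(1)] pw[OF w(1)]] ..
    also have "\<dots> = complex_class H j (C3 \<mu> v + C3 \<mu> w)"
      using cw(4)[OF frag_subgroupD(4)[OF frag_subgroup_words pw[OF v(1)] pw[OF w(1)]], of "j + 1"] by (simp add: frag_extend_simps)
    also have "\<dots> = complex_class H j (C3 \<mu> v) \<otimes>\<^bsub>cup_complex H j\<^esub> complex_class H j (C3 \<mu> w)"
      by (rule cw(2)) (intro C3_words pw[OF v(1)], intro C3_words pw[OF w(1)])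
    finally show "cup_differential H \<mu> (j + 1) (x \<otimes>\<^bsub>cup_complex H (j + 1)\<^esub> y)
      = cup_differential H \<mu> (j + 1) x \<otimes>\<^bsub>cup_complex H j\<^esub> cup_differential H \<mu> (j + 1) y"
      unfolding v(2) w(2) using cw(4)[OF pw[OF v(1)], of "j + 1"] cw(4)[OF pw[OF w(1)], of "j + 1"] by simp
  qed
  interpret C: comm_group "cup_complex H j" for j by (rule comm_group_cup_complex[OF H])
  define d where "d = cup_differential H \<mu> k"
  define d' where "d' = cup_differential H \<mu> (k + 1)"
  interpret d: group_hom "cup_complex H k" "cup_complex H (k - 1)" d
    using dhom[of "k - 1"] by unfold_locales (simp add: d_def)
  interpret d': group_hom "cup_complex H (k + 1)" "cup_complex H k" d'
    using dhom[of k] by unfold_locales (simp add: d'_def)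
  define K where "K = kernel (cup_complex H k) (cup_complex H (k - 1)) d"
  define I where "I = d' ` carrier (cup_complex H (k + 1))"
  define S where "S = subgroup_generated (cup_complex H k) K"
  have subK: "subgroup K (cup_complex H k)" unfolding K_def by (rule d.subgroup_kernel)
  have subI: "subgroup I (cup_complex H k)" unfolding I_def by (rule d'.img_is_subgroup)
  have K: "K = complex_class H k ` cycle_words H \<mu> k"
  proof -
    have "complex_class H k w \<in> K \<longleftrightarrow> w \<in> cycle_words H \<mu> k" if w: "w \<in> parity_words H k" for w
    proof -
      have "complex_class H k w \<in> carrier (cup_complex H k)" unfolding cw(1)[symmetric] using w by (rule imageI)
      then have "complex_class H k w \<in> K \<longleftrightarrow> complex_class H (k - 1) (C3 \<mu> w) = \<one>\<^bsub>cup_complex H (k - 1)\<^esub>"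
        unfolding K_def kernel_def d_def cw(4)[OF pw[OF w], symmetric] by blast
      also have "\<dots> \<longleftrightarrow> C3 \<mu> w \<in> relations H" by (rule cw(3)[OF C3_parity_words[OF w]])
      finally show ?thesis using w by (simp add: cycle_words_def)
    qed
    moreover have "K \<subseteq> complex_class H k ` parity_words H k" unfolding cw(1) using subgroup.subset[OF subK] .
    moreover have "cycle_words H \<mu> k \<subseteq> parity_words H k" by (auto simp: cycle_words_def)
    ultimately show ?thesis by blast
  qed
  have Iiff: "complex_class H k w \<in> I \<longleftrightarrow> w \<in> boundary_words H \<mu> k" if w: "w \<in> parity_words H k" for w
  proof -
    have 1: "complex_class H k w = d' (complex_class H (k + 1) v) \<longleftrightarrow> w - C3 \<mu> v \<in> relations H"
      if v: "v \<in> parity_words H (k + 1)" for v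
    proof -
      have d'v: "d' (complex_class H (k + 1) v) = complex_class H k (C3 \<mu> v)"
        using cw(4)[OF pw[OF v], of "k + 1"] by (simp add: d'_def)
      have C3v: "C3 \<mu> v \<in> parity_words H k" using C3_parity_words[OF v] by simp
      have sub: "w - C3 \<mu> v \<in> parity_words H k" by (rule frag_subgroupD(2)[OF frag_subgroup_parity_words w C3v])
      have car: "complex_class H k u \<in> carrier (cup_complex H k)" if "u \<in> parity_words H k" for u
        unfolding cw(1)[symmetric] using that by (rule imageI)
      have "complex_class H k w = complex_class H k ((w - C3 \<mu> v) + C3 \<mu> v)" by simp
      also have "\<dots> = complex_class H k (w - C3 \<mu> v) \<otimes>\<^bsub>cup_complex H k\<^esub> complex_class H k (C3 \<mu> v)"
        by (rule cw(2)[OF pw[OF sub] pw[OF C3v]])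
      finally have eq: "complex_class H k w = complex_class H k (w - C3 \<mu> v) \<otimes>\<^bsub>cup_complex H k\<^esub> complex_class H k (C3 \<mu> v)" .
      have "complex_class H k w = complex_class H k (C3 \<mu> v) \<longleftrightarrow> complex_class H k (w - C3 \<mu> v) = \<one>\<^bsub>cup_complex H k\<^esub>"
        unfolding eq by (rule C.r_cancel_one[OF car[OF C3v] car[OF sub]])
      then show ?thesis unfolding d'v cw(3)[OF sub] .
    qed
    have "I = d' ` complex_class H (k + 1) ` parity_words H (k + 1)" unfolding I_def cw(1) ..
    then have "complex_class H k w \<in> I \<longleftrightarrow> (\<exists>v\<in>parity_words H (k + 1). complex_class H k w = d' (complex_class H (k + 1) v))"
      by blast
    then show ?thesis unfolding boundary_words_def using 1 w by blast
  qed
  have IK: "I \<subseteq> K"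
  proof
    fix x assume x: "x \<in> I"
    then have "x \<in> complex_class H k ` parity_words H k" unfolding cw(1) using subgroup.subset[OF subI] by blast
    then obtain w where w: "w \<in> parity_words H k" "x = complex_class H k w" by blast
    then have "w \<in> boundary_words H \<mu> k" using Iiff x by blast
    then show "x \<in> K" unfolding K w(2) using boundary_words_subset[OF \<mu>] by blast
  qed
  have carS: "carrier S = K" unfolding S_def by (rule subgroup.carrier_subgroup_generated_subgroup[OF subK])
  have S: "comm_group S" unfolding S_def by (rule C.abelian_subgroup_generated[OF C.comm_group_axioms])
  have subIS: "subgroup I S" unfolding S_def by (rule C.subgroup_of_subgroup_generated[OF IK subI])
  have G: "cup_homology H \<mu> k = S Mod I" by (simp add: cup_homology_def S_def I_def K_def d_def d'_def)
  have hc: "homology_class H \<mu> k w = I #>\<^bsub>S\<^esub> complex_class H k w" for w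
    by (simp add: homology_class_def I_def d'_def r_coset_def S_def)
  have mS: "x \<otimes>\<^bsub>S\<^esub> y = x \<otimes>\<^bsub>cup_complex H k\<^esub> y" for x y by (simp add: S_def)
  note F = comm_FactGroup_facts[OF S subIS, folded G, unfolded carS]
  have KI: "complex_class H k w \<in> K" if "w \<in> cycle_words H \<mu> k" for w unfolding K using that by (rule imageI)
  have cp: "w \<in> parity_words H k" if "w \<in> cycle_words H \<mu> k" for w using that by (simp add: cycle_words_def)
  show "comm_group (cup_homology H \<mu> k)" by (rule F(1))
  show "homology_class H \<mu> k ` cycle_words H \<mu> k = carrier (cup_homology H \<mu> k)"
    unfolding F(2)[symmetric] K image_image hc ..
  show "homology_class H \<mu> k (v + w) = homology_class H \<mu> k v \<otimes>\<^bsub>cup_homology H \<mu> k\<^esub> homology_class H \<mu> k w"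
    if "v \<in> cycle_words H \<mu> k" "w \<in> cycle_words H \<mu> k" for v w
    unfolding hc F(3)[OF KI[OF that(1)] KI[OF that(2)], symmetric] mS
      cw(2)[OF pw[OF cp[OF that(1)]] pw[OF cp[OF that(2)]]] ..
  show "homology_class H \<mu> k w = \<one>\<^bsub>cup_homology H \<mu> k\<^esub> \<longleftrightarrow> w \<in> boundary_words H \<mu> k"
    if "w \<in> cycle_words H \<mu> k" for w
    unfolding hc F(4)[OF KI[OF that]] by (rule Iiff[OF cp[OF that]])
qed

context rational_basis
begin

definition coord_space :: "nat set set \<Rightarrow> (nat set \<Rightarrow> rat) set" where
  "coord_space A = Q.span (unit_vec ` A)"

lemma unit_vec_alt: "unit_vec = (\<lambda>j k. if k = j then 1 else 0)"
  by (simp add: unit_vec_def fun_eq_iff)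

lemma in_coord_spaceI: "finite A \<Longrightarrow> (\<And>S. S \<notin> A \<Longrightarrow> v S = 0) \<Longrightarrow> v \<in> coord_space A"
  unfolding coord_space_def unit_vec_alt by (rule span_scaled_units) auto

lemma in_coord_spaceD:
  assumes "v \<in> coord_space A" "S \<notin> A"
  shows "v S = 0"
  using assms(1) unfolding coord_space_def
proof (induction rule: Q.span_induct_alt)
  case (step c x y)
  then obtain T where T: "T \<in> A" "x = unit_vec T" by blast
  then have "x S = 0" using assms(2) by (auto simp: unit_vec_def)
  then show ?case using step by (simp add: qscale_def)
qed simp

lemma dim_coord_space: "finite A \<Longrightarrow> Q.dim (coord_space A) = card A"
proof -
  assume A: "finite A"
  have "Q.dim (coord_space A) = card (unit_vec ` A)"
    unfolding coord_space_def by (rule Q.dim_span_eq_card_independent) (unfold unit_vec_alt, rule independent_scaled_units(1)[OF A], simp)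
  also have "\<dots> = card A"
    by (rule card_image) (unfold unit_vec_alt, rule independent_scaled_units(2)[OF A], simp)
  finally show ?thesis .
qed

definition parity_sets :: "int \<Rightarrow> nat set set" where
  "parity_sets k = {S. S \<subseteq> {..<b} \<and> even (int (card S) - k)}"

lemma finite_parity_sets: "finite (parity_sets k)"
  unfolding parity_sets_def by (rule finite_subset[of _ "Pow {..<b}"]) auto

lemma basis_word_parity:
  assumes "S \<in> parity_sets k"
  shows "frag_of (basis_word S) \<in> parity_words H k"
proof -
  have S: "S \<subseteq> {..<b}" "even (int (card S) - k)" using assms by (auto simp: parity_sets_def)
  have "finite S" using S(1) by (rule finite_subset) simp
  then show ?thesis using S e by (auto simp: parity_words_def basis_word_def)
qed

lemma ext_coord_parity_words:
  assumes "w \<in> parity_words H k"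
  shows "ext_coord w \<in> coord_space (parity_sets k)"
proof (rule in_coord_spaceI[OF finite_parity_sets], rule ccontr)
  fix S assume S: "S \<notin> parity_sets k" "ext_coord w S \<noteq> 0"
  obtain xs where "S \<subseteq> {..<b}" "xs \<in> Poly_Mapping.keys w" "card S = length xs" using ext_coord_support[OF S(2)] by blast
  then show False using S(1) assms by (auto simp: parity_sets_def parity_words_def)
qed

lemma span_ext_coord:
  assumes B: "frag_subgroup B" and v: "v \<in> Q.span (ext_coord ` B)"
  shows "\<exists>N>0. \<exists>w\<in>B. qscale (of_int N) v = ext_coord w"
  using v
proof (induction rule: Q.span_induct_alt)
  case base
  have "qscale (of_int 1) 0 = ext_coord 0" by (simp only: ext_coord_simps Q.scale_zero_right)
  then show ?case using frag_subgroupD(1)[OF B] zero_less_one by blast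
next
  case (step c x y)
  obtain w where w: "w \<in> B" "x = ext_coord w" using step(1) by blast
  obtain N u where u: "N > 0" "u \<in> B" "qscale (of_int N) y = ext_coord u" using step(2) by blast
  obtain m n where mn: "c = of_int m / of_int n" "n > (0::int)"
    by (metis quotient_of_div quotient_of_denom_pos surj_pair)
  have "qscale (of_int (n * N)) (qscale c x + y) = qscale (of_int (N * m)) x + qscale (of_int n) (qscale (of_int N) y)"
    using mn by (simp add: Q.scale_right_distrib)
  also have "\<dots> = ext_coord (frag_cmul (N * m) w + frag_cmul n u)"
    unfolding u(3) w(2) ext_coord_simps ..
  finally have "qscale (of_int (n * N)) (qscale c x + y) = ext_coord (frag_cmul (N * m) w + frag_cmul n u)" .
  moreover have "frag_cmul (N * m) w + frag_cmul n u \<in> B"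
    by (intro frag_subgroupD(4)[OF B] frag_subgroup_cmul[OF B] w u)
  moreover have "n * N > 0" using mn u by simp
  ultimately show ?case by blast
qed

text \<open>Coordinates take cycles to the kernel of \<open>diff_map\<close> and boundaries to its image, both up to
  denominators.\<close>

lemma rank_cup_homology_kernel:
  assumes \<mu>: "alternating3 H \<mu>"
  shows "abelian_rank (cup_homology H \<mu> k) + Q.dim (diff_map \<mu> ` coord_space (parity_sets (k + 1)))
    = Q.dim {v \<in> coord_space (parity_sets k). diff_map \<mu> v = 0}"
proof -
  interpret d: Vector_Spaces.linear qscale qscale "diff_map \<mu>" by (rule linear_diff_map)
  define Z where "Z = cycle_words H \<mu> k"
  define B where "B = boundary_words H \<mu> k"
  define Ker where "Ker = {v \<in> coord_space (parity_sets k). diff_map \<mu> v = 0}"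
  define Im where "Im = diff_map \<mu> ` coord_space (parity_sets (k + 1))"
  note Z = frag_subgroup_cycle_words[of H \<mu> k, folded Z_def]
  note B = frag_subgroup_boundary_words[of H \<mu> k, folded B_def]
  note BZ = boundary_words_subset[OF \<mu>, of k, folded Z_def B_def]
  have pw: "w \<in> words H" if "w \<in> parity_words H j" for w j using that by (simp add: parity_words_def)
  have Zw: "w \<in> words H" "w \<in> parity_words H k" if "w \<in> Z" for w
    using that by (simp_all add: Z_def cycle_words_def parity_words_def)
  have ZKer: "ext_coord w \<in> Ker" if w: "w \<in> Z" for w
  proof -
    have "ext_coord (C3 \<mu> w) = 0" using w by (intro ext_coord_relations) (simp add: Z_def cycle_words_def)
    then have "diff_map \<mu> (ext_coord w) = 0" unfolding ext_coord_C3[OF \<mu> Zw(1)[OF w]] .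
    then show ?thesis unfolding Ker_def using ext_coord_parity_words[OF Zw(2)[OF w]] by blast
  qed
  have subKer: "Q.subspace Ker"
  proof -
    have "Ker = coord_space (parity_sets k) \<inter> {v. diff_map \<mu> v = 0}" unfolding Ker_def by blast
    then show ?thesis unfolding coord_space_def by (simp only: Q.subspace_inter Q.subspace_span d.subspace_kernel)
  qed
  have KerZ: "v \<in> Q.span (ext_coord ` Z)" if v: "v \<in> Ker" for v
  proof -
    have vA: "v \<in> coord_space (parity_sets k)" and dv: "diff_map \<mu> v = 0" using v unfolding Ker_def by blast+
    obtain D c where D: "(D::int) > 0" "\<And>S. S \<in> parity_sets k \<Longrightarrow> of_int (c S) = of_int D * v S"
      using clear_denominators[OF finite_parity_sets[of k], of v] by blast
    define u where "u = (\<Sum>S\<in>parity_sets k. frag_cmul (c S) (frag_of (basis_word S)))"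
    have up: "u \<in> parity_words H k"
      unfolding u_def
      by (intro frag_subgroup_sum[OF frag_subgroup_parity_words] frag_subgroup_cmul[OF frag_subgroup_parity_words] basis_word_parity)
    have "ext_coord u = (\<Sum>S\<in>parity_sets k. qscale (of_int (c S)) (unit_vec S))"
      unfolding u_def ext_coord_sum
    proof (rule sum.cong[OF refl])
      fix S assume "S \<in> parity_sets k"
      then have "S \<subseteq> {..<b}" by (simp add: parity_sets_def)
      then show "ext_coord (frag_cmul (c S) (frag_of (basis_word S))) = qscale (of_int (c S)) (unit_vec S)"
        unfolding ext_coord_simps(3) by (simp only: ext_coord_basis_word unit_vec_def)
    qed
    also have "\<dots> = qscale (of_int D) v"
    proof
      fix T
      have "(\<Sum>S\<in>parity_sets k. qscale (of_int (c S)) (unit_vec S)) T = (\<Sum>S\<in>parity_sets k. if S = T then of_int (c T) else 0)"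
        unfolding sum_fun_apply by (intro sum.cong) (auto simp: qscale_def unit_vec_def)
      also have "\<dots> = (if T \<in> parity_sets k then of_int (c T) else 0)" using finite_parity_sets by (simp add: sum.delta)
      also have "\<dots> = qscale (of_int D) v T" using D(2) in_coord_spaceD[OF vA, of T] by (simp add: qscale_def)
      finally show "(\<Sum>S\<in>parity_sets k. qscale (of_int (c S)) (unit_vec S)) T = qscale (of_int D) v T" .
    qed
    finally have u: "ext_coord u = qscale (of_int D) v" .
    have "ext_coord (C3 \<mu> u) = 0" unfolding ext_coord_C3[OF \<mu> pw[OF up]] u d.scale dv by (rule Q.scale_zero_right)
    then obtain N where N: "N > 0" "frag_cmul N (C3 \<mu> u) \<in> relations H"
      using ext_coord_torsion[OF C3_words[OF pw[OF up]]] by blast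
    have "frag_cmul N u \<in> Z"
      using N(2) frag_subgroup_cmul[OF frag_subgroup_parity_words up] by (simp add: Z_def cycle_words_def frag_extend_simps)
    then have "qscale (1 / of_int (N * D)) (ext_coord (frag_cmul N u)) \<in> Q.span (ext_coord ` Z)"
      by (intro Q.span_scale Q.span_base imageI)
    moreover have "qscale (1 / of_int (N * D)) (ext_coord (frag_cmul N u)) = v"
      unfolding ext_coord_simps(3) u using N(1) D(1) by simp
    ultimately show ?thesis by simp
  qed
  have spanZ: "Q.span (ext_coord ` Z) = Ker"
    using Q.span_minimal[OF _ subKer, of "ext_coord ` Z"] ZKer KerZ by blast
  have BIm: "ext_coord w \<in> Im" if wB: "w \<in> B" for w
  proof -
    obtain v where v: "v \<in> parity_words H (k + 1)" "w - C3 \<mu> v \<in> relations H"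
      using wB unfolding B_def boundary_words_def by blast
    have "ext_coord (w - C3 \<mu> v) = 0" by (rule ext_coord_relations[OF v(2)])
    then have "ext_coord w = diff_map \<mu> (ext_coord v)"
      unfolding ext_coord_simps(1) ext_coord_C3[OF \<mu> pw[OF v(1)]] by (rule eq_iff_diff_eq_0[THEN iffD2])
    then show ?thesis unfolding Im_def using ext_coord_parity_words[OF v(1)] by blast
  qed
  have spanB: "Q.span (ext_coord ` B) = Im"
  proof
    have "Q.subspace Im" unfolding Im_def coord_space_def by (rule d.subspace_image[OF Q.subspace_span])
    then show "Q.span (ext_coord ` B) \<subseteq> Im" using BIm by (intro Q.span_minimal) blast+
    have "diff_map \<mu> ` unit_vec ` parity_sets (k + 1) \<subseteq> ext_coord ` B"
    proof safe
      fix S assume S: "S \<in> parity_sets (k + 1)"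
      then have Sb: "S \<subseteq> {..<b}" by (simp add: parity_sets_def)
      have "C3 \<mu> (frag_of (basis_word S)) \<in> B"
        unfolding B_def using basis_word_parity[OF S] C3_parity_words[OF basis_word_parity[OF S], of \<mu>]
        by (intro boundary_wordsI[of _ _ _ "frag_of (basis_word S)"]) (simp_all add: rel_D(1))
      then show "diff_map \<mu> (unit_vec S) \<in> ext_coord ` B" unfolding diff_map_unit_vec[OF Sb] by (rule imageI)
    qed
    then show "Im \<subseteq> Q.span (ext_coord ` B)"
      unfolding Im_def coord_space_def d.span_image[symmetric] by (rule Q.span_mono)
  qed
  define F where "F = unit_vec ` parity_sets k"
  have F: "finite F" "Ker \<subseteq> Q.span F"
    using finite_parity_sets unfolding F_def Ker_def coord_space_def by auto
  have ZF: "ext_coord ` Z \<subseteq> Q.span F" using ZKer F(2) by blast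
  have BF: "ext_coord ` B \<subseteq> Q.span F" using ZF BZ by blast
  obtain K where K: "K \<subseteq> ext_coord ` B" "Q.independent K" "ext_coord ` B \<subseteq> Q.span K" "finite K" "card K = Q.dim (ext_coord ` B)"
    by (rule finite_basis_of_subset[OF empty_subsetI Q.independent_empty BF F(1)])
  have KZ: "K \<subseteq> ext_coord ` Z" using K(1) BZ by blast
  obtain C where C: "K \<subseteq> C" "C \<subseteq> ext_coord ` Z" "Q.independent C" "ext_coord ` Z \<subseteq> Q.span C" "finite C" "card C = Q.dim (ext_coord ` Z)"
    by (rule finite_basis_of_subset[OF KZ K(2) ZF F(1)])
  obtain g where g: "qlinear g" "\<And>x. x \<in> Q.span K \<Longrightarrow> g x = 0" "\<And>x. x \<in> Q.span (C - K) \<Longrightarrow> g x = x"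
    "\<And>x. x \<in> Q.span C \<Longrightarrow> x - g x \<in> Q.span K"
    using projection_along[OF C(3,1)] by blast
  interpret g: Vector_Spaces.linear qscale qscale g by (rule g(1))
  note hc = cup_homology_class[OF H.monoid_axioms \<mu>, where k = k, folded Z_def B_def]
  have "abelian_rank (cup_homology H \<mu> k) = card (C - K)"
  proof (rule abelian_rank_quotient[where Z = Z and \<pi> = "homology_class H \<mu> k" and \<Phi> = "\<lambda>w. g (ext_coord w)", OF hc(1) Z hc(2,3)])
    show "additive_on Z (\<lambda>w. g (ext_coord w))"
      unfolding additive_on_def ext_coord_simps g.add by blast
    show "g (ext_coord w) = 0" if "w \<in> Z" "homology_class H \<mu> k w = \<one>\<^bsub>cup_homology H \<mu> k\<^esub>" for w
    proof -
      have "w \<in> B" using hc(4)[OF that(1)] that(2) by blast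
      then show ?thesis using K(3) by (intro g(2)) blast
    qed
    show "\<exists>n>0. homology_class H \<mu> k (frag_cmul n w) = \<one>\<^bsub>cup_homology H \<mu> k\<^esub>" if w: "w \<in> Z" and 0: "g (ext_coord w) = 0" for w
    proof -
      have "ext_coord w \<in> Q.span C" using C(4) w by blast
      from g(4)[OF this] have "ext_coord w \<in> Q.span K" unfolding 0 by (simp only: diff_zero)
      then have "ext_coord w \<in> Q.span (ext_coord ` B)" using Q.span_mono[OF K(1)] by blast
      then obtain N b where b: "N > 0" "b \<in> B" "qscale (of_int N) (ext_coord w) = ext_coord b"
        using span_ext_coord[OF B] by blast
      have e0: "ext_coord (frag_cmul N w - b) = 0" unfolding ext_coord_simps(1,3) b(3) by (rule diff_self)
      have bZ: "b \<in> Z" using BZ b(2) by blast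
      have dZ: "frag_cmul N w - b \<in> Z" by (intro frag_subgroupD(2)[OF Z] frag_subgroup_cmul[OF Z] w bZ)
      obtain N' where N': "N' > 0" "frag_cmul N' (frag_cmul N w - b) \<in> relations H"
        using ext_coord_torsion[OF Zw(1)[OF dZ] e0] by blast
      have "frag_cmul N' (frag_cmul N w - b) \<in> B"
        unfolding B_def
      proof (rule boundary_wordsI[of _ _ _ 0])
        show "frag_cmul N' (frag_cmul N w - b) \<in> parity_words H k" by (rule Zw(2)[OF frag_subgroup_cmul[OF Z dZ]])
        show "0 \<in> parity_words H (k + 1)" by (rule frag_subgroupD(1)[OF frag_subgroup_parity_words])
        show "frag_cmul N' (frag_cmul N w - b) - C3 \<mu> 0 \<in> relations H" unfolding frag_extend_0 diff_zero by (rule N'(2))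
      qed
      then have "frag_cmul N' (frag_cmul N w - b) + frag_cmul N' b \<in> B"
        by (rule frag_subgroupD(4)[OF B _ frag_subgroup_cmul[OF B b(2)]])
      moreover have "frag_cmul N' (frag_cmul N w - b) + frag_cmul N' b = frag_cmul (N' * N) w" by (simp add: frag_cmul_diff)
      ultimately have "frag_cmul (N' * N) w \<in> B" by metis
      then have "homology_class H \<mu> k (frag_cmul (N' * N) w) = \<one>\<^bsub>cup_homology H \<mu> k\<^esub>"
        using hc(4)[OF frag_subgroup_cmul[OF Z w]] by blast
      moreover have "N' * N > 0" using N' b by simp
      ultimately show ?thesis by blast
    qed
    show "finite (C - K)" using C(5) by simp
    show "Q.independent (C - K)" by (rule Q.independent_mono[OF C(3) Diff_subset])
    show "C - K \<subseteq> (\<lambda>w. g (ext_coord w)) ` Z"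
    proof
      fix t assume t: "t \<in> C - K"
      then obtain w where w: "w \<in> Z" "t = ext_coord w" using C(2) by blast
      have "g t = t" by (rule g(3)[OF Q.span_base[OF t]])
      then show "t \<in> (\<lambda>w. g (ext_coord w)) ` Z" using w by (intro image_eqI[of _ _ w]) simp_all
    qed
    show "(\<lambda>w. g (ext_coord w)) ` Z \<subseteq> Q.span (C - K)"
    proof safe
      fix w assume "w \<in> Z"
      then have "g (ext_coord w) \<in> g ` Q.span C" using C(4) by blast
      also have "\<dots> = Q.span (g ` C)" by (rule g.span_image[symmetric])
      also have "\<dots> \<subseteq> Q.span (insert 0 (C - K))"
      proof (rule Q.span_mono, safe)
        fix x assume x: "x \<in> C" "g x \<noteq> 0"
        then have "x \<notin> K" using g(2)[OF Q.span_base] by blast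
        moreover have "g x = x" if "x \<in> C - K" using g(3)[OF Q.span_base[OF that]] .
        ultimately show "g x \<in> C" "g x \<in> K \<Longrightarrow> False" using x(1) by auto
      qed
      finally show "g (ext_coord w) \<in> Q.span (C - K)" unfolding Q.span_insert_0 .
    qed
  qed
  also have "\<dots> = card C - card K" by (rule card_Diff_subset[OF K(4) C(1)])
  finally have "abelian_rank (cup_homology H \<mu> k) + card K = card C" using card_mono[OF C(5,1)] by simp
  moreover have "card K = Q.dim Im" unfolding K(5) spanB[symmetric] Q.dim_span ..
  moreover have "card C = Q.dim Ker" unfolding C(6) spanZ[symmetric] Q.dim_span ..
  ultimately show ?thesis unfolding Ker_def Im_def by simp
qed

lemma rank_cup_homology:
  assumes \<mu>: "alternating3 H \<mu>"
  shows "abelian_rank (cup_homology H \<mu> k) + Q.dim (diff_map \<mu> ` coord_space (parity_sets (k + 1)))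
    + Q.dim (diff_map \<mu> ` coord_space (parity_sets k)) = card (parity_sets k)"
proof -
  have "Q.dim (coord_space (parity_sets k))
    = Q.dim {v \<in> coord_space (parity_sets k). diff_map \<mu> v = 0} + Q.dim (diff_map \<mu> ` coord_space (parity_sets k))"
    by (rule rank_nullity[OF linear_diff_map, where S = "unit_vec ` parity_sets k"])
      (simp_all add: coord_space_def Q.subspace_span finite_parity_sets)
  then show ?thesis using rank_cup_homology_kernel[OF \<mu>, of k] by (simp add: dim_coord_space finite_parity_sets)
qed

end

section \<open>Euler characteristics\<close>

text \<open>The Euler characteristic of the part of the exterior algebra on \<open>A\<close> whose degrees are congruent
  to \<open>r\<close> modulo 3.\<close>

definition euler_mod3 :: "nat set \<Rightarrow> nat \<Rightarrow> int" where
  "euler_mod3 A r = (\<Sum>S\<in>{S \<in> Pow A. card S mod 3 = r}. (-1) ^ card S)"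

lemma euler_mod3_insert:
  assumes A: "finite A" "a \<notin> A" and r: "r < 3"
  shows "euler_mod3 (insert a A) r = euler_mod3 A r - euler_mod3 A ((r + 2) mod 3)"
proof -
  let ?P = "\<lambda>A r. {S \<in> Pow A. card S mod 3 = r}"
  have card: "card (insert a S) = Suc (card S)" if "S \<subseteq> A" for S
    using A(2) that by (intro card_insert_disjoint finite_subset[OF that A(1)]) blast
  have res: "Suc n mod 3 = r \<longleftrightarrow> n mod 3 = (r + 2) mod 3" for n
  proof -
    consider "r = 0" | "r = 1" | "r = 2" using r by linarith
    then show ?thesis
    proof cases
      case 1
      show ?thesis unfolding 1 by presburger
    next
      case 2
      show ?thesis unfolding 2 by presburger
    next
      case 3
      show ?thesis unfolding 3 by presburger
    qed
  qed
  have eq: "?P (insert a A) r = ?P A r \<union> insert a ` ?P A ((r + 2) mod 3)"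
  proof (intro equalityI subsetI)
    fix S assume S: "S \<in> ?P (insert a A) r"
    show "S \<in> ?P A r \<union> insert a ` ?P A ((r + 2) mod 3)"
    proof (cases "a \<in> S")
      case True
      then have eq: "S = insert a (S - {a})" by blast
      have sub: "S - {a} \<subseteq> A" using S by blast
      have "Suc (card (S - {a})) mod 3 = r" using S card[OF sub] eq by simp
      then have "S - {a} \<in> ?P A ((r + 2) mod 3)" using sub res by simp
      then show ?thesis using eq by blast
    qed (use S in auto)
  next
    fix S assume "S \<in> ?P A r \<union> insert a ` ?P A ((r + 2) mod 3)"
    then show "S \<in> ?P (insert a A) r"
    proof
      assume "S \<in> insert a ` ?P A ((r + 2) mod 3)"
      then obtain T where T: "S = insert a T" "T \<subseteq> A" "card T mod 3 = (r + 2) mod 3" by blast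
      have "card S mod 3 = r" unfolding T(1) card[OF T(2)] using res T(3) by simp
      then show ?thesis using T by blast
    qed auto
  qed
  have inj: "inj_on (insert a) (?P A ((r + 2) mod 3))" using A(2) by (auto simp: inj_on_def)
  have "euler_mod3 (insert a A) r = euler_mod3 A r + (\<Sum>S\<in>insert a ` ?P A ((r + 2) mod 3). (-1) ^ card S)"
    unfolding euler_mod3_def eq using A by (intro sum.union_disjoint) auto
  also have "(\<Sum>S\<in>insert a ` ?P A ((r + 2) mod 3). (-1) ^ card S) = (\<Sum>S\<in>?P A ((r + 2) mod 3). - ((-1) ^ card S) :: int)"
    unfolding sum.reindex[OF inj] by (intro sum.cong) (auto simp: card)
  finally show ?thesis by (simp add: sum_negf euler_mod3_def)
qed

text \<open>Half of the sum of the absolute values of the three alternating sums.\<close>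

definition L_int :: "nat \<Rightarrow> int" where
  "L_int n = (if odd n then 3 ^ (n div 2) else 2 * 3 ^ (n div 2 - 1))"

text \<open>Adding an element replaces the three values by their cyclic differences. Up to rotation the pattern
  \<open>(t, -t, 0)\<close> becomes \<open>(t, -2t, t)\<close>, and this becomes \<open>(0, -3t, 3t)\<close>.\<close>

lemma euler_mod3_pattern:
  assumes "finite A" "A \<noteq> {}"
  defines "x \<equiv> euler_mod3 A 0" and "y \<equiv> euler_mod3 A 1" and "z \<equiv> euler_mod3 A 2"
  shows "\<bar>x\<bar> + \<bar>y\<bar> + \<bar>z\<bar> = 2 * L_int (card A) \<and>
    (if odd (card A) then x + y = 0 \<and> z = 0 \<or> y + z = 0 \<and> x = 0 \<or> z + x = 0 \<and> y = 0
     else y = -2 * x \<and> z = x \<or> z = -2 * y \<and> x = y \<or> x = -2 * z \<and> y = z)"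
  using assms(1,2) unfolding x_def y_def z_def
proof (induction A rule: finite_ne_induct)
  case (singleton a)
  have s: "{S \<in> Pow {a}. card S mod 3 = 0} = {{}}" "{S \<in> Pow {a}. card S mod 3 = 1} = {{a}}"
    "{S \<in> Pow {a}. card S mod 3 = 2} = {}"
    by (auto simp: subset_singleton_iff)
  have "euler_mod3 {a} 0 = 1" "euler_mod3 {a} 1 = -1" "euler_mod3 {a} 2 = 0"
    unfolding euler_mod3_def s by simp_all
  then show ?case by (simp add: L_int_def)
next
  case (insert a A)
  define x y z where "x = euler_mod3 A 0" and "y = euler_mod3 A 1" and "z = euler_mod3 A 2"
  have new: "euler_mod3 (insert a A) 0 = x - z" "euler_mod3 (insert a A) 1 = y - x" "euler_mod3 (insert a A) 2 = z - y"
  proof -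
    have m: "(0 + 2) mod 3 = (2::nat)" "(1 + 2) mod 3 = (0::nat)" "(2 + 2) mod 3 = (1::nat)" by simp_all
    show "euler_mod3 (insert a A) 0 = x - z" "euler_mod3 (insert a A) 1 = y - x" "euler_mod3 (insert a A) 2 = z - y"
      using euler_mod3_insert[OF insert(1,3), of 0, unfolded m] euler_mod3_insert[OF insert(1,3), of 1, unfolded m]
        euler_mod3_insert[OF insert(1,3), of 2, unfolded m]
      unfolding x_def y_def z_def by auto
  qed
  have card: "card (insert a A) = Suc (card A)" using insert by simp
  have pos: "card A > 0" using insert by (simp add: card_gt_0_iff)
  note IH = insert.IH[folded x_def y_def z_def]
  show ?case
  proof (cases "odd (card A)")
    case True
    then have L: "L_int (card (insert a A)) = 2 * L_int (card A)"
      by (auto simp: card L_int_def elim!: oddE)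
    have s: "\<bar>x\<bar> + \<bar>y\<bar> + \<bar>z\<bar> = 2 * L_int (card A)"
      and P: "x + y = 0 \<and> z = 0 \<or> y + z = 0 \<and> x = 0 \<or> z + x = 0 \<and> y = 0" using IH True by auto
    have "\<bar>x - z\<bar> + \<bar>y - x\<bar> + \<bar>z - y\<bar> = 2 * (2 * L_int (card A))"
      using s P by (elim disjE) linarith+
    moreover have "y - x = -2 * (x - z) \<and> z - y = x - z \<or> z - y = -2 * (y - x) \<and> x - z = y - x
        \<or> x - z = -2 * (z - y) \<and> y - x = z - y"
      using P by presburger
    ultimately show ?thesis unfolding new L using True card by simp
  next
    case False
    then obtain m where "card A = 2 * m" by (auto elim!: evenE)
    then have L: "2 * L_int (card (insert a A)) = 3 * L_int (card A)"
      using pos by (cases m) (auto simp: card L_int_def)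
    have s: "\<bar>x\<bar> + \<bar>y\<bar> + \<bar>z\<bar> = 2 * L_int (card A)"
      and P: "y = -2 * x \<and> z = x \<or> z = -2 * y \<and> x = y \<or> x = -2 * z \<and> y = z" using IH False by auto
    have "2 * (\<bar>x - z\<bar> + \<bar>y - x\<bar> + \<bar>z - y\<bar>) = 2 * (3 * L_int (card A))"
      using P
    proof (elim disjE conjE)
      assume "y = -2 * x" "z = x"
      then show ?thesis using s by (cases "x \<ge> 0") simp_all
    next
      assume "z = -2 * y" "x = y"
      then show ?thesis using s by (cases "y \<ge> 0") simp_all
    next
      assume "x = -2 * z" "y = z"
      then show ?thesis using s by (cases "z \<ge> 0") simp_all
    qed
    moreover have "(x - z) + (y - x) = 0 \<and> z - y = 0 \<or> (y - x) + (z - y) = 0 \<and> x - z = 0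
        \<or> (z - y) + (x - z) = 0 \<and> y - x = 0"
      using P by presburger
    ultimately show ?thesis unfolding new using L False card by simp
  qed
qed

lemma sum_abs_euler_mod3:
  assumes "finite A" "A \<noteq> {}"
  shows "(\<Sum>r<3. \<bar>euler_mod3 A r\<bar>) = 2 * L_int (card A)"
  using euler_mod3_pattern[OF assms] by (simp add: numeral_3_eq_3 numeral_2_eq_2)

lemma L_bound_int: "n \<ge> 1 \<Longrightarrow> L_bound n = of_int (L_int n)"
proof (cases "odd n")
  case True
  then obtain m where m: "n = 2 * m + 1" by (elim oddE)
  have "(real n - 1) / 2 = real m" using m by simp
  then have "(3::real) powr ((real n - 1) / 2) = 3 ^ m" using powr_realpow[of 3 m] by simp
  then show ?thesis using m by (simp add: L_bound_def L_int_def)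
next
  case False
  assume "n \<ge> 1"
  from False obtain m where m: "n = 2 * m" by (auto elim!: evenE)
  with \<open>n \<ge> 1\<close> obtain m' where m': "m = Suc m'" by (cases m) auto
  have "real n / 2 - 1 = real m'" using m m' by (simp add: add_divide_distrib)
  then have "(3::real) powr (real n / 2 - 1) = 3 ^ m'" using powr_realpow[of 3 m'] by simp
  then show ?thesis using m m' by (simp add: L_bound_def L_int_def)
qed

lemma L_int_product:
  assumes "m \<ge> 1" "n \<ge> 1" "\<not> (odd m \<and> odd n)"
  shows "3 * (L_int m * L_int n) = 2 * L_int (m + n)"
proof -
  have ev: "3 * (L_int m * L_int n) = 2 * L_int (m + n)" if mn: "even m" "m \<ge> 1" "n \<ge> 1" for m n
  proof -
    obtain p' where "m = 2 * p'" using mn(1) by (elim evenE)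
    then obtain p where p: "m = 2 * Suc p" using mn(2) by (cases p') auto
    show ?thesis
    proof (cases "odd n")
      case True
      then obtain q where q: "n = 2 * q + 1" by (elim oddE)
      then have "m + n = 2 * (p + q + 1) + 1" using p by simp
      then show ?thesis using p q by (simp add: L_int_def power_add)
    next
      case False
      then obtain q where "n = 2 * q" by (auto elim!: evenE)
      with mn(3) obtain q where q: "n = 2 * Suc q" by (cases q) auto
      then have "m + n = 2 * (p + q + 2)" using p by simp
      then show ?thesis using p q by (simp add: L_int_def power_add)
    qed
  qed
  show ?thesis
  proof (cases "even m")
    case True then show ?thesis using ev assms by blast
  next
    case False
    then have "3 * (L_int n * L_int m) = 2 * L_int (n + m)" using ev assms by blast
    then show ?thesis by (simp add: mult.commute add.commute)
  qed
qed

section \<open>The lower bound\<close>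

context rational_basis
begin

text \<open>Sets of basis elements by the parity of their cardinality and the residues modulo 3 of the
  numbers of elements below \<open>b1\<close> and from \<open>b1\<close> on.\<close>

definition type_sets :: "nat \<Rightarrow> int \<Rightarrow> nat \<Rightarrow> nat \<Rightarrow> nat set set" where
  "type_sets b1 k r s = {S \<in> parity_sets k. card (S \<inter> {..<b1}) mod 3 = r \<and> card (S - {..<b1}) mod 3 = s}"

lemma finite_type_sets: "finite (type_sets b1 k r s)"
  unfolding type_sets_def using finite_parity_sets by simp

lemma parity_sets_shift: "parity_sets (k + 2) = parity_sets k" "parity_sets (k - 1) = parity_sets (k + 1)"
  by (simp_all add: parity_sets_def)

lemma type_sets_shift: "type_sets b1 (k - 1) r s = type_sets b1 (k + 1) r s" "type_sets b1 (k + 2) r s = type_sets b1 k r s"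
  by (simp_all add: type_sets_def parity_sets_shift)

lemma parity_sets_Union: "parity_sets k = (\<Union>r<3. \<Union>s<3. type_sets b1 k r s)"
  by (auto simp: type_sets_def)

lemma card_parity_sets: "card (parity_sets k) = (\<Sum>r<3. \<Sum>s<3. card (type_sets b1 k r s))"
proof -
  have "card (parity_sets k) = (\<Sum>r<3. card (\<Union>s<3. type_sets b1 k r s))"
    unfolding parity_sets_Union[of k b1]
    by (rule card_UN_disjoint) (auto simp: finite_type_sets, auto simp: type_sets_def)
  also have "\<dots> = (\<Sum>r<3. \<Sum>s<3. card (type_sets b1 k r s))"
    by (intro sum.cong refl card_UN_disjoint) (auto simp: finite_type_sets, auto simp: type_sets_def)
  finally show ?thesis .
qed

text \<open>The sign of a set is the product of the signs of its two parts.\<close>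

lemma euler_type_sets:
  assumes "b1 \<le> b"
  shows "int (card (type_sets b1 k r s)) - int (card (type_sets b1 (k + 1) r s))
    = (if even k then 1 else -1) * (euler_mod3 {..<b1} r * euler_mod3 {b1..<b} s)"
proof -
  let ?P = "\<lambda>A r. {S \<in> Pow A. card S mod 3 = r}"
  define X where "X = {S \<in> Pow {..<b}. card (S \<inter> {..<b1}) mod 3 = r \<and> card (S - {..<b1}) mod 3 = s}"
  have finX: "finite X" unfolding X_def by simp
  have fin: "finite S" if "S \<in> X" for S using that unfolding X_def by (auto intro: finite_subset)
  have "(\<Sum>S\<in>X. (-1) ^ card S) = (\<Sum>p\<in>?P {..<b1} r \<times> ?P {b1..<b} s. (-1) ^ card (fst p) * (-1) ^ card (snd p) :: int)"
  proof (rule sum.reindex_bij_witness[of _ "\<lambda>p. fst p \<union> snd p" "\<lambda>S. (S \<inter> {..<b1}, S - {..<b1})"])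
    fix S assume S: "S \<in> X"
    show "(S \<inter> {..<b1}, S - {..<b1}) \<in> ?P {..<b1} r \<times> ?P {b1..<b} s" using S unfolding X_def by auto
    have "card (S \<inter> {..<b1}) + card (S - {..<b1}) = card S"
      using card_Int_Diff[OF fin[OF S], of "{..<b1}"] by simp
    then show "(-1) ^ card (fst (S \<inter> {..<b1}, S - {..<b1})) * (-1) ^ card (snd (S \<inter> {..<b1}, S - {..<b1})) = ((-1) ^ card S :: int)"
      by (metis fst_conv snd_conv power_add)
  next
    fix p assume p: "p \<in> ?P {..<b1} r \<times> ?P {b1..<b} s"
    then have eq: "(fst p \<union> snd p) \<inter> {..<b1} = fst p" "(fst p \<union> snd p) - {..<b1} = snd p" by auto
    show "((fst p \<union> snd p) \<inter> {..<b1}, (fst p \<union> snd p) - {..<b1}) = p" using eq by simp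
    show "fst p \<union> snd p \<in> X" unfolding X_def using p eq assms by auto
  qed auto
  also have "\<dots> = euler_mod3 {..<b1} r * euler_mod3 {b1..<b} s"
    unfolding euler_mod3_def sum_product sum.cartesian_product by (simp add: case_prod_beta)
  finally have 1: "(\<Sum>S\<in>X. (-1) ^ card S) = euler_mod3 {..<b1} r * euler_mod3 {b1..<b} s" .
  have X: "X = type_sets b1 k r s \<union> type_sets b1 (k + 1) r s"
    unfolding X_def type_sets_def parity_sets_def by auto
  have "(\<Sum>S\<in>X. (-1) ^ card S) = (\<Sum>S\<in>type_sets b1 k r s. (-1) ^ card S) + (\<Sum>S\<in>type_sets b1 (k + 1) r s. (-1) ^ card S :: int)"
    unfolding X by (rule sum.union_disjoint[OF finite_type_sets finite_type_sets]) (auto simp: type_sets_def parity_sets_def)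
  moreover have "(\<Sum>S\<in>type_sets b1 k r s. (-1) ^ card S) = (\<Sum>S\<in>type_sets b1 k r s. if even k then 1 else -1 :: int)"
    by (intro sum.cong) (auto simp: type_sets_def parity_sets_def)
  moreover have "(\<Sum>S\<in>type_sets b1 (k + 1) r s. (-1) ^ card S) = (\<Sum>S\<in>type_sets b1 (k + 1) r s. if even k then -1 else 1 :: int)"
    by (intro sum.cong) (auto simp: type_sets_def parity_sets_def)
  ultimately show ?thesis using 1 by (auto split: if_splits)
qed

text \<open>A triple on which the form does not vanish lies within one block. So contraction removes three
  elements of the same block, which changes no residue modulo 3.\<close>

lemma diff_map_type:
  assumes block: "\<And>i j l. i < j \<Longrightarrow> j < l \<Longrightarrow> l < b \<Longrightarrow> \<mu> (e i) (e j) (e l) \<noteq> 0 \<Longrightarrow> l < b1 \<or> b1 \<le> i"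
    and v: "v \<in> coord_space (type_sets b1 k r s)"
  shows "diff_map \<mu> v \<in> coord_space (type_sets b1 (k - 1) r s)"
proof -
  interpret d: Vector_Spaces.linear qscale qscale "diff_map \<mu>" by (rule linear_diff_map)
  have unit: "diff_map \<mu> (unit_vec S) \<in> coord_space (type_sets b1 (k - 1) r s)" if S: "S \<in> type_sets b1 k r s" for S
  proof (rule in_coord_spaceI[OF finite_type_sets], rule ccontr)
    fix T assume T: "T \<notin> type_sets b1 (k - 1) r s" and nz: "diff_map \<mu> (unit_vec S) T \<noteq> 0"
    have Sb: "S \<subseteq> {..<b}" using S by (simp add: type_sets_def parity_sets_def)
    have fin: "finite S" using Sb by (rule finite_subset) simp
    define l where "l = sorted_list_of_set S"
    have l: "sorted_wrt (<) l" "set l = S" "distinct l" using fin by (simp_all add: l_def strict_sorted_list_of_set)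
    have "ext_coord (contract3 \<mu> (map e l)) T \<noteq> 0"
      using nz unfolding diff_map_unit_vec[OF Sb] basis_word_def l_def[symmetric] by simp
    then obtain xs where xs: "xs \<in> Poly_Mapping.keys (contract3 \<mu> (map e l))" "word_vec xs T \<noteq> 0"
      unfolding ext_coord_def frag_eval_def by (metis (no_types, lifting) mult_zero_right sum.neutral)
    obtain i j m where ijm: "i < j" "j < m" "m < length (map e l)" "\<mu> (map e l ! i) (map e l ! j) (map e l ! m) \<noteq> 0"
      "xs = nths (map e l) (- {i, j, m})"
      using keys_contract3[OF xs(1)] by metis
    define x y z where "x = l ! i" and "y = l ! j" and "z = l ! m"
    have mem: "x \<in> S" "y \<in> S" "z \<in> S" and nz': "\<mu> (e x) (e y) (e z) \<noteq> 0"
      using ijm l(2) by (auto simp: x_def y_def z_def)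
    have lt: "x < y" "y < z"
      using ijm l(1) by (auto simp: x_def y_def z_def sorted_wrt_iff_nth_less)
    have side: "z < b1 \<or> b1 \<le> x" using block[OF lt _ nz'] mem Sb by blast
    let ?m = "nths l (- {i, j, m})"
    have xsm: "xs = map e ?m" using ijm(5) by (simp add: nths_map)
    have setm: "set ?m = S - {x, y, z}"
    proof -
      have "set ?m = {l ! q |q. q < length l \<and> q \<in> - {i, j, m}}" by (simp add: set_nths)
      also have "\<dots> = S - {x, y, z}"
        using l(2,3) ijm(1-3) by (auto simp: x_def y_def z_def set_conv_nth nth_eq_iff_index_eq)
      finally show ?thesis .
    qed
    have "sorted_wrt (<) ?m"
      using l(1) unfolding strict_sorted_iff by (simp add: sorted_nths distinct_nthsI)
    moreover have "set ?m \<subseteq> {..<b}" using setm Sb by blast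
    ultimately have "word_vec xs = (\<lambda>T. if T = set ?m then 1 else 0)" unfolding xsm by (rule word_vec_basis)
    then have "T = set ?m" using xs(2) by (metis (full_types))
    then have "T = S - {x, y, z}" unfolding setm .
    moreover have "card (S - {x, y, z}) + 3 = card S"
      using mem lt fin card_mono[of S "{x, y, z}"] by (subst card_Diff_subset) auto
    moreover have "card ((S - {x, y, z}) \<inter> {..<b1}) mod 3 = card (S \<inter> {..<b1}) mod 3 \<and> card ((S - {x, y, z}) - {..<b1}) mod 3 = card (S - {..<b1}) mod 3"
    proof (cases "z < b1")
      case True
      then have "(S - {x, y, z}) \<inter> {..<b1} = (S \<inter> {..<b1}) - {x, y, z}" "(S - {x, y, z}) - {..<b1} = S - {..<b1}"
        using lt by auto
      moreover have "card ((S \<inter> {..<b1}) - {x, y, z}) + 3 = card (S \<inter> {..<b1})"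
        using mem lt fin True card_mono[of "S \<inter> {..<b1}" "{x, y, z}"] by (subst card_Diff_subset) auto
      ultimately show ?thesis by presburger
    next
      case False
      then have "b1 \<le> x" using side by simp
      then have "(S - {x, y, z}) \<inter> {..<b1} = S \<inter> {..<b1}" "(S - {x, y, z}) - {..<b1} = (S - {..<b1}) - {x, y, z}"
        using lt by auto
      moreover have "card ((S - {..<b1}) - {x, y, z}) + 3 = card (S - {..<b1})"
        using mem lt fin \<open>b1 \<le> x\<close> card_mono[of "S - {..<b1}" "{x, y, z}"] by (subst card_Diff_subset) auto
      ultimately show ?thesis by presburger
    qed
    ultimately have TS: "T = S - {x, y, z}" "card T + 3 = card S" "card (T \<inter> {..<b1}) mod 3 = card (S \<inter> {..<b1}) mod 3"
      "card (T - {..<b1}) mod 3 = card (S - {..<b1}) mod 3" by simp_all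
    have "even (int (card S) - k)" using S by (simp add: type_sets_def parity_sets_def)
    moreover have "int (card S) - k = (int (card T) - (k - 1)) + 2" using TS(2) by simp
    ultimately have "even (int (card T) - (k - 1))" by presburger
    then have "T \<in> type_sets b1 (k - 1) r s"
      using S TS Sb by (simp add: type_sets_def parity_sets_def) blast
    with T show False by simp
  qed
  have "diff_map \<mu> v \<in> diff_map \<mu> ` Q.span (unit_vec ` type_sets b1 k r s)" using v by (simp add: coord_space_def)
  also have "\<dots> = Q.span (diff_map \<mu> ` unit_vec ` type_sets b1 k r s)" by (rule d.span_image[symmetric])
  also have "\<dots> \<subseteq> coord_space (type_sets b1 (k - 1) r s)"
    unfolding coord_space_def by (rule Q.span_minimal[OF _ Q.subspace_span]) (use unit in \<open>auto simp: coord_space_def\<close>)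
  finally show ?thesis .
qed

lemma diff_map_square:
  assumes \<mu>: "alternating3 H \<mu>" and v: "v \<in> coord_space (parity_sets k)"
  shows "diff_map \<mu> (diff_map \<mu> v) = 0"
proof -
  interpret d: Vector_Spaces.linear qscale qscale "diff_map \<mu>" by (rule linear_diff_map)
  show ?thesis
    using v unfolding coord_space_def
  proof (induction rule: Q.span_induct_alt)
    case base
    show ?case by (simp only: d.zero)
  next
    case (step c x y)
    then obtain S where S: "S \<in> parity_sets k" "x = unit_vec S" by blast
    have Sb: "S \<subseteq> {..<b}" using S by (simp add: parity_sets_def)
    have w: "frag_of (basis_word S) \<in> words H" using basis_word_parity[OF S(1)] by (simp only: parity_words_def mem_Collect_eq)
    have "diff_map \<mu> (diff_map \<mu> x) = ext_coord (C3 \<mu> (C3 \<mu> (frag_of (basis_word S))))"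
      unfolding S(2) diff_map_unit_vec[OF Sb] ext_coord_C3[OF \<mu> C3_words[OF w]] ..
    also have "\<dots> = 0" unfolding C3_square by (rule ext_coord_simps(6))
    finally have "diff_map \<mu> (diff_map \<mu> x) = 0" .
    then show ?case unfolding d.add d.scale step(2) by (simp only: Q.scale_zero_right add_0)
  qed
qed

text \<open>The complex splits by type, and each summand has homology of total rank at least the absolute value
  of its Euler characteristic. These absolute values add up to a product of two sums, which bounds the
  sum of the ranks in an even and an odd degree. As the total Euler characteristic vanishes, the two
  ranks agree, so each is at least half of the bound.\<close>

theorem cup_homology_rank_bound:
  assumes \<mu>: "alternating3 H \<mu>" and b1: "1 \<le> b1" "b1 < b"
    and block: "\<And>i j l. i < j \<Longrightarrow> j < l \<Longrightarrow> l < b \<Longrightarrow> \<mu> (e i) (e j) (e l) \<noteq> 0 \<Longrightarrow> l < b1 \<or> b1 \<le> i"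
  obtains h where "\<And>k. abelian_rank (cup_homology H \<mu> k) = h" "int h \<ge> 2 * (L_int b1 * L_int (b - b1))"
proof -
  define \<rho> where "\<rho> k = Q.dim (diff_map \<mu> ` coord_space (parity_sets k))" for k
  define \<rho>' where "\<rho>' k r s = Q.dim (diff_map \<mu> ` coord_space (type_sets b1 k r s))" for k r s
  define R where "R k = abelian_rank (cup_homology H \<mu> k)" for k
  define n where "n k r s = card (type_sets b1 k r s)" for k r s
  have R: "R k + \<rho> (k + 1) + \<rho> k = card (parity_sets k)" for k
    using rank_cup_homology[OF \<mu>, of k] by (simp add: R_def \<rho>_def)
  have span: "coord_space (type_sets b1 k r s) \<subseteq> Q.span (unit_vec ` parity_sets k)" for k r s
    unfolding coord_space_def by (rule Q.span_mono) (auto simp: type_sets_def)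
  have sub: "\<rho> k \<le> (\<Sum>r<3. \<Sum>s<3. \<rho>' k r s)" for k
  proof -
    interpret d: Vector_Spaces.linear qscale qscale "diff_map \<mu>" by (rule linear_diff_map)
    let ?W = "\<lambda>p. diff_map \<mu> ` coord_space (type_sets b1 k (fst p) (snd p))"
    have "unit_vec ` parity_sets k \<subseteq> (\<Union>p\<in>{..<3} \<times> {..<3}. coord_space (type_sets b1 k (fst p) (snd p)))"
    proof safe
      fix S assume "S \<in> parity_sets k"
      then obtain r s where rs: "r < 3" "s < 3" "S \<in> type_sets b1 k r s" unfolding parity_sets_Union[of k b1] by blast
      then have "unit_vec S \<in> coord_space (type_sets b1 k r s)" unfolding coord_space_def by (intro Q.span_base imageI)
      then show "unit_vec S \<in> (\<Union>p\<in>{..<3} \<times> {..<3}. coord_space (type_sets b1 k (fst p) (snd p)))"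
        using rs by (intro UN_I[of "(r, s)"]) auto
    qed
    then have "diff_map \<mu> ` unit_vec ` parity_sets k \<subseteq> (\<Union>p\<in>{..<3} \<times> {..<3}. ?W p)" by blast
    then have "diff_map \<mu> ` coord_space (parity_sets k) \<subseteq> Q.span (\<Union>p\<in>{..<3} \<times> {..<3}. ?W p)"
      unfolding coord_space_def[of "parity_sets k"] d.span_image[symmetric] by (rule Q.span_mono)
    moreover have "?W p \<subseteq> Q.span (diff_map \<mu> ` unit_vec ` type_sets b1 k (fst p) (snd p)) \<and>
        finite (diff_map \<mu> ` unit_vec ` type_sets b1 k (fst p) (snd p))" for p
      unfolding coord_space_def d.span_image using finite_type_sets by simp
    ultimately have "\<rho> k \<le> (\<Sum>p\<in>{..<3} \<times> {..<3}. Q.dim (?W p))"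
      unfolding \<rho>_def by (intro dim_le_sum_dim[where W = ?W and S = "\<lambda>p. diff_map \<mu> ` unit_vec ` type_sets b1 k (fst p) (snd p)"]) auto
    then show ?thesis by (simp add: \<rho>'_def sum.cartesian_product case_prod_beta)
  qed
  have le: "\<rho>' (k + 1) r s + \<rho>' k r s \<le> n k r s" for k r s
  proof -
    let ?V = "coord_space (type_sets b1 k r s)"
    have "diff_map \<mu> ` coord_space (type_sets b1 (k + 1) r s) \<subseteq> {v \<in> ?V. diff_map \<mu> v = 0}"
    proof safe
      fix v assume v: "v \<in> coord_space (type_sets b1 (k + 1) r s)"
      show "diff_map \<mu> v \<in> ?V" using diff_map_type[OF block v] by simp
      show "diff_map \<mu> (diff_map \<mu> v) = 0"
        using diff_map_square[OF \<mu>, of v "k + 1"] v span[of "k + 1" r s] by (auto simp: coord_space_def)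
    qed
    then have "\<rho>' (k + 1) r s \<le> Q.dim {v \<in> ?V. diff_map \<mu> v = 0}"
      unfolding \<rho>'_def
      by (rule dim_mono_finite[where S = "unit_vec ` parity_sets k"]) (use span[of k r s] finite_parity_sets in auto)
    moreover have "Q.dim ?V = Q.dim {v \<in> ?V. diff_map \<mu> v = 0} + \<rho>' k r s"
      unfolding \<rho>'_def
      by (rule rank_nullity[OF linear_diff_map, where S = "unit_vec ` parity_sets k"])
        (use span[of k r s] finite_parity_sets in \<open>auto simp: coord_space_def Q.subspace_span\<close>)
    ultimately show ?thesis by (simp add: dim_coord_space[OF finite_type_sets] n_def)
  qed
  have shift: "\<rho> (k + 2) = \<rho> k" "\<rho>' (k + 2) r s = \<rho>' k r s" "n (k + 2) r s = n k r s" for k r s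
    by (simp_all add: \<rho>_def \<rho>'_def n_def parity_sets_shift type_sets_shift)
  have card: "card (parity_sets k) = (\<Sum>r<3. \<Sum>s<3. n k r s)" for k
    unfolding n_def by (rule card_parity_sets)
  have euler: "int (n k r s) - int (n (k + 1) r s) = (if even k then 1 else -1) * (euler_mod3 {..<b1} r * euler_mod3 {b1..<b} s)" for k r s
    unfolding n_def by (rule euler_type_sets) (use b1 in simp)
  have sum0: "(\<Sum>r<3. euler_mod3 A r) = 0" if "finite A" "A \<noteq> {}" for A
  proof -
    have "euler_mod3 A 0 + euler_mod3 A 1 + euler_mod3 A 2 = 0"
      using euler_mod3_pattern[OF that] by (auto split: if_splits)
    then show ?thesis by (simp add: numeral_3_eq_3 numeral_2_eq_2)
  qed
  have "int (card (parity_sets k)) - int (card (parity_sets (k + 1))) = 0" for k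
  proof -
    have "int (card (parity_sets k)) - int (card (parity_sets (k + 1))) = (\<Sum>r<3. \<Sum>s<3. int (n k r s) - int (n (k + 1) r s))"
      unfolding card by (simp add: sum_subtractf)
    also have "\<dots> = (if even k then 1 else -1) * ((\<Sum>r<3. euler_mod3 {..<b1} r) * (\<Sum>s<3. euler_mod3 {b1..<b} s))"
      unfolding euler sum_distrib_left[symmetric] sum_product ..
    also have "\<dots> = 0" using sum0[of "{..<b1}"] b1 by (simp add: lessThan_empty_iff)
    finally show ?thesis .
  qed
  then have cardeq: "card (parity_sets k) = card (parity_sets (k + 1))" for k by (metis eq_iff_diff_eq_0 of_nat_eq_iff)
  have R1: "R (k + 1) = R k" for k
    using R[of k] R[of "k + 1"] shift(1)[of k] cardeq[of k] by (simp add: add.assoc)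
  have const: "R k = R 0" for k
  proof -
    have pos: "R (int m) = R 0" for m
    proof (induction m)
      case (Suc m)
      then show ?case using R1[of "int m"] by (simp add: add.commute)
    qed simp
    have neg: "R (- int m) = R 0" for m
    proof (induction m)
      case (Suc m)
      then show ?case using R1[of "- int (Suc m)"] by simp
    qed simp
    show ?thesis using pos[of "nat k"] neg[of "nat (- k)"] by (cases "k \<ge> 0") auto
  qed
  define s0 s1 where "s0 = (\<Sum>r<3. \<Sum>s<3. \<rho>' 0 r s)" and "s1 = (\<Sum>r<3. \<Sum>s<3. \<rho>' 1 r s)"
  have "2 * int (R 0) \<ge> (\<Sum>r<3. \<Sum>s<3. \<bar>euler_mod3 {..<b1} r\<bar> * \<bar>euler_mod3 {b1..<b} s\<bar>)"
  proof -
    have "\<bar>euler_mod3 {..<b1} r\<bar> * \<bar>euler_mod3 {b1..<b} s\<bar>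
      \<le> int (n 0 r s) + int (n 1 r s) - 2 * (int (\<rho>' 0 r s) + int (\<rho>' 1 r s))" for r s
    proof -
      have "\<bar>euler_mod3 {..<b1} r\<bar> * \<bar>euler_mod3 {b1..<b} s\<bar> = \<bar>int (n 0 r s) - int (n 1 r s)\<bar>"
        using euler[of 0 r s] by (simp add: abs_mult)
      then show ?thesis using le[of 0 r s] le[of 1 r s] shift(2)[of 0 r s] by simp
    qed
    then have "(\<Sum>r<3. \<Sum>s<3. \<bar>euler_mod3 {..<b1} r\<bar> * \<bar>euler_mod3 {b1..<b} s\<bar>)
      \<le> (\<Sum>r<3. \<Sum>s<3. int (n 0 r s) + int (n 1 r s) - 2 * (int (\<rho>' 0 r s) + int (\<rho>' 1 r s)))"
      by (intro sum_mono)
    also have "\<dots> = int (card (parity_sets 0)) + int (card (parity_sets 1)) - 2 * (int s0 + int s1)"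
      unfolding card s0_def s1_def by (simp add: sum.distrib sum_subtractf sum_distrib_left)
    also have "\<dots> \<le> 2 * int (R 0)"
    proof -
      have "int (\<rho> 0) \<le> int s0" "int (\<rho> 1) \<le> int s1"
        using sub[of 0] sub[of 1] unfolding s0_def s1_def by (simp_all only: of_nat_le_iff)
      moreover have "int (R 0) + int (\<rho> 1) + int (\<rho> 0) = int (card (parity_sets 0))" using R[of 0] by simp
      moreover have "int (card (parity_sets 1)) = int (card (parity_sets 0))" using cardeq[of 0] by simp
      moreover have "c + c' - 2 * (t0 + t1) \<le> 2 * r" if "p0 \<le> t0" "p1 \<le> t1" "r + p1 + p0 = c" "c' = c"
        for r p0 p1 t0 t1 c c' :: int using that by simp
      ultimately show ?thesis by blast
    qed
    finally show ?thesis .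
  qed
  also have "(\<Sum>r<3. \<Sum>s<3. \<bar>euler_mod3 {..<b1} r\<bar> * \<bar>euler_mod3 {b1..<b} s\<bar>)
    = (\<Sum>r<3. \<bar>euler_mod3 {..<b1} r\<bar>) * (\<Sum>s<3. \<bar>euler_mod3 {b1..<b} s\<bar>)"
    by (rule sum_product[symmetric])
  also have "\<dots> = 2 * L_int b1 * (2 * L_int (b - b1))"
    using sum_abs_euler_mod3[of "{..<b1}"] sum_abs_euler_mod3[of "{b1..<b}"] b1 by (simp add: lessThan_empty_iff)
  finally have "int (R 0) \<ge> 2 * (L_int b1 * L_int (b - b1))" by simp
  then show ?thesis using that[of "R 0"] const unfolding R_def by blast
qed

end

section \<open>One-dimensional cycles\<close>

definition cycles1 :: "'a topology \<Rightarrow> 'a chain set" where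
  "cycles1 X = {c. singular_chain 1 X c \<and> chain_boundary 1 c = 0}"

definition bounds1 :: "'a topology \<Rightarrow> 'a chain set" where
  "bounds1 X = chain_boundary 2 ` {d. singular_chain 2 X d}"

definition vertex0 :: "nat \<Rightarrow> real" where "vertex0 = (\<lambda>j. if j = 0 then 1 else 0)"
definition vertex1 :: "nat \<Rightarrow> real" where "vertex1 = (\<lambda>j. if j = 1 then 1 else 0)"

definition point_chain :: "'a \<Rightarrow> 'a chain" where
  "point_chain x = frag_of (\<lambda>t\<in>standard_simplex 0. x)"

text \<open>Chains rather than paths connect points here: this is as good for homological purposes,
  and it makes the relation an equivalence by mere addition.\<close>

definition joined :: "'a topology \<Rightarrow> 'a \<Rightarrow> 'a \<Rightarrow> bool" where
  "joined X x y \<longleftrightarrow> (\<exists>a. singular_chain 1 X a \<and> chain_boundary 1 a = point_chain y - point_chain x)"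

definition acyclic1 :: "'a topology \<Rightarrow> bool" where
  "acyclic1 X \<longleftrightarrow> (\<forall>x\<in>topspace X. \<forall>y\<in>topspace X. joined X x y) \<and> cycles1 X \<subseteq> bounds1 X"

lemma vertex_in_simplex: "vertex0 \<in> standard_simplex 0" "vertex0 \<in> standard_simplex 1" "vertex1 \<in> standard_simplex 1"
  by (simp_all add: vertex0_def vertex1_def)

lemma standard_simplex_0_vertex: "standard_simplex 0 = {vertex0}"
  by (simp add: standard_simplex_0 vertex0_def)

lemma chain_boundary_simplex:
  "chain_boundary 1 (frag_of \<sigma>) = point_chain (\<sigma> vertex1) - point_chain (\<sigma> vertex0)"
proof -
  have "simplical_face 0 vertex0 = vertex1" "simplical_face 1 vertex0 = vertex0"
    by (auto simp: simplical_face_def vertex0_def vertex1_def fun_eq_iff)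
  then have "singular_face 1 0 \<sigma> = (\<lambda>t\<in>standard_simplex 0. \<sigma> vertex1)"
    "singular_face 1 1 \<sigma> = (\<lambda>t\<in>standard_simplex 0. \<sigma> vertex0)"
    by (auto simp: singular_face_def standard_simplex_0_vertex intro!: restrict_ext)
  then show ?thesis by (simp add: chain_boundary_of point_chain_def)
qed

lemma singular_chain_subtopologyD: "singular_chain p (subtopology X S) c \<Longrightarrow> singular_chain p X c"
  by (simp add: singular_chain_subtopology)

lemma frag_subgroup_cycles1: "frag_subgroup (cycles1 X)"
  by (simp add: frag_subgroup_def cycles1_def singular_chain_diff chain_boundary_diff)

lemma frag_subgroup_bounds1: "frag_subgroup (bounds1 X)"
  unfolding frag_subgroup_def
proof (intro conjI ballI)
  show "0 \<in> bounds1 X" unfolding bounds1_def by (rule image_eqI[of _ _ 0]) simp_all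
  fix a b assume "a \<in> bounds1 X" "b \<in> bounds1 X"
  then obtain d e where "a = chain_boundary 2 d" "singular_chain 2 X d" "b = chain_boundary 2 e" "singular_chain 2 X e"
    by (auto simp: bounds1_def)
  then show "a - b \<in> bounds1 X"
    unfolding bounds1_def by (intro image_eqI[of _ _ "d - e"]) (simp_all add: chain_boundary_diff singular_chain_diff)
qed

lemmas bounds1_D = frag_subgroupD[OF frag_subgroup_bounds1]
lemmas cycles1_D = frag_subgroupD[OF frag_subgroup_cycles1]

lemma bounds1_subset_cycles1: "bounds1 X \<subseteq> cycles1 X"
  using singular_chain_boundary_alt[of 1 X] chain_boundary_boundary_alt[of 1 X]
  by (auto simp: bounds1_def cycles1_def numeral_2_eq_2)

lemma bounds1_mono: "S \<subseteq> T \<Longrightarrow> c \<in> bounds1 (subtopology X S) \<Longrightarrow> c \<in> bounds1 (subtopology X T)"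
  by (auto simp: bounds1_def elim: singular_chain_mono)

lemma cycles1_subtopologyD: "c \<in> cycles1 (subtopology X S) \<Longrightarrow> c \<in> cycles1 X"
  by (auto simp: cycles1_def dest: singular_chain_subtopologyD)

lemma bounds1_subtopologyD: "c \<in> bounds1 (subtopology X S) \<Longrightarrow> c \<in> bounds1 X"
  by (auto simp: bounds1_def dest: singular_chain_subtopologyD)

lemma cycles1_relcycle: "c \<in> cycles1 X \<longleftrightarrow> singular_relcycle 1 X {} c"
  by (simp add: cycles1_def singular_cycle)

lemma bounds1_relboundary: "c \<in> bounds1 X \<longleftrightarrow> singular_relboundary 1 X {} c"
  by (auto simp: bounds1_def singular_boundary numeral_2_eq_2)

lemma homologous_bounds1: "homologous_rel 1 X {} a b \<longleftrightarrow> a - b \<in> bounds1 X"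
  by (simp add: homologous_rel_def bounds1_relboundary)

lemma joined_refl: "joined X x x"
  unfolding joined_def by (intro exI[of _ 0]) simp

lemma joined_sym:
  assumes "joined X x y"
  shows "joined X y x"
proof -
  obtain a where "singular_chain 1 X a" "chain_boundary 1 a = point_chain y - point_chain x"
    using assms by (auto simp: joined_def)
  then show ?thesis unfolding joined_def
    by (intro exI[of _ "- a"]) (simp add: singular_chain_minus chain_boundary_minus)
qed

lemma joined_trans:
  assumes "joined X x y" "joined X y z"
  shows "joined X x z"
proof -
  obtain a b where "singular_chain 1 X a" "chain_boundary 1 a = point_chain y - point_chain x"
    "singular_chain 1 X b" "chain_boundary 1 b = point_chain z - point_chain y"
    using assms by (auto simp: joined_def)
  then show ?thesis unfolding joined_def
    by (intro exI[of _ "a + b"]) (simp add: singular_chain_add chain_boundary_add)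
qed

lemma joined_subtopologyD: "joined (subtopology X S) x y \<Longrightarrow> joined X x y"
  unfolding joined_def using singular_chain_subtopologyD by blast

lemma joined_mono: "joined (subtopology X S) x y \<Longrightarrow> S \<subseteq> T \<Longrightarrow> joined (subtopology X T) x y"
  unfolding joined_def using singular_chain_mono by blast

lemma joined_simplex: "singular_simplex 1 X \<sigma> \<Longrightarrow> joined X (\<sigma> vertex0) (\<sigma> vertex1)"
  unfolding joined_def using chain_boundary_simplex by (intro exI[of _ "frag_of \<sigma>"]) (simp add: singular_chain_of)

lemma path_component_joined:
  assumes "path_component_of X x y"
  shows "joined X x y"
proof -
  obtain g where g: "pathin X g" "g 0 = x" "g 1 = y" using assms unfolding path_component_of_def by blast
  let ?\<sigma> = "\<lambda>t\<in>standard_simplex 1. g (t 1)"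
  have "continuous_map (subtopology (powertop_real UNIV) (standard_simplex 1)) (top_of_set {0..1}) (\<lambda>t. t 1)"
    by (auto simp: continuous_map_in_subtopology standard_simplex_def intro!: continuous_map_from_subtopology continuous_map_product_projection)
  then have "continuous_map (subtopology (powertop_real UNIV) (standard_simplex 1)) X (g \<circ> (\<lambda>t. t 1))"
    using g(1) unfolding pathin_def by (rule continuous_map_compose)
  then have "continuous_map (subtopology (powertop_real UNIV) (standard_simplex 1)) X ?\<sigma>"
    by (rule continuous_map_eq) simp
  then have "singular_simplex 1 X ?\<sigma>" by (simp add: singular_simplex_def)
  from joined_simplex[OF this] show ?thesis
    using g vertex_in_simplex by (simp add: vertex0_def vertex1_def)
qed

lemma chain_map_point: "chain_map 0 f (point_chain x) = point_chain (f x)"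
  by (simp add: point_chain_def simplex_map_def restrict_compose_right comp_def) (rule arg_cong[of _ _ frag_of], auto simp: fun_eq_iff)

lemma chain_map_cycles1:
  assumes "continuous_map X Y f" "c \<in> cycles1 X"
  shows "chain_map 1 f c \<in> cycles1 Y"
  using assms(2) chain_boundary_chain_map[of 1 X c f] singular_chain_chain_map[OF _ assms(1), of 1 c]
  by (simp add: cycles1_def)

lemma chain_map_bounds1:
  assumes "continuous_map X Y f" "c \<in> bounds1 X"
  shows "chain_map 1 f c \<in> bounds1 Y"
proof -
  obtain d where d: "c = chain_boundary 2 d" "singular_chain 2 X d" using assms(2) by (auto simp: bounds1_def)
  have "chain_map 1 f c = chain_boundary 2 (chain_map 2 f d)"
    using chain_boundary_chain_map[OF d(2), of f] d(1) by (simp add: numeral_2_eq_2)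
  then show ?thesis unfolding bounds1_def using singular_chain_chain_map[OF d(2) assms(1)] by blast
qed

lemma chain_map_joined:
  assumes "continuous_map X Y f" "joined X x y"
  shows "joined Y (f x) (f y)"
proof -
  obtain a where a: "singular_chain 1 X a" "chain_boundary 1 a = point_chain y - point_chain x"
    using assms(2) by (auto simp: joined_def)
  show ?thesis unfolding joined_def
    using chain_boundary_chain_map[OF a(1), of f] a singular_chain_chain_map[OF a(1) assms(1)]
    by (intro exI[of _ "chain_map 1 f a"]) (simp add: chain_map_diff chain_map_point)
qed

lemma acyclic1_retract:
  assumes X: "acyclic1 X" and f: "continuous_map X Y f" and g: "continuous_map Y X g"
    and fg: "\<And>y. y \<in> topspace Y \<Longrightarrow> f (g y) = y"
  shows "acyclic1 Y"
  unfolding acyclic1_def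
proof (intro conjI ballI subsetI)
  fix x y assume xy: "x \<in> topspace Y" "y \<in> topspace Y"
  then have "joined X (g x) (g y)" using X g by (auto simp: acyclic1_def continuous_map_def)
  from chain_map_joined[OF f this] show "joined Y x y" using fg xy by simp
next
  fix c assume c: "c \<in> cycles1 Y"
  have "chain_map 1 g c \<in> bounds1 X" using X chain_map_cycles1[OF g c] by (auto simp: acyclic1_def)
  then have "chain_map 1 f (chain_map 1 g c) \<in> bounds1 Y" by (rule chain_map_bounds1[OF f])
  moreover have "chain_map 1 f (chain_map 1 g c) = chain_map 1 (f \<circ> g) c" by (simp add: chain_map_compose)
  moreover have "\<dots> = c" using c fg by (intro chain_map_id_gen[of 1 Y]) (auto simp: cycles1_def)
  ultimately show "c \<in> bounds1 Y" by simp
qed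

lemma acyclic1_homeomorphic:
  assumes "acyclic1 X" "X homeomorphic_space Y"
  shows "acyclic1 Y"
  using assms(2) acyclic1_retract[OF assms(1)] unfolding homeomorphic_space_def homeomorphic_maps_def by blast

lemma acyclic1_contractible:
  assumes "contractible_space X"
  shows "acyclic1 X"
  unfolding acyclic1_def
proof (intro conjI ballI subsetI)
  fix x y assume "x \<in> topspace X" "y \<in> topspace X"
  then show "joined X x y"
    using contractible_imp_path_connected_space[OF assms]
    by (intro path_component_joined) (simp add: path_connected_space_iff_path_component)
next
  fix c assume c: "c \<in> cycles1 X"
  obtain a where a: "homotopic_with (\<lambda>x. True) X X id (\<lambda>x. a)" using assms unfolding contractible_space_def by blast
  show "c \<in> bounds1 X"
  proof (cases "topspace X = {}")
    case True
    then have "c = 0" using c by (simp add: cycles1_def singular_chain_empty)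
    then show ?thesis using bounds1_D(1) by simp
  next
    case False
    have cm: "continuous_map X X (\<lambda>x. a)" using homotopic_with_imp_continuous_maps[OF a] by blast
    then have aX: "a \<in> topspace X" using False by (auto simp: continuous_map_def)
    have "homotopic_with (\<lambda>h. h \<in> {} \<rightarrow> {}) X X id (\<lambda>x. a)" using a by (rule homotopic_with_mono) auto
    from homotopic_imp_homologous_rel_chain_maps[OF this, of 1 c]
    have "homologous_rel 1 X {} (chain_map 1 id c) (chain_map 1 (\<lambda>x. a) c)" using c by (simp add: cycles1_relcycle)
    moreover have "chain_map 1 id c = c" using c by (intro chain_map_ident[of 1 X]) (simp add: cycles1_def)
    ultimately have 1: "c - chain_map 1 (\<lambda>x. a) c \<in> bounds1 X" by (simp only: homologous_bounds1)
    have "continuous_map X (subtopology X {a}) (\<lambda>x. a)" using aX by (simp add: continuous_map_in_subtopology)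
    from chain_map_cycles1[OF this c] have "chain_map 1 (\<lambda>x. a) c \<in> bounds1 (subtopology X {a})"
      using singular_boundary_eq_cycle_singleton[of "subtopology X {a}" a 1] aX
      by (simp add: cycles1_relcycle bounds1_relboundary)
    then have "chain_map 1 (\<lambda>x. a) c \<in> bounds1 X" by (rule bounds1_subtopologyD)
    from bounds1_D(4)[OF 1 this] show ?thesis by simp
  qed
qed

lemma augmentation_boundary: "frag_eval (\<lambda>_. 1 :: int) (chain_boundary 1 c) = 0"
  using subset_UNIV
proof (induction c rule: frag_induction)
  case (one \<sigma>)
  then show ?case unfolding chain_boundary_simplex by (simp add: point_chain_def)
qed (simp_all add: chain_boundary_diff)

lemma fill_zero_chain:
  assumes W: "\<And>x y. x \<in> topspace W \<Longrightarrow> y \<in> topspace W \<Longrightarrow> joined W x y"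
    and z: "singular_chain 0 W z" "frag_eval (\<lambda>_. 1 :: int) z = 0"
  obtains t where "singular_chain 1 W t" "chain_boundary 1 t = z"
proof (cases "topspace W = {}")
  case True
  then have "z = 0" using z(1) by (simp add: singular_chain_empty)
  then show ?thesis using that[of 0] by simp
next
  case False
  then obtain w where w: "w \<in> topspace W" by blast
  obtain a where a: "\<And>x. x \<in> topspace W \<Longrightarrow> singular_chain 1 W (a x) \<and> chain_boundary 1 (a x) = point_chain x - point_chain w"
    using W[OF w] unfolding joined_def by metis
  have P: "frag_subgroup {z. singular_chain 1 W (frag_extend (\<lambda>f. a (f vertex0)) z) \<and>
      chain_boundary 1 (frag_extend (\<lambda>f. a (f vertex0)) z) = z - frag_cmul (frag_eval (\<lambda>_. 1) z) (point_chain w)}"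
    unfolding frag_subgroup_def
    by (auto simp: frag_extend_diff chain_boundary_diff singular_chain_diff frag_cmul_distrib left_diff_distrib
        simp flip: frag_cmul_diff_distrib)
  have "z \<in> {z. singular_chain 1 W (frag_extend (\<lambda>f. a (f vertex0)) z) \<and>
      chain_boundary 1 (frag_extend (\<lambda>f. a (f vertex0)) z) = z - frag_cmul (frag_eval (\<lambda>_. 1) z) (point_chain w)}"
  proof (rule frag_subgroup_induct[OF P _ z(1)[unfolded singular_chain_def]])
    fix f assume "f \<in> singular_simplex_set 0 W"
    then have f: "singular_simplex 0 W f" by simp
    have "f vertex0 \<in> topspace W"
      using f vertex_in_simplex(1) unfolding singular_simplex_def continuous_map_def by auto
    moreover have "point_chain (f vertex0) = frag_of f"
    proof -
      have "(\<lambda>t\<in>standard_simplex 0. f vertex0) = f"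
        using f unfolding singular_simplex_def standard_simplex_0_vertex
        by (intro ext) (simp add: restrict_def extensional_def)
      then show ?thesis by (simp add: point_chain_def)
    qed
    ultimately show "frag_of f \<in> {z. singular_chain 1 W (frag_extend (\<lambda>f. a (f vertex0)) z) \<and>
      chain_boundary 1 (frag_extend (\<lambda>f. a (f vertex0)) z) = z - frag_cmul (frag_eval (\<lambda>_. 1) z) (point_chain w)}"
      using a by simp
  qed
  then show ?thesis
    by (intro that[of "frag_extend (\<lambda>f. a (f vertex0)) z"]) (use z(2) in simp_all)
qed

lemma split_small_chain:
  assumes c: "singular_chain p X c" and small: "\<And>f. f \<in> Poly_Mapping.keys c \<Longrightarrow> f ` standard_simplex p \<subseteq> U \<or> f ` standard_simplex p \<subseteq> V"
  obtains c1 c2 where "singular_chain p (subtopology X U) c1" "singular_chain p (subtopology X V) c2" "c = c1 + c2"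
proof -
  let ?P = "{c. \<exists>c1 c2. singular_chain p (subtopology X U) c1 \<and> singular_chain p (subtopology X V) c2 \<and> c = c1 + c2}"
  have "frag_subgroup ?P"
    unfolding frag_subgroup_def
  proof (intro conjI ballI)
    show "0 \<in> ?P" by (intro CollectI exI[of _ 0]) simp
    fix a b assume "a \<in> ?P" "b \<in> ?P"
    then obtain a1 a2 b1 b2 where "singular_chain p (subtopology X U) a1" "singular_chain p (subtopology X V) a2" "a = a1 + a2"
      "singular_chain p (subtopology X U) b1" "singular_chain p (subtopology X V) b2" "b = b1 + b2" by blast
    then show "a - b \<in> ?P"
      by (intro CollectI exI[of _ "a1 - b1"] exI[of _ "a2 - b2"]) (simp add: singular_chain_diff)
  qed
  then have "c \<in> ?P"
  proof (rule frag_subgroup_induct[OF _ _ order_refl])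
    fix f assume f: "f \<in> Poly_Mapping.keys c"
    then have fX: "singular_simplex p X f" using c by (auto simp: singular_chain_def)
    show "frag_of f \<in> ?P"
    proof (cases "f ` standard_simplex p \<subseteq> U")
      case True
      then show ?thesis using fX
        by (intro CollectI exI[of _ "frag_of f"] exI[of _ 0]) (simp add: singular_chain_of singular_simplex_subtopology)
    next
      case False
      then show ?thesis using fX small[OF f]
        by (intro CollectI exI[of _ 0] exI[of _ "frag_of f"]) (simp add: singular_chain_of singular_simplex_subtopology)
    qed
  qed
  then show ?thesis using that by blast
qed

lemma singular_chain_Int:
  "singular_chain p (subtopology X U) c \<Longrightarrow> singular_chain p (subtopology X V) c \<Longrightarrow> singular_chain p (subtopology X (U \<inter> V)) c"
  by (simp add: singular_chain_subtopology)

text \<open>The two halves of the Mayer--Vietoris argument in dimension one.\<close>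

lemma cycles1_union:
  assumes UV: "openin X U" "openin X V" "topspace X = U \<union> V"
    and W: "\<And>x y. x \<in> U \<inter> V \<Longrightarrow> y \<in> U \<inter> V \<Longrightarrow> joined (subtopology X (U \<inter> V)) x y"
    and c: "c \<in> cycles1 X"
  obtains c1 c2 where "c1 \<in> cycles1 (subtopology X U)" "c2 \<in> cycles1 (subtopology X V)" "c - (c1 + c2) \<in> bounds1 X"
proof -
  obtain c' where c': "singular_relcycle 1 X {} c'" "homologous_rel 1 X {} c c'"
      "\<And>f. f \<in> Poly_Mapping.keys c' \<Longrightarrow> \<exists>V\<in>{U, V}. f \<in> standard_simplex 1 \<rightarrow> V"
    using small_homologous_rel_relcycle_exists[of "{U, V}" X 1 "{}" c] UV c by (auto simp: cycles1_relcycle)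
  have ch: "singular_chain 1 X c'" and bd: "chain_boundary 1 c' = 0" using c'(1) unfolding singular_cycle by blast+
  have "f ` standard_simplex 1 \<subseteq> U \<or> f ` standard_simplex 1 \<subseteq> V" if "f \<in> Poly_Mapping.keys c'" for f
    using c'(3)[OF that] by blast
  then obtain a1 a2 where a: "singular_chain 1 (subtopology X U) a1" "singular_chain 1 (subtopology X V) a2" "c' = a1 + a2"
    using split_small_chain[OF ch] by metis
  have bd12: "chain_boundary 1 a1 = - chain_boundary 1 a2"
    using bd unfolding a(3) chain_boundary_add by (simp add: eq_neg_iff_add_eq_0)
  have "singular_chain 0 (subtopology X U) (chain_boundary 1 a1)" using singular_chain_boundary[OF a(1)] by simp
  moreover have "singular_chain 0 (subtopology X V) (chain_boundary 1 a1)"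
    using singular_chain_boundary[OF a(2)] unfolding bd12 by (simp add: singular_chain_minus)
  ultimately have "singular_chain 0 (subtopology X (U \<inter> V)) (chain_boundary 1 a1)" by (rule singular_chain_Int)
  then obtain t where t: "singular_chain 1 (subtopology X (U \<inter> V)) t" "chain_boundary 1 t = chain_boundary 1 a1"
    using fill_zero_chain[of "subtopology X (U \<inter> V)" "chain_boundary 1 a1"] W augmentation_boundary by (metis IntD2 topspace_subtopology)
  have tU: "singular_chain 1 (subtopology X U) t" and tV: "singular_chain 1 (subtopology X V) t"
    using t(1) by (auto elim!: singular_chain_mono)
  show ?thesis
  proof (rule that)
    show "a1 - t \<in> cycles1 (subtopology X U)"
      using a(1) tU t(2) by (simp add: cycles1_def singular_chain_diff chain_boundary_diff)
    show "a2 + t \<in> cycles1 (subtopology X V)"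
      using a(2) tV t(2) bd12 by (simp add: cycles1_def singular_chain_add chain_boundary_add)
    show "c - (a1 - t + (a2 + t)) \<in> bounds1 X"
      using c'(2) unfolding a(3) homologous_bounds1 by simp
  qed
qed

lemma bounds1_union:
  assumes UV: "openin X U" "openin X V" "topspace X = U \<union> V"
    and W: "cycles1 (subtopology X (U \<inter> V)) \<subseteq> bounds1 (subtopology X (U \<inter> V))"
    and c: "c \<in> cycles1 (subtopology X U)" "c \<in> bounds1 X"
  shows "c \<in> bounds1 (subtopology X U)"
proof -
  obtain d where d: "singular_chain 2 X d" "chain_boundary 2 d = c" using c(2) by (auto simp: bounds1_def)
  obtain n where n: "\<And>m f. n \<le> m \<Longrightarrow> f \<in> Poly_Mapping.keys ((singular_subdivision 2 ^^ m) d) \<Longrightarrow> \<exists>V\<in>{U, V}. f \<in> standard_simplex 2 \<rightarrow> V"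
    using sufficient_iterated_singular_subdivision_exists[of "{U, V}" X 2 d] UV d(1) by auto
  define sd where "sd p = (singular_subdivision p ^^ n :: 'a chain \<Rightarrow> 'a chain)" for p
  have iter: "singular_chain 2 X ((singular_subdivision 2 ^^ m) d) \<and>
      chain_boundary 2 ((singular_subdivision 2 ^^ m) d) = (singular_subdivision 1 ^^ m) c" for m
  proof (induction m)
    case (Suc m)
    then show ?case
      using singular_chain_singular_subdivision[of 2 X] chain_boundary_singular_subdivision[of 2 X "(singular_subdivision 2 ^^ m) d"]
      by (simp add: numeral_2_eq_2)
  qed (use d in simp)
  have sd: "singular_chain 2 X (sd 2 d)" "chain_boundary 2 (sd 2 d) = sd 1 c" using iter[of n] by (simp_all add: sd_def)
  have "f ` standard_simplex 2 \<subseteq> U \<or> f ` standard_simplex 2 \<subseteq> V" if "f \<in> Poly_Mapping.keys (sd 2 d)" for f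
    using n[OF order_refl] that unfolding sd_def by blast
  then obtain d1 d2 where d12: "singular_chain 2 (subtopology X U) d1" "singular_chain 2 (subtopology X V) d2" "sd 2 d = d1 + d2"
    using split_small_chain[OF sd(1)] by metis
  obtain h where h: "\<And>p. h p 0 = (0 :: 'a chain)"
    "\<And>p X c. singular_chain p X c \<Longrightarrow> singular_chain (Suc p) X (h p c)"
    "\<And>p X c. singular_chain p X c \<Longrightarrow> chain_boundary (Suc p) (h p c) + h (p - Suc 0) (chain_boundary p c) = (singular_subdivision p ^^ n) c - c"
    using chain_homotopic_iterated_singular_subdivision[of n] by metis
  have cU: "singular_chain 1 (subtopology X U) c" and bc: "chain_boundary 1 c = 0" using c(1) by (simp_all add: cycles1_def)
  have "chain_boundary 2 (h 1 c) = sd 1 c - c" using h(3)[OF cU] bc h(1) by (simp add: sd_def numeral_2_eq_2)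
  moreover have "singular_chain 2 (subtopology X U) (h 1 c)" using h(2)[OF cU] by (simp add: numeral_2_eq_2)
  ultimately have sc: "sd 1 c - c \<in> bounds1 (subtopology X U)" unfolding bounds1_def by (metis (mono_tags) image_eqI mem_Collect_eq)
  have d1U: "chain_boundary 2 d1 \<in> bounds1 (subtopology X U)" unfolding bounds1_def using d12(1) by blast
  have eq: "sd 1 c - chain_boundary 2 d1 = chain_boundary 2 d2" using sd(2) unfolding d12(3) chain_boundary_add by (metis add_diff_cancel_left')
  have sdU: "sd 1 c \<in> cycles1 (subtopology X U)"
    using cycles1_D(4)[OF subsetD[OF bounds1_subset_cycles1 sc] c(1)] by simp
  have "sd 1 c - chain_boundary 2 d1 \<in> cycles1 (subtopology X U)"
    by (rule cycles1_D(2)[OF sdU subsetD[OF bounds1_subset_cycles1 d1U]])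
  moreover have "chain_boundary 2 d2 \<in> cycles1 (subtopology X V)"
    using d12(2) by (intro subsetD[OF bounds1_subset_cycles1]) (auto simp: bounds1_def)
  ultimately have "sd 1 c - chain_boundary 2 d1 \<in> cycles1 (subtopology X (U \<inter> V))"
    unfolding eq by (simp add: cycles1_def singular_chain_Int)
  then have "sd 1 c - chain_boundary 2 d1 \<in> bounds1 (subtopology X (U \<inter> V))" using W by blast
  then have "sd 1 c - chain_boundary 2 d1 \<in> bounds1 (subtopology X U)" by (rule bounds1_mono[OF Int_lower1])
  from bounds1_D(2)[OF bounds1_D(4)[OF this d1U] sc] show ?thesis by simp
qed

lemma acyclic1_union:
  assumes UV: "openin X U" "openin X V" "topspace X = U \<union> V"
    and U: "acyclic1 (subtopology X U)" and V: "acyclic1 (subtopology X V)"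
    and W: "\<And>x y. x \<in> U \<inter> V \<Longrightarrow> y \<in> U \<inter> V \<Longrightarrow> joined (subtopology X (U \<inter> V)) x y" and ne: "U \<inter> V \<noteq> {}"
  shows "acyclic1 X"
  unfolding acyclic1_def
proof (intro conjI ballI subsetI)
  fix x y assume xy: "x \<in> topspace X" "y \<in> topspace X"
  obtain w where w: "w \<in> U" "w \<in> V" using ne by blast
  have wX: "w \<in> topspace X" using w UV(3) by blast
  have "joined X z w" if "z \<in> topspace X" for z
    using that w wX U V UV(3) unfolding acyclic1_def by (metis IntI Un_iff joined_subtopologyD topspace_subtopology)
  then show "joined X x y" using xy joined_trans joined_sym by metis
next
  fix c assume c: "c \<in> cycles1 X"
  obtain c1 c2 where c12: "c1 \<in> cycles1 (subtopology X U)" "c2 \<in> cycles1 (subtopology X V)" "c - (c1 + c2) \<in> bounds1 X"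
    by (rule cycles1_union[OF UV W c])
  have "c1 \<in> bounds1 X" "c2 \<in> bounds1 X"
    using U V c12(1,2) unfolding acyclic1_def by (blast intro: bounds1_subtopologyD)+
  from bounds1_D(4)[OF c12(3) bounds1_D(4)[OF this]] show "c \<in> bounds1 X" by simp
qed

text \<open>Summation by parts: differences of vertex values along a chain depend on its boundary only.\<close>

lemma vertex_sum:
  "frag_extend (\<lambda>\<sigma>. P (\<sigma> vertex1) - P (\<sigma> vertex0)) c = frag_extend (\<lambda>p. P (p vertex0)) (chain_boundary 1 c)"
  using subset_UNIV
proof (induction c rule: frag_induction)
  case (one \<sigma>)
  then show ?case unfolding chain_boundary_simplex by (simp add: point_chain_def frag_extend_diff vertex_in_simplex)
qed (simp_all add: chain_boundary_diff frag_extend_diff)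

lemma segment_joined:
  assumes T: "T \<subseteq> topspace (Euclidean_space n)"
    and seg: "\<And>u. 0 \<le> u \<Longrightarrow> u \<le> 1 \<Longrightarrow> (\<lambda>i. (1 - u) * x i + u * y i) \<in> T"
  shows "joined (subtopology (Euclidean_space n) T) x y"
proof (rule path_component_joined, unfold path_component_of_def, intro exI conjI)
  have "continuous_on {0..1} (\<lambda>u. (1 - u) * x k + u * y k)" for k
    by (intro continuous_intros)
  moreover have "(\<lambda>i. (1 - u) * x i + u * y i) \<in> topspace (Euclidean_space n)" if "0 \<le> u" "u \<le> 1" for u
    using seg[OF that] T by blast
  ultimately show "pathin (subtopology (Euclidean_space n) T) (\<lambda>u i. (1 - u) * x i + u * y i)"
    using seg unfolding pathin_def
    by (auto simp: Euclidean_space_def subtopology_subtopology continuous_map_in_subtopology continuous_map_componentwise_UNIV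
        topspace_Euclidean_space)
qed auto

lemma contractible_starlike:
  assumes T: "T \<subseteq> topspace (Euclidean_space n)" and a: "a \<in> T"
    and star: "\<And>x u. x \<in> T \<Longrightarrow> 0 \<le> u \<Longrightarrow> u \<le> 1 \<Longrightarrow> (\<lambda>i. (1 - u) * a i + u * x i) \<in> T"
  shows "contractible_space (subtopology (Euclidean_space n) T)"
proof -
  let ?S = "subtopology (Euclidean_space n) T"
  let ?P = "prod_topology (top_of_set {0..1}) ?S"
  have S: "?S = subtopology (powertop_real UNIV) T"
    using T by (simp add: Euclidean_space_def subtopology_subtopology Int_absorb1 topspace_Euclidean_space)
  have f: "continuous_map ?P euclideanreal fst"
    using continuous_map_fst[of "top_of_set {0..1}" ?S] unfolding continuous_map_in_subtopology by blast
  have s: "continuous_map ?P euclideanreal (\<lambda>p. snd p i)" for i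
  proof -
    have "continuous_map ?S euclideanreal (\<lambda>x. x i)"
      unfolding S by (intro continuous_map_from_subtopology continuous_map_product_projection) simp
    from continuous_map_compose[OF continuous_map_snd this] show ?thesis by (simp add: comp_def)
  qed
  have "continuous_map ?P ?S (\<lambda>p i. (1 - fst p) * a i + fst p * snd p i)"
    unfolding S continuous_map_in_subtopology continuous_map_componentwise_UNIV
  proof (intro conjI allI)
    show "continuous_map (prod_topology (top_of_set {0..1}) (subtopology (powertop_real UNIV) T)) euclideanreal
        (\<lambda>p. (1 - fst p) * a i + fst p * snd p i)" for i
      using f s[of i] unfolding S by (intro continuous_intros)
    show "(\<lambda>p i. (1 - fst p) * a i + fst p * snd p i) \<in> topspace (prod_topology (top_of_set {0..1}) (subtopology (powertop_real UNIV) T)) \<rightarrow> T"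
      using star by auto
  qed
  then have "homotopic_with (\<lambda>x. True) ?S ?S (\<lambda>x. a) id"
    unfolding homotopic_with_def by (intro exI[of _ "\<lambda>p i. (1 - fst p) * a i + fst p * snd p i"]) simp
  then have "homotopic_with (\<lambda>x. True) ?S ?S id (\<lambda>x. a)" by (rule homotopic_with_symD)
  then show ?thesis unfolding contractible_space_def by blast
qed

lemma acyclic1_Euclidean_space: "acyclic1 (Euclidean_space n)"
  by (rule acyclic1_contractible) simp

lemma openin_Euclidean_open: "open S \<Longrightarrow> openin (Euclidean_space n) (topspace (Euclidean_space n) \<inter> S)"
  unfolding Euclidean_space_def by (simp add: openin_subtopology_Int2 euclidean_product_topology)

text \<open>Euclidean 3-space minus a point is the union of the complements of two opposite closed rays,
  which are starlike; they intersect in the complement of a line, which is connected.\<close>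

lemma acyclic1_punctured:
  "acyclic1 (subtopology (Euclidean_space 3) (topspace (Euclidean_space 3) - {\<lambda>i. 0}))"
proof -
  let ?E = "Euclidean_space 3"
  define U where "U = {x \<in> topspace ?E. \<not> (x 1 = 0 \<and> x 2 = 0 \<and> 0 \<le> x 0)}"
  define V where "V = {x \<in> topspace ?E. \<not> (x 1 = 0 \<and> x 2 = 0 \<and> x 0 \<le> 0)}"
  define X where "X = subtopology ?E (topspace ?E - {\<lambda>i. 0})"
  have zero: "x = (\<lambda>i. 0)" if "x \<in> topspace ?E" "x 0 = 0" "x 1 = 0" "x 2 = 0" for x
  proof
    fix i :: nat
    consider "i = 0" | "i = 1" | "i = 2" | "i \<ge> 3" by linarith
    then show "x i = 0" using that by cases (auto simp: topspace_Euclidean_space)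
  qed
  have UV: "topspace X = U \<union> V"
    using zero by (auto simp: X_def U_def V_def)
  have UVsub: "U \<subseteq> topspace ?E - {\<lambda>i. 0}" "V \<subseteq> topspace ?E - {\<lambda>i. 0}" by (auto simp: U_def V_def)
  have clU: "closed {x::nat \<Rightarrow> real. x 1 = 0 \<and> x 2 = 0 \<and> 0 \<le> x 0}"
    and clV: "closed {x::nat \<Rightarrow> real. x 1 = 0 \<and> x 2 = 0 \<and> x 0 \<le> 0}"
    by (intro closed_Collect_conj closed_Collect_eq closed_Collect_le continuous_on_product_coordinates continuous_on_const)+
  have "openin ?E (topspace ?E \<inter> - {x. x 1 = 0 \<and> x 2 = 0 \<and> 0 \<le> x 0})" "openin ?E (topspace ?E \<inter> - {x. x 1 = 0 \<and> x 2 = 0 \<and> x 0 \<le> 0})"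
    using clU clV by (simp_all add: openin_Euclidean_open open_closed)
  moreover have "topspace ?E \<inter> - {x. x 1 = 0 \<and> x 2 = 0 \<and> 0 \<le> x 0} = U" "topspace ?E \<inter> - {x. x 1 = 0 \<and> x 2 = 0 \<and> x 0 \<le> 0} = V"
    by (auto simp: U_def V_def)
  ultimately have op: "openin X U" "openin X V"
    unfolding X_def using UVsub by (auto simp: openin_subtopology)
  have sub: "subtopology X U = subtopology ?E U" "subtopology X V = subtopology ?E V" "subtopology X (U \<inter> V) = subtopology ?E (U \<inter> V)"
    unfolding X_def subtopology_subtopology using UVsub by (auto intro!: arg_cong[of _ _ "subtopology ?E"])
  have star: "contractible_space (subtopology ?E U)" "contractible_space (subtopology ?E V)"
  proof -
    let ?a = "\<lambda>i::nat. if i = 0 then -1 else (0::real)"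
    show "contractible_space (subtopology ?E U)"
    proof (rule contractible_starlike[of _ _ ?a])
      fix x :: "nat \<Rightarrow> real" and u :: real
      assume x: "x \<in> U" and u: "0 \<le> u" "u \<le> 1"
      have "\<not> (u * x 1 = 0 \<and> u * x 2 = 0 \<and> 0 \<le> - (1 - u) + u * x 0)"
      proof
        assume A: "u * x 1 = 0 \<and> u * x 2 = 0 \<and> 0 \<le> - (1 - u) + u * x 0"
        then have "u \<noteq> 0" by auto
        then have "u > 0" using u by simp
        moreover have "0 \<le> u * x 0" using A u by simp
        ultimately have "0 \<le> x 0" by (simp add: zero_le_mult_iff)
        then show False using A x \<open>u \<noteq> 0\<close> by (auto simp: U_def)
      qed
      then show "(\<lambda>i. (1 - u) * ?a i + u * x i) \<in> U" using x by (auto simp: U_def topspace_Euclidean_space)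
    qed (auto simp: U_def topspace_Euclidean_space)
    let ?b = "\<lambda>i::nat. if i = 0 then 1 else (0::real)"
    show "contractible_space (subtopology ?E V)"
    proof (rule contractible_starlike[of _ _ ?b])
      fix x :: "nat \<Rightarrow> real" and u :: real
      assume x: "x \<in> V" and u: "0 \<le> u" "u \<le> 1"
      have "\<not> (u * x 1 = 0 \<and> u * x 2 = 0 \<and> (1 - u) + u * x 0 \<le> 0)"
      proof
        assume A: "u * x 1 = 0 \<and> u * x 2 = 0 \<and> (1 - u) + u * x 0 \<le> 0"
        then have "u \<noteq> 0" by auto
        then have "u > 0" using u by simp
        moreover have "u * x 0 \<le> 0" using A u by simp
        ultimately have "x 0 \<le> 0" by (simp add: mult_le_0_iff)
        then show False using A x \<open>u \<noteq> 0\<close> by (auto simp: V_def)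
      qed
      then show "(\<lambda>i. (1 - u) * ?b i + u * x i) \<in> V" using x by (auto simp: V_def topspace_Euclidean_space)
    qed (auto simp: V_def topspace_Euclidean_space)
  qed
  define W where "W = U \<inter> V"
  have W: "x \<in> W \<longleftrightarrow> x \<in> topspace ?E \<and> (x 1 \<noteq> 0 \<or> x 2 \<noteq> 0)" for x by (auto simp: W_def U_def V_def)
  have Wsub: "W \<subseteq> topspace ?E" using W by blast
  have pos: "(1 - u) * s + u * t > 0" if "0 \<le> u" "u \<le> 1" "s > 0" "t > 0" for u s t :: real
    using that by (cases "u = 0") (auto intro: add_nonneg_pos)
  have seg_pos: "joined (subtopology ?E W) x y"
    if "x \<in> W" "y \<in> W" "c * x k > 0" "c * y k > 0" "k = 1 \<or> k = 2" for x y c k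
  proof (rule segment_joined[OF Wsub])
    fix u :: real assume u: "0 \<le> u" "u \<le> 1"
    have "c * ((1 - u) * x k + u * y k) > 0" using pos[OF u that(3,4)] by (simp add: algebra_simps)
    then have "(1 - u) * x k + u * y k \<noteq> 0" by auto
    then show "(\<lambda>i. (1 - u) * x i + u * y i) \<in> W" using that(1,2,5) unfolding W by (auto simp: topspace_Euclidean_space)
  qed
  define p :: "real \<Rightarrow> real \<Rightarrow> nat \<Rightarrow> real" where "p s t = (\<lambda>i. if i = 1 then s else if i = 2 then t else 0)" for s t
  have p: "p s t \<in> W" if "s \<noteq> 0" for s t using that unfolding W by (auto simp: p_def topspace_Euclidean_space)
  have to_p: "joined (subtopology ?E W) x (p 1 1)" if x: "x \<in> W" for x
  proof -
    consider "x 1 > 0" | "x 1 < 0" | "x 2 > 0" | "x 2 < 0" using x unfolding W by linarith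
    then show ?thesis
    proof cases
      case 1
      then show ?thesis using seg_pos[OF x p, of 1 1 1 1] by (simp add: p_def)
    next
      case 2
      have "joined (subtopology ?E W) x (p (-1) 1)" using seg_pos[OF x p, of "-1" "-1" 1 1] 2 by (simp add: p_def)
      moreover have "joined (subtopology ?E W) (p (-1) 1) (p 1 1)" using seg_pos[OF p p, of "-1" 1 1 1 2 1] by (simp add: p_def)
      ultimately show ?thesis by (rule joined_trans)
    next
      case 3
      then show ?thesis using seg_pos[OF x p, of 1 1 2 1] by (simp add: p_def)
    next
      case 4
      have "joined (subtopology ?E W) x (p 1 (-1))" using seg_pos[OF x p, of 1 "-1" 2 "-1"] 4 by (simp add: p_def)
      moreover have "joined (subtopology ?E W) (p 1 (-1)) (p 1 1)" using seg_pos[OF p p, of 1 1 1 "-1" 1 1] by (simp add: p_def)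
      ultimately show ?thesis by (rule joined_trans)
    qed
  qed
  show ?thesis
    unfolding X_def[symmetric]
  proof (rule acyclic1_union[OF op UV])
    show "acyclic1 (subtopology X U)" "acyclic1 (subtopology X V)"
      unfolding sub using star by (auto intro: acyclic1_contractible)
    show "joined (subtopology X (U \<inter> V)) x y" if "x \<in> U \<inter> V" "y \<in> U \<inter> V" for x y
      unfolding sub using that to_p joined_sym joined_trans unfolding W_def by metis
    show "U \<inter> V \<noteq> {}" using p[of 1 1] unfolding W_def by auto
  qed
qed

text \<open>Choose finitely many charts, with smaller closed sets whose interiors cover, and in each overlap of
  two charts finitely many points such that every point common to the two closed sets can be joined to
  one of them within the overlap. Within a chart, a simplex is homologous to the difference of the
  paths from the centre of the chart to its ends. Passing from one chart to another at a vertex changes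
  such a path by one of finitely many differences \<open>\<gamma> x w - \<gamma> y w\<close>, where \<open>w\<close> is a chosen point.
  Once every vertex has been given its own chart, the paths cancel along a cycle.\<close>

theorem cycles1_finitely_generated:
  assumes X: "compact_space X" "Hausdorff_space X"
    and charts: "\<And>x. x \<in> topspace X \<Longrightarrow> \<exists>V. openin X V \<and> x \<in> V \<and> acyclic1 (subtopology X V) \<and> locally_path_connected_space (subtopology X V)"
  obtains D where "finite D" "\<And>c. c \<in> cycles1 X \<Longrightarrow> \<exists>k. c - (\<Sum>d\<in>D. frag_cmul (k d) d) \<in> bounds1 X"
proof -
  obtain V where V: "\<And>x. x \<in> topspace X \<Longrightarrow> openin X (V x) \<and> x \<in> V x \<and> acyclic1 (subtopology X (V x)) \<and> locally_path_connected_space (subtopology X (V x))"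
    using charts by metis
  have "regular_space X" using compact_Hausdorff_imp_regular_space[OF X] .
  then have "neighbourhood_base_of (closedin X) X" by (simp add: neighbourhood_base_of_closedin)
  then have "\<exists>B K. openin X B \<and> closedin X K \<and> x \<in> B \<and> B \<subseteq> K \<and> K \<subseteq> V x" if "x \<in> topspace X" for x
    using V[OF that] unfolding neighbourhood_base_of by blast
  then obtain B K where BK: "\<And>x. x \<in> topspace X \<Longrightarrow> openin X (B x) \<and> closedin X (K x) \<and> x \<in> B x \<and> B x \<subseteq> K x \<and> K x \<subseteq> V x"
    by metis
  have "\<exists>\<F>. finite \<F> \<and> \<F> \<subseteq> B ` topspace X \<and> topspace X \<subseteq> \<Union>\<F>"
    using X(1) BK unfolding compact_space_def compactin_def by (auto elim!: allE[of _ "B ` topspace X"])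
  then obtain I where I: "finite I" "I \<subseteq> topspace X" "topspace X \<subseteq> (\<Union>x\<in>I. B x)"
    by (metis (no_types, lifting) finite_subset_image)
  have joins: "\<exists>m. finite m \<and> m \<subseteq> V x \<inter> V y \<and> (\<forall>z\<in>K x \<inter> K y. \<exists>w\<in>m. joined (subtopology X (V x \<inter> V y)) z w)"
    if xy: "x \<in> I" "y \<in> I" for x y
  proof -
    have xX: "x \<in> topspace X" "y \<in> topspace X" using xy I by auto
    have "\<exists>N. openin X N \<and> path_connectedin X N \<and> z \<in> N \<and> N \<subseteq> V x \<inter> V y" if z: "z \<in> K x \<inter> K y" for z
    proof -
      have zV: "z \<in> V x \<inter> V y" using z BK xX by blast
      have "openin (subtopology X (V x)) (V x \<inter> V y)" using V xX by (simp add: openin_subtopology_Int2)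
      then obtain N where N: "openin (subtopology X (V x)) N" "path_connectedin (subtopology X (V x)) N" "z \<in> N" "N \<subseteq> V x \<inter> V y"
        using V[OF xX(1)] zV unfolding locally_path_connected_space by metis
      have "openin X N" using N(1) V[OF xX(1)] by (metis openin_trans_full)
      moreover have "path_connectedin X N" using N(2) by (simp add: path_connectedin_subtopology)
      ultimately show ?thesis using N by blast
    qed
    then obtain N where N: "\<And>z. z \<in> K x \<inter> K y \<Longrightarrow> openin X (N z) \<and> path_connectedin X (N z) \<and> z \<in> N z \<and> N z \<subseteq> V x \<inter> V y"
      by metis
    have "compactin X (K x \<inter> K y)" using BK xX by (intro closedin_compact_space[OF X(1)] closedin_Int) auto
    then have "\<exists>\<F>. finite \<F> \<and> \<F> \<subseteq> N ` (K x \<inter> K y) \<and> K x \<inter> K y \<subseteq> \<Union>\<F>"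
      using N unfolding compactin_def by (auto elim!: allE[of _ "N ` (K x \<inter> K y)"])
    then obtain m where m: "finite m" "m \<subseteq> K x \<inter> K y" "K x \<inter> K y \<subseteq> (\<Union>w\<in>m. N w)"
      by (metis (no_types, lifting) finite_subset_image)
    have "\<exists>w\<in>m. joined (subtopology X (V x \<inter> V y)) z w" if z: "z \<in> K x \<inter> K y" for z
    proof -
      obtain w where w: "w \<in> m" "z \<in> N w" using m(3) z by blast
      then have Nw: "path_connectedin X (N w)" "w \<in> N w" "N w \<subseteq> V x \<inter> V y" using N m(2) by blast+
      then have "path_component_of (subtopology X (N w)) z w"
        using w(2) unfolding path_connectedin_def path_connected_space_iff_path_component by (simp add: subset_iff)
      then show ?thesis using joined_mono[OF path_component_joined Nw(3)] w(1) by blast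
    qed
    moreover have "m \<subseteq> V x \<inter> V y" using m(2) BK xX by blast
    ultimately show ?thesis using m(1) by blast
  qed
  then obtain m where m: "\<And>x y. x \<in> I \<Longrightarrow> y \<in> I \<Longrightarrow> finite (m x y) \<and> m x y \<subseteq> V x \<inter> V y \<and> (\<forall>z\<in>K x \<inter> K y. \<exists>w\<in>m x y. joined (subtopology X (V x \<inter> V y)) z w)"
    by metis
  have VX: "V x \<subseteq> topspace X" if "x \<in> I" for x using V I that openin_subset by blast
  have "\<exists>a. singular_chain 1 (subtopology X (V x)) a \<and> chain_boundary 1 a = point_chain y - point_chain x"
    if "x \<in> I" "y \<in> V x" for x y
  proof -
    have "x \<in> V x" "acyclic1 (subtopology X (V x))" using V I that by auto
    then show ?thesis using that VX[OF that(1)] unfolding acyclic1_def joined_def by (simp add: subset_iff)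
  qed
  then obtain \<gamma> where \<gamma>: "\<And>x y. x \<in> I \<Longrightarrow> y \<in> V x \<Longrightarrow> singular_chain 1 (subtopology X (V x)) (\<gamma> x y) \<and> chain_boundary 1 (\<gamma> x y) = point_chain y - point_chain x"
    by metis
  have Vb: "c \<in> bounds1 X" if "x \<in> I" "c \<in> cycles1 (subtopology X (V x))" for x c
    using V[of x] I that unfolding acyclic1_def by (blast intro: bounds1_subtopologyD)
  define D where "D = (\<Union>x\<in>I. \<Union>y\<in>I. (\<lambda>w. \<gamma> x w - \<gamma> y w) ` m x y)"
  have finD: "finite D" unfolding D_def using I(1) m by auto
  define F where "F = {c. \<exists>k. c - (\<Sum>d\<in>D. frag_cmul (k d) d) \<in> bounds1 X}"
  have FI: "c \<in> F" if "c - (\<Sum>d\<in>D. frag_cmul (k d) d) \<in> bounds1 X" for c k using that unfolding F_def by blast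
  have F: "frag_subgroup F"
    unfolding frag_subgroup_def
  proof (intro conjI ballI)
    show "0 \<in> F" by (rule FI[of _ "\<lambda>_. 0"]) (simp add: bounds1_D(1))
    fix a c assume "a \<in> F" "c \<in> F"
    then obtain k l where "a - (\<Sum>d\<in>D. frag_cmul (k d) d) \<in> bounds1 X" "c - (\<Sum>d\<in>D. frag_cmul (l d) d) \<in> bounds1 X"
      unfolding F_def by blast
    from bounds1_D(2)[OF this]
    show "a - c \<in> F" by (intro FI[of _ "\<lambda>d. k d - l d"]) (simp add: sum_subtractf frag_cmul_diff_distrib algebra_simps)
  qed
  have BF: "c \<in> F" if "c \<in> bounds1 X" for c using that by (intro FI[of _ "\<lambda>_. 0"]) simp
  have DF: "d \<in> F" if "d \<in> D" for d
  proof (rule FI[of _ "\<lambda>e. if e = d then 1 else 0"])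
    have "(\<Sum>e\<in>D. frag_cmul (if e = d then 1 else 0) e) = (\<Sum>e\<in>D. if e = d then d else 0)" by (intro sum.cong) auto
    then show "d - (\<Sum>e\<in>D. frag_cmul (if e = d then 1 else 0) e) \<in> bounds1 X" using that finD by (simp add: bounds1_D(1))
  qed
  have change: "\<gamma> x z - \<gamma> y z \<in> F" if xy: "x \<in> I" "y \<in> I" and z: "z \<in> B x" "z \<in> B y" for x y z
  proof -
    have xX: "x \<in> topspace X" "y \<in> topspace X" using xy I by auto
    have zK: "z \<in> K x \<inter> K y" using BK xX z by blast
    then obtain w where w: "w \<in> m x y" "joined (subtopology X (V x \<inter> V y)) z w" using m[OF xy] by blast
    obtain a where a: "singular_chain 1 (subtopology X (V x \<inter> V y)) a" "chain_boundary 1 a = point_chain w - point_chain z"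
      using w(2) unfolding joined_def by blast
    have aV: "singular_chain 1 (subtopology X (V x)) a" "singular_chain 1 (subtopology X (V y)) a"
      using a(1) by (auto elim!: singular_chain_mono)
    have mem: "z \<in> V x" "z \<in> V y" "w \<in> V x" "w \<in> V y" using zK BK xX m[OF xy] w(1) by blast+
    have "\<gamma> v z + a - \<gamma> v w \<in> bounds1 X" if v: "v \<in> I" "z \<in> V v" "w \<in> V v" "singular_chain 1 (subtopology X (V v)) a" for v
      using \<gamma>[OF v(1,2)] \<gamma>[OF v(1,3)] v(4) a(2)
      by (intro Vb[OF v(1)]) (simp add: cycles1_def singular_chain_add singular_chain_diff chain_boundary_add chain_boundary_diff)
    from bounds1_D(2)[OF this[OF xy(1) mem(1,3) aV(1)] this[OF xy(2) mem(2,4) aV(2)]]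
    have "(\<gamma> x z - \<gamma> y z) - (\<gamma> x w - \<gamma> y w) \<in> F" by (intro BF) (simp add: algebra_simps)
    moreover have "\<gamma> x w - \<gamma> y w \<in> F" using w(1) xy by (intro DF) (auto simp: D_def)
    ultimately have "(\<gamma> x z - \<gamma> y z) - (\<gamma> x w - \<gamma> y w) + (\<gamma> x w - \<gamma> y w) \<in> F" by (rule frag_subgroupD(4)[OF F])
    then show ?thesis by simp
  qed
  obtain s where s: "\<And>z. z \<in> topspace X \<Longrightarrow> s z \<in> I \<and> z \<in> B (s z)" using I(3) by (metis UN_E subsetD)
  define P where "P z = \<gamma> (s z) z" for z
  have simplex: "frag_of \<sigma> - (P (\<sigma> vertex1) - P (\<sigma> vertex0)) \<in> F"
    if \<sigma>: "singular_simplex 1 X \<sigma>" and x: "x \<in> I" "\<sigma> ` standard_simplex 1 \<subseteq> B x" for \<sigma> x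
  proof -
    have xX: "x \<in> topspace X" using x I by auto
    have ends: "\<sigma> vertex0 \<in> B x" "\<sigma> vertex1 \<in> B x" using x(2) vertex_in_simplex by auto
    then have endsX: "\<sigma> vertex0 \<in> topspace X" "\<sigma> vertex1 \<in> topspace X" using BK[OF xX] openin_subset by blast+
    have BV: "B x \<subseteq> V x" using BK[OF xX] by blast
    have "singular_chain 1 (subtopology X (V x)) (frag_of \<sigma>)"
      using \<sigma> x(2) BV by (simp add: singular_chain_of singular_simplex_subtopology)
    then have "frag_of \<sigma> - (\<gamma> x (\<sigma> vertex1) - \<gamma> x (\<sigma> vertex0)) \<in> bounds1 X"
      using \<gamma>[OF x(1) subsetD[OF BV ends(1)]] \<gamma>[OF x(1) subsetD[OF BV ends(2)]] chain_boundary_simplex[of \<sigma>]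
      by (intro Vb[OF x(1)]) (simp add: cycles1_def singular_chain_diff chain_boundary_diff)
    then have 1: "frag_of \<sigma> - (\<gamma> x (\<sigma> vertex1) - \<gamma> x (\<sigma> vertex0)) \<in> F" by (rule BF)
    have 2: "\<gamma> x (\<sigma> vertex1) - P (\<sigma> vertex1) \<in> F" "\<gamma> x (\<sigma> vertex0) - P (\<sigma> vertex0) \<in> F"
      unfolding P_def using s endsX ends x(1) by (auto intro: change)
    from frag_subgroupD(4)[OF F 1 frag_subgroupD(2)[OF F 2]] show ?thesis by (simp add: algebra_simps)
  qed
  have "c \<in> F" if c: "c \<in> cycles1 X" for c
  proof -
    obtain c' where c': "singular_relcycle 1 X {} c'" "homologous_rel 1 X {} c c'"
      "\<And>f. f \<in> Poly_Mapping.keys c' \<Longrightarrow> \<exists>U\<in>B ` I. f \<in> standard_simplex 1 \<rightarrow> U"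
    proof (rule small_homologous_rel_relcycle_exists[of "B ` I" X 1 "{}" c])
      show "topspace X \<subseteq> \<Union> (B ` I)" by (rule I(3))
      show "openin X U" if "U \<in> B ` I" for U using that I(2) BK by blast
      show "singular_relcycle 1 X {} c" using c unfolding cycles1_relcycle .
    qed (rule that)
    have c'1: "singular_chain 1 X c'" "chain_boundary 1 c' = 0" using c'(1) unfolding singular_cycle by blast+
    have "c' \<in> {w. w - frag_extend (\<lambda>\<sigma>. P (\<sigma> vertex1) - P (\<sigma> vertex0)) w \<in> F}"
    proof (rule frag_subgroup_induct[OF _ _ order_refl])
      show "frag_subgroup {w. w - frag_extend (\<lambda>\<sigma>. P (\<sigma> vertex1) - P (\<sigma> vertex0)) w \<in> F}"
        by (rule frag_subgroup_vimage[OF F]) (simp_all add: frag_extend_diff algebra_simps)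
      fix f assume f: "f \<in> Poly_Mapping.keys c'"
      then obtain x where "x \<in> I" "f \<in> standard_simplex 1 \<rightarrow> B x" using c'(3) by blast
      moreover have "singular_simplex 1 X f" using c'1(1) f by (auto simp: singular_chain_def)
      ultimately show "frag_of f \<in> {w. w - frag_extend (\<lambda>\<sigma>. P (\<sigma> vertex1) - P (\<sigma> vertex0)) w \<in> F}"
        using simplex by (simp add: image_subset_iff_funcset)
    qed
    then have "c' - frag_extend (\<lambda>\<sigma>. P (\<sigma> vertex1) - P (\<sigma> vertex0)) c' \<in> F" by (rule CollectD)
    then have "c' \<in> F" unfolding vertex_sum c'1(2) frag_extend_0 diff_zero .
    moreover have "c - c' \<in> F" using c'(2) unfolding homologous_bounds1 by (rule BF)
    ultimately show ?thesis using frag_subgroupD(4)[OF F, of "c - c'" c'] by simp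
  qed
  then show ?thesis using that[OF finD] unfolding F_def by blast
qed

text \<open>A homomorphism from the first homology is represented by a cocycle: join every point to a
  base point of its component and evaluate on the loops that arise from the simplices.\<close>

lemma exists_cocycle:
  assumes f: "additive_on (cycles1 X) f" "\<And>c. c \<in> bounds1 X \<Longrightarrow> f c = (0::int)"
    and E: "E \<subseteq> topspace X" "acyclic1 (subtopology X E)" "e0 \<in> E"
  obtains \<phi> where "\<And>c. c \<in> cycles1 X \<Longrightarrow> frag_eval \<phi> c = f c"
    "\<And>\<sigma>. singular_simplex 1 X \<sigma> \<Longrightarrow> \<sigma> ` standard_simplex 1 \<subseteq> E \<Longrightarrow> \<phi> \<sigma> = (0::int)"
proof -
  define r where "r x = (if joined X x e0 then e0 else SOME y. joined X x y)" for x
  have r: "joined X (r x) x" for x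
  proof (rule joined_sym)
    show "joined X x (r x)"
      unfolding r_def using someI[of "joined X x" x, OF joined_refl] by (cases "joined X x e0") simp_all
  qed
  have r_eq: "r x = r y" if "joined X x y" for x y
  proof -
    have "joined X x = joined X y"
      using joined_trans[OF that] joined_trans[OF joined_sym[OF that]] by (intro ext iffI)
    then show ?thesis by (simp add: r_def)
  qed
  have "\<exists>a. singular_chain 1 X a \<and> chain_boundary 1 a = point_chain x - point_chain (r x) \<and>
      (x \<in> E \<longrightarrow> singular_chain 1 (subtopology X E) a)" for x
  proof (cases "x \<in> E")
    case True
    then have j: "joined (subtopology X E) e0 x" using E unfolding acyclic1_def by (simp add: subset_iff)
    then have "r x = e0" using joined_sym[OF joined_subtopologyD[OF j]] by (simp add: r_def)
    then show ?thesis using j singular_chain_subtopologyD unfolding joined_def by metis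
  next
    case False
    then show ?thesis using r[of x] unfolding joined_def by blast
  qed
  then obtain p where p: "\<And>x. singular_chain 1 X (p x)" "\<And>x. chain_boundary 1 (p x) = point_chain x - point_chain (r x)"
    "\<And>x. x \<in> E \<Longrightarrow> singular_chain 1 (subtopology X E) (p x)" by metis
  define L where "L c = c - frag_extend (\<lambda>\<sigma>. p (\<sigma> vertex1) - p (\<sigma> vertex0)) c" for c
  have L_simplex: "L (frag_of \<sigma>) \<in> cycles1 X" if "singular_simplex 1 X \<sigma>" for \<sigma>
    using p that r_eq[OF joined_simplex[OF that]] chain_boundary_simplex[of \<sigma>]
    by (simp add: L_def cycles1_def singular_chain_diff singular_chain_of chain_boundary_diff)
  define \<phi> where "\<phi> \<sigma> = f (L (frag_of \<sigma>))" for \<sigma>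
  have L_diff: "L (a - c) = L a - L c" "L 0 = 0" for a c by (simp_all add: L_def frag_extend_diff)
  have key: "L c \<in> cycles1 X \<and> frag_eval \<phi> c = f (L c)" if "singular_chain 1 X c" for c
  proof -
    have "c \<in> {c. L c \<in> cycles1 X \<and> frag_eval \<phi> c = f (L c)}"
    proof (rule frag_subgroup_induct[OF _ _ that[unfolded singular_chain_def]])
      show "frag_subgroup {c. L c \<in> cycles1 X \<and> frag_eval \<phi> c = f (L c)}"
        unfolding frag_subgroup_def
        using cycles1_D(1)[of X] cycles1_D(2)[of _ X] additive_on_0[OF frag_subgroup_cycles1 f(1)]
          additive_on_diff[OF frag_subgroup_cycles1 f(1)]
        by (auto simp: L_diff)
    qed (use L_simplex in \<open>auto simp: \<phi>_def\<close>)
    then show ?thesis by simp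
  qed
  show ?thesis
  proof (rule that)
    fix c assume c: "c \<in> cycles1 X"
    then have "L c = c" unfolding L_def vertex_sum by (simp add: cycles1_def)
    then show "frag_eval \<phi> c = f c" using key[of c] c by (simp add: cycles1_def)
  next
    fix \<sigma> assume \<sigma>: "singular_simplex 1 X \<sigma>" "\<sigma> ` standard_simplex 1 \<subseteq> E"
    have ends: "\<sigma> vertex0 \<in> E" "\<sigma> vertex1 \<in> E" using \<sigma>(2) vertex_in_simplex by auto
    have "singular_chain 1 (subtopology X E) (L (frag_of \<sigma>))"
      using \<sigma> p(3)[OF ends(1)] p(3)[OF ends(2)]
      by (simp add: L_def singular_chain_diff singular_chain_of singular_simplex_subtopology)
    then have "L (frag_of \<sigma>) \<in> cycles1 (subtopology X E)" using L_simplex[OF \<sigma>(1)] by (simp add: cycles1_def)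
    then have "L (frag_of \<sigma>) \<in> bounds1 X" using E(2) unfolding acyclic1_def by (blast intro: bounds1_subtopologyD)
    then show "\<phi> \<sigma> = 0" unfolding \<phi>_def by (rule f(2))
  qed
qed

text \<open>Conversely a cochain that vanishes on cycles is a coboundary.\<close>

lemma cochain_primitive:
  assumes \<phi>: "\<And>c. c \<in> cycles1 X \<Longrightarrow> frag_eval \<phi> c = (0::int)"
  obtains g where "\<And>\<sigma>. singular_simplex 1 X \<sigma> \<Longrightarrow> \<phi> \<sigma> = g (\<sigma> vertex1) - g (\<sigma> vertex0)"
proof -
  define r where "r x = (SOME y. joined X x y)" for x
  have r: "joined X (r x) x" for x
    unfolding r_def by (rule joined_sym) (rule someI[of "joined X x" x, OF joined_refl])
  have r_eq: "r x = r y" if "joined X x y" for x y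
  proof -
    have "joined X x = joined X y"
      using joined_trans[OF that] joined_trans[OF joined_sym[OF that]] by (intro ext iffI)
    then show ?thesis by (simp add: r_def)
  qed
  obtain p where p: "\<And>x. singular_chain 1 X (p x)" "\<And>x. chain_boundary 1 (p x) = point_chain x - point_chain (r x)"
    using r unfolding joined_def by metis
  show ?thesis
  proof (rule that)
    fix \<sigma> assume \<sigma>: "singular_simplex 1 X \<sigma>"
    have "frag_of \<sigma> - (p (\<sigma> vertex1) - p (\<sigma> vertex0)) \<in> cycles1 X"
      using p \<sigma> r_eq[OF joined_simplex[OF \<sigma>]] chain_boundary_simplex[of \<sigma>]
      by (simp add: cycles1_def singular_chain_diff singular_chain_of chain_boundary_diff)
    from \<phi>[OF this] show "\<phi> \<sigma> = frag_eval \<phi> (p (\<sigma> vertex1)) - frag_eval \<phi> (p (\<sigma> vertex0))" by simp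
  qed
qed

section \<open>Maps between manifolds\<close>

definition locally_Euclidean :: "nat \<Rightarrow> 'a topology \<Rightarrow> bool" where
  "locally_Euclidean n X \<longleftrightarrow>
     (\<forall>x\<in>topspace X. \<exists>U. openin X U \<and> x \<in> U \<and> subtopology X U homeomorphic_space Euclidean_space n)"

lemma locally_Euclidean_Euclidean_space: "locally_Euclidean n (Euclidean_space n)"
  unfolding locally_Euclidean_def
  by (intro ballI exI[of _ "topspace (Euclidean_space n)"]) (auto intro: homeomorphic_space_refl)

lemma closed_manifold_locally_Euclidean: "closed_manifold n X \<Longrightarrow> locally_Euclidean n X"
  by (simp add: closed_manifold_def locally_Euclidean_def)

lemma locally_Euclidean_chart:
  assumes "locally_Euclidean n X" "x \<in> topspace X"
  obtains U g g' where "openin X U" "x \<in> U" "homeomorphic_maps (subtopology X U) (Euclidean_space n) g g'"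
  using assms unfolding locally_Euclidean_def homeomorphic_space_def by metis

text \<open>Invariance of domain, transported to manifolds through charts.\<close>

theorem injective_map_open_image:
  assumes X: "locally_Euclidean n X" and Y: "locally_Euclidean n Y" and S: "openin X S"
    and f: "continuous_map (subtopology X S) Y f" "inj_on f S"
  shows "openin Y (f ` S)"
proof (subst openin_subopen, intro ballI)
  fix y assume "y \<in> f ` S"
  then obtain x where x: "x \<in> S" "y = f x" by blast
  have SX: "S \<subseteq> topspace X" using S by (rule openin_subset)
  have fS: "f s \<in> topspace Y" if "s \<in> S" for s
    using f(1) that SX by (auto simp: continuous_map_def)
  obtain U g g' where U: "openin X U" "x \<in> U" and g: "homeomorphic_maps (subtopology X U) (Euclidean_space n) g g'"
    using locally_Euclidean_chart[OF X] x SX by blast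
  obtain V k k' where V: "openin Y V" "y \<in> V" and k: "homeomorphic_maps (subtopology Y V) (Euclidean_space n) k k'"
    using locally_Euclidean_chart[OF Y, of y] x fS by blast
  have UX: "topspace X \<inter> U = U" and VY: "topspace Y \<inter> V = V" using U V openin_subset by blast+
  define W where "W = {s \<in> topspace (subtopology X S). f s \<in> V} \<inter> U"
  have "openin (subtopology X S) {s \<in> topspace (subtopology X S). f s \<in> V}"
    using f(1) V(1) by (rule openin_continuous_map_preimage)
  then have W: "openin X W" using S U(1) unfolding W_def by (meson openin_trans_full openin_Int)
  have WS: "W \<subseteq> S" "W \<subseteq> U" "f ` W \<subseteq> V" "x \<in> W" using x U(2) V(2) SX by (auto simp: W_def)
  have "openin (subtopology X U) W" using W WS(2) by (simp add: openin_open_subtopology U(1))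
  moreover have "homeomorphic_map (subtopology X U) (Euclidean_space n) g" using g homeomorphic_maps_map by blast
  ultimately have gW: "openin (Euclidean_space n) (g ` W)" using homeomorphic_imp_open_map open_map_def by blast
  have gg: "g' (g u) = u" if "u \<in> U" for u using g that UX unfolding homeomorphic_maps_def by simp
  have kk: "k' (k v) = v" if "v \<in> V" for v using k that VY unfolding homeomorphic_maps_def by simp
  have g'W: "g' ` g ` W = W" using gg WS(2) by (force simp: image_image)
  have "continuous_map (Euclidean_space n) (subtopology X U) g'" using g unfolding homeomorphic_maps_def by blast
  then have "continuous_map (subtopology (Euclidean_space n) (g ` W)) X g'"
    by (metis continuous_map_from_subtopology continuous_map_in_subtopology)
  then have 1: "continuous_map (subtopology (Euclidean_space n) (g ` W)) (subtopology X W) g'"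
    using g'W by (intro continuous_map_into_subtopology) auto
  have "continuous_map (subtopology X W) Y f" using f(1) WS(1) by (rule continuous_map_from_subtopology_mono)
  then have 2: "continuous_map (subtopology X W) (subtopology Y V) f"
    using WS(3) by (intro continuous_map_into_subtopology) auto
  have 3: "continuous_map (subtopology Y V) (Euclidean_space n) k" using k unfolding homeomorphic_maps_def by blast
  have "inj_on (k \<circ> (f \<circ> g')) (g ` W)"
  proof (rule inj_onI)
    fix a c assume a: "a \<in> g ` W" and c: "c \<in> g ` W" and eq: "(k \<circ> (f \<circ> g')) a = (k \<circ> (f \<circ> g')) c"
    have ac: "g' a \<in> W" "g' c \<in> W" using a c g'W by blast+
    then have fV: "f (g' a) \<in> V" "f (g' c) \<in> V" using WS(3) by blast+
    have "k' (k (f (g' a))) = k' (k (f (g' c)))" using eq by simp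
    then have "f (g' a) = f (g' c)" unfolding kk[OF fV(1)] kk[OF fV(2)] .
    then have "g' a = g' c" by (rule inj_onD[OF f(2)]) (use ac WS(1) in blast)+
    moreover have "g (g' s) = s" if "s \<in> g ` W" for s using that gg WS(2) by auto
    ultimately show "a = c" using a c by metis
  qed
  then have "openin (Euclidean_space n) ((k \<circ> (f \<circ> g')) ` (g ` W))"
    by (rule invariance_of_domain_Euclidean_space[OF gW continuous_map_compose[OF continuous_map_compose[OF 1 2] 3]])
  moreover have "(k \<circ> (f \<circ> g')) ` (g ` W) = k ` f ` W" unfolding image_comp[symmetric] g'W ..
  ultimately have "openin (Euclidean_space n) (k ` f ` W)" by simp
  moreover have "homeomorphic_map (Euclidean_space n) (subtopology Y V) k'" using k homeomorphic_maps_map by blast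
  ultimately have "openin (subtopology Y V) (k' ` k ` f ` W)" using homeomorphic_imp_open_map open_map_def by blast
  moreover have "k' ` k ` f ` W = f ` W" using kk WS(3) by (force simp: image_image)
  ultimately have "openin Y (f ` W)" using V(1) openin_trans_full by metis
  then show "\<exists>T. openin Y T \<and> y \<in> T \<and> T \<subseteq> f ` S" using WS x by blast
qed

lemma locally_Euclidean_good_chart:
  assumes "locally_Euclidean n X" "x \<in> topspace X"
  shows "\<exists>V. openin X V \<and> x \<in> V \<and> acyclic1 (subtopology X V) \<and> locally_path_connected_space (subtopology X V)"
proof -
  obtain V where V: "openin X V" "x \<in> V" "subtopology X V homeomorphic_space Euclidean_space n"
    using assms unfolding locally_Euclidean_def by blast
  have "acyclic1 (subtopology X V)"
    using acyclic1_homeomorphic[OF acyclic1_Euclidean_space] V(3) homeomorphic_space_sym by blast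
  moreover have "locally_path_connected_space (subtopology X V)"
    using homeomorphic_locally_path_connected_space[OF V(3)] locally_path_connected_Euclidean_space by blast
  ultimately show ?thesis using V by blast
qed

text \<open>The inverse of an open embedding of a punctured compact space collapses the complement of the
  image to the missing point, like the one-point compactification.\<close>

lemma extended_inverse_continuous:
  assumes X: "compact_space X" and x0: "x0 \<in> topspace X" and Y: "Hausdorff_space Y"
    and p: "continuous_map (subtopology X (topspace X - {x0})) Y p" "inj_on p (topspace X - {x0})"
    and op: "\<And>S. openin X S \<Longrightarrow> S \<subseteq> topspace X - {x0} \<Longrightarrow> openin Y (p ` S)"
    and q: "\<And>x. x \<in> topspace X - {x0} \<Longrightarrow> q (p x) = x" "\<And>y. y \<notin> p ` (topspace X - {x0}) \<Longrightarrow> q y = x0"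
  shows "continuous_map Y X q"
  unfolding continuous_map_closedin
proof (intro conjI allI impI)
  have pY: "p ` (topspace X - {x0}) \<subseteq> topspace Y" using p(1) by (auto simp: continuous_map_def)
  show "q \<in> topspace Y \<rightarrow> topspace X"
  proof
    fix y show "q y \<in> topspace X"
    proof (cases "y \<in> p ` (topspace X - {x0})")
      case True
      then obtain x where "x \<in> topspace X - {x0}" "y = p x" by blast
      then show ?thesis using q(1) by simp
    qed (use q(2) x0 in simp)
  qed
  fix C assume C: "closedin X C"
  then have CX: "C \<subseteq> topspace X" by (rule closedin_subset)
  show "closedin Y {y \<in> topspace Y. q y \<in> C}"
  proof (cases "x0 \<in> C")
    case True
    have "{y \<in> topspace Y. q y \<in> C} = topspace Y - p ` (topspace X - C)"
    proof (intro equalityI subsetI)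
      fix y assume y: "y \<in> {y \<in> topspace Y. q y \<in> C}"
      have "y \<noteq> p x" if "x \<in> topspace X - C" for x
      proof
        assume "y = p x"
        then have "q y = x" using q(1)[of x] that True by blast
        then show False using y that by blast
      qed
      then show "y \<in> topspace Y - p ` (topspace X - C)" using y by blast
    next
      fix y assume y: "y \<in> topspace Y - p ` (topspace X - C)"
      show "y \<in> {y \<in> topspace Y. q y \<in> C}"
      proof (cases "y \<in> p ` (topspace X - {x0})")
        case t: True
        then obtain x where x: "x \<in> topspace X - {x0}" "y = p x" by blast
        then have "x \<in> C" using y by blast
        then show ?thesis using x q(1) y by simp
      qed (use y q(2) True in simp)
    qed
    moreover have "openin Y (p ` (topspace X - C))" using C True by (intro op) auto
    ultimately show ?thesis by (simp add: closedin_diff)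
  next
    case False
    have CS: "C \<subseteq> topspace X - {x0}" using CX False by blast
    have "{y \<in> topspace Y. q y \<in> C} = p ` C"
    proof (intro equalityI subsetI)
      fix y assume y: "y \<in> {y \<in> topspace Y. q y \<in> C}"
      then have "y \<in> p ` (topspace X - {x0})" using q(2)[of y] False by fastforce
      then obtain x where "x \<in> topspace X - {x0}" "y = p x" by blast
      then show "y \<in> p ` C" using q(1) y by auto
    next
      fix y assume "y \<in> p ` C"
      then obtain x where x: "x \<in> C" "y = p x" by blast
      then have "x \<in> topspace X - {x0}" using CS by blast
      then have "q y = x" "y \<in> topspace Y" using q(1)[of x] pY x(2) by auto
      then show "y \<in> {y \<in> topspace Y. q y \<in> C}" using x(1) by simp
    qed
    moreover have "compactin (subtopology X (topspace X - {x0})) C"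
      using closedin_compact_space[OF X C] CS by (simp add: compactin_subtopology)
    then have "compactin Y (p ` C)" using p(1) by (rule image_compactin)
    ultimately show ?thesis using compactin_imp_closedin[OF Y] by simp
  qed
qed

section \<open>Inversion in the unit sphere\<close>

definition sqnorm :: "nat \<Rightarrow> (nat \<Rightarrow> real) \<Rightarrow> real" where
  "sqnorm n u = (\<Sum>i<n. (u i)\<^sup>2)"

definition inversion :: "nat \<Rightarrow> (nat \<Rightarrow> real) \<Rightarrow> (nat \<Rightarrow> real)" where
  "inversion n u = (\<lambda>i. u i / sqnorm n u)"

lemma Euclidean_space_top_of_set: "Euclidean_space n = top_of_set (topspace (Euclidean_space n))"
  unfolding Euclidean_space_def by (simp add: euclidean_product_topology)

lemma sqnorm_nonneg: "sqnorm n u \<ge> 0"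
  by (simp add: sqnorm_def sum_nonneg)

lemma sqnorm_eq_0:
  assumes "u \<in> topspace (Euclidean_space n)"
  shows "sqnorm n u = 0 \<longleftrightarrow> u = (\<lambda>i. 0)"
proof
  assume "sqnorm n u = 0"
  then have "u i = 0" if "i < n" for i using that by (simp add: sqnorm_def sum_nonneg_eq_0_iff)
  moreover have "u i = 0" if "\<not> i < n" for i using that assms by (auto simp: topspace_Euclidean_space)
  ultimately show "u = (\<lambda>i. 0)" by blast
qed (simp add: sqnorm_def)

lemma sqnorm_inversion: "sqnorm n (inversion n u) = 1 / sqnorm n u"
proof -
  have "sqnorm n (inversion n u) = (\<Sum>i<n. (u i)\<^sup>2) / (sqnorm n u)\<^sup>2"
    unfolding inversion_def sqnorm_def[of n "\<lambda>i. u i / sqnorm n u"] power_divide by (rule sum_divide_distrib[symmetric])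
  also have "\<dots> = 1 / sqnorm n u"
    unfolding sqnorm_def[symmetric] by (simp add: power2_eq_square)
  finally show ?thesis .
qed

lemma inversion_in_space: "u \<in> topspace (Euclidean_space n) \<Longrightarrow> inversion n u \<in> topspace (Euclidean_space n)"
  by (simp add: inversion_def topspace_Euclidean_space)

lemma inversion_inversion:
  assumes "u \<in> topspace (Euclidean_space n)"
  shows "inversion n (inversion n u) = u"
proof (cases "u = (\<lambda>i. 0)")
  case False
  then have "sqnorm n u \<noteq> 0" using sqnorm_eq_0[OF assms] by simp
  then show ?thesis by (simp add: inversion_def[of n "inversion n u"] sqnorm_inversion) (simp add: inversion_def)
qed (simp add: inversion_def)

lemma continuous_on_sqnorm: "continuous_on S (sqnorm n)"
proof -
  have "continuous_on S (\<lambda>u. u i)" for i :: nat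
    by (rule continuous_on_subset[OF continuous_on_product_coordinates subset_UNIV])
  then have "continuous_on S (\<lambda>u. \<Sum>i<n. (u i)\<^sup>2)" by (intro continuous_on_sum continuous_on_power)
  then show ?thesis by (simp add: sqnorm_def[abs_def])
qed

lemma continuous_map_inversion:
  assumes "S \<subseteq> topspace (Euclidean_space n)" "(\<lambda>i. 0) \<notin> S"
  shows "continuous_map (subtopology (Euclidean_space n) S) (Euclidean_space n) (inversion n)"
proof -
  have "continuous_on S (inversion n)"
    unfolding inversion_def
  proof (intro continuous_on_coordinatewise_then_product continuous_on_divide continuous_on_sqnorm ballI)
    show "continuous_on S (\<lambda>u. u i)" for i
      by (rule continuous_on_subset[OF continuous_on_product_coordinates subset_UNIV])
    show "sqnorm n u \<noteq> 0" if "u \<in> S" for u using sqnorm_eq_0 assms that by blast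
  qed
  moreover have "inversion n ` S \<subseteq> topspace (Euclidean_space n)" using inversion_in_space assms(1) by blast
  ultimately have "continuous_map (top_of_set S) (top_of_set (topspace (Euclidean_space n))) (inversion n)"
    by (auto simp: continuous_map_in_subtopology)
  moreover have "subtopology (Euclidean_space n) S = top_of_set S"
    by (subst Euclidean_space_top_of_set) (simp add: subtopology_subtopology Int_absorb1 assms(1))
  ultimately show ?thesis by (simp flip: Euclidean_space_top_of_set)
qed

lemma openin_unit_ball: "openin (Euclidean_space n) (open_unit_ball n)"
proof -
  have "open {u. sqnorm n u < 1}" by (intro open_Collect_less continuous_on_sqnorm continuous_on_const)
  from openin_Euclidean_open[OF this, of n] show ?thesis
    by (simp add: open_unit_ball_def sqnorm_def Int_def)
qed

lemma compactin_unit_disc: "compactin (Euclidean_space n) {u \<in> topspace (Euclidean_space n). sqnorm n u \<le> 1}"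
proof -
  let ?D = "{u \<in> topspace (Euclidean_space n). sqnorm n u \<le> 1}"
  let ?P = "PiE UNIV (\<lambda>i::nat. if i < n then {-1..1} else {0::real})"
  have "compactin (product_topology (\<lambda>i. euclideanreal) UNIV) ?P"
    by (subst compactin_PiE) simp
  then have "compact ?P" by (simp add: euclidean_product_topology)
  moreover have "closed {u. sqnorm n u \<le> 1}" by (intro closed_Collect_le continuous_on_sqnorm continuous_on_const)
  ultimately have "compact (?P \<inter> {u. sqnorm n u \<le> 1})" by (rule compact_Int_closed)
  moreover have "?P \<inter> {u. sqnorm n u \<le> 1} = ?D"
  proof (intro equalityI subsetI)
    fix u assume u: "u \<in> ?D"
    have "u i \<in> (if i < n then {-1..1} else {0})" for i
    proof (cases "i < n")
      case True
      then have "(u i)\<^sup>2 \<le> sqnorm n u" unfolding sqnorm_def by (intro member_le_sum) auto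
      then have "(u i)\<^sup>2 \<le> 1" using u by simp
      then show ?thesis using True by (simp add: abs_square_le_1 abs_le_iff)
    qed (use u in \<open>auto simp: topspace_Euclidean_space\<close>)
    then show "u \<in> ?P \<inter> {u. sqnorm n u \<le> 1}" using u by (simp add: PiE_UNIV_domain)
  next
    fix u assume u: "u \<in> ?P \<inter> {u. sqnorm n u \<le> 1}"
    have "u i = 0" if "i \<ge> n" for i using u that by (auto simp: PiE_UNIV_domain dest!: spec[of _ i] split: if_splits)
    then show "u \<in> ?D" using u by (simp add: topspace_Euclidean_space)
  qed
  ultimately show ?thesis by (subst Euclidean_space_top_of_set) (simp add: compactin_subtopology)
qed

section \<open>The two pieces of a connected sum\<close>

definition sphere_outside :: "nat \<Rightarrow> (nat \<Rightarrow> real) set" where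
  "sphere_outside n = {u \<in> topspace (Euclidean_space n). 1 \<le> sqnorm n u}"

lemma embedding_imp_continuous_map: "embedding_map X Y f \<Longrightarrow> continuous_map X Y f"
  unfolding embedding_map_def by (metis continuous_map_in_subtopology homeomorphic_imp_continuous_map)

text \<open>The complement of the ball in the second summand is mapped by its inclusion; the punctured ball is
  turned inside out, onto the collar of the first summand.\<close>

lemma collar_extension:
  fixes X1 :: "'a topology" and X2 :: "'b topology" and Y :: "'c topology"
  assumes X2: "Hausdorff_space X2"
    and e1: "embedding_map (Euclidean_space n) X1 e1"
    and e2: "embedding_map (Euclidean_space n) X2 e2" "openin X2 (e2 ` topspace (Euclidean_space n))"
    and h1: "embedding_map (subtopology X1 (remove_ball n X1 e1)) Y h1"
    and h2: "embedding_map (subtopology X2 (remove_ball n X2 e2)) Y h2"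
    and meet: "h1 ` remove_ball n X1 e1 \<inter> h2 ` remove_ball n X2 e2 = h1 ` e1 ` unit_sphere n"
    and agree: "\<And>u. u \<in> unit_sphere n \<Longrightarrow> h1 (e1 u) = h2 (e2 u)"
  obtains p where "continuous_map (subtopology X2 (topspace X2 - {e2 (\<lambda>i. 0)})) Y p"
    "inj_on p (topspace X2 - {e2 (\<lambda>i. 0)})"
    "p ` (topspace X2 - {e2 (\<lambda>i. 0)}) = h2 ` remove_ball n X2 e2 \<union> h1 ` e1 ` sphere_outside n"
    "p ` (e2 ` topspace (Euclidean_space n) - {e2 (\<lambda>i. 0)}) = h2 ` e2 ` sphere_outside n \<union> h1 ` e1 ` sphere_outside n"
proof -
  let ?E = "Euclidean_space n"
  let ?P1 = "remove_ball n X1 e1" and ?P2 = "remove_ball n X2 e2"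
  let ?x = "e2 (\<lambda>i. 0)"
  define B where "B = {u \<in> topspace ?E. 0 < sqnorm n u \<and> sqnorm n u \<le> 1}"
  have zero: "(\<lambda>i. 0) \<in> topspace ?E" by (simp add: topspace_Euclidean_space)
  have inj1: "inj_on e1 (topspace ?E)" and inj2: "inj_on e2 (topspace ?E)"
    using e1 e2(1) homeomorphic_imp_injective_map unfolding embedding_map_def by blast+
  have e1X: "e1 ` topspace ?E \<subseteq> topspace X1" and e2X: "e2 ` topspace ?E \<subseteq> topspace X2"
    using embedding_imp_continuous_map[OF e1] embedding_imp_continuous_map[OF e2(1)] by (auto simp: continuous_map_def)
  have P1: "?P1 \<subseteq> topspace X1" and P2: "?P2 \<subseteq> topspace X2" by (auto simp: remove_ball_def)
  have injh1: "inj_on h1 ?P1" and injh2: "inj_on h2 ?P2"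
    using h1 h2 homeomorphic_imp_injective_map P1 P2 unfolding embedding_map_def by (fastforce simp: Int_absorb1)+
  have in_ball: "u \<in> open_unit_ball n \<longleftrightarrow> sqnorm n u < 1" if "u \<in> topspace ?E" for u
    using that by (simp add: open_unit_ball_def sqnorm_def)
  have ball_sub: "open_unit_ball n \<subseteq> topspace ?E" by (auto simp: open_unit_ball_def)
  have sphere: "u \<in> unit_sphere n \<longleftrightarrow> u \<in> topspace ?E \<and> sqnorm n u = 1" for u
    by (simp add: unit_sphere_def sqnorm_def)
  have outP1: "e1 u \<in> ?P1 \<longleftrightarrow> 1 \<le> sqnorm n u" if u: "u \<in> topspace ?E" for u
    using inj_on_image_mem_iff[OF inj1 u ball_sub] e1X u in_ball[OF u] by (auto simp: remove_ball_def)
  have outP2: "e2 u \<in> ?P2 \<longleftrightarrow> 1 \<le> sqnorm n u" if u: "u \<in> topspace ?E" for u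
    using inj_on_image_mem_iff[OF inj2 u ball_sub] e2X u in_ball[OF u] by (auto simp: remove_ball_def)
  obtain e' where e': "homeomorphic_maps ?E (subtopology X2 (e2 ` topspace ?E)) e2 e'"
    using e2(1) unfolding embedding_map_def homeomorphic_map_maps by blast
  have e'e: "e' (e2 u) = u" if "u \<in> topspace ?E" for u using e' that unfolding homeomorphic_maps_def by blast
  define p where "p y = (if y \<in> ?P2 then h2 y else h1 (e1 (inversion n (e' y))))" for y
  have pP: "p y = h2 y" if "y \<in> ?P2" for y using that by (simp add: p_def)
  have BE: "B \<subseteq> topspace ?E" by (auto simp: B_def)
  have inv_out: "inversion n u \<in> sphere_outside n" if "u \<in> B" for u
    using that inversion_in_space[of u n] by (simp add: B_def sphere_outside_def sqnorm_inversion)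
  have pB: "p (e2 u) = h1 (e1 (inversion n u))" if u: "u \<in> B" for u
  proof (cases "sqnorm n u = 1")
    case True
    then have "inversion n u = u" "u \<in> unit_sphere n" using u sphere by (auto simp: inversion_def B_def)
    then show ?thesis using agree[of u] outP2[of u] True u by (simp add: p_def B_def)
  next
    case False
    then show ?thesis using outP2[of u] e'e[of u] u by (simp add: p_def B_def)
  qed
  have inv_B: "inversion n ` B = sphere_outside n"
  proof (intro equalityI subsetI)
    fix w assume w: "w \<in> sphere_outside n"
    then have "inversion n w \<in> B" using inversion_in_space[of w n] by (simp add: B_def sphere_outside_def sqnorm_inversion)
    moreover have "w = inversion n (inversion n w)" using inversion_inversion w by (simp add: sphere_outside_def)
    ultimately show "w \<in> inversion n ` B" by (rule image_eqI[of w "inversion n" "inversion n w", rotated])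
  qed (use inv_out in blast)
  have pB_image: "p ` e2 ` B = h1 ` e1 ` sphere_outside n"
    unfolding inv_B[symmetric] image_image using pB by (intro image_cong) auto
  have not_zero: "e2 u \<noteq> ?x" if "u \<in> topspace ?E" "u \<noteq> (\<lambda>i. 0)" for u using inj2 that zero by (auto dest: inj_onD)
  have zeroP2: "?x \<notin> ?P2" using outP2[OF zero] by (simp add: sqnorm_def)
  have B_nonzero: "(\<lambda>i. 0) \<notin> B" by (simp add: B_def sqnorm_def)
  have in_B: "u \<in> B" if "u \<in> topspace ?E" "u \<noteq> (\<lambda>i. 0)" "sqnorm n u \<le> 1" for u
    using that sqnorm_eq_0[of u n] sqnorm_nonneg[of n u] by (simp add: B_def)
  have cover: "topspace X2 - {?x} = ?P2 \<union> e2 ` B"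
  proof (intro equalityI subsetI)
    fix y assume y: "y \<in> topspace X2 - {?x}"
    show "y \<in> ?P2 \<union> e2 ` B"
    proof (cases "y \<in> ?P2")
      case False
      then obtain u where u: "u \<in> open_unit_ball n" "y = e2 u" using y by (auto simp: remove_ball_def)
      then have "u \<in> B" using y ball_sub in_ball by (intro in_B) auto
      then show ?thesis using u(2) by blast
    qed simp
  next
    fix y assume "y \<in> ?P2 \<union> e2 ` B"
    then show "y \<in> topspace X2 - {?x}"
    proof
      assume "y \<in> e2 ` B"
      then obtain u where u: "u \<in> B" "y = e2 u" by blast
      then have u': "u \<in> topspace ?E" "u \<noteq> (\<lambda>i. 0)" using BE B_nonzero by auto
      have "e2 u \<in> topspace X2" using e2X imageI[OF u'(1), of e2] by (rule subsetD)
      then show ?thesis using not_zero[OF u'] u(2) by simp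
    next
      assume "y \<in> ?P2"
      then show ?thesis using P2 zeroP2 by blast
    qed
  qed
  have cover_E: "e2 ` topspace ?E - {?x} = e2 ` sphere_outside n \<union> e2 ` B"
  proof (intro equalityI subsetI)
    fix y assume "y \<in> e2 ` topspace ?E - {?x}"
    then obtain u where u: "u \<in> topspace ?E" "u \<noteq> (\<lambda>i. 0)" "y = e2 u" by blast
    then have "u \<in> sphere_outside n \<or> u \<in> B" using in_B[of u] by (simp add: sphere_outside_def) linarith
    then show "y \<in> e2 ` sphere_outside n \<union> e2 ` B" using u(3) by blast
  next
    fix y assume "y \<in> e2 ` sphere_outside n \<union> e2 ` B"
    then obtain u where u: "u \<in> sphere_outside n \<union> B" "y = e2 u" by blast
    have "u \<noteq> (\<lambda>i. 0)" using u(1) B_nonzero by (auto simp: sphere_outside_def sqnorm_def)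
    then show "y \<in> e2 ` topspace ?E - {?x}" using u not_zero[of u] BE by (auto simp: sphere_outside_def)
  qed
  have out_P2: "e2 ` sphere_outside n \<subseteq> ?P2" using outP2 by (auto simp: sphere_outside_def)
  have out_P1: "e1 ` sphere_outside n \<subseteq> ?P1" using outP1 by (auto simp: sphere_outside_def)
  show ?thesis
  proof (rule that[of p])
    have "p ` (?P2 \<union> e2 ` B) = h2 ` ?P2 \<union> h1 ` e1 ` sphere_outside n"
      unfolding image_Un pB_image using pP by (simp cong: image_cong_simp)
    then show "p ` (topspace X2 - {?x}) = h2 ` ?P2 \<union> h1 ` e1 ` sphere_outside n" unfolding cover .
    have "p ` e2 ` sphere_outside n = h2 ` e2 ` sphere_outside n" using pP out_P2 by (intro image_cong refl) blast
    then show "p ` (e2 ` topspace ?E - {?x}) = h2 ` e2 ` sphere_outside n \<union> h1 ` e1 ` sphere_outside n"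
      unfolding cover_E image_Un pB_image by simp
    have cross: False if y: "y \<in> ?P2" and u: "u \<in> B" "e2 u \<notin> ?P2" and eq: "p y = p (e2 u)" for y u
    proof -
      have w: "inversion n u \<in> sphere_outside n" using inv_out[OF u(1)] .
      have hy: "h2 y = h1 (e1 (inversion n u))" using eq unfolding pP[OF y] pB[OF u(1)] .
      have wP1: "e1 (inversion n u) \<in> ?P1" using w out_P1 by blast
      have "h2 y \<in> h1 ` ?P1" unfolding hy using wP1 by (rule imageI)
      moreover have "h2 y \<in> h2 ` ?P2" using y by (rule imageI)
      ultimately have "h2 y \<in> h1 ` e1 ` unit_sphere n" using meet by blast
      then obtain v where v: "v \<in> unit_sphere n" "h2 y = h1 (e1 v)" by blast
      have v_out: "v \<in> sphere_outside n" "v \<in> topspace ?E" using v(1) sphere by (simp_all add: sphere_outside_def)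
      have "e1 v = e1 (inversion n u)"
        by (rule inj_onD[OF injh1]) (use hy v(2) v_out(1) out_P1 wP1 in auto)
      then have "v = inversion n u" by (rule inj_onD[OF inj1]) (use v_out w in \<open>auto simp: sphere_outside_def\<close>)
      then have "sqnorm n (inversion n u) = 1" using v(1) sphere by blast
      then have "sqnorm n u = 1" unfolding sqnorm_inversion by simp
      then show False using outP2[of u] u BE by auto
    qed
    show "inj_on p (topspace X2 - {?x})"
    proof (rule inj_onI)
      fix y z assume "y \<in> topspace X2 - {?x}" "z \<in> topspace X2 - {?x}" and eq: "p y = p z"
      then have mem: "y \<in> ?P2 \<union> e2 ` B" "z \<in> ?P2 \<union> e2 ` B" unfolding cover by blast+
      show "y = z"
      proof (cases "y \<in> ?P2")
        case y: True
        show ?thesis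
        proof (cases "z \<in> ?P2")
          case True
          then show ?thesis using y eq pP injh2 by (simp add: inj_on_eq_iff)
        next
          case False
          then show ?thesis using mem(2) cross[OF y] eq by blast
        qed
      next
        case y: False
        then obtain u where u: "u \<in> B" "y = e2 u" using mem(1) by blast
        show ?thesis
        proof (cases "z \<in> ?P2")
          case True
          then show ?thesis using cross[OF True u(1)] y u(2) eq by simp
        next
          case False
          then obtain v where v: "v \<in> B" "z = e2 v" using mem(2) by blast
          have "h1 (e1 (inversion n u)) = h1 (e1 (inversion n v))" using eq pB u v by simp
          then have "e1 (inversion n u) = e1 (inversion n v)"
            by (rule inj_onD[OF injh1]) (use inv_out[OF u(1)] inv_out[OF v(1)] out_P1 in blast)+
          then have "inversion n u = inversion n v"
            by (rule inj_onD[OF inj1]) (use inv_out[OF u(1)] inv_out[OF v(1)] in \<open>auto simp: sphere_outside_def\<close>)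
          then have "inversion n (inversion n u) = inversion n (inversion n v)" by simp
          then have "u = v" using inversion_inversion[OF subsetD[OF BE u(1)]] inversion_inversion[OF subsetD[OF BE v(1)]] by simp
          then show ?thesis using u v by simp
        qed
      qed
    qed
    let ?X = "subtopology X2 (topspace X2 - {?x})"
    let ?T = "\<lambda>b. if b then ?P2 else e2 ` B"
    let ?f = "\<lambda>b. if b then h2 else (h1 \<circ> (e1 \<circ> (inversion n \<circ> e')))"
    show "continuous_map ?X Y p"
    proof (rule pasting_lemma_closed[where I = UNIV and T = ?T and f = ?f])
      have "openin (subtopology X2 (e2 ` topspace ?E)) (e2 ` open_unit_ball n)"
        using openin_unit_ball[of n] e2(1) homeomorphic_imp_open_map unfolding embedding_map_def open_map_def by blast
      then have "openin X2 (e2 ` open_unit_ball n)" using e2(2) openin_trans_full by blast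
      then have cP2: "closedin X2 ?P2" unfolding remove_ball_def by blast
      have "compactin X2 (e2 ` {u \<in> topspace ?E. sqnorm n u \<le> 1})"
        using image_compactin[OF compactin_unit_disc embedding_imp_continuous_map[OF e2(1)]] .
      then have cB: "closedin X2 (e2 ` {u \<in> topspace ?E. sqnorm n u \<le> 1})" by (rule compactin_imp_closedin[OF X2])
      have "?P2 = ?P2 \<inter> (topspace X2 - {?x})" using P2 zeroP2 by blast
      then have 1: "closedin ?X ?P2" using cP2 unfolding closedin_subtopology by blast
      have "e2 ` B = e2 ` {u \<in> topspace ?E. sqnorm n u \<le> 1} \<inter> (topspace X2 - {?x})"
      proof (intro equalityI subsetI)
        fix y assume "y \<in> e2 ` B"
        then show "y \<in> e2 ` {u \<in> topspace ?E. sqnorm n u \<le> 1} \<inter> (topspace X2 - {?x})"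
          using cover BE unfolding B_def by blast
      next
        fix y assume "y \<in> e2 ` {u \<in> topspace ?E. sqnorm n u \<le> 1} \<inter> (topspace X2 - {?x})"
        then show "y \<in> e2 ` B" using in_B by blast
      qed
      then have 2: "closedin ?X (e2 ` B)" using cB unfolding closedin_subtopology by blast
      show "closedin ?X (?T b)" for b using 1 2 by simp
      have sub: "subtopology ?X ?P2 = subtopology X2 ?P2" "subtopology ?X (e2 ` B) = subtopology X2 (e2 ` B)"
        unfolding subtopology_subtopology using cover by (auto intro!: arg_cong[of _ _ "subtopology X2"])
      have "continuous_map (subtopology X2 (e2 ` topspace ?E)) ?E e'" using e' unfolding homeomorphic_maps_def by blast
      then have "continuous_map (subtopology X2 (e2 ` B)) ?E e'"
        by (rule continuous_map_from_subtopology_mono) (rule image_mono[OF BE])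
      then have c1: "continuous_map (subtopology X2 (e2 ` B)) (subtopology ?E B) e'"
        using e'e BE by (intro continuous_map_into_subtopology) auto
      have c2: "continuous_map (subtopology ?E B) (subtopology ?E (sphere_outside n)) (inversion n)"
        using continuous_map_inversion[OF BE B_nonzero] inv_out by (intro continuous_map_into_subtopology) auto
      have c3: "continuous_map (subtopology ?E (sphere_outside n)) (subtopology X1 ?P1) e1"
        using embedding_imp_continuous_map[OF e1] out_P1
        by (intro continuous_map_into_subtopology continuous_map_from_subtopology) auto
      have "continuous_map (subtopology X2 (e2 ` B)) Y (h1 \<circ> (e1 \<circ> (inversion n \<circ> e')))"
        using continuous_map_compose[OF continuous_map_compose[OF continuous_map_compose[OF c1 c2] c3] embedding_imp_continuous_map[OF h1]] .
      then show "continuous_map (subtopology ?X (?T b)) Y (?f b)" for b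
        using embedding_imp_continuous_map[OF h2] sub by simp
      have f_eq: "?f b y = p y" if y: "y \<in> ?T b" for b y
      proof (cases b)
        case False
        then obtain u where "u \<in> B" "y = e2 u" using y by auto
        then show ?thesis using False pB[of u] e'e[of u] BE by auto
      qed (use y pP in simp)
      show "?f b y = ?f c y" if "y \<in> topspace ?X \<inter> ?T b \<inter> ?T c" for b c y
      proof -
        have y: "y \<in> ?T b" "y \<in> ?T c" using that by blast+
        show ?thesis by (rule trans[OF f_eq[OF y(1)] f_eq[OF y(2), symmetric]])
      qed
      show "\<exists>b. b \<in> UNIV \<and> y \<in> ?T b \<and> p y = ?f b y" if "y \<in> topspace ?X" for y
      proof -
        have "y \<in> ?T True \<or> y \<in> ?T False" using that cover by auto
        then show ?thesis using f_eq[of y] by (metis UNIV_I)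
      qed
    qed simp
  qed
qed

section \<open>Pinching a summand\<close>

text \<open>The map \<open>q\<close> collapses one summand of a connected sum to a disc \<open>E\<close> and is injective over the
  complement of its centre \<open>x\<close>.\<close>

locale pinch_map =
  fixes Y :: "'c topology" and X :: "'a topology" and q :: "'c \<Rightarrow> 'a" and U V :: "'c set" and E :: "'a set" and x :: 'a
  assumes cont: "continuous_map Y X q"
    and cover: "openin Y U" "openin Y V" "topspace Y = U \<union> V"
    and neck: "acyclic1 (subtopology Y (U \<inter> V))"
    and homeo: "homeomorphic_map (subtopology Y U) (subtopology X (topspace X - {x})) q"
    and disc: "openin X E" "openin X (topspace X - {x})" "x \<in> E"
      "acyclic1 (subtopology X E)" "acyclic1 (subtopology X (E - {x}))"
    and pinched: "q ` V \<subseteq> E"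
begin

lemma neck_joined: "a \<in> U \<inter> V \<Longrightarrow> c \<in> U \<inter> V \<Longrightarrow> joined (subtopology Y (U \<inter> V)) a c"
  using neck cover(3) unfolding acyclic1_def by auto

lemma punctured_cover: "topspace X = (topspace X - {x}) \<union> E" "(topspace X - {x}) \<inter> E = E - {x}"
  using openin_subset[OF disc(1)] disc(3) by auto

lemma kills:
  assumes "c \<in> cycles1 (subtopology Y V)"
  shows "chain_map 1 q c \<in> bounds1 X"
proof -
  have "continuous_map (subtopology Y V) (subtopology X E) q"
    using pinched by (intro continuous_map_into_subtopology continuous_map_from_subtopology cont) auto
  from chain_map_cycles1[OF this assms] have "chain_map 1 q c \<in> bounds1 (subtopology X E)"
    using disc(4) unfolding acyclic1_def by blast
  then show ?thesis by (rule bounds1_subtopologyD)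
qed

lemma lift:
  assumes w: "w \<in> cycles1 X"
  obtains c where "c \<in> cycles1 (subtopology Y U)" "chain_map 1 q c - w \<in> bounds1 X"
proof -
  obtain g where g: "homeomorphic_maps (subtopology Y U) (subtopology X (topspace X - {x})) q g"
    using homeo unfolding homeomorphic_map_maps by blast
  have W: "joined (subtopology X ((topspace X - {x}) \<inter> E)) a c"
    if "a \<in> (topspace X - {x}) \<inter> E" "c \<in> (topspace X - {x}) \<inter> E" for a c
  proof -
    have "topspace (subtopology X (E - {x})) = E - {x}" using openin_subset[OF disc(1)] by auto
    then show ?thesis using disc(5) that unfolding punctured_cover(2) acyclic1_def by blast
  qed
  obtain w1 w2 where w12: "w1 \<in> cycles1 (subtopology X (topspace X - {x}))" "w2 \<in> cycles1 (subtopology X E)"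
    "w - (w1 + w2) \<in> bounds1 X"
    using cycles1_union[OF disc(2,1) punctured_cover(1) W w] by blast
  have "w2 \<in> bounds1 (subtopology X E)" using w12(2) disc(4) unfolding acyclic1_def by blast
  then have w2: "w2 \<in> bounds1 X" by (rule bounds1_subtopologyD)
  have gc: "continuous_map (subtopology X (topspace X - {x})) (subtopology Y U) g"
    using g unfolding homeomorphic_maps_def by blast
  have qg: "q (g a) = a" if "a \<in> topspace (subtopology X (topspace X - {x}))" for a
    using g that unfolding homeomorphic_maps_def by blast
  have "chain_map 1 q (chain_map 1 g w1) = chain_map 1 (q \<circ> g) w1" by (simp add: chain_map_compose)
  also have "\<dots> = w1"
    using w12(1) qg by (intro chain_map_id_gen[of 1 "subtopology X (topspace X - {x})"]) (auto simp: cycles1_def)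
  finally have "chain_map 1 q (chain_map 1 g w1) - w = - (w - (w1 + w2)) - w2" by simp
  then have "chain_map 1 q (chain_map 1 g w1) - w \<in> bounds1 X"
    using bounds1_D(2)[OF bounds1_D(3)[OF w12(3)] w2] by (simp only:)
  moreover have "chain_map 1 g w1 \<in> cycles1 (subtopology Y U)"
    by (rule chain_map_cycles1[OF gc w12(1)])
  ultimately show ?thesis using that by blast
qed

lemma detects:
  assumes c: "c \<in> cycles1 (subtopology Y U)" and qc: "chain_map 1 q c \<in> bounds1 X"
  shows "c \<in> bounds1 Y"
proof -
  let ?X = "subtopology X (topspace X - {x})"
  obtain g where g: "homeomorphic_maps (subtopology Y U) ?X q g"
    using homeo unfolding homeomorphic_map_maps by blast
  have qc': "continuous_map (subtopology Y U) ?X q" and gc: "continuous_map ?X (subtopology Y U) g"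
    using g unfolding homeomorphic_maps_def by blast+
  have W: "cycles1 (subtopology X ((topspace X - {x}) \<inter> E)) \<subseteq> bounds1 (subtopology X ((topspace X - {x}) \<inter> E))"
    using disc(5) unfolding punctured_cover(2) acyclic1_def by blast
  have "chain_map 1 q c \<in> bounds1 ?X"
    by (rule bounds1_union[OF disc(2,1) punctured_cover(1) W chain_map_cycles1[OF qc' c] qc])
  then have "chain_map 1 g (chain_map 1 q c) \<in> bounds1 (subtopology Y U)" by (rule chain_map_bounds1[OF gc])
  moreover have "chain_map 1 g (chain_map 1 q c) = chain_map 1 (g \<circ> q) c" by (simp add: chain_map_compose)
  moreover have "\<dots> = c"
    using c g by (intro chain_map_id_gen[of 1 "subtopology Y U"]) (auto simp: cycles1_def homeomorphic_maps_def)
  ultimately show ?thesis by (metis bounds1_subtopologyD)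
qed

end

lemma frag_cmul_bounds1: "c \<in> bounds1 X \<Longrightarrow> frag_cmul k c \<in> bounds1 X"
  by (rule frag_subgroup_cmul[OF frag_subgroup_bounds1])

lemma chain_map_diff_cmul:
  "chain_map p f (a - c) = chain_map p f a - chain_map p f c"
  "chain_map p f (a + c) = chain_map p f a + chain_map p f c"
  "chain_map p f (frag_cmul k a) = frag_cmul k (chain_map p f a)"
  by (simp_all add: chain_map_def frag_extend_diff frag_extend_add frag_extend_cmul)

text \<open>Both pinch maps together induce an isomorphism on first homology.\<close>

lemma pinch_pair_detects:
  assumes P1: "pinch_map Y X1 q1 U V E1 x1" and P2: "pinch_map Y X2 q2 V U E2 x2"
    and c: "c \<in> cycles1 Y" and qc: "chain_map 1 q1 c \<in> bounds1 X1" "chain_map 1 q2 c \<in> bounds1 X2"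
  shows "c \<in> bounds1 Y"
proof -
  interpret P1: pinch_map Y X1 q1 U V E1 x1 by (rule P1)
  interpret P2: pinch_map Y X2 q2 V U E2 x2 by (rule P2)
  obtain c1 c2 where c12: "c1 \<in> cycles1 (subtopology Y U)" "c2 \<in> cycles1 (subtopology Y V)" "c - (c1 + c2) \<in> bounds1 Y"
    using cycles1_union[OF P1.cover P1.neck_joined c] by blast
  have d: "chain_map 1 q1 (c - (c1 + c2)) \<in> bounds1 X1" "chain_map 1 q2 (c - (c1 + c2)) \<in> bounds1 X2"
    using chain_map_bounds1[OF P1.cont c12(3)] chain_map_bounds1[OF P2.cont c12(3)] by blast+
  have "chain_map 1 q1 c - chain_map 1 q1 (c - (c1 + c2)) - chain_map 1 q1 c2 \<in> bounds1 X1"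
    using bounds1_D(2)[OF bounds1_D(2)[OF qc(1) d(1)] P1.kills[OF c12(2)]] .
  then have "chain_map 1 q1 c1 \<in> bounds1 X1" unfolding chain_map_diff_cmul by simp
  then have 1: "c1 \<in> bounds1 Y" by (rule P1.detects[OF c12(1)])
  have "chain_map 1 q2 c - chain_map 1 q2 (c - (c1 + c2)) - chain_map 1 q2 c1 \<in> bounds1 X2"
    using bounds1_D(2)[OF bounds1_D(2)[OF qc(2) d(2)] P2.kills[OF c12(1)]] .
  then have "chain_map 1 q2 c2 \<in> bounds1 X2" unfolding chain_map_diff_cmul by simp
  then have 2: "c2 \<in> bounds1 Y" by (rule P2.detects[OF c12(2)])
  from bounds1_D(4)[OF c12(3) bounds1_D(4)[OF 1 2]] show ?thesis by simp
qed

text \<open>Cycles of a summand lift to its punctured copy, and the other pinch map kills the lifts. Scaling the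
  forms of each summand by the factor of the other one makes the factors equal.\<close>

lemma dual_basis_pinch:
  assumes P1: "pinch_map Y X1 q1 U V E1 x1" and P2: "pinch_map Y X2 q2 V U E2 x2"
    and d1: "dual_basis (cycles1 X1) (bounds1 X1) b1 w1 f1 N1" and d2: "dual_basis (cycles1 X2) (bounds1 X2) b2 w2 f2 N2"
  obtains w where "dual_basis (cycles1 Y) (bounds1 Y) (b1 + b2) w
     (\<lambda>j c. if j < b1 then N2 * f1 j (chain_map 1 q1 c) else N1 * f2 (j - b1) (chain_map 1 q2 c)) (N1 * N2)"
proof -
  interpret P1: pinch_map Y X1 q1 U V E1 x1 by (rule P1)
  interpret P2: pinch_map Y X2 q2 V U E2 x2 by (rule P2)
  have N: "N1 > 0" "N2 > 0" using d1 d2 by (simp_all add: dual_basis_def)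
  have w1: "w1 j \<in> cycles1 X1" if "j < b1" for j using d1 that by (simp add: dual_basis_def)
  have w2: "w2 j \<in> cycles1 X2" if "j < b2" for j using d2 that by (simp add: dual_basis_def)
  have f1: "additive_on (cycles1 X1) (f1 j)" "\<And>a. a \<in> bounds1 X1 \<Longrightarrow> f1 j a = 0" if "j < b1" for j
    using d1 that by (simp_all add: dual_basis_def)
  have f2: "additive_on (cycles1 X2) (f2 j)" "\<And>a. a \<in> bounds1 X2 \<Longrightarrow> f2 j a = 0" if "j < b2" for j
    using d2 that by (simp_all add: dual_basis_def)
  have fw1: "f1 j (w1 i) = (if i = j then N1 else 0)" if "i < b1" "j < b1" for i j using d1 that by (simp add: dual_basis_def)
  have fw2: "f2 j (w2 i) = (if i = j then N2 else 0)" if "i < b2" "j < b2" for i j using d2 that by (simp add: dual_basis_def)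
  have "\<exists>c. c \<in> cycles1 (subtopology Y U) \<and> chain_map 1 q1 c - w1 j \<in> bounds1 X1" if "j < b1" for j
    using P1.lift[OF w1[OF that]] by blast
  then obtain l1 where l1: "\<And>j. j < b1 \<Longrightarrow> l1 j \<in> cycles1 (subtopology Y U) \<and> chain_map 1 q1 (l1 j) - w1 j \<in> bounds1 X1" by metis
  have "\<exists>c. c \<in> cycles1 (subtopology Y V) \<and> chain_map 1 q2 c - w2 j \<in> bounds1 X2" if "j < b2" for j
    using P2.lift[OF w2[OF that]] by blast
  then obtain l2 where l2: "\<And>j. j < b2 \<Longrightarrow> l2 j \<in> cycles1 (subtopology Y V) \<and> chain_map 1 q2 (l2 j) - w2 j \<in> bounds1 X2" by metis
  define w where "w j = (if j < b1 then l1 j else l2 (j - b1))" for j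
  define f where "f = (\<lambda>j c. if j < b1 then N2 * f1 j (chain_map 1 q1 c) else N1 * f2 (j - b1) (chain_map 1 q2 c))"
  have cm1: "chain_map 1 q1 c \<in> cycles1 X1" and cm2: "chain_map 1 q2 c \<in> cycles1 X2" if "c \<in> cycles1 Y" for c
    using chain_map_cycles1[OF P1.cont that] chain_map_cycles1[OF P2.cont that] .
  have l1Y: "l1 j \<in> cycles1 Y" if "j < b1" for j using l1[OF that] by (blast intro: cycles1_subtopologyD)
  have l2Y: "l2 j \<in> cycles1 Y" if "j < b2" for j using l2[OF that] by (blast intro: cycles1_subtopologyD)
  have v11: "f1 j (chain_map 1 q1 (l1 i)) = (if i = j then N1 else 0)" if "i < b1" "j < b1" for i j
  proof -
    have "f1 j (chain_map 1 q1 (l1 i) - w1 i) = f1 j (chain_map 1 q1 (l1 i)) - f1 j (w1 i)"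
      by (rule additive_on_diff[OF frag_subgroup_cycles1 f1(1)[OF that(2)] cm1[OF l1Y[OF that(1)]] w1[OF that(1)]])
    then show ?thesis using f1(2)[OF that(2)] l1[OF that(1)] fw1[OF that] by simp
  qed
  have v22: "f2 j (chain_map 1 q2 (l2 i)) = (if i = j then N2 else 0)" if "i < b2" "j < b2" for i j
  proof -
    have "f2 j (chain_map 1 q2 (l2 i) - w2 i) = f2 j (chain_map 1 q2 (l2 i)) - f2 j (w2 i)"
      by (rule additive_on_diff[OF frag_subgroup_cycles1 f2(1)[OF that(2)] cm2[OF l2Y[OF that(1)]] w2[OF that(1)]])
    then show ?thesis using f2(2)[OF that(2)] l2[OF that(1)] fw2[OF that] by simp
  qed
  have v12: "f1 j (chain_map 1 q1 (l2 i)) = 0" if "i < b2" "j < b1" for i j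
    using f1(2)[OF that(2)] P1.kills l2[OF that(1)] by blast
  have v21: "f2 j (chain_map 1 q2 (l1 i)) = 0" if "i < b1" "j < b2" for i j
    using f2(2)[OF that(2)] P2.kills l1[OF that(1)] by blast
  have "dual_basis (cycles1 Y) (bounds1 Y) (b1 + b2) w f (N1 * N2)"
    unfolding dual_basis_def
  proof (intro conjI allI impI ballI)
    show "N1 * N2 > 0" using N by simp
    fix j assume j: "j < b1 + b2"
    show "w j \<in> cycles1 Y" using l1Y l2Y j by (auto simp: w_def)
    show "additive_on (cycles1 Y) (f j)"
      unfolding additive_on_def
    proof (intro ballI)
      fix a c assume ac: "a \<in> cycles1 Y" "c \<in> cycles1 Y"
      show "f j (a + c) = f j a + f j c"
      proof (cases "j < b1")
        case True
        have "f1 j (chain_map 1 q1 a + chain_map 1 q1 c) = f1 j (chain_map 1 q1 a) + f1 j (chain_map 1 q1 c)"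
          using f1(1)[OF True] cm1 ac unfolding additive_on_def by blast
        then show ?thesis using True unfolding f_def chain_map_diff_cmul by (simp add: distrib_left)
      next
        case False
        then have "j - b1 < b2" using j by simp
        then have "f2 (j - b1) (chain_map 1 q2 a + chain_map 1 q2 c) = f2 (j - b1) (chain_map 1 q2 a) + f2 (j - b1) (chain_map 1 q2 c)"
          using f2(1) cm2 ac unfolding additive_on_def by blast
        then show ?thesis using False unfolding f_def chain_map_diff_cmul by (simp add: distrib_left)
      qed
    qed
    show "f j a = 0" if "a \<in> bounds1 Y" for a
      using f1(2) f2(2) chain_map_bounds1[OF P1.cont that] chain_map_bounds1[OF P2.cont that] j unfolding f_def by simp
    fix i assume i: "i < b1 + b2"
    show "f j (w i) = (if i = j then N1 * N2 else 0)"
      using v11[of i j] v12[of "i - b1" j] v21[of i "j - b1"] v22[of "i - b1" "j - b1"] i j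
      unfolding f_def w_def by (cases "i < b1"; cases "j < b1") (simp_all, linarith+)
  next
    fix c assume c: "c \<in> cycles1 Y" and z: "\<forall>j<b1 + b2. f j c = 0"
    have "f1 j (chain_map 1 q1 c) = 0" if "j < b1" for j using z[rule_format, of j] that N by (simp add: f_def)
    then obtain n1 where n1: "n1 > 0" "frag_cmul n1 (chain_map 1 q1 c) \<in> bounds1 X1"
      using d1 cm1[OF c] unfolding dual_basis_def by blast
    have "f2 j (chain_map 1 q2 c) = 0" if "j < b2" for j using z[rule_format, of "b1 + j"] that N by (simp add: f_def)
    then obtain n2 where n2: "n2 > 0" "frag_cmul n2 (chain_map 1 q2 c) \<in> bounds1 X2"
      using d2 cm2[OF c] unfolding dual_basis_def by blast
    have "frag_cmul n2 (frag_cmul n1 (chain_map 1 q1 c)) \<in> bounds1 X1" by (rule frag_cmul_bounds1[OF n1(2)])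
    then have 1: "chain_map 1 q1 (frag_cmul (n1 * n2) c) \<in> bounds1 X1"
      unfolding chain_map_diff_cmul by (simp add: mult.commute)
    have "frag_cmul n1 (frag_cmul n2 (chain_map 1 q2 c)) \<in> bounds1 X2" by (rule frag_cmul_bounds1[OF n2(2)])
    then have 2: "chain_map 1 q2 (frag_cmul (n1 * n2) c) \<in> bounds1 X2"
      unfolding chain_map_diff_cmul by simp
    have "frag_cmul (n1 * n2) c \<in> bounds1 Y"
      by (rule pinch_pair_detects[OF P1 P2 frag_subgroup_cmul[OF frag_subgroup_cycles1 c] 1 2])
    then show "\<exists>n>0. frag_cmul n c \<in> bounds1 Y" using n1(1) n2(1) by (intro exI[of _ "n1 * n2"]) simp
  qed
  then show ?thesis using that unfolding f_def by blast
qed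

lemma betti_1_dual_basis:
  assumes "dual_basis (cycles1 X) (bounds1 X) b x f N"
  shows "betti 1 X = b"
  unfolding betti_def
proof (rule abelian_rank_dual_basis[OF _ frag_subgroup_cycles1 _ _ _ assms])
  let ?S = "relcycle_group 1 X {}" and ?I = "singular_relboundary_set 1 X {}"
  let ?\<pi> = "\<lambda>c. ?I #>\<^bsub>?S\<^esub> c"
  have G: "homology_group (int 1) X = ?S Mod ?I" by (rule nontrivial_relative_homology_group)
  have S: "comm_group ?S" by (rule abelian_relcycle_group)
  have I: "subgroup ?I ?S" by (rule subgroup_singular_relboundary_relcycle)
  have car: "carrier ?S = cycles1 X" by (auto simp: cycles1_relcycle)
  note facts = comm_FactGroup_facts[OF S I]
  show "comm_group (homology_group (int 1) X)" unfolding G by (rule facts(1))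
  show "?\<pi> ` cycles1 X = carrier (homology_group (int 1) X)" unfolding G car[symmetric] by (rule facts(2))
  show "?\<pi> (a + c) = ?\<pi> a \<otimes>\<^bsub>homology_group (int 1) X\<^esub> ?\<pi> c" if "a \<in> cycles1 X" "c \<in> cycles1 X" for a c
    using facts(3)[of a c] that unfolding G car by (simp add: relcycle_group_def)
  show "?\<pi> a = \<one>\<^bsub>homology_group (int 1) X\<^esub> \<longleftrightarrow> a \<in> bounds1 X" if "a \<in> cycles1 X" for a
    using facts(4)[of a] that unfolding G car bounds1_relboundary by simp
qed

section \<open>Pinch maps of a connected sum\<close>

text \<open>The inverse of an embedding of the punctured space, extended by the puncture.\<close>

lemma pinch_mapI:
  assumes X: "compact_space X" "Hausdorff_space X" "locally_Euclidean 3 X"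
    and Y: "Hausdorff_space Y" "locally_Euclidean 3 Y"
    and e: "embedding_map (Euclidean_space 3) X e" "openin X (e ` topspace (Euclidean_space 3))" and x: "x = e (\<lambda>i. 0)"
    and p: "continuous_map (subtopology X (topspace X - {x})) Y p" "inj_on p (topspace X - {x})"
    and U: "U = p ` (topspace X - {x})" and V: "openin Y V" "topspace Y = U \<union> V"
    and UV: "U \<inter> V = p ` (e ` topspace (Euclidean_space 3) - {x})"
  shows "\<exists>q. pinch_map Y X q U V (e ` topspace (Euclidean_space 3)) x"
proof -
  let ?E = "Euclidean_space 3"
  have zero: "(\<lambda>i. 0) \<in> topspace ?E" by (simp add: topspace_Euclidean_space)
  have eX: "e ` topspace ?E \<subseteq> topspace X" using e(2) by (rule openin_subset)
  have xE: "x \<in> e ` topspace ?E" using zero x by blast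
  then have xX: "x \<in> topspace X" using eX by blast
  have op: "openin Y (p ` S)" if S: "openin X S" "S \<subseteq> topspace X - {x}" for S
    using continuous_map_from_subtopology_mono[OF p(1) S(2)] inj_on_subset[OF p(2) S(2)]
    by (rule injective_map_open_image[OF X(3) Y(2) S(1)])
  have "closedin X {x}" using xX by (intro compactin_imp_closedin[OF X(2)]) simp
  then have ox: "openin X (topspace X - {x})" by blast
  define q where "q y = (if y \<in> U then inv_into (topspace X - {x}) p y else x)" for y
  have qp: "q (p a) = a" if "a \<in> topspace X - {x}" for a
    using that p(2) unfolding q_def U by simp
  have pq: "p (q y) = y" and qU: "q y \<in> topspace X - {x}" if "y \<in> U" for y
    using that f_inv_into_f[of y p "topspace X - {x}"] inv_into_into[of y p "topspace X - {x}"] unfolding q_def U by auto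
  have qx: "q y = x" if "y \<notin> p ` (topspace X - {x})" for y using that unfolding q_def U by simp
  have q: "continuous_map Y X q"
    by (rule extended_inverse_continuous[OF X(1) xX Y(1) p op qp qx])
  have oU: "openin Y U" unfolding U by (rule op[OF ox order_refl])
  have cE: "continuous_map ?E X e" by (rule embedding_imp_continuous_map[OF e(1)])
  obtain e' where e': "homeomorphic_maps ?E (subtopology X (e ` topspace ?E)) e e'"
    using e(1) unfolding embedding_map_def homeomorphic_map_maps by blast
  have e'c: "continuous_map (subtopology X (e ` topspace ?E)) ?E e'" using e' unfolding homeomorphic_maps_def by blast
  have e'e: "e' (e u) = u" if "u \<in> topspace ?E" for u using e' that unfolding homeomorphic_maps_def by blast
  have acE: "acyclic1 (subtopology X (e ` topspace ?E))"
    using acyclic1_homeomorphic[OF acyclic1_Euclidean_space] e' unfolding homeomorphic_space_def by blast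
  have acE': "acyclic1 (subtopology X (e ` topspace ?E - {x}))"
  proof (rule acyclic1_retract[OF acyclic1_punctured, where f = e and g = e'])
    have ne: "e u \<noteq> x" if "u \<in> topspace ?E - {\<lambda>i. 0}" for u using that e'e[of u] e'e[OF zero] x by auto
    show "continuous_map (subtopology ?E (topspace ?E - {\<lambda>i. 0})) (subtopology X (e ` topspace ?E - {x})) e"
      using ne by (intro continuous_map_into_subtopology continuous_map_from_subtopology cE) auto
    show "continuous_map (subtopology X (e ` topspace ?E - {x})) (subtopology ?E (topspace ?E - {\<lambda>i. 0})) e'"
      using e'e x by (intro continuous_map_into_subtopology continuous_map_from_subtopology_mono[OF e'c]) auto
    show "e (e' y) = y" if "y \<in> topspace (subtopology X (e ` topspace ?E - {x}))" for y using that e'e by auto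
  qed
  have EX: "e ` topspace ?E - {x} \<subseteq> topspace X - {x}" using eX by blast
  have "pinch_map Y X q U V (e ` topspace ?E) x"
  proof
    show "continuous_map Y X q" by (rule q)
    show "openin Y U" by (rule oU)
    show "openin Y V" "topspace Y = U \<union> V" by (rule V)+
    show "openin X (e ` topspace ?E)" by (rule e(2))
    show "openin X (topspace X - {x})" by (rule ox)
    show "x \<in> e ` topspace ?E" by (rule xE)
    show "acyclic1 (subtopology X (e ` topspace ?E))" by (rule acE)
    show "acyclic1 (subtopology X (e ` topspace ?E - {x}))" by (rule acE')
    show "acyclic1 (subtopology Y (U \<inter> V))"
    proof (rule acyclic1_retract[OF acE', where f = p and g = q])
      show "continuous_map (subtopology X (e ` topspace ?E - {x})) (subtopology Y (U \<inter> V)) p"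
        unfolding UV by (intro continuous_map_into_subtopology continuous_map_from_subtopology_mono[OF p(1) EX]) auto
      have "q y \<in> e ` topspace ?E - {x}" if "y \<in> U \<inter> V" for y
      proof -
        obtain a where a: "a \<in> e ` topspace ?E - {x}" "y = p a" using \<open>y \<in> U \<inter> V\<close> unfolding UV by blast
        then show ?thesis using qp[of a] EX by auto
      qed
      then show "continuous_map (subtopology Y (U \<inter> V)) (subtopology X (e ` topspace ?E - {x})) q"
        by (intro continuous_map_into_subtopology continuous_map_from_subtopology q) auto
      show "p (q y) = y" if "y \<in> topspace (subtopology Y (U \<inter> V))" for y using that pq by simp
    qed
    show "homeomorphic_map (subtopology Y U) (subtopology X (topspace X - {x})) q"
      unfolding homeomorphic_map_maps homeomorphic_maps_def
    proof (intro exI[of _ p] conjI ballI)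
      show "continuous_map (subtopology Y U) (subtopology X (topspace X - {x})) q"
        using qU by (intro continuous_map_into_subtopology continuous_map_from_subtopology q) auto
      show "continuous_map (subtopology X (topspace X - {x})) (subtopology Y U) p"
        using p(1) U by (intro continuous_map_into_subtopology) auto
    qed (use pq qp in auto)
    show "q ` V \<subseteq> e ` topspace ?E"
    proof
      fix a assume "a \<in> q ` V"
      then obtain y where y: "y \<in> V" "a = q y" by blast
      show "a \<in> e ` topspace ?E"
      proof (cases "y \<in> U")
        case True
        then obtain c where c: "c \<in> e ` topspace ?E - {x}" "y = p c" using UV y(1) by blast
        then show ?thesis using qp[of c] EX y(2) by auto
      next
        case False
        then show ?thesis using xE y(2) by (simp add: q_def)
      qed
    qed
  qed
  then show ?thesis by blast
qed

lemma outside_in_remove_ball: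
  assumes e: "embedding_map (Euclidean_space n) X e"
  shows "e ` sphere_outside n \<subseteq> remove_ball n X e"
proof -
  have inj: "inj_on e (topspace (Euclidean_space n))"
    using e homeomorphic_imp_injective_map unfolding embedding_map_def by blast
  have eX: "e u \<in> topspace X" if "u \<in> topspace (Euclidean_space n)" for u
    using embedding_imp_continuous_map[OF e] that by (auto simp: continuous_map_def)
  have "e u \<notin> e ` open_unit_ball n" if u: "u \<in> sphere_outside n" for u
  proof
    assume "e u \<in> e ` open_unit_ball n"
    then obtain v where v: "v \<in> open_unit_ball n" "e u = e v" by blast
    have "u = v" by (rule inj_onD[OF inj]) (use u v in \<open>auto simp: sphere_outside_def open_unit_ball_def\<close>)
    then show False using u v(1) by (simp add: sphere_outside_def open_unit_ball_def sqnorm_def)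
  qed
  then show ?thesis using eX by (auto simp: remove_ball_def sphere_outside_def)
qed

text \<open>Both inclusions extend over a punctured ball. The images of the extensions cover the sum, and they
  overlap in the common image of the two punctured discs.\<close>

theorem connected_sum_pinch_maps:
  assumes "connected_sum 3 Y1 z1 Y2 z2 Y z"
  obtains q1 q2 U1 U2 E1 E2 x1 x2 where "pinch_map Y Y1 q1 U1 U2 E1 x1" "pinch_map Y Y2 q2 U2 U1 E2 x2"
proof -
  let ?E = "Euclidean_space 3"
  let ?O = "sphere_outside 3"
  have M1: "closed_manifold 3 Y1" and M2: "closed_manifold 3 Y2" and M: "closed_manifold 3 Y"
    using assms unfolding connected_sum_def closed_oriented_manifold_def by blast+
  obtain e1 e2 h1 h2 where e1: "embedding_map ?E Y1 e1" and e2: "embedding_map ?E Y2 e2"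
    and h1: "embedding_map (subtopology Y1 (remove_ball 3 Y1 e1)) Y h1"
    and h2: "embedding_map (subtopology Y2 (remove_ball 3 Y2 e2)) Y h2"
    and all: "h1 ` remove_ball 3 Y1 e1 \<union> h2 ` remove_ball 3 Y2 e2 = topspace Y"
    and meet: "h1 ` remove_ball 3 Y1 e1 \<inter> h2 ` remove_ball 3 Y2 e2 = h1 ` e1 ` unit_sphere 3"
    and agree: "\<forall>u\<in>unit_sphere 3. h1 (e1 u) = h2 (e2 u)"
    using assms[unfolded connected_sum_def, THEN conjunct2, THEN conjunct2, THEN conjunct2]
    by (elim exE conjE) (rule that; assumption)
  note LE = closed_manifold_locally_Euclidean[OF M1] closed_manifold_locally_Euclidean[OF M2] closed_manifold_locally_Euclidean[OF M]
  have T2: "compact_space Y1" "Hausdorff_space Y1" "compact_space Y2" "Hausdorff_space Y2" "Hausdorff_space Y"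
    using M1 M2 M by (simp_all add: closed_manifold_def)
  have o1: "openin Y1 (e1 ` topspace ?E)" 
  proof (rule injective_map_open_image[OF locally_Euclidean_Euclidean_space LE(1) openin_topspace])
    show "continuous_map (subtopology ?E (topspace ?E)) Y1 e1" using embedding_imp_continuous_map[OF e1] by simp
    show "inj_on e1 (topspace ?E)" using e1 homeomorphic_imp_injective_map unfolding embedding_map_def by blast
  qed
  have o2: "openin Y2 (e2 ` topspace ?E)"
  proof (rule injective_map_open_image[OF locally_Euclidean_Euclidean_space LE(2) openin_topspace])
    show "continuous_map (subtopology ?E (topspace ?E)) Y2 e2" using embedding_imp_continuous_map[OF e2] by simp
    show "inj_on e2 (topspace ?E)" using e2 homeomorphic_imp_injective_map unfolding embedding_map_def by blast
  qed
  have "h1 ` e1 ` unit_sphere 3 = h2 ` e2 ` unit_sphere 3"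
    unfolding image_image using agree by (intro image_cong) auto
  then have meet': "h2 ` remove_ball 3 Y2 e2 \<inter> h1 ` remove_ball 3 Y1 e1 = h2 ` e2 ` unit_sphere 3"
    using meet by (simp add: Int_commute)
  obtain p2 where p2: "continuous_map (subtopology Y2 (topspace Y2 - {e2 (\<lambda>i. 0)})) Y p2"
    "inj_on p2 (topspace Y2 - {e2 (\<lambda>i. 0)})"
    "p2 ` (topspace Y2 - {e2 (\<lambda>i. 0)}) = h2 ` remove_ball 3 Y2 e2 \<union> h1 ` e1 ` ?O"
    "p2 ` (e2 ` topspace ?E - {e2 (\<lambda>i. 0)}) = h2 ` e2 ` ?O \<union> h1 ` e1 ` ?O"
    by (rule collar_extension[OF T2(4) e1 e2 o2 h1 h2 meet]) (use agree in blast)+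
  obtain p1 where p1: "continuous_map (subtopology Y1 (topspace Y1 - {e1 (\<lambda>i. 0)})) Y p1"
    "inj_on p1 (topspace Y1 - {e1 (\<lambda>i. 0)})"
    "p1 ` (topspace Y1 - {e1 (\<lambda>i. 0)}) = h1 ` remove_ball 3 Y1 e1 \<union> h2 ` e2 ` ?O"
    "p1 ` (e1 ` topspace ?E - {e1 (\<lambda>i. 0)}) = h1 ` e1 ` ?O \<union> h2 ` e2 ` ?O"
    by (rule collar_extension[OF T2(2) e2 e1 o1 h2 h1 meet']) (use agree in auto)
  define U1 where "U1 = p1 ` (topspace Y1 - {e1 (\<lambda>i. 0)})"
  define U2 where "U2 = p2 ` (topspace Y2 - {e2 (\<lambda>i. 0)})"
  have out1: "h1 ` e1 ` ?O \<subseteq> h1 ` remove_ball 3 Y1 e1" using outside_in_remove_ball[OF e1] by (rule image_mono)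
  have out2: "h2 ` e2 ` ?O \<subseteq> h2 ` remove_ball 3 Y2 e2" using outside_in_remove_ball[OF e2] by (rule image_mono)
  have "unit_sphere 3 \<subseteq> ?O" by (auto simp: unit_sphere_def sphere_outside_def sqnorm_def)
  then have sph: "h1 ` e1 ` unit_sphere 3 \<subseteq> h1 ` e1 ` ?O" by blast
  have cov: "topspace Y = U1 \<union> U2" unfolding U1_def U2_def p1(3) p2(3) using all out1 out2 by blast
  have int: "U1 \<inter> U2 = h1 ` e1 ` ?O \<union> h2 ` e2 ` ?O"
  proof -
    have gen: "(A \<union> b) \<inter> (B \<union> a) = a \<union> b" if "A \<inter> B \<subseteq> a" "a \<subseteq> A" "b \<subseteq> B" for A B a b :: "'c set"
      using that by blast
    show ?thesis unfolding U1_def U2_def p1(3) p2(3)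
      by (rule gen[OF _ out1 out2]) (simp only: meet sph)
  qed
  have x1: "e1 (\<lambda>i. 0) \<in> topspace Y1" "e2 (\<lambda>i. 0) \<in> topspace Y2"
    using openin_subset[OF o1] openin_subset[OF o2] by (auto simp: topspace_Euclidean_space)
  have "closedin Y1 {e1 (\<lambda>i. 0)}" using x1 by (intro compactin_imp_closedin[OF T2(2)]) simp
  then have "openin Y1 (topspace Y1 - {e1 (\<lambda>i. 0)})" by blast
  then have oU1: "openin Y U1" unfolding U1_def using p1(1,2) by (rule injective_map_open_image[OF LE(1) LE(3)])
  have "closedin Y2 {e2 (\<lambda>i. 0)}" using x1 by (intro compactin_imp_closedin[OF T2(4)]) simp
  then have "openin Y2 (topspace Y2 - {e2 (\<lambda>i. 0)})" by blast
  then have oU2: "openin Y U2" unfolding U2_def using p2(1,2) by (rule injective_map_open_image[OF LE(2) LE(3)])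
  have "\<exists>q. pinch_map Y Y1 q U1 U2 (e1 ` topspace ?E) (e1 (\<lambda>i. 0))"
    using int p1(4) by (intro pinch_mapI[OF T2(1,2) LE(1) T2(5) LE(3) e1 o1 refl p1(1,2) U1_def oU2 cov]) simp
  moreover have "\<exists>q. pinch_map Y Y2 q U2 U1 (e2 ` topspace ?E) (e2 (\<lambda>i. 0))"
    using int p2(4) cov by (intro pinch_mapI[OF T2(3,4) LE(2) T2(5) LE(3) e2 o2 refl p2(1,2) U2_def oU1]) auto
  ultimately show ?thesis using that by blast
qed

section \<open>Edges of simplices\<close>

text \<open>The affine path from the vertex \<open>i\<close> to the vertex \<open>j\<close> of a simplex. Products of one-dimensional
  cochains, and all their coboundaries, are expressed by values on edges.\<close>

definition edge :: "nat \<Rightarrow> nat \<Rightarrow> ((nat \<Rightarrow> real) \<Rightarrow> 'a) \<Rightarrow> ((nat \<Rightarrow> real) \<Rightarrow> 'a)" where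
  "edge i j \<sigma> = (\<lambda>t\<in>standard_simplex 1. \<sigma> (\<lambda>k. if k = i then t 0 else if k = j then t 1 else 0))"

text \<open>The vertices of the face opposite to \<open>k\<close>, in order.\<close>

definition skip :: "nat \<Rightarrow> nat \<Rightarrow> nat" where
  "skip k i = (if i < k then i else Suc i)"

lemma simplex1D:
  assumes "t \<in> standard_simplex 1"
  shows "t 0 + t 1 = 1" "0 \<le> t 0" "0 \<le> t 1" "t 0 \<le> 1" "t 1 \<le> 1" "\<And>k. 1 < k \<Longrightarrow> t k = 0"
  using assms by (auto simp: standard_simplex_def)

lemma segment_in_simplex:
  assumes t: "t \<in> standard_simplex 1" and ij: "i < j" "j \<le> p"
  shows "(\<lambda>k. if k = i then t 0 else if k = j then t 1 else 0) \<in> standard_simplex p"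
proof -
  have "(\<Sum>k\<le>p. if k = i then t 0 else if k = j then t 1 else 0)
      = (\<Sum>k\<le>p. (if k = i then t 0 else 0) + (if k = j then t 1 else 0))"
    using ij by (intro sum.cong) auto
  also have "\<dots> = 1" unfolding sum.distrib using ij simplex1D(1)[OF t] by simp
  finally show ?thesis using simplex1D[OF t] ij by (auto simp: standard_simplex_def)
qed

lemma edge_singular_face:
  assumes "i < j" "j < p" "k \<le> p"
  shows "edge i j (singular_face p k \<sigma>) = edge (skip k i) (skip k j) \<sigma>"
  unfolding edge_def
proof (rule restrict_ext)
  fix t :: "nat \<Rightarrow> real" assume t: "t \<in> standard_simplex 1"
  have "(\<lambda>m. if m = i then t 0 else if m = j then t 1 else 0) \<in> standard_simplex (p - Suc 0)"
    using assms by (intro segment_in_simplex[OF t]) auto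
  moreover have "simplical_face k (\<lambda>m. if m = i then t 0 else if m = j then t 1 else 0)
      = (\<lambda>m. if m = skip k i then t 0 else if m = skip k j then t 1 else 0)"
    by (rule ext) (auto simp: simplical_face_def skip_def)
  ultimately show "singular_face p k \<sigma> (\<lambda>m. if m = i then t 0 else if m = j then t 1 else 0)
      = \<sigma> (\<lambda>m. if m = skip k i then t 0 else if m = skip k j then t 1 else 0)"
    by (simp add: singular_face_def)
qed

lemma edge_01: "edge 0 1 \<sigma> = restrict \<sigma> (standard_simplex 1)"
  unfolding edge_def
proof (rule restrict_ext)
  fix t :: "nat \<Rightarrow> real" assume t: "t \<in> standard_simplex 1"
  have "(\<lambda>k. if k = 0 then t 0 else if k = 1 then t 1 else 0) = t"
    using simplex1D(6)[OF t] by (intro ext) (metis less_one nat_neq_iff)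
  then show "\<sigma> (\<lambda>k. if k = 0 then t 0 else if k = 1 then t 1 else 0) = \<sigma> t" by simp
qed

lemma singular_face_2:
  assumes "k \<le> 2"
  shows "singular_face 2 k \<tau> = edge (skip k 0) (skip k 1) \<tau>"
proof -
  have "singular_face 2 k \<tau> = edge 0 1 (singular_face 2 k \<tau>)"
    unfolding edge_01 by (simp add: singular_face_def)
  also have "\<dots> = edge (skip k 0) (skip k 1) \<tau>" using assms by (intro edge_singular_face) auto
  finally show ?thesis .
qed

lemma chain_boundary_2:
  "chain_boundary 2 (frag_of \<tau>) = frag_of (edge 1 2 \<tau>) - frag_of (edge 0 2 \<tau>) + frag_of (edge 0 1 \<tau>)"
proof -
  have "{..2::nat} = {0, 1, 2}" by auto
  then have "chain_boundary 2 (frag_of \<tau>)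
      = frag_of (singular_face 2 0 \<tau>) - frag_of (singular_face 2 1 \<tau>) + frag_of (singular_face 2 2 \<tau>)"
    by (simp add: chain_boundary_of)
  moreover have "singular_face 2 0 \<tau> = edge 1 2 \<tau>" "singular_face 2 1 \<tau> = edge 0 2 \<tau>" "singular_face 2 2 \<tau> = edge 0 1 \<tau>"
    using singular_face_2[of 0 \<tau>] singular_face_2[of 1 \<tau>] singular_face_2[of 2 \<tau>]
    by (simp_all add: skip_def eval_nat_numeral)
  ultimately show ?thesis by (simp only:)
qed

lemma front_face_1: "front_face 1 \<tau> = edge 0 1 \<tau>"
  unfolding edge_01 front_face_def ..

lemma edge_front_face:
  assumes "i < j" "j \<le> p"
  shows "edge i j (front_face p \<sigma>) = edge i j \<sigma>"
  unfolding edge_def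
proof (rule restrict_ext)
  fix t :: "nat \<Rightarrow> real" assume t: "t \<in> standard_simplex 1"
  show "front_face p \<sigma> (\<lambda>k. if k = i then t 0 else if k = j then t 1 else 0)
      = \<sigma> (\<lambda>k. if k = i then t 0 else if k = j then t 1 else 0)"
    unfolding front_face_def using segment_in_simplex[OF t assms] by (rule restrict_apply')
qed

lemma back_face_edge: "back_face p 1 \<sigma> = edge p (Suc p) \<sigma>"
  unfolding back_face_def edge_def
proof (rule restrict_ext)
  fix t :: "nat \<Rightarrow> real" assume t: "t \<in> standard_simplex 1"
  have "(\<lambda>i. if i < p then 0 else t (i - p)) = (\<lambda>k. if k = p then t 0 else if k = Suc p then t 1 else 0)"
  proof
    fix i
    consider "i < p" | "i = p" | "i = Suc p" | "i > Suc p" by linarith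
    then show "(if i < p then 0 else t (i - p)) = (if i = p then t 0 else if i = Suc p then t 1 else 0)"
    proof cases
      case 4
      then have "t (i - p) = 0" by (intro simplex1D(6)[OF t]) simp
      then show ?thesis using 4 by simp
    qed auto
  qed
  then show "(\<sigma> \<circ> (\<lambda>t i. if i < p then 0 else t (i - p))) t = \<sigma> (\<lambda>k. if k = p then t 0 else if k = Suc p then t 1 else 0)"
    by simp
qed

lemma singular_simplex_edge:
  assumes \<sigma>: "singular_simplex p X \<sigma>" and ij: "i < j" "j \<le> p"
  shows "singular_simplex 1 X (edge i j \<sigma>)" "edge i j \<sigma> ` standard_simplex 1 \<subseteq> \<sigma> ` standard_simplex p"
proof -
  let ?D = "\<lambda>p. subtopology (powertop_real UNIV) (standard_simplex p)"
  let ?l = "\<lambda>t::nat \<Rightarrow> real. \<lambda>k. if k = i then t 0 else if k = j then t 1 else 0"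
  have coord: "continuous_map (?D 1) euclideanreal (\<lambda>t. t m)" for m
    by (intro continuous_map_from_subtopology continuous_map_product_projection) simp
  have "continuous_map (?D 1) euclideanreal (\<lambda>t. ?l t k)" for k
    using coord[of 0] coord[of 1] by (cases "k = i"; cases "k = j") simp_all
  then have "continuous_map (?D 1) (powertop_real UNIV) ?l" by (simp add: continuous_map_componentwise_UNIV)
  then have "continuous_map (?D 1) (?D p) ?l"
    using segment_in_simplex[OF _ ij] by (intro continuous_map_into_subtopology) auto
  moreover have "continuous_map (?D p) X \<sigma>" using \<sigma> by (simp add: singular_simplex_def)
  ultimately have "continuous_map (?D 1) X (\<sigma> \<circ> ?l)" by (rule continuous_map_compose)
  then have "continuous_map (?D 1) X (edge i j \<sigma>)"
    by (rule continuous_map_eq) (simp add: edge_def)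
  moreover have "edge i j \<sigma> \<in> extensional (standard_simplex 1)" unfolding edge_def by simp
  ultimately show "singular_simplex 1 X (edge i j \<sigma>)" unfolding singular_simplex_def by simp
  show "edge i j \<sigma> ` standard_simplex 1 \<subseteq> \<sigma> ` standard_simplex p"
    using segment_in_simplex[OF _ ij] by (auto simp: edge_def)
qed

lemma edge_vertex:
  assumes "i \<noteq> j"
  shows "edge i j \<sigma> vertex0 = \<sigma> (\<lambda>k. if k = i then 1 else 0)" "edge i j \<sigma> vertex1 = \<sigma> (\<lambda>k. if k = j then 1 else 0)"
proof -
  have "(\<lambda>k. if k = i then vertex0 0 else if k = j then vertex0 1 else 0) = (\<lambda>k. if k = i then 1 else 0)"
    "(\<lambda>k. if k = i then vertex1 0 else if k = j then vertex1 1 else 0) = (\<lambda>k. if k = j then 1 else 0)"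
    using assms by (auto simp: vertex0_def vertex1_def fun_eq_iff)
  then show "edge i j \<sigma> vertex0 = \<sigma> (\<lambda>k. if k = i then 1 else 0)" "edge i j \<sigma> vertex1 = \<sigma> (\<lambda>k. if k = j then 1 else 0)"
    unfolding edge_def using vertex_in_simplex by simp_all
qed

section \<open>Cup products of one-dimensional cocycles\<close>

definition cocycle1 :: "'a topology \<Rightarrow> (((nat \<Rightarrow> real) \<Rightarrow> 'a) \<Rightarrow> int) \<Rightarrow> bool" where
  "cocycle1 Y \<phi> \<longleftrightarrow> (\<forall>\<tau>. singular_simplex 2 Y \<tau> \<longrightarrow> \<phi> (edge 0 2 \<tau>) = \<phi> (edge 0 1 \<tau>) + \<phi> (edge 1 2 \<tau>))"

text \<open>Functions on points stand for zero-dimensional cochains.\<close>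

definition exact1 :: "'a topology \<Rightarrow> (((nat \<Rightarrow> real) \<Rightarrow> 'a) \<Rightarrow> int) \<Rightarrow> bool" where
  "exact1 Y \<phi> \<longleftrightarrow> (\<exists>g. \<forall>e. singular_simplex 1 Y e \<longrightarrow> \<phi> e = g (e vertex1) - g (e vertex0))"

definition triple_eval where
  "triple_eval \<zeta> \<phi> \<psi> \<theta> = frag_eval (\<lambda>\<sigma>. \<phi> (edge 0 1 \<sigma>) * \<psi> (edge 1 2 \<sigma>) * \<theta> (edge 2 3 \<sigma>) :: int) \<zeta>"

lemma frag_eval_boundary:
  fixes F \<kappa> :: "((nat \<Rightarrow> real) \<Rightarrow> 'a) \<Rightarrow> int"
  assumes \<zeta>: "singular_chain p Y \<zeta>"
    and F: "\<And>\<sigma>. singular_simplex p Y \<sigma> \<Longrightarrow> F \<sigma> = frag_eval \<kappa> (chain_boundary p (frag_of \<sigma>))"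
  shows "frag_eval F \<zeta> = frag_eval \<kappa> (chain_boundary p \<zeta>)"
proof -
  have "\<zeta> \<in> {c. frag_eval F c = frag_eval \<kappa> (chain_boundary p c)}"
    by (rule frag_subgroup_induct[OF _ _ \<zeta>[unfolded singular_chain_def]])
      (auto simp: frag_subgroup_def chain_boundary_diff F)
  then show ?thesis by simp
qed

lemma frag_eval_cong:
  assumes "singular_chain p Y \<zeta>" "\<And>\<sigma>. singular_simplex p Y \<sigma> \<Longrightarrow> F \<sigma> = F' \<sigma>"
  shows "frag_eval F \<zeta> = frag_eval F' \<zeta>"
  unfolding frag_eval_def using assms by (intro sum.cong) (auto simp: singular_chain_def)

lemma exact_cocycle1: "exact1 Y \<phi> \<Longrightarrow> cocycle1 Y \<phi>"
  unfolding exact1_def cocycle1_def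
proof (elim exE, intro allI impI)
  fix g \<tau> assume g: "\<forall>e. singular_simplex 1 Y e \<longrightarrow> \<phi> e = g (e vertex1) - g (e vertex0)" and \<tau>: "singular_simplex 2 Y \<tau>"
  have "singular_simplex 1 Y (edge 0 2 \<tau>)" "singular_simplex 1 Y (edge 0 1 \<tau>)" "singular_simplex 1 Y (edge 1 2 \<tau>)"
    by (rule singular_simplex_edge(1)[OF \<tau>]; simp)+
  then have "\<phi> (edge 0 2 \<tau>) = g (edge 0 2 \<tau> vertex1) - g (edge 0 2 \<tau> vertex0)"
    "\<phi> (edge 0 1 \<tau>) = g (edge 0 1 \<tau> vertex1) - g (edge 0 1 \<tau> vertex0)"
    "\<phi> (edge 1 2 \<tau>) = g (edge 1 2 \<tau> vertex1) - g (edge 1 2 \<tau> vertex0)"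
    using g by blast+
  then show "\<phi> (edge 0 2 \<tau>) = \<phi> (edge 0 1 \<tau>) + \<phi> (edge 1 2 \<tau>)"
    by (simp only: edge_vertex[of 0 2] edge_vertex[of 0 1] edge_vertex[of 1 2] zero_neq_numeral zero_neq_one one_eq_numeral_iff
        not_False_eq_True num.distinct)
qed

lemma exact1_cycles:
  assumes "exact1 Y \<phi>" "c \<in> cycles1 Y"
  shows "frag_eval \<phi> c = 0"
proof -
  obtain g where g: "\<And>e. singular_simplex 1 Y e \<Longrightarrow> \<phi> e = g (e vertex1) - g (e vertex0)"
    using assms(1) unfolding exact1_def by blast
  have c: "singular_chain 1 Y c" "chain_boundary 1 c = 0" using assms(2) by (simp_all only: cycles1_def mem_Collect_eq)
  have "frag_eval \<phi> c = frag_eval (\<lambda>s. g (s vertex0)) (chain_boundary 1 c)"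
    by (rule frag_eval_boundary[OF c(1)])
      (simp only: g chain_boundary_simplex, simp add: point_chain_def vertex_in_simplex)
  then show ?thesis using c(2) by simp
qed

lemma cocycle1_bounds:
  assumes "cocycle1 Y \<phi>" "c \<in> bounds1 Y"
  shows "frag_eval \<phi> c = 0"
proof -
  obtain d where d: "c = chain_boundary 2 d" "singular_chain 2 Y d" using assms(2) unfolding bounds1_def by blast
  have "frag_eval (\<lambda>_. 0) d = frag_eval \<phi> (chain_boundary 2 d)"
    using assms(1) by (intro frag_eval_boundary[OF d(2)]) (simp add: chain_boundary_2 cocycle1_def)
  then show ?thesis using d(1) by (simp add: frag_eval_def)
qed

lemma cocycle1I:
  assumes "\<And>c. c \<in> bounds1 Y \<Longrightarrow> frag_eval \<phi> c = 0"
  shows "cocycle1 Y \<phi>"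
  unfolding cocycle1_def
proof (intro allI impI)
  fix \<tau> assume "singular_simplex 2 Y \<tau>"
  then have "chain_boundary 2 (frag_of \<tau>) \<in> bounds1 Y" unfolding bounds1_def by (intro imageI) (simp add: singular_chain_of)
  from assms[OF this] show "\<phi> (edge 0 2 \<tau>) = \<phi> (edge 0 1 \<tau>) + \<phi> (edge 1 2 \<tau>)" by (simp add: chain_boundary_2)
qed

lemma edges_face_3:
  "edge 0 1 (singular_face 3 0 \<sigma>) = edge 1 2 \<sigma>" "edge 0 2 (singular_face 3 0 \<sigma>) = edge 1 3 \<sigma>" "edge 1 2 (singular_face 3 0 \<sigma>) = edge 2 3 \<sigma>"
  "edge 0 1 (singular_face 3 1 \<sigma>) = edge 0 2 \<sigma>" "edge 0 2 (singular_face 3 1 \<sigma>) = edge 0 3 \<sigma>" "edge 1 2 (singular_face 3 1 \<sigma>) = edge 2 3 \<sigma>"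
  "edge 0 1 (singular_face 3 2 \<sigma>) = edge 0 1 \<sigma>" "edge 0 2 (singular_face 3 2 \<sigma>) = edge 0 3 \<sigma>" "edge 1 2 (singular_face 3 2 \<sigma>) = edge 1 3 \<sigma>"
  "edge 0 1 (singular_face 3 3 \<sigma>) = edge 0 1 \<sigma>" "edge 0 2 (singular_face 3 3 \<sigma>) = edge 0 2 \<sigma>" "edge 1 2 (singular_face 3 3 \<sigma>) = edge 1 2 \<sigma>"
  by (simp_all add: edge_singular_face skip_def eval_nat_numeral)

lemma edges_face_4:
  "edge 0 1 (singular_face 4 0 \<sigma>) = edge 1 2 \<sigma>" "edge 1 2 (singular_face 4 0 \<sigma>) = edge 2 3 \<sigma>" "edge 2 3 (singular_face 4 0 \<sigma>) = edge 3 4 \<sigma>"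
  "edge 0 1 (singular_face 4 1 \<sigma>) = edge 0 2 \<sigma>" "edge 1 2 (singular_face 4 1 \<sigma>) = edge 2 3 \<sigma>" "edge 2 3 (singular_face 4 1 \<sigma>) = edge 3 4 \<sigma>"
  "edge 0 1 (singular_face 4 2 \<sigma>) = edge 0 1 \<sigma>" "edge 1 2 (singular_face 4 2 \<sigma>) = edge 1 3 \<sigma>" "edge 2 3 (singular_face 4 2 \<sigma>) = edge 3 4 \<sigma>"
  "edge 0 1 (singular_face 4 3 \<sigma>) = edge 0 1 \<sigma>" "edge 1 2 (singular_face 4 3 \<sigma>) = edge 1 2 \<sigma>" "edge 2 3 (singular_face 4 3 \<sigma>) = edge 2 4 \<sigma>"
  "edge 0 1 (singular_face 4 4 \<sigma>) = edge 0 1 \<sigma>" "edge 1 2 (singular_face 4 4 \<sigma>) = edge 1 2 \<sigma>" "edge 2 3 (singular_face 4 4 \<sigma>) = edge 2 3 \<sigma>"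
  "edge 0 2 (singular_face 4 4 \<sigma>) = edge 0 2 \<sigma>" "edge 1 3 (singular_face 4 4 \<sigma>) = edge 1 3 \<sigma>" "edge 1 3 (singular_face 4 0 \<sigma>) = edge 2 4 \<sigma>"
  by (simp_all add: edge_singular_face skip_def eval_nat_numeral)

lemma shared_vertices:
  "edge 0 2 \<sigma> vertex0 = edge 0 1 \<sigma> vertex0" "edge 1 2 \<sigma> vertex0 = edge 0 1 \<sigma> vertex1" "edge 1 3 \<sigma> vertex0 = edge 0 1 \<sigma> vertex1"
  "edge 0 2 \<sigma> vertex1 = edge 1 2 \<sigma> vertex1" "edge 2 3 \<sigma> vertex0 = edge 1 2 \<sigma> vertex1" "edge 1 3 \<sigma> vertex1 = edge 2 3 \<sigma> vertex1"
  by (simp_all add: edge_vertex)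

lemma cocycle_edges_3:
  assumes "cocycle1 Y \<phi>" "singular_simplex 3 Y \<sigma>"
  shows "\<phi> (edge 0 2 \<sigma>) = \<phi> (edge 0 1 \<sigma>) + \<phi> (edge 1 2 \<sigma>)" "\<phi> (edge 1 3 \<sigma>) = \<phi> (edge 1 2 \<sigma>) + \<phi> (edge 2 3 \<sigma>)"
proof -
  have face: "singular_simplex 2 Y (singular_face 3 k \<sigma>)" if "k \<le> 3" for k
    using singular_simplex_singular_face[OF assms(2) _ that] by simp
  have "\<phi> (edge 0 2 (singular_face 3 k \<sigma>)) = \<phi> (edge 0 1 (singular_face 3 k \<sigma>)) + \<phi> (edge 1 2 (singular_face 3 k \<sigma>))"
    if "k \<le> 3" for k
    using assms(1) face[OF that] unfolding cocycle1_def by blast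
  from this[of 3] this[of 0] show "\<phi> (edge 0 2 \<sigma>) = \<phi> (edge 0 1 \<sigma>) + \<phi> (edge 1 2 \<sigma>)" "\<phi> (edge 1 3 \<sigma>) = \<phi> (edge 1 2 \<sigma>) + \<phi> (edge 2 3 \<sigma>)"
    unfolding edges_face_3 by simp_all
qed

lemma cocycle_edges_4:
  assumes "cocycle1 Y \<phi>" "singular_simplex 4 Y \<sigma>"
  shows "\<phi> (edge 0 2 \<sigma>) = \<phi> (edge 0 1 \<sigma>) + \<phi> (edge 1 2 \<sigma>)" "\<phi> (edge 1 3 \<sigma>) = \<phi> (edge 1 2 \<sigma>) + \<phi> (edge 2 3 \<sigma>)"
    "\<phi> (edge 2 4 \<sigma>) = \<phi> (edge 2 3 \<sigma>) + \<phi> (edge 3 4 \<sigma>)"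
proof -
  have face: "singular_simplex 3 Y (singular_face 4 k \<sigma>)" if "k \<le> 4" for k
    using singular_simplex_singular_face[OF assms(2) _ that] by simp
  show "\<phi> (edge 0 2 \<sigma>) = \<phi> (edge 0 1 \<sigma>) + \<phi> (edge 1 2 \<sigma>)" "\<phi> (edge 1 3 \<sigma>) = \<phi> (edge 1 2 \<sigma>) + \<phi> (edge 2 3 \<sigma>)"
    using cocycle_edges_3[OF assms(1) face[of 4]] unfolding edges_face_4 by simp_all
  show "\<phi> (edge 2 4 \<sigma>) = \<phi> (edge 2 3 \<sigma>) + \<phi> (edge 3 4 \<sigma>)"
    using cocycle_edges_3(2)[OF assms(1) face[of 0]] unfolding edges_face_4 by simp
qed

lemma eval_exact_3:
  fixes \<kappa> :: "((nat \<Rightarrow> real) \<Rightarrow> 'a) \<Rightarrow> int"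
  assumes \<zeta>: "singular_chain 3 Y \<zeta>" "chain_boundary 3 \<zeta> = 0"
    and F: "\<And>\<sigma>. singular_simplex 3 Y \<sigma> \<Longrightarrow> F \<sigma> =
      \<kappa> (singular_face 3 0 \<sigma>) - \<kappa> (singular_face 3 1 \<sigma>) + \<kappa> (singular_face 3 2 \<sigma>) - \<kappa> (singular_face 3 3 \<sigma>)"
  shows "frag_eval F \<zeta> = 0"
proof -
  have "{..3::nat} = {0, 1, 2, 3}" by auto
  then have "frag_eval F \<zeta> = frag_eval \<kappa> (chain_boundary 3 \<zeta>)"
    by (intro frag_eval_boundary[OF \<zeta>(1)]) (simp add: F chain_boundary_of)
  then show ?thesis using \<zeta>(2) by simp
qed

text \<open>With values of a one-dimensional cocycle on the edges of a simplex determined by consecutive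
  edges, each of the following identities exhibits the cochain as a coboundary of an explicit
  two-dimensional cochain, and reduces to a polynomial identity. For the cup square of a cocycle,
  the product of the values on consecutive edges is the coboundary of the binomial coefficient.\<close>

context
  fixes Y :: "'a topology" and \<zeta> :: "'a chain"
  assumes \<zeta>: "singular_chain 3 Y \<zeta>" "chain_boundary 3 \<zeta> = 0"
begin

lemma triple_eval_exact:
  assumes \<phi>: "cocycle1 Y \<phi>" and \<psi>: "cocycle1 Y \<psi>" and \<theta>: "cocycle1 Y \<theta>"
  shows "exact1 Y \<phi> \<Longrightarrow> triple_eval \<zeta> \<phi> \<psi> \<theta> = 0"
    and "exact1 Y \<psi> \<Longrightarrow> triple_eval \<zeta> \<phi> \<psi> \<theta> = 0"
    and "exact1 Y \<theta> \<Longrightarrow> triple_eval \<zeta> \<phi> \<psi> \<theta> = 0"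
proof -
  have edges: "singular_simplex 1 Y (edge 0 1 \<sigma>)" "singular_simplex 1 Y (edge 1 2 \<sigma>)" "singular_simplex 1 Y (edge 2 3 \<sigma>)"
    if "singular_simplex 3 Y \<sigma>" for \<sigma>
    by (rule singular_simplex_edge(1)[OF that]; simp)+
  show "triple_eval \<zeta> \<phi> \<psi> \<theta> = 0" if exact: "exact1 Y \<phi>"
  proof -
    obtain g where g: "\<And>e. singular_simplex 1 Y e \<Longrightarrow> \<phi> e = g (e vertex1) - g (e vertex0)"
      using exact unfolding exact1_def by blast
    show ?thesis unfolding triple_eval_def
    proof (rule eval_exact_3[OF \<zeta>, where \<kappa> = "\<lambda>\<tau>. g (edge 0 1 \<tau> vertex0) * \<psi> (edge 0 1 \<tau>) * \<theta> (edge 1 2 \<tau>)"])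
      fix \<sigma> assume \<sigma>: "singular_simplex 3 Y \<sigma>"
      show "\<phi> (edge 0 1 \<sigma>) * \<psi> (edge 1 2 \<sigma>) * \<theta> (edge 2 3 \<sigma>) =
        (\<lambda>\<tau>. g (edge 0 1 \<tau> vertex0) * \<psi> (edge 0 1 \<tau>) * \<theta> (edge 1 2 \<tau>)) (singular_face 3 0 \<sigma>) -
        (\<lambda>\<tau>. g (edge 0 1 \<tau> vertex0) * \<psi> (edge 0 1 \<tau>) * \<theta> (edge 1 2 \<tau>)) (singular_face 3 1 \<sigma>) +
        (\<lambda>\<tau>. g (edge 0 1 \<tau> vertex0) * \<psi> (edge 0 1 \<tau>) * \<theta> (edge 1 2 \<tau>)) (singular_face 3 2 \<sigma>) -
        (\<lambda>\<tau>. g (edge 0 1 \<tau> vertex0) * \<psi> (edge 0 1 \<tau>) * \<theta> (edge 1 2 \<tau>)) (singular_face 3 3 \<sigma>)"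
        using cocycle_edges_3[OF \<psi> \<sigma>] cocycle_edges_3[OF \<theta> \<sigma>]
        unfolding g[OF edges(1)[OF \<sigma>]] edges_face_3 shared_vertices by (simp add: algebra_simps)
    qed
  qed
  show "triple_eval \<zeta> \<phi> \<psi> \<theta> = 0" if exact: "exact1 Y \<psi>"
  proof -
    obtain g where g: "\<And>e. singular_simplex 1 Y e \<Longrightarrow> \<psi> e = g (e vertex1) - g (e vertex0)"
      using exact unfolding exact1_def by blast
    show ?thesis unfolding triple_eval_def
    proof (rule eval_exact_3[OF \<zeta>, where \<kappa> = "\<lambda>\<tau>. - \<phi> (edge 0 1 \<tau>) * g (edge 0 1 \<tau> vertex1) * \<theta> (edge 1 2 \<tau>)"])
      fix \<sigma> assume \<sigma>: "singular_simplex 3 Y \<sigma>"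
      show "\<phi> (edge 0 1 \<sigma>) * \<psi> (edge 1 2 \<sigma>) * \<theta> (edge 2 3 \<sigma>) =
        (\<lambda>\<tau>. - \<phi> (edge 0 1 \<tau>) * g (edge 0 1 \<tau> vertex1) * \<theta> (edge 1 2 \<tau>)) (singular_face 3 0 \<sigma>) -
        (\<lambda>\<tau>. - \<phi> (edge 0 1 \<tau>) * g (edge 0 1 \<tau> vertex1) * \<theta> (edge 1 2 \<tau>)) (singular_face 3 1 \<sigma>) +
        (\<lambda>\<tau>. - \<phi> (edge 0 1 \<tau>) * g (edge 0 1 \<tau> vertex1) * \<theta> (edge 1 2 \<tau>)) (singular_face 3 2 \<sigma>) -
        (\<lambda>\<tau>. - \<phi> (edge 0 1 \<tau>) * g (edge 0 1 \<tau> vertex1) * \<theta> (edge 1 2 \<tau>)) (singular_face 3 3 \<sigma>)"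
        using cocycle_edges_3[OF \<phi> \<sigma>] cocycle_edges_3[OF \<theta> \<sigma>]
        unfolding g[OF edges(2)[OF \<sigma>]] edges_face_3 shared_vertices by (simp add: algebra_simps)
    qed
  qed
  show "triple_eval \<zeta> \<phi> \<psi> \<theta> = 0" if exact: "exact1 Y \<theta>"
  proof -
    obtain g where g: "\<And>e. singular_simplex 1 Y e \<Longrightarrow> \<theta> e = g (e vertex1) - g (e vertex0)"
      using exact unfolding exact1_def by blast
    show ?thesis unfolding triple_eval_def
    proof (rule eval_exact_3[OF \<zeta>, where \<kappa> = "\<lambda>\<tau>. \<phi> (edge 0 1 \<tau>) * \<psi> (edge 1 2 \<tau>) * g (edge 1 2 \<tau> vertex1)"])
      fix \<sigma> assume \<sigma>: "singular_simplex 3 Y \<sigma>"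
      show "\<phi> (edge 0 1 \<sigma>) * \<psi> (edge 1 2 \<sigma>) * \<theta> (edge 2 3 \<sigma>) =
        (\<lambda>\<tau>. \<phi> (edge 0 1 \<tau>) * \<psi> (edge 1 2 \<tau>) * g (edge 1 2 \<tau> vertex1)) (singular_face 3 0 \<sigma>) -
        (\<lambda>\<tau>. \<phi> (edge 0 1 \<tau>) * \<psi> (edge 1 2 \<tau>) * g (edge 1 2 \<tau> vertex1)) (singular_face 3 1 \<sigma>) +
        (\<lambda>\<tau>. \<phi> (edge 0 1 \<tau>) * \<psi> (edge 1 2 \<tau>) * g (edge 1 2 \<tau> vertex1)) (singular_face 3 2 \<sigma>) -
        (\<lambda>\<tau>. \<phi> (edge 0 1 \<tau>) * \<psi> (edge 1 2 \<tau>) * g (edge 1 2 \<tau> vertex1)) (singular_face 3 3 \<sigma>)"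
        using cocycle_edges_3[OF \<phi> \<sigma>] cocycle_edges_3[OF \<psi> \<sigma>]
        unfolding g[OF edges(3)[OF \<sigma>]] edges_face_3 shared_vertices by (simp add: algebra_simps)
    qed
  qed
qed

lemma coboundary_cup_eval:
  fixes \<kappa> :: "((nat \<Rightarrow> real) \<Rightarrow> 'a) \<Rightarrow> int"
  assumes \<theta>: "cocycle1 Y \<theta>"
  shows "frag_eval (\<lambda>\<sigma>. (\<kappa> (edge 1 2 \<sigma>) - \<kappa> (edge 0 2 \<sigma>) + \<kappa> (edge 0 1 \<sigma>)) * \<theta> (edge 2 3 \<sigma>)) \<zeta> = 0"
proof (rule eval_exact_3[OF \<zeta>, where \<kappa> = "\<lambda>\<tau>. \<kappa> (edge 0 1 \<tau>) * \<theta> (edge 1 2 \<tau>)"])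
  fix \<sigma> assume \<sigma>: "singular_simplex 3 Y \<sigma>"
  show "(\<kappa> (edge 1 2 \<sigma>) - \<kappa> (edge 0 2 \<sigma>) + \<kappa> (edge 0 1 \<sigma>)) * \<theta> (edge 2 3 \<sigma>) =
     \<kappa> (edge 0 1 (singular_face 3 0 \<sigma>)) * \<theta> (edge 1 2 (singular_face 3 0 \<sigma>)) -
     \<kappa> (edge 0 1 (singular_face 3 1 \<sigma>)) * \<theta> (edge 1 2 (singular_face 3 1 \<sigma>)) +
     \<kappa> (edge 0 1 (singular_face 3 2 \<sigma>)) * \<theta> (edge 1 2 (singular_face 3 2 \<sigma>)) -
     \<kappa> (edge 0 1 (singular_face 3 3 \<sigma>)) * \<theta> (edge 1 2 (singular_face 3 3 \<sigma>))"
    using cocycle_edges_3[OF \<theta> \<sigma>] unfolding edges_face_3 by (simp add: algebra_simps)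
qed

lemma binomial_add: "(a + b) * (a + b - 1) div 2 = a * (a - 1) div 2 + b * (b - 1) div 2 + a * (b::int)"
proof -
  have "even (a * (a - 1))" "even (b * (b - 1))" by simp_all
  then obtain k l where "a * (a - 1) = 2 * k" "b * (b - 1) = 2 * l" by (elim evenE)
  moreover have "(a + b) * (a + b - 1) = a * (a - 1) + b * (b - 1) + 2 * (a * b)" by (simp add: algebra_simps)
  ultimately show ?thesis by simp
qed

lemma triple_eval_alternating:
  assumes \<phi>: "cocycle1 Y \<phi>" and \<theta>: "cocycle1 Y \<theta>"
  shows "triple_eval \<zeta> \<phi> \<phi> \<theta> = 0" "triple_eval \<zeta> \<phi> \<theta> \<theta> = 0"
proof -
  define C where "C n = n * (n - 1) div 2" for n :: int
  have C: "C (a + b) = C a + C b + a * b" for a b unfolding C_def by (rule binomial_add)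
  show "triple_eval \<zeta> \<phi> \<phi> \<theta> = 0" unfolding triple_eval_def
  proof (rule eval_exact_3[OF \<zeta>, where \<kappa> = "\<lambda>\<tau>. - C (\<phi> (edge 0 1 \<tau>)) * \<theta> (edge 1 2 \<tau>)"])
    fix \<sigma> assume \<sigma>: "singular_simplex 3 Y \<sigma>"
    show "\<phi> (edge 0 1 \<sigma>) * \<phi> (edge 1 2 \<sigma>) * \<theta> (edge 2 3 \<sigma>) =
      - C (\<phi> (edge 0 1 (singular_face 3 0 \<sigma>))) * \<theta> (edge 1 2 (singular_face 3 0 \<sigma>)) -
      - C (\<phi> (edge 0 1 (singular_face 3 1 \<sigma>))) * \<theta> (edge 1 2 (singular_face 3 1 \<sigma>)) +
      - C (\<phi> (edge 0 1 (singular_face 3 2 \<sigma>))) * \<theta> (edge 1 2 (singular_face 3 2 \<sigma>)) -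
      - C (\<phi> (edge 0 1 (singular_face 3 3 \<sigma>))) * \<theta> (edge 1 2 (singular_face 3 3 \<sigma>))"
      using cocycle_edges_3[OF \<phi> \<sigma>] cocycle_edges_3[OF \<theta> \<sigma>]
      unfolding edges_face_3 by (simp add: C algebra_simps)
  qed
  show "triple_eval \<zeta> \<phi> \<theta> \<theta> = 0" unfolding triple_eval_def
  proof (rule eval_exact_3[OF \<zeta>, where \<kappa> = "\<lambda>\<tau>. \<phi> (edge 0 1 \<tau>) * C (\<theta> (edge 1 2 \<tau>))"])
    fix \<sigma> assume \<sigma>: "singular_simplex 3 Y \<sigma>"
    show "\<phi> (edge 0 1 \<sigma>) * \<theta> (edge 1 2 \<sigma>) * \<theta> (edge 2 3 \<sigma>) =
      \<phi> (edge 0 1 (singular_face 3 0 \<sigma>)) * C (\<theta> (edge 1 2 (singular_face 3 0 \<sigma>))) -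
      \<phi> (edge 0 1 (singular_face 3 1 \<sigma>)) * C (\<theta> (edge 1 2 (singular_face 3 1 \<sigma>))) +
      \<phi> (edge 0 1 (singular_face 3 2 \<sigma>)) * C (\<theta> (edge 1 2 (singular_face 3 2 \<sigma>))) -
      \<phi> (edge 0 1 (singular_face 3 3 \<sigma>)) * C (\<theta> (edge 1 2 (singular_face 3 3 \<sigma>)))"
      using cocycle_edges_3[OF \<phi> \<sigma>] cocycle_edges_3[OF \<theta> \<sigma>]
      unfolding edges_face_3 by (simp add: C algebra_simps)
  qed
qed

end

text \<open>The triple product is a cocycle, so its value depends on the homology class of the chain only.\<close>

lemma triple_eval_boundary:
  assumes \<phi>: "cocycle1 Y \<phi>" and \<psi>: "cocycle1 Y \<psi>" and \<theta>: "cocycle1 Y \<theta>" and d: "singular_chain 4 Y d"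
  shows "triple_eval (chain_boundary 4 d) \<phi> \<psi> \<theta> = 0"
proof -
  let ?\<kappa> = "\<lambda>\<sigma>. \<phi> (edge 0 1 \<sigma>) * \<psi> (edge 1 2 \<sigma>) * \<theta> (edge 2 3 \<sigma>)"
  have "frag_eval (\<lambda>_. 0) d = frag_eval ?\<kappa> (chain_boundary 4 d)"
  proof (rule frag_eval_boundary[OF d])
    fix \<sigma> assume \<sigma>: "singular_simplex 4 Y \<sigma>"
    have "{..4::nat} = {0, 1, 2, 3, 4}" by auto
    then have "frag_eval ?\<kappa> (chain_boundary 4 (frag_of \<sigma>)) =
        ?\<kappa> (singular_face 4 0 \<sigma>) - ?\<kappa> (singular_face 4 1 \<sigma>) + ?\<kappa> (singular_face 4 2 \<sigma>) - ?\<kappa> (singular_face 4 3 \<sigma>) + ?\<kappa> (singular_face 4 4 \<sigma>)"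
      by (simp add: chain_boundary_of)
    also have "\<dots> = 0"
      using cocycle_edges_4[OF \<phi> \<sigma>] cocycle_edges_4[OF \<psi> \<sigma>] cocycle_edges_4[OF \<theta> \<sigma>]
      unfolding edges_face_4 by (simp add: algebra_simps)
    finally show "0 = frag_eval ?\<kappa> (chain_boundary 4 (frag_of \<sigma>))" by simp
  qed
  then show ?thesis by (simp add: triple_eval_def frag_eval_def)
qed

section \<open>First cohomology and the triple cup form\<close>

lemma cochain_eval_eq: "cochain_eval \<phi> c = frag_eval \<phi> c"
  by (simp add: cochain_eval_def frag_eval_def)

lemma cochain_group_simps:
  "carrier (cochain_group p Y) = extensional (singular_simplex_set p Y)"
  "\<phi> \<otimes>\<^bsub>cochain_group p Y\<^esub> \<psi> = (\<lambda>\<sigma>\<in>singular_simplex_set p Y. \<phi> \<sigma> + \<psi> \<sigma>)"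
  "\<one>\<^bsub>cochain_group p Y\<^esub> = (\<lambda>\<sigma>\<in>singular_simplex_set p Y. 0)"
  by (simp_all add: cochain_group_def PiE_def)

lemma comm_group_cochain_group: "comm_group (cochain_group p Y)"
proof -
  interpret group "cochain_group p Y" unfolding cochain_group_def by (rule product_group) simp
  show ?thesis by (rule group_comm_groupI) (simp add: cochain_group_simps add.commute)
qed

lemma inv_cochain_group:
  assumes "\<phi> \<in> extensional (singular_simplex_set p Y)"
  shows "inv\<^bsub>cochain_group p Y\<^esub> \<phi> = (\<lambda>\<sigma>\<in>singular_simplex_set p Y. - \<phi> \<sigma>)"
proof -
  interpret comm_group "cochain_group p Y" by (rule comm_group_cochain_group)
  show ?thesis
    by (rule inv_equality) (use assms in \<open>simp_all add: cochain_group_simps cong: restrict_cong\<close>)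
qed

lemma cocycle1_cong:
  assumes "\<And>e. singular_simplex 1 Y e \<Longrightarrow> \<phi> e = \<psi> e" and "cocycle1 Y \<phi>"
  shows "cocycle1 Y \<psi>"
  unfolding cocycle1_def
proof (intro allI impI)
  fix \<tau> assume \<tau>: "singular_simplex 2 Y \<tau>"
  have e: "singular_simplex 1 Y (edge 0 2 \<tau>)" "singular_simplex 1 Y (edge 0 1 \<tau>)" "singular_simplex 1 Y (edge 1 2 \<tau>)"
    by (rule singular_simplex_edge(1)[OF \<tau>]; simp)+
  show "\<psi> (edge 0 2 \<tau>) = \<psi> (edge 0 1 \<tau>) + \<psi> (edge 1 2 \<tau>)"
    unfolding assms(1)[OF e(1), symmetric] assms(1)[OF e(2), symmetric] assms(1)[OF e(3), symmetric]
    using assms(2) \<tau> unfolding cocycle1_def by blast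
qed

lemma exact1_cong:
  assumes "\<And>e. singular_simplex 1 Y e \<Longrightarrow> \<phi> e = \<psi> e" and "exact1 Y \<phi>"
  shows "exact1 Y \<psi>"
  using assms unfolding exact1_def by metis

lemma cocycle1_add: "cocycle1 Y \<phi> \<Longrightarrow> cocycle1 Y \<psi> \<Longrightarrow> cocycle1 Y (\<lambda>e. \<phi> e + \<psi> e)"
  and cocycle1_uminus: "cocycle1 Y \<phi> \<Longrightarrow> cocycle1 Y (\<lambda>e. - \<phi> e)"
  by (simp_all add: cocycle1_def)

lemma exact1_add:
  assumes "exact1 Y \<phi>" "exact1 Y \<psi>"
  shows "exact1 Y (\<lambda>e. \<phi> e + \<psi> e)"
proof -
  obtain g h where "\<forall>e. singular_simplex 1 Y e \<longrightarrow> \<phi> e = g (e vertex1) - g (e vertex0)"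
    "\<forall>e. singular_simplex 1 Y e \<longrightarrow> \<psi> e = h (e vertex1) - h (e vertex0)"
    using assms unfolding exact1_def by blast
  then show ?thesis unfolding exact1_def by (intro exI[of _ "\<lambda>x. g x + h x"]) simp
qed

lemma exact1_uminus:
  assumes "exact1 Y \<phi>"
  shows "exact1 Y (\<lambda>e. - \<phi> e)"
proof -
  obtain g where "\<forall>e. singular_simplex 1 Y e \<longrightarrow> \<phi> e = g (e vertex1) - g (e vertex0)"
    using assms unfolding exact1_def by blast
  then show ?thesis unfolding exact1_def by (intro exI[of _ "\<lambda>x. - g x"]) simp
qed

lemma exact1_zero: "exact1 Y (\<lambda>e. 0)"
  unfolding exact1_def by (intro exI[of _ "\<lambda>x. 0"]) simp

lemma cocycle_set_1: "\<phi> \<in> cocycle_set 1 Y \<longleftrightarrow> \<phi> \<in> extensional (singular_simplex_set 1 Y) \<and> cocycle1 Y \<phi>"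
proof -
  have "coboundary 1 Y \<phi> = \<one>\<^bsub>cochain_group (Suc 1) Y\<^esub> \<longleftrightarrow>
      (\<forall>\<tau>. singular_simplex 2 Y \<tau> \<longrightarrow> frag_eval \<phi> (chain_boundary 2 (frag_of \<tau>)) = 0)"
    unfolding coboundary_def cochain_group_simps cochain_eval_eq Suc_1
    by (auto simp: fun_eq_iff restrict_def)
  also have "\<dots> \<longleftrightarrow> cocycle1 Y \<phi>"
  proof -
    have eq: "(frag_eval \<phi> (chain_boundary 2 (frag_of \<tau>)) = 0) = (\<phi> (edge 0 2 \<tau>) = \<phi> (edge 0 1 \<tau>) + \<phi> (edge 1 2 \<tau>))" for \<tau>
      unfolding chain_boundary_2 frag_eval_add frag_eval_diff frag_eval_of by arith
    show ?thesis unfolding cocycle1_def eq ..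
  qed
  finally show ?thesis unfolding cocycle_set_def kernel_def cochain_group_simps(1) by blast
qed

lemma coboundary_set_1: "\<phi> \<in> coboundary_set 1 Y \<longleftrightarrow> \<phi> \<in> extensional (singular_simplex_set 1 Y) \<and> exact1 Y \<phi>"
proof -
  have cs: "coboundary_set 1 Y = coboundary 0 Y ` carrier (cochain_group 0 Y)" by (simp add: coboundary_set_def)
  let ?pt = "\<lambda>x. \<lambda>t\<in>standard_simplex 0. x"
  have val: "coboundary 0 Y \<psi> = (\<lambda>e\<in>singular_simplex_set 1 Y. \<psi> (?pt (e vertex1)) - \<psi> (?pt (e vertex0)))" for \<psi>
    unfolding coboundary_def cochain_eval_eq One_nat_def[symmetric] chain_boundary_simplex point_chain_def by simp
  show ?thesis
  proof
    assume "\<phi> \<in> coboundary_set 1 Y"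
    then obtain \<psi> where "\<phi> = coboundary 0 Y \<psi>" unfolding cs by blast
    then have \<phi>: "\<phi> = (\<lambda>e\<in>singular_simplex_set 1 Y. \<psi> (?pt (e vertex1)) - \<psi> (?pt (e vertex0)))" unfolding val .
    have "\<phi> e = \<psi> (?pt (e vertex1)) - \<psi> (?pt (e vertex0))" if "singular_simplex 1 Y e" for e
      unfolding \<phi> using that by simp
    then have "exact1 Y \<phi>" unfolding exact1_def by (intro exI[of _ "\<lambda>x. \<psi> (?pt x)"]) blast
    then show "\<phi> \<in> extensional (singular_simplex_set 1 Y) \<and> exact1 Y \<phi>" unfolding \<phi> by simp
  next
    assume \<phi>: "\<phi> \<in> extensional (singular_simplex_set 1 Y) \<and> exact1 Y \<phi>"
    then obtain g where g: "\<And>e. singular_simplex 1 Y e \<Longrightarrow> \<phi> e = g (e vertex1) - g (e vertex0)"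
      unfolding exact1_def by blast
    define \<psi> where "\<psi> = (\<lambda>s\<in>singular_simplex_set 0 Y. g (s vertex0))"
    have pt: "singular_simplex 0 Y (?pt x)" if "x \<in> topspace Y" for x
      unfolding singular_simplex_def using that by (auto intro: continuous_map_eq[of _ _ "\<lambda>_. x"])
    have \<psi>: "\<psi> (?pt x) = g x" if "x \<in> topspace Y" for x
      using pt[OF that] vertex_in_simplex(1) by (simp add: \<psi>_def)
    have "\<phi> e = coboundary 0 Y \<psi> e" for e
    proof (cases "singular_simplex 1 Y e")
      case True
      have "e vertex0 \<in> topspace Y" "e vertex1 \<in> topspace Y"
        using True vertex_in_simplex(2,3) unfolding singular_simplex_def continuous_map_def by auto
      then show ?thesis unfolding val using g[OF True] \<psi> True by simp
    next
      case False
      then have "\<phi> e = undefined" using \<phi> unfolding extensional_def by blast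
      then show ?thesis unfolding val using False by simp
    qed
    then have "\<phi> = coboundary 0 Y \<psi>" by blast
    moreover have "\<psi> \<in> carrier (cochain_group 0 Y)" unfolding cochain_group_simps \<psi>_def by simp
    ultimately show "\<phi> \<in> coboundary_set 1 Y" unfolding cs by blast
  qed
qed

abbreviation cocycle_group1 :: "'a topology \<Rightarrow> (((nat \<Rightarrow> real) \<Rightarrow> 'a) \<Rightarrow> int) monoid" where
  "cocycle_group1 Y \<equiv> subgroup_generated (cochain_group 1 Y) (cocycle_set 1 Y)"

lemma cocycle_group1:
  shows "comm_group (cocycle_group1 Y)" and "carrier (cocycle_group1 Y) = cocycle_set 1 Y"
    and "subgroup (coboundary_set 1 Y) (cocycle_group1 Y)"
    and "\<And>\<phi>. \<phi> \<in> cocycle_set 1 Y \<Longrightarrow> inv\<^bsub>cocycle_group1 Y\<^esub> \<phi> = (\<lambda>\<sigma>\<in>singular_simplex_set 1 Y. - \<phi> \<sigma>)"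
proof -
  interpret C: comm_group "cochain_group 1 Y" by (rule comm_group_cochain_group)
  have sub: "subgroup (cocycle_set 1 Y) (cochain_group 1 Y)"
  proof (rule C.subgroupI)
    show "cocycle_set 1 Y \<subseteq> carrier (cochain_group 1 Y)"
      unfolding cochain_group_simps using cocycle_set_1 by blast
    have "cocycle1 Y (\<lambda>e\<in>singular_simplex_set 1 Y. 0)"
      by (rule cocycle1_cong[OF _ exact_cocycle1[OF exact1_zero]]) simp
    then have "(\<lambda>e\<in>singular_simplex_set 1 Y. 0) \<in> cocycle_set 1 Y" unfolding cocycle_set_1 by simp
    then show "cocycle_set 1 Y \<noteq> {}" by blast
    show "inv\<^bsub>cochain_group 1 Y\<^esub> \<phi> \<in> cocycle_set 1 Y" if "\<phi> \<in> cocycle_set 1 Y" for \<phi>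
    proof -
      have \<phi>: "\<phi> \<in> extensional (singular_simplex_set 1 Y)" "cocycle1 Y \<phi>" using that unfolding cocycle_set_1 by blast+
      have "cocycle1 Y (\<lambda>\<sigma>\<in>singular_simplex_set 1 Y. - \<phi> \<sigma>)"
        by (rule cocycle1_cong[OF _ cocycle1_uminus[OF \<phi>(2)]]) simp
      then show ?thesis unfolding inv_cochain_group[OF \<phi>(1)] cocycle_set_1 by simp
    qed
    show "\<phi> \<otimes>\<^bsub>cochain_group 1 Y\<^esub> \<psi> \<in> cocycle_set 1 Y" if "\<phi> \<in> cocycle_set 1 Y" "\<psi> \<in> cocycle_set 1 Y" for \<phi> \<psi>
    proof -
      have "cocycle1 Y \<phi>" "cocycle1 Y \<psi>" using that unfolding cocycle_set_1 by blast+
      from cocycle1_add[OF this] have "cocycle1 Y (\<lambda>\<sigma>\<in>singular_simplex_set 1 Y. \<phi> \<sigma> + \<psi> \<sigma>)"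
        by (rule cocycle1_cong[rotated]) simp
      then show ?thesis unfolding cochain_group_simps cocycle_set_1 by simp
    qed
  qed
  show car: "carrier (cocycle_group1 Y) = cocycle_set 1 Y" by (rule subgroup.carrier_subgroup_generated_subgroup[OF sub])
  show S: "comm_group (cocycle_group1 Y)" by (rule C.abelian_subgroup_generated[OF comm_group_cochain_group])
  show inv: "inv\<^bsub>cocycle_group1 Y\<^esub> \<phi> = (\<lambda>\<sigma>\<in>singular_simplex_set 1 Y. - \<phi> \<sigma>)" if "\<phi> \<in> cocycle_set 1 Y" for \<phi>
  proof -
    have "\<phi> \<in> carrier (cocycle_group1 Y)" using that unfolding car .
    then have "inv\<^bsub>cocycle_group1 Y\<^esub> \<phi> = inv\<^bsub>cochain_group 1 Y\<^esub> \<phi>" by (rule C.inv_subgroup_generated)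
    then show ?thesis using inv_cochain_group[of \<phi> 1 Y] that unfolding cocycle_set_1 by simp
  qed
  interpret S: comm_group "cocycle_group1 Y" by (rule S)
  have BZ: "coboundary_set 1 Y \<subseteq> cocycle_set 1 Y"
    unfolding subset_iff cocycle_set_1 coboundary_set_1 using exact_cocycle1 by blast
  show "subgroup (coboundary_set 1 Y) (cocycle_group1 Y)"
  proof (rule S.subgroupI)
    show "coboundary_set 1 Y \<subseteq> carrier (cocycle_group1 Y)" using BZ unfolding car .
    have "exact1 Y (\<lambda>e\<in>singular_simplex_set 1 Y. 0)" by (rule exact1_cong[OF _ exact1_zero]) simp
    then have "(\<lambda>e\<in>singular_simplex_set 1 Y. 0) \<in> coboundary_set 1 Y" unfolding coboundary_set_1 by simp
    then show "coboundary_set 1 Y \<noteq> {}" by blast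
    show "inv\<^bsub>cocycle_group1 Y\<^esub> \<phi> \<in> coboundary_set 1 Y" if "\<phi> \<in> coboundary_set 1 Y" for \<phi>
    proof -
      have "exact1 Y \<phi>" using that unfolding coboundary_set_1 by blast
      from exact1_uminus[OF this] have "exact1 Y (\<lambda>\<sigma>\<in>singular_simplex_set 1 Y. - \<phi> \<sigma>)"
        by (rule exact1_cong[rotated]) simp
      moreover have "\<phi> \<in> cocycle_set 1 Y" using that BZ by blast
      ultimately show ?thesis unfolding inv[OF \<open>\<phi> \<in> cocycle_set 1 Y\<close>] coboundary_set_1 by simp
    qed
    show "\<phi> \<otimes>\<^bsub>cocycle_group1 Y\<^esub> \<psi> \<in> coboundary_set 1 Y" if "\<phi> \<in> coboundary_set 1 Y" "\<psi> \<in> coboundary_set 1 Y" for \<phi> \<psi>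
    proof -
      have "exact1 Y \<phi>" "exact1 Y \<psi>" using that unfolding coboundary_set_1 by blast+
      from exact1_add[OF this] have "exact1 Y (\<lambda>\<sigma>\<in>singular_simplex_set 1 Y. \<phi> \<sigma> + \<psi> \<sigma>)"
        by (rule exact1_cong[rotated]) simp
      then show ?thesis unfolding mult_subgroup_generated cochain_group_simps coboundary_set_1 by simp
    qed
  qed
qed

definition cohom_class :: "'a topology \<Rightarrow> (((nat \<Rightarrow> real) \<Rightarrow> 'a) \<Rightarrow> int) \<Rightarrow> (((nat \<Rightarrow> real) \<Rightarrow> 'a) \<Rightarrow> int) set" where
  "cohom_class Y \<phi> = coboundary_set 1 Y #>\<^bsub>cocycle_group1 Y\<^esub> \<phi>"

abbreviation cohom_rep :: "(((nat \<Rightarrow> real) \<Rightarrow> 'a) \<Rightarrow> int) set \<Rightarrow> (((nat \<Rightarrow> real) \<Rightarrow> 'a) \<Rightarrow> int)" where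
  "cohom_rep A \<equiv> SOME \<phi>. \<phi> \<in> A"

lemma cohomology_group_1: "cohomology_group 1 Y = cocycle_group1 Y Mod coboundary_set 1 Y"
  by (simp only: cohomology_group_def)

lemmas cohomology_facts = comm_FactGroup_facts[OF cocycle_group1(1,3), folded cohomology_group_1 cohom_class_def, unfolded cocycle_group1(2)]

lemma cohomology_cases:
  assumes "a \<in> carrier (cohomology_group 1 Y)"
  obtains \<phi> where "\<phi> \<in> cocycle_set 1 Y" "a = cohom_class Y \<phi>"
  using assms cohomology_facts(2)[of Y] by blast

lemma cohom_class_mult:
  assumes "\<phi> \<in> cocycle_set 1 Y" "\<psi> \<in> cocycle_set 1 Y"
  shows "cohom_class Y \<phi> \<otimes>\<^bsub>cohomology_group 1 Y\<^esub> cohom_class Y \<psi> = cohom_class Y (\<lambda>\<sigma>\<in>singular_simplex_set 1 Y. \<phi> \<sigma> + \<psi> \<sigma>)"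
    and "(\<lambda>\<sigma>\<in>singular_simplex_set 1 Y. \<phi> \<sigma> + \<psi> \<sigma>) \<in> cocycle_set 1 Y"
proof -
  have eq: "\<phi> \<otimes>\<^bsub>cocycle_group1 Y\<^esub> \<psi> = (\<lambda>\<sigma>\<in>singular_simplex_set 1 Y. \<phi> \<sigma> + \<psi> \<sigma>)"
    unfolding mult_subgroup_generated cochain_group_simps ..
  show "cohom_class Y \<phi> \<otimes>\<^bsub>cohomology_group 1 Y\<^esub> cohom_class Y \<psi> = cohom_class Y (\<lambda>\<sigma>\<in>singular_simplex_set 1 Y. \<phi> \<sigma> + \<psi> \<sigma>)"
    using cohomology_facts(3)[OF assms] unfolding eq by (rule sym)
  interpret S: comm_group "cocycle_group1 Y" by (rule cocycle_group1)
  have "\<phi> \<otimes>\<^bsub>cocycle_group1 Y\<^esub> \<psi> \<in> carrier (cocycle_group1 Y)"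
    using assms by (intro S.m_closed) (simp_all only: cocycle_group1(2))
  then show "(\<lambda>\<sigma>\<in>singular_simplex_set 1 Y. \<phi> \<sigma> + \<psi> \<sigma>) \<in> cocycle_set 1 Y" unfolding eq cocycle_group1(2) .
qed

lemma cohom_rep:
  assumes \<phi>: "\<phi> \<in> cocycle_set 1 Y"
  shows "cohom_rep (cohom_class Y \<phi>) \<in> cocycle_set 1 Y" "exact1 Y (\<lambda>e. cohom_rep (cohom_class Y \<phi>) e - \<phi> e)"
proof -
  interpret S: comm_group "cocycle_group1 Y" by (rule cocycle_group1)
  have "\<phi> \<in> cohom_class Y \<phi>"
    unfolding cohom_class_def using \<phi> cocycle_group1(2,3) by (intro S.rcos_self) blast+
  then have "cohom_rep (cohom_class Y \<phi>) \<in> cohom_class Y \<phi>" by (rule someI[of "\<lambda>\<psi>. \<psi> \<in> cohom_class Y \<phi>"])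
  then obtain \<beta> where \<beta>: "\<beta> \<in> coboundary_set 1 Y" "cohom_rep (cohom_class Y \<phi>) = \<beta> \<otimes>\<^bsub>cocycle_group1 Y\<^esub> \<phi>"
    unfolding cohom_class_def[of Y \<phi>] r_coset_def by blast
  have \<beta>Z: "\<beta> \<in> cocycle_set 1 Y" using \<beta>(1) exact_cocycle1 unfolding cocycle_set_1 coboundary_set_1 by blast
  have eq: "cohom_rep (cohom_class Y \<phi>) = (\<lambda>\<sigma>\<in>singular_simplex_set 1 Y. \<beta> \<sigma> + \<phi> \<sigma>)"
    unfolding \<beta>(2) mult_subgroup_generated cochain_group_simps ..
  show "cohom_rep (cohom_class Y \<phi>) \<in> cocycle_set 1 Y" unfolding eq by (rule cohom_class_mult(2)[OF \<beta>Z \<phi>])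
  have "exact1 Y \<beta>" using \<beta>(1) unfolding coboundary_set_1 by blast
  then show "exact1 Y (\<lambda>e. cohom_rep (cohom_class Y \<phi>) e - \<phi> e)"
    unfolding eq by (rule exact1_cong[rotated]) simp
qed

lemma frag_eval_fun_add: "frag_eval (\<lambda>x. f x + g x) c = frag_eval f c + frag_eval g (c :: 'x \<Rightarrow>\<^sub>0 int)"
  by (simp add: frag_eval_def sum.distrib distrib_left)

lemma frag_eval_fun_diff: "frag_eval (\<lambda>x. f x - g x) c = frag_eval f c - frag_eval g (c :: 'x \<Rightarrow>\<^sub>0 int)"
  by (simp add: frag_eval_def sum_subtractf right_diff_distrib)

lemma frag_eval_fun_scale: "frag_eval (\<lambda>x. k * f x) c = k * frag_eval f (c :: 'x \<Rightarrow>\<^sub>0 int)" for k :: int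
  by (simp add: frag_eval_def sum_distrib_left mult.left_commute)

lemma cohom_rep_eval:
  assumes "\<phi> \<in> cocycle_set 1 Y" "c \<in> cycles1 Y"
  shows "frag_eval (cohom_rep (cohom_class Y \<phi>)) c = frag_eval \<phi> c"
  using exact1_cycles[OF cohom_rep(2)[OF assms(1)] assms(2)] unfolding frag_eval_fun_diff by simp

text \<open>The representative of a product is an unspecified choice, hence known up to a coboundary only.\<close>

lemma cup_representative:
  assumes r: "p + q = Suc r"
  obtains \<kappa> where "\<And>\<sigma>. singular_simplex (Suc r) Y \<sigma> \<Longrightarrow>
    (SOME \<xi>. \<xi> \<in> cup p q Y A B) \<sigma> = frag_eval \<kappa> (chain_boundary (Suc r) (frag_of \<sigma>))
      + (SOME \<phi>. \<phi> \<in> A) (front_face p \<sigma>) * (SOME \<psi>. \<psi> \<in> B) (back_face p q \<sigma>)"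
proof -
  define cc where "cc = cochain_cup p q Y (SOME \<phi>. \<phi> \<in> A) (SOME \<psi>. \<psi> \<in> B)"
  define \<xi> where "\<xi> = (SOME \<xi>. \<xi> \<in> cup p q Y A B)"
  have cup: "cup p q Y A B = coboundary_set (Suc r) Y #>\<^bsub>cochain_group (Suc r) Y\<^esub> cc"
    unfolding cup_def cc_def r ..
  have cs: "coboundary_set (Suc r) Y = coboundary r Y ` carrier (cochain_group r Y)" by (simp add: coboundary_set_def)
  have "(\<lambda>\<sigma>\<in>singular_simplex_set r Y. 0) \<in> carrier (cochain_group r Y)" unfolding cochain_group_simps by simp
  then have "coboundary r Y (\<lambda>\<sigma>\<in>singular_simplex_set r Y. 0) \<otimes>\<^bsub>cochain_group (Suc r) Y\<^esub> cc \<in> cup p q Y A B"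
    unfolding cup cs r_coset_def by blast
  then have "\<xi> \<in> cup p q Y A B" unfolding \<xi>_def by (rule someI[of "\<lambda>\<xi>. \<xi> \<in> cup p q Y A B"])
  then obtain \<kappa> where "\<xi> = coboundary r Y \<kappa> \<otimes>\<^bsub>cochain_group (Suc r) Y\<^esub> cc"
    unfolding cup cs r_coset_def by blast
  then have "\<xi> \<sigma> = frag_eval \<kappa> (chain_boundary (Suc r) (frag_of \<sigma>))
      + (SOME \<phi>. \<phi> \<in> A) (front_face p \<sigma>) * (SOME \<psi>. \<psi> \<in> B) (back_face p q \<sigma>)" if "singular_simplex (Suc r) Y \<sigma>" for \<sigma>
    using that r by (simp add: cochain_group_simps coboundary_def cochain_eval_eq cc_def cochain_cup_def)
  then show ?thesis unfolding \<xi>_def by (rule that)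
qed

lemma front_face_singular_face: "front_face 2 \<sigma> = singular_face 3 3 \<sigma>"
proof -
  have "simplical_face 3 t = t" if "t \<in> standard_simplex 2" for t :: "nat \<Rightarrow> real"
  proof
    fix i
    have z: "t k = 0" if "k > 2" for k using \<open>t \<in> standard_simplex 2\<close> that by (simp add: standard_simplex_def)
    show "simplical_face 3 t i = t i" using z[of i] z[of "i - 1"] by (simp add: simplical_face_def)
  qed
  then show ?thesis unfolding front_face_def singular_face_def by (auto intro!: restrict_ext)
qed

lemma triple_eval_fun_add:
  "triple_eval \<zeta> (\<lambda>e. \<phi> e + \<phi>' e) \<psi> \<theta> = triple_eval \<zeta> \<phi> \<psi> \<theta> + triple_eval \<zeta> \<phi>' \<psi> \<theta>"
  "triple_eval \<zeta> \<phi> (\<lambda>e. \<psi> e + \<psi>' e) \<theta> = triple_eval \<zeta> \<phi> \<psi> \<theta> + triple_eval \<zeta> \<phi> \<psi>' \<theta>"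
  "triple_eval \<zeta> \<phi> \<psi> (\<lambda>e. \<theta> e + \<theta>' e) = triple_eval \<zeta> \<phi> \<psi> \<theta> + triple_eval \<zeta> \<phi> \<psi> \<theta>'"
  unfolding triple_eval_def by (simp_all add: distrib_left distrib_right frag_eval_fun_add)

lemma triple_eval_cong:
  assumes \<zeta>: "singular_chain 3 Y \<zeta>"
    and "\<And>e. singular_simplex 1 Y e \<Longrightarrow> \<phi> e = \<phi>' e" "\<And>e. singular_simplex 1 Y e \<Longrightarrow> \<psi> e = \<psi>' e"
      "\<And>e. singular_simplex 1 Y e \<Longrightarrow> \<theta> e = \<theta>' e"
  shows "triple_eval \<zeta> \<phi> \<psi> \<theta> = triple_eval \<zeta> \<phi>' \<psi>' \<theta>'"
  unfolding triple_eval_def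
proof (rule frag_eval_cong[OF \<zeta>])
  fix \<sigma> assume \<sigma>: "singular_simplex 3 Y \<sigma>"
  have e: "singular_simplex 1 Y (edge 0 1 \<sigma>)" "singular_simplex 1 Y (edge 1 2 \<sigma>)" "singular_simplex 1 Y (edge 2 3 \<sigma>)"
    by (rule singular_simplex_edge(1)[OF \<sigma>]; simp)+
  show "\<phi> (edge 0 1 \<sigma>) * \<psi> (edge 1 2 \<sigma>) * \<theta> (edge 2 3 \<sigma>) = \<phi>' (edge 0 1 \<sigma>) * \<psi>' (edge 1 2 \<sigma>) * \<theta>' (edge 2 3 \<sigma>)"
    unfolding assms(2)[OF e(1)] assms(3)[OF e(2)] assms(4)[OF e(3)] ..
qed

context
  fixes Y :: "'a topology" and z :: "'a chain set"
  assumes z: "z \<in> carrier (homology_group (int 3) Y)"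
begin

abbreviation rep_cycle :: "'a chain" where "rep_cycle \<equiv> SOME c. c \<in> z"

lemma rep_cycle: "singular_chain 3 Y rep_cycle" "chain_boundary 3 rep_cycle = 0"
proof -
  obtain c where c: "singular_relcycle 3 Y {} c" "z = homologous_rel_set 3 Y {} c"
    using z unfolding carrier_relative_homology_group by blast
  have "c \<in> z" unfolding c(2) by simp
  then have "rep_cycle \<in> z" by (rule someI)
  then have "homologous_rel 3 Y {} c rep_cycle" unfolding c(2) by blast
  then have "singular_relcycle 3 Y {} rep_cycle" using c(1) homologous_rel_singular_relcycle by blast
  then show "singular_chain 3 Y rep_cycle" "chain_boundary 3 rep_cycle = 0" unfolding singular_cycle by blast+
qed

text \<open>The choices of representatives change the product by coboundaries, which vanish on a cycle.\<close>

theorem triple_cup_form_eval: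
  assumes Z: "\<phi> \<in> cocycle_set 1 Y" "\<psi> \<in> cocycle_set 1 Y" "\<theta> \<in> cocycle_set 1 Y"
  shows "triple_cup_form Y z (cohom_class Y \<phi>) (cohom_class Y \<psi>) (cohom_class Y \<theta>) = triple_eval rep_cycle \<phi> \<psi> \<theta>"
proof -
  define a b c where "a = cohom_rep (cohom_class Y \<phi>)" and "b = cohom_rep (cohom_class Y \<psi>)" and "c = cohom_rep (cohom_class Y \<theta>)"
  define \<xi>2 where "\<xi>2 = (SOME \<xi>. \<xi> \<in> cup 1 1 Y (cohom_class Y \<phi>) (cohom_class Y \<psi>))"
  define \<xi>3 where "\<xi>3 = (SOME \<xi>. \<xi> \<in> cup 2 1 Y (cup 1 1 Y (cohom_class Y \<phi>) (cohom_class Y \<psi>)) (cohom_class Y \<theta>))"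
  have co: "cocycle1 Y \<phi>" "cocycle1 Y \<psi>" "cocycle1 Y \<theta>" using Z unfolding cocycle_set_1 by blast+
  have co': "cocycle1 Y a" "cocycle1 Y b" "cocycle1 Y c"
    using cohom_rep(1)[OF Z(1)] cohom_rep(1)[OF Z(2)] cohom_rep(1)[OF Z(3)] unfolding cocycle_set_1 a_def b_def c_def by blast+
  have s: "Suc 1 = (2::nat)" "Suc 2 = (3::nat)" by simp_all
  obtain \<kappa>2 where \<kappa>2: "\<And>\<sigma>. singular_simplex 2 Y \<sigma> \<Longrightarrow>
      \<xi>2 \<sigma> = frag_eval \<kappa>2 (chain_boundary 2 (frag_of \<sigma>)) + a (front_face 1 \<sigma>) * b (back_face 1 1 \<sigma>)"
  proof (rule cup_representative[of 1 1 1 Y "cohom_class Y \<phi>" "cohom_class Y \<psi>", unfolded s, OF one_add_one])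
    fix \<kappa> assume "\<And>\<sigma>. singular_simplex 2 Y \<sigma> \<Longrightarrow>
      (SOME \<xi>. \<xi> \<in> cup 1 1 Y (cohom_class Y \<phi>) (cohom_class Y \<psi>)) \<sigma> = frag_eval \<kappa> (chain_boundary 2 (frag_of \<sigma>))
        + cohom_rep (cohom_class Y \<phi>) (front_face 1 \<sigma>) * cohom_rep (cohom_class Y \<psi>) (back_face 1 1 \<sigma>)"
    then show thesis by (rule that[of \<kappa>, unfolded \<xi>2_def a_def b_def])
  qed
  obtain \<kappa>3 where \<kappa>3: "\<And>\<sigma>. singular_simplex 3 Y \<sigma> \<Longrightarrow>
      \<xi>3 \<sigma> = frag_eval \<kappa>3 (chain_boundary 3 (frag_of \<sigma>)) + \<xi>2 (front_face 2 \<sigma>) * c (back_face 2 1 \<sigma>)"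
  proof (rule cup_representative[of 2 1 2, unfolded s])
    show "2 + 1 = (3::nat)" by simp
  qed (use that in \<open>unfold \<xi>2_def \<xi>3_def c_def, blast\<close>)
  let ?D = "\<lambda>\<sigma>. (\<kappa>2 (edge 1 2 \<sigma>) - \<kappa>2 (edge 0 2 \<sigma>) + \<kappa>2 (edge 0 1 \<sigma>)) * c (edge 2 3 \<sigma>)"
  let ?T = "\<lambda>\<sigma>. a (edge 0 1 \<sigma>) * b (edge 1 2 \<sigma>) * c (edge 2 3 \<sigma>)"
  let ?K = "\<lambda>\<sigma>. frag_eval \<kappa>3 (chain_boundary 3 (frag_of \<sigma>))"
  have "\<xi>3 \<sigma> = ?K \<sigma> + (?D \<sigma> + ?T \<sigma>)" if \<sigma>: "singular_simplex 3 Y \<sigma>" for \<sigma>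
  proof -
    have "singular_simplex 2 Y (front_face 2 \<sigma>)"
      unfolding front_face_singular_face using singular_simplex_singular_face[OF \<sigma>, of 3] by simp
    from \<kappa>2[OF this] have front: "\<xi>2 (front_face 2 \<sigma>) = \<kappa>2 (edge 1 2 \<sigma>) - \<kappa>2 (edge 0 2 \<sigma>) + \<kappa>2 (edge 0 1 \<sigma>) + a (edge 0 1 \<sigma>) * b (edge 1 2 \<sigma>)"
      unfolding chain_boundary_2 front_face_1 back_face_edge s frag_eval_add frag_eval_diff frag_eval_of
      by (simp only: edge_front_face zero_less_numeral zero_less_one one_less_numeral_iff num.simps semiring_norm order_refl one_le_numeral)
    show ?thesis unfolding \<kappa>3[OF \<sigma>] front back_face_edge s by (simp add: algebra_simps)
  qed
  then have "frag_eval \<xi>3 rep_cycle = frag_eval (\<lambda>\<sigma>. ?K \<sigma> + (?D \<sigma> + ?T \<sigma>)) rep_cycle"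
    by (rule frag_eval_cong[OF rep_cycle(1)])
  also have "\<dots> = frag_eval ?K rep_cycle + (frag_eval ?D rep_cycle + frag_eval ?T rep_cycle)"
    unfolding frag_eval_fun_add ..
  also have "frag_eval ?K rep_cycle = 0"
    using frag_eval_boundary[OF rep_cycle(1), of ?K \<kappa>3] rep_cycle(2) by simp
  also have "frag_eval ?D rep_cycle = 0" by (rule coboundary_cup_eval[OF rep_cycle co'(3)])
  finally have "frag_eval \<xi>3 rep_cycle = triple_eval rep_cycle a b c" unfolding triple_eval_def by simp
  also have "triple_eval rep_cycle a b c = triple_eval rep_cycle \<phi> b c"
  proof -
    have ex: "exact1 Y (\<lambda>e. a e - \<phi> e)" unfolding a_def by (rule cohom_rep(2)[OF Z(1)])
    have "triple_eval rep_cycle (\<lambda>e. \<phi> e + (a e - \<phi> e)) b c = triple_eval rep_cycle \<phi> b c + triple_eval rep_cycle (\<lambda>e. a e - \<phi> e) b c"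
      by (rule triple_eval_fun_add)
    then show ?thesis using triple_eval_exact(1)[OF rep_cycle exact_cocycle1[OF ex] co'(2,3) ex] by simp
  qed
  also have "triple_eval rep_cycle \<phi> b c = triple_eval rep_cycle \<phi> \<psi> c"
  proof -
    have ex: "exact1 Y (\<lambda>e. b e - \<psi> e)" unfolding b_def by (rule cohom_rep(2)[OF Z(2)])
    have "triple_eval rep_cycle \<phi> (\<lambda>e. \<psi> e + (b e - \<psi> e)) c = triple_eval rep_cycle \<phi> \<psi> c + triple_eval rep_cycle \<phi> (\<lambda>e. b e - \<psi> e) c"
      by (rule triple_eval_fun_add)
    then show ?thesis using triple_eval_exact(2)[OF rep_cycle co(1) exact_cocycle1[OF ex] co'(3) ex] by simp
  qed
  also have "triple_eval rep_cycle \<phi> \<psi> c = triple_eval rep_cycle \<phi> \<psi> \<theta>"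
  proof -
    have ex: "exact1 Y (\<lambda>e. c e - \<theta> e)" unfolding c_def by (rule cohom_rep(2)[OF Z(3)])
    have "triple_eval rep_cycle \<phi> \<psi> (\<lambda>e. \<theta> e + (c e - \<theta> e)) = triple_eval rep_cycle \<phi> \<psi> \<theta> + triple_eval rep_cycle \<phi> \<psi> (\<lambda>e. c e - \<theta> e)"
      by (rule triple_eval_fun_add)
    then show ?thesis using triple_eval_exact(3)[OF rep_cycle co(1,2) exact_cocycle1[OF ex] ex] by simp
  qed
  finally show ?thesis unfolding triple_cup_form_def class_eval_def cochain_eval_eq \<xi>3_def .
qed

theorem alternating3_triple_cup_form: "alternating3 (cohomology_group 1 Y) (triple_cup_form Y z)"
proof -
  let ?H = "cohomology_group 1 Y" and ?\<mu> = "triple_cup_form Y z" and ?S = "singular_simplex_set 1 Y"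
  have co: "cocycle1 Y \<phi>" if "\<phi> \<in> cocycle_set 1 Y" for \<phi> using that unfolding cocycle_set_1 by blast
  have res: "(\<lambda>\<sigma>\<in>?S. \<phi> \<sigma> + \<psi> \<sigma>) e = \<phi> e + \<psi> e" if "singular_simplex 1 Y e" for \<phi> \<psi> :: "_ \<Rightarrow> int" and e
    using that by simp
  have add1: "?\<mu> (a \<otimes>\<^bsub>?H\<^esub> a') b c = ?\<mu> a b c + ?\<mu> a' b c"
    and add2: "?\<mu> b (a \<otimes>\<^bsub>?H\<^esub> a') c = ?\<mu> b a c + ?\<mu> b a' c"
    and add3: "?\<mu> b c (a \<otimes>\<^bsub>?H\<^esub> a') = ?\<mu> b c a + ?\<mu> b c a'"
    and alt: "?\<mu> b b c = 0" "?\<mu> b c c = 0"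
    if abc: "a \<in> carrier ?H" "a' \<in> carrier ?H" "b \<in> carrier ?H" "c \<in> carrier ?H" for a a' b c
  proof -
    obtain \<alpha> where a: "\<alpha> \<in> cocycle_set 1 Y" "a = cohom_class Y \<alpha>" by (rule cohomology_cases[OF abc(1)])
    obtain \<alpha>' where a': "\<alpha>' \<in> cocycle_set 1 Y" "a' = cohom_class Y \<alpha>'" by (rule cohomology_cases[OF abc(2)])
    obtain \<beta> where b: "\<beta> \<in> cocycle_set 1 Y" "b = cohom_class Y \<beta>" by (rule cohomology_cases[OF abc(3)])
    obtain \<gamma> where c: "\<gamma> \<in> cocycle_set 1 Y" "c = cohom_class Y \<gamma>" by (rule cohomology_cases[OF abc(4)])
    note prod = cohom_class_mult[OF a(1) a'(1)]
    show "?\<mu> (a \<otimes>\<^bsub>?H\<^esub> a') b c = ?\<mu> a b c + ?\<mu> a' b c"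
      unfolding a(2) a'(2) b(2) c(2) prod(1) triple_cup_form_eval[OF prod(2) b(1) c(1)]
        triple_cup_form_eval[OF a(1) b(1) c(1)] triple_cup_form_eval[OF a'(1) b(1) c(1)] triple_eval_fun_add(1)[symmetric]
      by (rule triple_eval_cong[OF rep_cycle(1) res refl refl])
    show "?\<mu> b (a \<otimes>\<^bsub>?H\<^esub> a') c = ?\<mu> b a c + ?\<mu> b a' c"
      unfolding a(2) a'(2) b(2) c(2) prod(1) triple_cup_form_eval[OF b(1) prod(2) c(1)]
        triple_cup_form_eval[OF b(1) a(1) c(1)] triple_cup_form_eval[OF b(1) a'(1) c(1)] triple_eval_fun_add(2)[symmetric]
      by (rule triple_eval_cong[OF rep_cycle(1) refl res refl])
    show "?\<mu> b c (a \<otimes>\<^bsub>?H\<^esub> a') = ?\<mu> b c a + ?\<mu> b c a'"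
      unfolding a(2) a'(2) b(2) c(2) prod(1) triple_cup_form_eval[OF b(1) c(1) prod(2)]
        triple_cup_form_eval[OF b(1) c(1) a(1)] triple_cup_form_eval[OF b(1) c(1) a'(1)] triple_eval_fun_add(3)[symmetric]
      by (rule triple_eval_cong[OF rep_cycle(1) refl refl res])
    show "?\<mu> b b c = 0" "?\<mu> b c c = 0"
      unfolding b(2) c(2) triple_cup_form_eval[OF b(1) b(1) c(1)] triple_cup_form_eval[OF b(1) c(1) c(1)]
      using triple_eval_alternating[OF rep_cycle co[OF b(1)] co[OF c(1)]] by blast+
  qed
  show ?thesis
    unfolding alternating3_def alternating2_def additive_form_def
  proof (intro ballI conjI)
    fix a b c d assume m: "a \<in> carrier ?H" "b \<in> carrier ?H" "c \<in> carrier ?H" "d \<in> carrier ?H"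
    show "?\<mu> a b (c \<otimes>\<^bsub>?H\<^esub> d) = ?\<mu> a b c + ?\<mu> a b d" by (rule add3[OF m(3,4,1,2)])
    show "?\<mu> a (c \<otimes>\<^bsub>?H\<^esub> d) b = ?\<mu> a c b + ?\<mu> a d b" by (rule add2[OF m(3,4,1,2)])
    show "?\<mu> (c \<otimes>\<^bsub>?H\<^esub> d) a b = ?\<mu> c a b + ?\<mu> d a b" by (rule add1[OF m(3,4,1,2)])
  next
    fix a b assume m: "a \<in> carrier ?H" "b \<in> carrier ?H"
    show "?\<mu> a b b = 0" by (rule alt(2)[OF m(1) m(1) m])
    show "?\<mu> a a b = 0" by (rule alt(1)[OF m(1) m(1) m])
  qed
qed

end

text \<open>First cohomology is torsion-free and dual to first homology; a dual basis of the latter therefore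
  provides rational coordinates on it.\<close>

theorem rational_basis_cohomology:
  assumes db: "dual_basis (cycles1 Y) (bounds1 Y) b x f N"
    and \<alpha>: "\<And>j c. j < b \<Longrightarrow> c \<in> cycles1 Y \<Longrightarrow> frag_eval (\<alpha> j) c = f j c"
  shows "rational_basis (cohomology_group 1 Y) b (\<lambda>a j. of_int (frag_eval (cohom_rep a) (if j < b then x j else 0)) / of_int N)
     (\<lambda>j. cohom_class Y (restrict (\<alpha> j) (singular_simplex_set 1 Y))) N"
    and "\<And>j. j < b \<Longrightarrow> restrict (\<alpha> j) (singular_simplex_set 1 Y) \<in> cocycle_set 1 Y"
proof -
  let ?H = "cohomology_group 1 Y" and ?S = "singular_simplex_set 1 Y"
  \<comment> \<open>Coordinates have to be additive at every index, so those from \<open>b\<close> on are evaluated at zero.\<close>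
  let ?x = "\<lambda>j. if j < b then x j else 0"
  let ?co = "\<lambda>a j. of_int (frag_eval (cohom_rep a) (?x j)) / of_int N :: rat"
  have xZ': "?x j \<in> cycles1 Y" for j using db cycles1_D(1)[of Y] by (simp add: dual_basis_def)
  have N: "N > 0" and xZ: "\<And>j. j < b \<Longrightarrow> x j \<in> cycles1 Y" and fB: "\<And>j a. j < b \<Longrightarrow> a \<in> bounds1 Y \<Longrightarrow> f j a = 0"
    and fx: "\<And>i j. i < b \<Longrightarrow> j < b \<Longrightarrow> f j (x i) = (if i = j then N else 0)"
    and fadd: "\<And>j. j < b \<Longrightarrow> additive_on (cycles1 Y) (f j)"
    and ker: "\<And>c. c \<in> cycles1 Y \<Longrightarrow> (\<And>j. j < b \<Longrightarrow> f j c = 0) \<Longrightarrow> \<exists>n>0. frag_cmul n c \<in> bounds1 Y"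
    using db unfolding dual_basis_def by blast+
  have res: "restrict (\<alpha> j) ?S e = \<alpha> j e" if "singular_simplex 1 Y e" for e j using that by simp
  have res_eval: "frag_eval (restrict (\<alpha> j) ?S) c = f j c" if "j < b" "c \<in> cycles1 Y" for j c
  proof -
    have "singular_chain 1 Y c" using that(2) unfolding cycles1_def by blast
    then have "frag_eval (restrict (\<alpha> j) ?S) c = frag_eval (\<alpha> j) c" by (rule frag_eval_cong[OF _ res])
    then show ?thesis using \<alpha>[OF that] by simp
  qed
  show \<alpha>Z: "restrict (\<alpha> j) ?S \<in> cocycle_set 1 Y" if "j < b" for j
  proof -
    have "cocycle1 Y (restrict (\<alpha> j) ?S)"
    proof (rule cocycle1I)
      fix c assume c: "c \<in> bounds1 Y"
      then have "c \<in> cycles1 Y" using bounds1_subset_cycles1 by blast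
      then show "frag_eval (restrict (\<alpha> j) ?S) c = 0" using res_eval[OF that] fB[OF that c] by simp
    qed
    then show ?thesis unfolding cocycle_set_1 by simp
  qed
  have co: "?co (cohom_class Y \<phi>) j = of_int (frag_eval \<phi> (x j)) / of_int N" if "\<phi> \<in> cocycle_set 1 Y" "j < b" for \<phi> j
    using cohom_rep_eval[OF that(1) xZ[OF that(2)]] that(2) by simp
  have inj: "cohom_class Y \<phi> = cohom_class Y \<psi>"
    if Z: "\<phi> \<in> cocycle_set 1 Y" "\<psi> \<in> cocycle_set 1 Y" and eq: "\<And>j. j < b \<Longrightarrow> frag_eval \<phi> (x j) = frag_eval \<psi> (x j)" for \<phi> \<psi>
  proof -
    define D where "D e = \<phi> e - \<psi> e" for e
    have coD: "cocycle1 Y D"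
      using cocycle1_add[of Y \<phi> "\<lambda>e. - \<psi> e"] cocycle1_uminus[of Y \<psi>] Z unfolding cocycle_set_1 D_def by simp
    have Dx: "frag_eval D (x j) = 0" if "j < b" for j using eq[OF that] unfolding D_def frag_eval_fun_diff by simp
    have D0: "frag_eval D c = 0" if c: "c \<in> cycles1 Y" for c
    proof -
      let ?s = "\<Sum>j<b. frag_cmul (f j c) (x j)"
      have s: "?s \<in> cycles1 Y" using xZ by (intro frag_subgroup_sum[OF frag_subgroup_cycles1] frag_subgroup_cmul[OF frag_subgroup_cycles1]) auto
      have Nc: "frag_cmul N c \<in> cycles1 Y" by (rule frag_subgroup_cmul[OF frag_subgroup_cycles1 c])
      have "f i (frag_cmul N c - ?s) = 0" if i: "i < b" for i
      proof -
        have "f i ?s = (\<Sum>j<b. f i (frag_cmul (f j c) (x j)))"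
          using xZ by (intro additive_on_sum[OF frag_subgroup_cycles1 fadd[OF i]] frag_subgroup_cmul[OF frag_subgroup_cycles1]) auto
        also have "\<dots> = (\<Sum>j<b. f j c * f i (x j))"
          using xZ by (intro sum.cong refl additive_on_cmul[OF frag_subgroup_cycles1 fadd[OF i]]) auto
        also have "\<dots> = (\<Sum>j<b. if j = i then f i c * N else 0)" using fx i by (intro sum.cong) auto
        also have "\<dots> = f i c * N" using i by simp
        finally have "f i ?s = f i c * N" .
        moreover have "f i (frag_cmul N c) = N * f i c" by (rule additive_on_cmul[OF frag_subgroup_cycles1 fadd[OF i] c])
        ultimately show ?thesis using additive_on_diff[OF frag_subgroup_cycles1 fadd[OF i] Nc s] by simp
      qed
      then obtain n where n: "n > 0" "frag_cmul n (frag_cmul N c - ?s) \<in> bounds1 Y"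
        using ker[OF cycles1_D(2)[OF Nc s]] by blast
      have "frag_eval D (frag_cmul n (frag_cmul N c - ?s)) = 0" by (rule cocycle1_bounds[OF coD n(2)])
      moreover have "frag_eval D ?s = 0" using Dx by (simp add: frag_eval_sum)
      ultimately show ?thesis using n(1) N by simp
    qed
    obtain g where g: "\<And>e. singular_simplex 1 Y e \<Longrightarrow> D e = g (e vertex1) - g (e vertex0)"
      using cochain_primitive[of Y D, OF D0] by blast
    then have "exact1 Y D" unfolding exact1_def by blast
    interpret S: comm_group "cocycle_group1 Y" by (rule cocycle_group1)
    have "\<phi> \<otimes>\<^bsub>cocycle_group1 Y\<^esub> inv\<^bsub>cocycle_group1 Y\<^esub> \<psi> = (\<lambda>\<sigma>\<in>?S. D \<sigma>)"
      unfolding cocycle_group1(4)[OF Z(2)] mult_subgroup_generated cochain_group_simps D_def by (intro restrict_ext) simp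
    moreover have "(\<lambda>\<sigma>\<in>?S. D \<sigma>) \<in> coboundary_set 1 Y"
      unfolding coboundary_set_1 using exact1_cong[OF _ \<open>exact1 Y D\<close>, of "\<lambda>\<sigma>\<in>?S. D \<sigma>"] by simp
    ultimately show ?thesis using cohomology_facts(5)[OF Z] by simp
  qed
  show "rational_basis ?H b ?co (\<lambda>j. cohom_class Y (restrict (\<alpha> j) ?S)) N"
  proof (intro rational_basis.intro rational_basis_axioms.intro)
    show "comm_group ?H" by (rule cohomology_facts(1))
    show "?co (u \<otimes>\<^bsub>?H\<^esub> v) i = ?co u i + ?co v i" if uv: "u \<in> carrier ?H" "v \<in> carrier ?H" for u v i
    proof -
      have i: "?x i \<in> cycles1 Y" by (rule xZ')
      obtain \<phi> where u: "\<phi> \<in> cocycle_set 1 Y" "u = cohom_class Y \<phi>" by (rule cohomology_cases[OF uv(1)])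
      obtain \<psi> where v: "\<psi> \<in> cocycle_set 1 Y" "v = cohom_class Y \<psi>" by (rule cohomology_cases[OF uv(2)])
      note prod = cohom_class_mult[OF u(1) v(1)]
      have "singular_chain 1 Y (?x i)" using i unfolding cycles1_def by blast
      then have "frag_eval (\<lambda>\<sigma>\<in>?S. \<phi> \<sigma> + \<psi> \<sigma>) (?x i) = frag_eval (\<lambda>\<sigma>. \<phi> \<sigma> + \<psi> \<sigma>) (?x i)"
        by (rule frag_eval_cong) simp
      then show ?thesis
        unfolding u(2) v(2) prod(1) cohom_rep_eval[OF prod(2) i] cohom_rep_eval[OF u(1) i] cohom_rep_eval[OF v(1) i]
        by (simp add: frag_eval_fun_add add_divide_distrib)
    qed
    show "u = v" if uv: "u \<in> carrier ?H" "v \<in> carrier ?H" and eq: "\<And>i. i < b \<Longrightarrow> ?co u i = ?co v i" for u v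
    proof -
      obtain \<phi> where u: "\<phi> \<in> cocycle_set 1 Y" "u = cohom_class Y \<phi>" by (rule cohomology_cases[OF uv(1)])
      obtain \<psi> where v: "\<psi> \<in> cocycle_set 1 Y" "v = cohom_class Y \<psi>" by (rule cohomology_cases[OF uv(2)])
      have "frag_eval \<phi> (x j) = frag_eval \<psi> (x j)" if "j < b" for j
        using eq[OF that] N unfolding u(2) v(2) co[OF u(1) that] co[OF v(1) that] by simp
      then show ?thesis unfolding u(2) v(2) by (rule inj[OF u(1) v(1)])
    qed
    show "cohom_class Y (restrict (\<alpha> i) ?S) \<in> carrier ?H" if "i < b" for i
      using cohomology_facts(2)[of Y] \<alpha>Z[OF that] by blast
    show "?co (cohom_class Y (restrict (\<alpha> i) ?S)) j = (if i = j then 1 else 0)" if "i < b" "j < b" for i j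
      unfolding co[OF \<alpha>Z[OF that(1)] that(2)] res_eval[OF that(1) xZ[OF that(2)]] fx[OF that(2,1)] using N by simp
    show "N > 0" by (rule N)
    show "of_int N * ?co u i \<in> \<int>" for u i using N by simp
  qed
qed

section \<open>The connected sum theorem\<close>

lemma frag_eval_chain_map: "frag_eval \<phi> (chain_map p q c) = frag_eval (\<lambda>e. \<phi> (simplex_map p q e)) c"
  by (simp add: chain_map_def frag_eval_frag_extend)

lemma closed_manifold_dual_basis:
  assumes "closed_manifold n X"
  obtains b x f N where "dual_basis (cycles1 X) (bounds1 X) b x f N"
proof -
  have X: "compact_space X" "Hausdorff_space X" using assms by (simp_all add: closed_manifold_def)
  obtain D where D: "finite D" "\<And>c. c \<in> cycles1 X \<Longrightarrow> \<exists>k. c - (\<Sum>d\<in>D. frag_cmul (k d) d) \<in> bounds1 X"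
    using cycles1_finitely_generated[OF X locally_Euclidean_good_chart[OF closed_manifold_locally_Euclidean[OF assms]]] by blast
  show ?thesis
    by (rule exists_dual_basis[OF frag_subgroup_cycles1 frag_subgroup_bounds1 D bounds1_subset_cycles1]) (assumption, rule that)
qed

text \<open>The cocycles pulled back from one summand can be chosen to vanish on the part of the sum that
  comes from the other one, so a product of cocycles of both kinds vanishes on small simplices.\<close>

lemma mixed_triple_eval:
  assumes P1: "pinch_map Y X1 q1 U V E1 x1" and P2: "pinch_map Y X2 q2 V U E2 x2"
    and \<zeta>: "singular_chain 3 Y \<zeta>" "chain_boundary 3 \<zeta> = 0"
    and co: "cocycle1 Y \<phi>" "cocycle1 Y \<psi>" "cocycle1 Y \<theta>"
    and \<phi>: "\<And>e. singular_simplex 1 Y e \<Longrightarrow> q1 ` e ` standard_simplex 1 \<subseteq> E1 \<Longrightarrow> \<phi> e = 0"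
    and \<theta>: "\<And>e. singular_simplex 1 Y e \<Longrightarrow> q2 ` e ` standard_simplex 1 \<subseteq> E2 \<Longrightarrow> \<theta> e = 0"
  shows "triple_eval \<zeta> \<phi> \<psi> \<theta> = 0"
proof -
  interpret P1: pinch_map Y X1 q1 U V E1 x1 by (rule P1)
  interpret P2: pinch_map Y X2 q2 V U E2 x2 by (rule P2)
  let ?C = "{U, V}"
  have rc: "singular_relcycle 3 Y {} \<zeta>" using \<zeta> unfolding singular_cycle by blast
  obtain \<zeta>' where \<zeta>': "singular_relcycle 3 Y {} \<zeta>'" "homologous_rel 3 Y {} \<zeta> \<zeta>'"
    "\<And>\<sigma>. \<sigma> \<in> Poly_Mapping.keys \<zeta>' \<Longrightarrow> \<exists>W\<in>?C. \<sigma> \<in> standard_simplex 3 \<rightarrow> W"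
  proof (rule small_homologous_rel_relcycle_exists[of ?C Y 3 "{}" \<zeta>])
    show "topspace Y \<subseteq> \<Union> ?C" using P1.cover(3) by blast
    show "openin Y W" if "W \<in> ?C" for W using that P1.cover(1,2) by blast
    show "singular_relcycle 3 Y {} \<zeta>" by (rule rc)
  qed (rule that)
  have c': "singular_chain 3 Y \<zeta>'" using \<zeta>'(1) unfolding singular_cycle by blast
  have "singular_relboundary 3 Y {} (\<zeta> - \<zeta>')" using \<zeta>'(2) unfolding homologous_rel_def .
  then obtain d where d: "singular_chain 4 Y d" "chain_boundary 4 d = \<zeta> - \<zeta>'"
    unfolding singular_boundary by auto
  have "triple_eval (\<zeta> - \<zeta>') \<phi> \<psi> \<theta> = 0" using triple_eval_boundary[OF co d(1)] unfolding d(2) .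
  then have "triple_eval \<zeta> \<phi> \<psi> \<theta> = triple_eval \<zeta>' \<phi> \<psi> \<theta>" unfolding triple_eval_def frag_eval_diff by simp
  also have "\<dots> = 0"
    unfolding triple_eval_def frag_eval_def
  proof (rule sum.neutral, intro ballI)
    fix \<sigma> assume \<sigma>: "\<sigma> \<in> Poly_Mapping.keys \<zeta>'"
    then have s: "singular_simplex 3 Y \<sigma>" using c' unfolding singular_chain_def by blast
    have e: "singular_simplex 1 Y (edge 0 1 \<sigma>)" "singular_simplex 1 Y (edge 2 3 \<sigma>)"
      "edge 0 1 \<sigma> ` standard_simplex 1 \<subseteq> \<sigma> ` standard_simplex 3" "edge 2 3 \<sigma> ` standard_simplex 1 \<subseteq> \<sigma> ` standard_simplex 3"
      by (rule singular_simplex_edge[OF s]; simp)+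
    have "\<sigma> ` standard_simplex 3 \<subseteq> U \<or> \<sigma> ` standard_simplex 3 \<subseteq> V" using \<zeta>'(3)[OF \<sigma>] by auto
    then have "\<phi> (edge 0 1 \<sigma>) = 0 \<or> \<theta> (edge 2 3 \<sigma>) = 0"
    proof
      assume "\<sigma> ` standard_simplex 3 \<subseteq> U"
      then have "q2 ` edge 2 3 \<sigma> ` standard_simplex 1 \<subseteq> E2" using e(4) P2.pinched by blast
      then show ?thesis using \<theta>[OF e(2)] by blast
    next
      assume "\<sigma> ` standard_simplex 3 \<subseteq> V"
      then have "q1 ` edge 0 1 \<sigma> ` standard_simplex 1 \<subseteq> E1" using e(3) P1.pinched by blast
      then show ?thesis using \<phi>[OF e(1)] by blast
    qed
    then show "of_int (Poly_Mapping.lookup \<zeta>' \<sigma>) * (\<phi> (edge 0 1 \<sigma>) * \<psi> (edge 1 2 \<sigma>) * \<theta> (edge 2 3 \<sigma>)) = 0" by auto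
  qed
  finally show ?thesis .
qed

text \<open>Over \<open>V\<close> the pinch map takes values in the disc \<open>E\<close>, on which a cocycle can be made to vanish.\<close>

lemma pinch_cocycles:
  assumes P: "pinch_map Y X q U V E x" and db: "dual_basis (cycles1 X) (bounds1 X) b w f N"
  obtains \<phi> where "\<And>j c. j < b \<Longrightarrow> c \<in> cycles1 Y \<Longrightarrow> frag_eval (\<phi> j) c = f j (chain_map 1 q c)"
    "\<And>j e. j < b \<Longrightarrow> singular_simplex 1 Y e \<Longrightarrow> q ` e ` standard_simplex 1 \<subseteq> E \<Longrightarrow> \<phi> j e = (0::int)"
proof -
  interpret P: pinch_map Y X q U V E x by (rule P)
  have "\<exists>\<psi>. (\<forall>c\<in>cycles1 X. frag_eval \<psi> c = f j c) \<and>
      (\<forall>\<sigma>. singular_simplex 1 X \<sigma> \<longrightarrow> \<sigma> ` standard_simplex 1 \<subseteq> E \<longrightarrow> \<psi> \<sigma> = 0)" if j: "j < b" for j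
  proof -
    have f: "additive_on (cycles1 X) (f j)" "\<And>c. c \<in> bounds1 X \<Longrightarrow> f j c = 0"
      using db j unfolding dual_basis_def by blast+
    obtain \<psi> where "\<And>c. c \<in> cycles1 X \<Longrightarrow> frag_eval \<psi> c = f j c"
      "\<And>\<sigma>. singular_simplex 1 X \<sigma> \<Longrightarrow> \<sigma> ` standard_simplex 1 \<subseteq> E \<Longrightarrow> \<psi> \<sigma> = 0"
    proof (rule exists_cocycle[OF f openin_subset[OF P.disc(1)] P.disc(4,3)])
      fix \<psi> assume "\<And>c. c \<in> cycles1 X \<Longrightarrow> frag_eval \<psi> c = f j c"
        "\<And>\<sigma>. singular_simplex 1 X \<sigma> \<Longrightarrow> \<sigma> ` standard_simplex 1 \<subseteq> E \<Longrightarrow> \<psi> \<sigma> = 0"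
      then show thesis by (rule that)
    qed
    then show ?thesis by blast
  qed
  then obtain \<psi> where \<psi>: "\<And>j. j < b \<Longrightarrow> (\<forall>c\<in>cycles1 X. frag_eval (\<psi> j) c = f j c) \<and>
      (\<forall>\<sigma>. singular_simplex 1 X \<sigma> \<longrightarrow> \<sigma> ` standard_simplex 1 \<subseteq> E \<longrightarrow> \<psi> j \<sigma> = 0)" by metis
  show ?thesis
  proof (rule that[of "\<lambda>j e. \<psi> j (simplex_map 1 q e)"])
    show "frag_eval (\<lambda>e. \<psi> j (simplex_map 1 q e)) c = f j (chain_map 1 q c)" if "j < b" "c \<in> cycles1 Y" for j c
      unfolding frag_eval_chain_map[symmetric] using \<psi>[OF that(1)] chain_map_cycles1[OF P.cont that(2)] by blast
    show "\<psi> j (simplex_map 1 q e) = 0" if "j < b" "singular_simplex 1 Y e" "q ` e ` standard_simplex 1 \<subseteq> E" for j e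
    proof -
      have "singular_simplex 1 X (simplex_map 1 q e)" by (rule singular_simplex_simplex_map[OF that(2) P.cont])
      moreover have "simplex_map 1 q e ` standard_simplex 1 \<subseteq> E" using that(3) by (auto simp: simplex_map_def)
      ultimately show ?thesis using \<psi>[OF that(1)] by blast
    qed
  qed
qed

theorem theorem6:
  fixes Y1 :: "'a topology" and Y2 :: "'b topology" and Y :: "'c topology"
    and z1 :: "'a chain set" and z2 :: "'b chain set" and z :: "'c chain set"
  assumes "closed_oriented_manifold 3 Y1 z1" and "connected_space Y1"
    and "closed_oriented_manifold 3 Y2 z2" and "connected_space Y2"
    and "betti 1 Y1 \<ge> 1" and "betti 1 Y2 \<ge> 1"
    and "\<not> (odd (betti 1 Y1) \<and> odd (betti 1 Y2))"
    and "connected_sum 3 Y1 z1 Y2 z2 Y z"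
  shows "betti 1 Y = betti 1 Y1 + betti 1 Y2 \<and>
         cup_rank Y z \<ge> 4 / 3 * L_bound (betti 1 Y)"
proof -
  have M1: "closed_manifold 3 Y1" and M2: "closed_manifold 3 Y2"
    using assms(1,3) unfolding closed_oriented_manifold_def by blast+
  have z: "z \<in> carrier (homology_group (int 3) Y)"
    using assms(8) unfolding connected_sum_def closed_oriented_manifold_def fundamental_class_def by blast
  obtain q1 q2 U1 U2 E1 E2 x1 x2 where P: "pinch_map Y Y1 q1 U1 U2 E1 x1" "pinch_map Y Y2 q2 U2 U1 E2 x2"
    by (rule connected_sum_pinch_maps[OF assms(8)])
  obtain b1 w1 f1 N1 where d1: "dual_basis (cycles1 Y1) (bounds1 Y1) b1 w1 f1 N1" by (rule closed_manifold_dual_basis[OF M1])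
  obtain b2 w2 f2 N2 where d2: "dual_basis (cycles1 Y2) (bounds1 Y2) b2 w2 f2 N2" by (rule closed_manifold_dual_basis[OF M2])
  define f where "f = (\<lambda>j c. if j < b1 then N2 * f1 j (chain_map 1 q1 c) else N1 * f2 (j - b1) (chain_map 1 q2 c))"
  obtain w where d: "dual_basis (cycles1 Y) (bounds1 Y) (b1 + b2) w f (N1 * N2)"
    unfolding f_def by (rule dual_basis_pinch[OF P d1 d2])
  have betti: "betti 1 Y1 = b1" "betti 1 Y2 = b2" "betti 1 Y = b1 + b2"
    by (rule betti_1_dual_basis[OF d1] betti_1_dual_basis[OF d2] betti_1_dual_basis[OF d])+
  have b: "1 \<le> b1" "1 \<le> b2" "\<not> (odd b1 \<and> odd b2)" using assms(5,6,7) unfolding betti by blast+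
  obtain \<phi>1 where \<phi>1: "\<And>j c. j < b1 \<Longrightarrow> c \<in> cycles1 Y \<Longrightarrow> frag_eval (\<phi>1 j) c = f1 j (chain_map 1 q1 c)"
    "\<And>j e. j < b1 \<Longrightarrow> singular_simplex 1 Y e \<Longrightarrow> q1 ` e ` standard_simplex 1 \<subseteq> E1 \<Longrightarrow> \<phi>1 j e = 0"
  proof (rule pinch_cocycles[OF P(1) d1])
    fix \<phi> assume "\<And>j c. j < b1 \<Longrightarrow> c \<in> cycles1 Y \<Longrightarrow> frag_eval (\<phi> j) c = f1 j (chain_map 1 q1 c)"
      "\<And>j e. j < b1 \<Longrightarrow> singular_simplex 1 Y e \<Longrightarrow> q1 ` e ` standard_simplex 1 \<subseteq> E1 \<Longrightarrow> \<phi> j e = 0"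
    then show thesis by (rule that)
  qed
  obtain \<phi>2 where \<phi>2: "\<And>j c. j < b2 \<Longrightarrow> c \<in> cycles1 Y \<Longrightarrow> frag_eval (\<phi>2 j) c = f2 j (chain_map 1 q2 c)"
    "\<And>j e. j < b2 \<Longrightarrow> singular_simplex 1 Y e \<Longrightarrow> q2 ` e ` standard_simplex 1 \<subseteq> E2 \<Longrightarrow> \<phi>2 j e = 0"
  proof (rule pinch_cocycles[OF P(2) d2])
    fix \<phi> assume "\<And>j c. j < b2 \<Longrightarrow> c \<in> cycles1 Y \<Longrightarrow> frag_eval (\<phi> j) c = f2 j (chain_map 1 q2 c)"
      "\<And>j e. j < b2 \<Longrightarrow> singular_simplex 1 Y e \<Longrightarrow> q2 ` e ` standard_simplex 1 \<subseteq> E2 \<Longrightarrow> \<phi> j e = 0"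
    then show thesis by (rule that)
  qed
  \<comment> \<open>Each family is scaled by the factor of the other one, as the dual basis requires.\<close>
  define \<alpha> where "\<alpha> j = (if j < b1 then (\<lambda>e. N2 * \<phi>1 j e) else (\<lambda>e. N1 * \<phi>2 (j - b1) e))" for j
  have \<alpha>f: "frag_eval (\<alpha> j) c = f j c" if "j < b1 + b2" "c \<in> cycles1 Y" for j c
    using that \<phi>1(1)[of j c] \<phi>2(1)[of "j - b1" c] unfolding \<alpha>_def f_def by (simp add: frag_eval_fun_scale)
  let ?S = "singular_simplex_set 1 Y"
  let ?e = "\<lambda>j. cohom_class Y (restrict (\<alpha> j) ?S)"
  let ?H = "cohomology_group 1 Y" and ?\<mu> = "triple_cup_form Y z"
  have \<alpha>Z: "restrict (\<alpha> j) ?S \<in> cocycle_set 1 Y" if "j < b1 + b2" for j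
    by (rule rational_basis_cohomology(2)[where \<alpha> = \<alpha>, OF d _ that]) (rule \<alpha>f; assumption)
  have basis: "rational_basis ?H (b1 + b2) (\<lambda>a j. of_int (frag_eval (cohom_rep a) (if j < b1 + b2 then w j else 0)) / of_int (N1 * N2)) ?e (N1 * N2)"
    by (rule rational_basis_cohomology(1)[where \<alpha> = \<alpha>, OF d]) (rule \<alpha>f; assumption)
  have block: "l < b1 \<or> b1 \<le> i" if ijl: "i < j" "j < l" "l < b1 + b2" and ne: "?\<mu> (?e i) (?e j) (?e l) \<noteq> 0" for i j l
  proof (rule ccontr)
    assume "\<not> (l < b1 \<or> b1 \<le> i)"
    then have il: "i < b1" "b1 \<le> l" by simp_all
    have lt: "i < b1 + b2" "j < b1 + b2" using ijl by linarith+
    have Z: "restrict (\<alpha> i) ?S \<in> cocycle_set 1 Y" "restrict (\<alpha> j) ?S \<in> cocycle_set 1 Y" "restrict (\<alpha> l) ?S \<in> cocycle_set 1 Y"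
      by (rule \<alpha>Z[OF lt(1)] \<alpha>Z[OF lt(2)] \<alpha>Z[OF ijl(3)])+
    have "triple_eval (SOME c. c \<in> z) (restrict (\<alpha> i) ?S) (restrict (\<alpha> j) ?S) (restrict (\<alpha> l) ?S) = 0"
    proof (rule mixed_triple_eval[OF P rep_cycle[OF z]])
      show "cocycle1 Y (restrict (\<alpha> i) ?S)" "cocycle1 Y (restrict (\<alpha> j) ?S)" "cocycle1 Y (restrict (\<alpha> l) ?S)"
        using Z unfolding cocycle_set_1 by blast+
      show "restrict (\<alpha> i) ?S e = 0" if "singular_simplex 1 Y e" "q1 ` e ` standard_simplex 1 \<subseteq> E1" for e
        using \<phi>1(2)[OF il(1) that] il(1) that(1) by (simp add: \<alpha>_def)
      show "restrict (\<alpha> l) ?S e = 0" if "singular_simplex 1 Y e" "q2 ` e ` standard_simplex 1 \<subseteq> E2" for e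
      proof -
        have "l - b1 < b2" using ijl(3) il(2) by simp
        then show ?thesis using \<phi>2(2)[OF _ that] il(2) that(1) by (simp add: \<alpha>_def)
      qed
    qed
    then show False using ne unfolding triple_cup_form_eval[OF z Z] by blast
  qed
  obtain h where h: "\<And>k. abelian_rank (cup_homology ?H ?\<mu> k) = h" "int h \<ge> 2 * (L_int b1 * L_int (b1 + b2 - b1))"
  proof (rule rational_basis.cup_homology_rank_bound[OF basis alternating3_triple_cup_form[OF z] b(1)])
    show "b1 < b1 + b2" using b(2) by simp
    show "l < b1 \<or> b1 \<le> i" if "i < j" "j < l" "l < b1 + b2" "?\<mu> (?e i) (?e j) (?e l) \<noteq> 0" for i j l
      by (rule block[OF that])
  qed (rule that)
  have "(THE r. \<forall>k::int. abelian_rank (HC_infinity Y z k) = r) = h"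
    unfolding HC_infinity_def using h(1) by (intro the_equality) auto
  then have rank: "cup_rank Y z = real h" using b(1) unfolding cup_rank_def betti by simp
  have "L_bound (b1 + b2) = of_int (L_int (b1 + b2))" using b(1) by (intro L_bound_int) simp
  moreover have "3 * (L_int b1 * L_int b2) = 2 * L_int (b1 + b2)" by (rule L_int_product[OF b])
  then have "3 * int h \<ge> 4 * L_int (b1 + b2)" using h(2) by simp
  then have "3 * real h \<ge> 4 * of_int (L_int (b1 + b2))" by linarith
  ultimately have "cup_rank Y z \<ge> 4 / 3 * L_bound (b1 + b2)" unfolding rank by simp
  then show ?thesis unfolding betti by simp
qed

end
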